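(* Let $T=1$, $V\sim N(0,1)$ (so $\mu=N(0,1)$), $f\equiv0$, and let $$P^*(t,Q_{[0,t]})=Q_t,\qquad \theta^*(v;t,Q_{[0,t]})=\frac{v-Q_t}{1-t},\quad 0\le t<1,$$ be Back's (bridge type) equilibrium. Then the function $v\mapsto J_0(P^*;v,\theta^*(v;\cdot))$ belongs to the set value $\mathbb{V}$ of the game.
   Context: Strong formulation value of $(P^*,\theta^* )$. Let $B$ be a one-dimensional Brownian motion on $[0,1]$ under a probability $\mathbb{P}$. For each $v\in\mathbb{R}$, the SDE $Q^v_t=\int_0^t\frac{v-Q^v_s}{1-s}ds+B_t$, $0\le t<1$, has the unique solution $Q^v_t=vt+(1-t)\int_0^t\frac{dB_s}{1-s}$, and $$J_0(P^*;v,\theta^*(v;\cdot)):=\mathbb{E}\Big[\int_0^1[v-P^*(t,Q^v_{[0,t]})]\,\theta^*(v;t,Q^v_{[0,t]})\,dt\Big].$$ Weak formulation. Now take $Q\equiv B$ a $\mathbb{P}$-Brownian motion with filtration $\mathbb{F}^Q=\mathbb{F}^B$, and $V$ with law $\mu$, independent of $B$ under $\mathbb{P}$. Let $A=\mathbb{R}$. $\mathcal{A}'$ is the set of $\mathbb{F}^B$-progressively measurable bounded real-valued processes $\theta'$ (the bound may depend on $\theta'$). $\mathcal{A}$ is the set of $\theta=\theta(v;t,Q_{[0,t]})$, progressively measurable in all variables, with $\theta^v:=\theta(v;\cdot)\in\mathcal{A}'$ for each $v\in\mathrm{Supp}(V)$. A pricing rule $P$ is an $\mathbb{F}^B$-progressively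 measurable process $P_t=P(t,Q_{[0,t]})$. For $\theta'\in\mathcal{A}'$, let $M^{\theta'}_t:=\exp\big(\int_0^t\theta'_sdB_s-\frac12\int_0^t|\theta'_s|^2ds\big)$, $d\mathbb{P}^{\theta'}:=M^{\theta'}_1d\mathbb{P}$, and $$J(P;v,\theta'):=\mathbb{E}^{\mathbb{P}^{\theta'}}\Big[\int_0^1[v-P_t]\theta'_tdt\Big].$$ For $\theta\in\mathcal{A}$, $P^\theta_t:=\mathbb{E}^{\mathbb{P}^\theta}[V|\mathcal{F}^Q_t]$, where $d\mathbb{P}^\theta:=d\mathbb{P}^{\theta^v}\mu(dv)$ is the joint law of $(V,Q)$; equivalently $P^\theta_t=\frac{\int vM^{\theta^v}_t\mu(dv)}{\int M^{\theta^v}_t\mu(dv)}$, $\mathbb{P}$-a.s. $\varepsilon$-equilibrium: for $\varepsilon>0$, a pair $(P^\varepsilon,\theta^\varepsilon)$ of a pricing rule and $\theta^\varepsilon\in\mathcal{A}$ is in $\mathcal{E}_\varepsilon$ if $$\int_{\mathbb{R}}\Big[\sup_{\theta'\in\mathcal{A}'}J(P^\varepsilon;v,\theta')-J(P^\varepsilon;v,\theta^{\varepsilon,v})\Big]\mu(dv)\le\varepsilon,\qquad \mathbb{E}^{\mathbb{P}}\Big[\int_0^1|P^\varepsilon_t-P^{\theta^\varepsilon}_t|^2dt\Big]\le\varepsilon^2.$$ Set value: let $\mathbb{L}^0_V$ be the set of measurable functions $\mathrm{Supp}(V)\to\mathbb{R}$. Then $\mathbb{V}:=\bigcap_{\varepsilon>0}\mathbb{V}_\varepsilon\subset\mathbb{L}^0_V$,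 where $$\mathbb{V}_\varepsilon:=\Big\{\varphi\in\mathbb{L}^0_V:\ \int_{\mathrm{Supp}(V)}\big|\varphi(v)-J(P^\varepsilon;v,\theta^\varepsilon(v;\cdot))\big|\mu(dv)\le\varepsilon\ \text{for some}\ (P^\varepsilon,\theta^\varepsilon)\in\mathcal{E}_\varepsilon\Big\}.$$ *)

theory Defs
  imports "HOL-Probability.Probability"
begin

text \<open>
  Throughout, time runs over \<open>[0,1]\<close>; a process is a curried function of time and sample point.
  Feedback rules such as \<open>P(t, Q\<^sub>[\<^sub>0\<^sub>,\<^sub>t\<^sub>])\<close> are functionals of time and of a path
  restricted to \<open>{0..t}\<close>; the asset value has law \<open>\<mu>\<close>.
\<close>

section \<open>Paths, filtrations and Brownian motion\<close>

definition path_upto :: "(real \<Rightarrow> 'a \<Rightarrow> real) \<Rightarrow> real \<Rightarrow> 'a \<Rightarrow> real \<Rightarrow> real" where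
  "path_upto X t \<omega> = (\<lambda>s\<in>{0..t}. X s \<omega>)"

definition along :: "(real \<Rightarrow> 'a \<Rightarrow> real) \<Rightarrow> (real \<Rightarrow> (real \<Rightarrow> real) \<Rightarrow> real) \<Rightarrow> real \<Rightarrow> 'a \<Rightarrow> real" where
  "along X F t \<omega> = F t (path_upto X t \<omega>)"

text \<open>The raw (not augmented by null sets) filtration generated by \<open>X\<close>.\<close>

definition natural_filtration :: "'a measure \<Rightarrow> (real \<Rightarrow> 'a \<Rightarrow> real) \<Rightarrow> real \<Rightarrow> 'a measure" where
  "natural_filtration M X t = vimage_algebra (space M) (path_upto X t) (Pi\<^sub>M {0..t} (\<lambda>_. borel))"

definition progressive :: "(real \<Rightarrow> 'a measure) \<Rightarrow> (real \<Rightarrow> 'a \<Rightarrow> real) \<Rightarrow> bool" where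
  "progressive F X \<longleftrightarrow> (\<forall>t\<in>{0..1}.
     (\<lambda>(s, \<omega>). X s \<omega>) \<in> borel_measurable (restrict_space borel {0..t} \<Otimes>\<^sub>M F t))"

definition brownian_motion :: "'a measure \<Rightarrow> (real \<Rightarrow> 'a \<Rightarrow> real) \<Rightarrow> bool" where
  "brownian_motion M B \<longleftrightarrow>
     prob_space M \<and>
     (\<forall>t\<in>{0..1}. B t \<in> borel_measurable M) \<and>
     (\<forall>\<omega>\<in>space M. B 0 \<omega> = 0 \<and> continuous_on {0..1} (\<lambda>t. B t \<omega>)) \<and>
     (\<forall>s t. 0 \<le> s \<longrightarrow> s < t \<longrightarrow> t \<le> 1 \<longrightarrow>
        distributed M lborel (\<lambda>\<omega>. B t \<omega> - B s \<omega>) (normal_density 0 (sqrt (t - s))) \<and>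
        prob_space.indep_set M (sets (natural_filtration M B s))
          (sets (vimage_algebra (space M) (\<lambda>\<omega>. B t \<omega> - B s \<omega>) borel)))"

definition measure_support :: "real measure \<Rightarrow> real set" where
  "measure_support \<mu> = {x. \<forall>U. open U \<longrightarrow> x \<in> U \<longrightarrow> emeasure \<mu> U > 0}"

section \<open>The Ito integral against Brownian motion\<close>

text \<open>
  A simple integrand is \<open>\<xi>\<^sub>0 1\<^bsub>(s\<^sub>0,s\<^sub>1]\<^esub> + \<dots> + \<xi>\<^bsub>n-1\<^esub> 1\<^bsub>(s\<^sub>n\<^sub>-\<^sub>1,s\<^sub>n]\<^esub>\<close>
  with \<open>0 = s\<^sub>0 \<le> \<dots> \<le> s\<^sub>n = 1\<close> and each \<open>\<xi>\<^sub>i\<close> bounded and known at time \<open>s\<^sub>i\<close>.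
\<close>

definition simple_integrand ::
  "'a measure \<Rightarrow> (real \<Rightarrow> 'a \<Rightarrow> real) \<Rightarrow> nat \<Rightarrow> (nat \<Rightarrow> real) \<Rightarrow> (nat \<Rightarrow> 'a \<Rightarrow> real) \<Rightarrow> bool" where
  "simple_integrand M B n s \<xi> \<longleftrightarrow>
     s 0 = 0 \<and> s n = 1 \<and> (\<forall>i<n. s i \<le> s (Suc i)) \<and>
     (\<forall>i<n. \<xi> i \<in> borel_measurable (natural_filtration M B (s i)) \<and>
            (\<exists>C. \<forall>\<omega>\<in>space M. \<bar>\<xi> i \<omega>\<bar> \<le> C))"

definition simple_process :: "nat \<Rightarrow> (nat \<Rightarrow> real) \<Rightarrow> (nat \<Rightarrow> 'a \<Rightarrow> real) \<Rightarrow> real \<Rightarrow> 'a \<Rightarrow> real" where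
  "simple_process n s \<xi> r \<omega> = (\<Sum>i<n. \<xi> i \<omega> * indicator {s i<..s (Suc i)} r)"

definition simple_ito ::
  "(real \<Rightarrow> 'a \<Rightarrow> real) \<Rightarrow> nat \<Rightarrow> (nat \<Rightarrow> real) \<Rightarrow> (nat \<Rightarrow> 'a \<Rightarrow> real) \<Rightarrow> real \<Rightarrow> 'a \<Rightarrow> real" where
  "simple_ito B n s \<xi> t \<omega> = (\<Sum>i<n. \<xi> i \<omega> * (B (min (s (Suc i)) t) \<omega> - B (min (s i) t) \<omega>))"

definition has_ito_integral ::
  "'a measure \<Rightarrow> (real \<Rightarrow> 'a \<Rightarrow> real) \<Rightarrow> (real \<Rightarrow> 'a \<Rightarrow> real) \<Rightarrow> real \<Rightarrow> ('a \<Rightarrow> real) \<Rightarrow> bool" where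
  "has_ito_integral M B \<eta> t X \<longleftrightarrow>
     X \<in> borel_measurable (natural_filtration M B t) \<and>
     (\<exists>n s \<xi>. (\<forall>k. simple_integrand M B (n k) (s k) (\<xi> k)) \<and>
        (\<lambda>k. \<integral>\<^sup>+\<omega>. (\<integral>\<^sup>+r\<in>{0..t}.
            ennreal ((simple_process (n k) (s k) (\<xi> k) r \<omega> - \<eta> r \<omega>)\<^sup>2) \<partial>lborel) \<partial>M)
          \<longlonglongrightarrow> 0 \<and>
        (\<lambda>k. \<integral>\<^sup>+\<omega>. ennreal ((simple_ito B (n k) (s k) (\<xi> k) t \<omega> - X \<omega>)\<^sup>2) \<partial>M) \<longlonglongrightarrow> 0)"

text \<open>The integral over \<open>[0,t]\<close> is determined up to an almost sure modification; any one is chosen.\<close>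

definition ito_integral ::
  "'a measure \<Rightarrow> (real \<Rightarrow> 'a \<Rightarrow> real) \<Rightarrow> (real \<Rightarrow> 'a \<Rightarrow> real) \<Rightarrow> real \<Rightarrow> 'a \<Rightarrow> real" where
  "ito_integral M B \<eta> t = (SOME X. has_ito_integral M B \<eta> t X)"

definition stoch_exp ::
  "'a measure \<Rightarrow> (real \<Rightarrow> 'a \<Rightarrow> real) \<Rightarrow> (real \<Rightarrow> 'a \<Rightarrow> real) \<Rightarrow> real \<Rightarrow> 'a \<Rightarrow> real" where
  "stoch_exp M B \<eta> t \<omega> =
     exp (ito_integral M B \<eta> t \<omega> - (1/2) * (LINT s:{0..t}|lborel. \<bar>\<eta> s \<omega>\<bar>\<^sup>2))"

definition girsanov ::
  "'a measure \<Rightarrow> (real \<Rightarrow> 'a \<Rightarrow> real) \<Rightarrow> (real \<Rightarrow> 'a \<Rightarrow> real) \<Rightarrow> 'a measure" where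
  "girsanov M B \<eta> = density M (\<lambda>\<omega>. ennreal (stoch_exp M B \<eta> 1 \<omega>))"

section \<open>The game in weak formulation\<close>

definition admissible_controls ::
  "'a measure \<Rightarrow> (real \<Rightarrow> 'a \<Rightarrow> real) \<Rightarrow> (real \<Rightarrow> 'a \<Rightarrow> real) set" where
  "admissible_controls M B =
     {\<eta>. progressive (natural_filtration M B) \<eta> \<and>
         (\<exists>C. \<forall>t\<in>{0..1}. \<forall>\<omega>\<in>space M. \<bar>\<eta> t \<omega>\<bar> \<le> C)}"

text \<open>Strategies: the bound on \<open>\<theta>(v; \<cdot>)\<close> may depend on \<open>v\<close>.\<close>

definition admissible_strategies ::
  "'a measure \<Rightarrow> (real \<Rightarrow> 'a \<Rightarrow> real) \<Rightarrow> real measure \<Rightarrow>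
   (real \<Rightarrow> real \<Rightarrow> (real \<Rightarrow> real) \<Rightarrow> real) set" where
  "admissible_strategies M B \<mu> =
     {\<theta>. (\<forall>t\<in>{0..1}. (\<lambda>(v, s, \<omega>). along B (\<theta> v) s \<omega>) \<in> borel_measurable
            (restrict_space borel (measure_support \<mu>) \<Otimes>\<^sub>M
              (restrict_space borel {0..t} \<Otimes>\<^sub>M natural_filtration M B t))) \<and>
         (\<forall>v\<in>measure_support \<mu>. along B (\<theta> v) \<in> admissible_controls M B)}"

definition pricing_rules ::
  "'a measure \<Rightarrow> (real \<Rightarrow> 'a \<Rightarrow> real) \<Rightarrow> (real \<Rightarrow> (real \<Rightarrow> real) \<Rightarrow> real) set" where
  "pricing_rules M B = {P. progressive (natural_filtration M B) (along B P)}"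

definition payoff ::
  "'a measure \<Rightarrow> (real \<Rightarrow> 'a \<Rightarrow> real) \<Rightarrow> (real \<Rightarrow> 'a \<Rightarrow> real) \<Rightarrow> real \<Rightarrow> (real \<Rightarrow> 'a \<Rightarrow> real) \<Rightarrow> real" where
  "payoff M B X v \<eta> =
     (LINT \<omega>|girsanov M B \<eta>. (LINT t:{0..1}|lborel. (v - X t \<omega>) * \<eta> t \<omega>))"

definition payoff_exists ::
  "'a measure \<Rightarrow> (real \<Rightarrow> 'a \<Rightarrow> real) \<Rightarrow> (real \<Rightarrow> 'a \<Rightarrow> real) \<Rightarrow> real \<Rightarrow> (real \<Rightarrow> 'a \<Rightarrow> real) \<Rightarrow> bool" where
  "payoff_exists M B X v \<eta> \<longleftrightarrow>
     integrable (girsanov M B \<eta> \<Otimes>\<^sub>M restrict_space lborel {0..1})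
       (\<lambda>(\<omega>, t). (v - X t \<omega>) * \<eta> t \<omega>)"

text \<open>
  The joint law \<open>\<mu>(dv) d\<P>\<^bsup>\<theta>(v;\<cdot>)\<^esup>\<close>, on the product of the value space and the sample space
  on which the order flow \<open>B\<close> is defined.
\<close>

definition joint_law ::
  "'a measure \<Rightarrow> (real \<Rightarrow> 'a \<Rightarrow> real) \<Rightarrow> real measure \<Rightarrow>
   (real \<Rightarrow> real \<Rightarrow> (real \<Rightarrow> real) \<Rightarrow> real) \<Rightarrow> (real \<times> 'a) measure" where
  "joint_law M B \<mu> \<theta> = restrict_space \<mu> (measure_support \<mu>) \<bind>
     (\<lambda>v. distr (girsanov M B (along B (\<theta> v))) (borel \<Otimes>\<^sub>M M) (\<lambda>\<omega>. (v, \<omega>)))"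

text \<open>
  Conditional expectations are defined only up to null sets for each \<open>t\<close>, so the rational price
  is a progressively measurable process which is a version of them for every \<open>t\<close>.
\<close>

definition rational_price ::
  "'a measure \<Rightarrow> (real \<Rightarrow> 'a \<Rightarrow> real) \<Rightarrow> real measure \<Rightarrow>
   (real \<Rightarrow> real \<Rightarrow> (real \<Rightarrow> real) \<Rightarrow> real) \<Rightarrow> (real \<Rightarrow> 'a \<Rightarrow> real) \<Rightarrow> bool" where
  "rational_price M B \<mu> \<theta> R \<longleftrightarrow>
     progressive (natural_filtration M B) R \<and>
     (\<forall>t\<in>{0..1}. AE z in joint_law M B \<mu> \<theta>.
        R t (snd z) =
          real_cond_exp (joint_law M B \<mu> \<theta>)
            (natural_filtration (joint_law M B \<mu> \<theta>) (\<lambda>s y. B s (snd y)) t) fst z)"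

text \<open>
  The condition \<open>payoff_exists\<close> makes explicit that the expectations defining the payoffs exist;
  Bochner integrals of non-integrable functions would otherwise silently be \<open>0\<close>.
\<close>

definition eps_equilibria ::
  "'a measure \<Rightarrow> (real \<Rightarrow> 'a \<Rightarrow> real) \<Rightarrow> real measure \<Rightarrow> real \<Rightarrow>
   ((real \<Rightarrow> (real \<Rightarrow> real) \<Rightarrow> real) \<times> (real \<Rightarrow> real \<Rightarrow> (real \<Rightarrow> real) \<Rightarrow> real)) set" where
  "eps_equilibria M B \<mu> \<epsilon> =
     {(P, \<theta>). P \<in> pricing_rules M B \<and> \<theta> \<in> admissible_strategies M B \<mu> \<and>
        (\<forall>v\<in>measure_support \<mu>. \<forall>\<eta>\<in>admissible_controls M B. payoff_exists M B (along B P) v \<eta>) \<and>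
        (\<integral>\<^sup>+v. e2ennreal
            ((SUP \<eta>\<in>admissible_controls M B. ereal (payoff M B (along B P) v \<eta>))
              - ereal (payoff M B (along B P) v (along B (\<theta> v)))) \<partial>\<mu>) \<le> ennreal \<epsilon> \<and>
        (\<exists>R. rational_price M B \<mu> \<theta> R \<and>
           (\<integral>\<^sup>+\<omega>. (\<integral>\<^sup>+t\<in>{0..1}. ennreal (\<bar>along B P t \<omega> - R t \<omega>\<bar>\<^sup>2) \<partial>lborel) \<partial>M)
             \<le> ennreal (\<epsilon>\<^sup>2))}"

text \<open>
  Elements of the set value are functions on the support of \<open>\<mu>\<close>, represented by functions on the
  reals whose values off the support are irrelevant.
\<close>

definition eps_set_value ::
  "'a measure \<Rightarrow> (real \<Rightarrow> 'a \<Rightarrow> real) \<Rightarrow> real measure \<Rightarrow> real \<Rightarrow> (real \<Rightarrow> real) set" where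
  "eps_set_value M B \<mu> \<epsilon> =
     {\<phi>. \<phi> \<in> borel_measurable (restrict_space borel (measure_support \<mu>)) \<and>
        (\<exists>(P, \<theta>)\<in>eps_equilibria M B \<mu> \<epsilon>.
           (\<integral>\<^sup>+v\<in>measure_support \<mu>.
              ennreal \<bar>\<phi> v - payoff M B (along B P) v (along B (\<theta> v))\<bar> \<partial>\<mu>) \<le> ennreal \<epsilon>)}"

definition set_value ::
  "'a measure \<Rightarrow> (real \<Rightarrow> 'a \<Rightarrow> real) \<Rightarrow> real measure \<Rightarrow> (real \<Rightarrow> real) set" where
  "set_value M B \<mu> = (\<Inter>\<epsilon>\<in>{0<..}. eps_set_value M B \<mu> \<epsilon>)"

section \<open>The strong formulation\<close>

text \<open>Adapted continuous solutions on \<open>[0,1)\<close> of \<open>dQ\<^sub>t = \<eta>(t, Q\<^sub>[\<^sub>0\<^sub>,\<^sub>t\<^sub>]) dt + dB\<^sub>t\<close>, \<open>Q\<^sub>0 = 0\<close>.\<close>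

definition solves_sde ::
  "'a measure \<Rightarrow> (real \<Rightarrow> 'a \<Rightarrow> real) \<Rightarrow> (real \<Rightarrow> (real \<Rightarrow> real) \<Rightarrow> real) \<Rightarrow>
   (real \<Rightarrow> 'a \<Rightarrow> real) \<Rightarrow> bool" where
  "solves_sde M B \<eta> Q \<longleftrightarrow>
     (\<forall>t\<in>{0..<1}. Q t \<in> borel_measurable (natural_filtration M B t)) \<and>
     (\<forall>\<omega>\<in>space M. continuous_on {0..<1} (\<lambda>t. Q t \<omega>) \<and>
        (\<forall>t\<in>{0..<1}. set_integrable lborel {0..t} (\<lambda>s. along Q \<eta> s \<omega>) \<and>
           Q t \<omega> = (LINT s:{0..t}|lborel. along Q \<eta> s \<omega>) + B t \<omega>))"

definition order_flow ::
  "'a measure \<Rightarrow> (real \<Rightarrow> 'a \<Rightarrow> real) \<Rightarrow> (real \<Rightarrow> (real \<Rightarrow> real) \<Rightarrow> real) \<Rightarrow> real \<Rightarrow> 'a \<Rightarrow> real" where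
  "order_flow M B \<eta> = (SOME Q. solves_sde M B \<eta> Q)"

definition strong_payoff ::
  "'a measure \<Rightarrow> (real \<Rightarrow> 'a \<Rightarrow> real) \<Rightarrow> (real \<Rightarrow> (real \<Rightarrow> real) \<Rightarrow> real) \<Rightarrow> real \<Rightarrow>
   (real \<Rightarrow> (real \<Rightarrow> real) \<Rightarrow> real) \<Rightarrow> real" where
  "strong_payoff M B P v \<eta> =
     (LINT \<omega>|M. (LINT t:{0..<1}|lborel.
        (v - along (order_flow M B \<eta>) P t \<omega>) * along (order_flow M B \<eta>) \<eta> t \<omega>))"

definition back_price :: "real \<Rightarrow> (real \<Rightarrow> real) \<Rightarrow> real" where
  "back_price t q = q t"

definition back_strategy :: "real \<Rightarrow> real \<Rightarrow> (real \<Rightarrow> real) \<Rightarrow> real" where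
  "back_strategy v t q = (v - q t) / (1 - t)"

end

theory Submission
  imports Defs
begin

text \<open>
  Take the price \<open>P\<^sub>t = Q\<^sub>t\<close>. For every bounded control \<open>\<eta>\<close>, Girsanov's and Ito's formulas give the payoff
  \<open>(v\<^sup>2 + 1) / 2 - E\<^bsup>\<eta>\<^esup>[(Q\<^sub>1 - v)\<^sup>2] / 2\<close>, and \<open>(v\<^sup>2 + 1) / 2\<close> is also the payoff of the bridge in the strong formulation.
  So any strategy that drives \<open>Q\<^sub>1\<close> close to \<open>v\<close> is almost optimal against this price.

  The strategy is \<open>(v - Q\<^bsub>s\<^esub>) / q\<^bsup>i+1\<^esup>\<close> on the \<open>i\<close>-th cell of a geometric grid, \<open>s\<close> being the left end of the cell,
  and it stops for good once \<open>\<bar>Q\<bar>\<close> exceeds \<open>K\<close> at a grid point. It is bounded for each \<open>v\<close>, and the posterior law of \<open>V\<close> is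
  exactly Gaussian. The slopes are chosen such that the posterior mean at a grid point is \<open>Q\<close> itself until the strategy stops;
  hence the rational price is an explicit functional, which is close to \<open>Q\<close> under Wiener measure when \<open>q\<close> is
  close to \<open>1\<close> and \<open>K\<close> is large.

  Since the likelihoods are piecewise explicit, only the Ito isometry, the existence and uniqueness of the Ito
  integral of bounded controls, and Gaussian integrals are needed.
\<close>

section \<open>Brownian motion and its raw filtration\<close>

text \<open>The bridge is unbounded, through the factor 1/(1-t) and through v - Q, hence not
  admissible. The stopping rule reads Q alone and never v, and this saves the filtering problem:
  each cell still multiplies the law of v by the exponential of a quadratic polynomial in v. Let the
  posterior variance be q^i when cell i starts, and put a = q^(i+1). With slope 1/a and length d =
  (1-q) a the precision becomes q/a + d/a^2 = 1/a, and the mean moves by exactly the increment of Q.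
  This fixes both the grid and the slopes.

  The two equilibrium conditions live under different measures. The pricing error is taken without
  drift, where second moments make stopping rare; the optimality gap is taken under the law with
  drift, where fourth moments do so. Both estimates grow with the number of cells, so K has to be
  chosen after q and n.

  The payoff identity rests on a discrete Ito formula: on a grid the square of Q - v telescopes up
  to an error of the order of the mesh, and fourth moments of the exponentials that are uniform in
  the grid let the mesh tend to 0.\<close>

lemma diff_square_le: "(x - y)\<^sup>2 \<le> 2 * x\<^sup>2 + 2 * y\<^sup>2" for x y :: real
  using zero_le_power2[of "x + y"] by (simp add: power2_eq_square algebra_simps)

lemma mult_le_square_sum: "\<bar>x\<bar> * \<bar>y\<bar> \<le> x\<^sup>2 + y\<^sup>2" for x y :: real
proof -
  have "2 * (\<bar>x\<bar> * \<bar>y\<bar>) \<le> x\<^sup>2 + y\<^sup>2" using sum_squares_bound[of "\<bar>x\<bar>" "\<bar>y\<bar>"] by (simp add: mult.assoc)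
  moreover have "0 \<le> \<bar>x\<bar> * \<bar>y\<bar>" by simp
  ultimately show ?thesis by linarith
qed

lemma space_natural_filtration [simp]: "space (natural_filtration N X t) = space N"
  by (simp add: natural_filtration_def)

lemma measurable_natural_filtration:
  assumes "0 \<le> s" "s \<le> t"
  shows "X s \<in> borel_measurable (natural_filtration N X t)"
proof -
  have "path_upto X t \<in> measurable (natural_filtration N X t) (Pi\<^sub>M {0..t} (\<lambda>_. borel))"
    unfolding natural_filtration_def by (rule measurable_vimage_algebra1) (auto simp: path_upto_def space_PiM)
  then have "(\<lambda>\<omega>. path_upto X t \<omega> s) \<in> borel_measurable (natural_filtration N X t)"
    by (rule measurable_compose[OF _ measurable_component_singleton]) (use assms in auto)
  then show ?thesis using assms by (simp add: path_upto_def)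
qed

text \<open>Minimality of the generated sigma-algebra. It yields monotonicity in time, inclusion in
  the sigma-algebra of \<open>M\<close>, and later the subalgebra condition on the product
  space.\<close>

lemma sets_natural_filtration_subset:
  assumes "space N' = space N" "\<And>s. 0 \<le> s \<Longrightarrow> s \<le> t \<Longrightarrow> X s \<in> borel_measurable N'"
  shows "sets (natural_filtration N X t) \<subseteq> sets N'"
proof -
  have "path_upto X t \<in> measurable N' (Pi\<^sub>M {0..t} (\<lambda>_. borel))"
    unfolding path_upto_def[abs_def] using assms(2) by (intro measurable_restrict) auto
  then show ?thesis unfolding natural_filtration_def using sets_image_in_sets[OF _] assms(1)
    by (intro sets_image_in_sets) auto
qed

lemma natural_filtration_mono:
  assumes "s \<le> t"
  shows "sets (natural_filtration N X s) \<subseteq> sets (natural_filtration N X t)"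
  using assms by (intro sets_natural_filtration_subset) (auto intro: measurable_natural_filtration)

lemma natural_filtration_measurable_mono:
  assumes "f \<in> measurable (natural_filtration N X s) L" "s \<le> t"
  shows "f \<in> measurable (natural_filtration N X t) L"
  using natural_filtration_mono[OF assms(2), of N X] assms(1) by (auto simp: measurable_def)

section \<open>The standard Gaussian law: moments and exponential tilting\<close>

definition gaussian :: "real measure" where
  "gaussian = density lborel std_normal_density"

lemma sets_gaussian [simp, measurable_cong]: "sets gaussian = sets borel"
  and space_gaussian [simp]: "space gaussian = UNIV"
  by (simp_all add: gaussian_def)

lemma prob_space_gaussian: "prob_space gaussian"
  unfolding gaussian_def by (rule prob_space_normal_density) simp

interpretation gaussian: prob_space gaussian by (rule prob_space_gaussian)

lemma gaussian_UNIV [simp]: "emeasure gaussian UNIV = 1" "measure gaussian UNIV = 1"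
  using gaussian.emeasure_space_1 gaussian.prob_space by simp_all

lemma integrable_gaussian_iff:
  fixes f :: "real \<Rightarrow> real"
  assumes [measurable]: "f \<in> borel_measurable borel"
  shows "integrable gaussian f \<longleftrightarrow> integrable lborel (\<lambda>x. std_normal_density x * f x)"
  unfolding gaussian_def by (subst integrable_density) auto

lemma integral_gaussian_eq:
  fixes f :: "real \<Rightarrow> real"
  assumes [measurable]: "f \<in> borel_measurable borel"
  shows "integral\<^sup>L gaussian f = integral\<^sup>L lborel (\<lambda>x. std_normal_density x * f x)"
  unfolding gaussian_def by (subst integral_density) auto

lemma integrable_gaussian_power: "integrable gaussian (\<lambda>x. x ^ k)"
  by (subst integrable_gaussian_iff) (auto intro: integrable_std_normal_moment)

lemma gaussian_moments:
  shows "(\<integral>x. x \<partial>gaussian) = 0" "(\<integral>x. x\<^sup>2 \<partial>gaussian) = 1" 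
    "(\<integral>x. x ^ 3 \<partial>gaussian) = 0" "(\<integral>x. x ^ 4 \<partial>gaussian) = 3"
  using integral_std_normal_moment_odd[of 0] integral_std_normal_moment_odd[of 1]
    integral_std_normal_moment_even[of 1] integral_std_normal_moment_even[of 2]
  by (simp_all add: integral_gaussian_eq fact_numeral numeral_3_eq_3)

text \<open>The means of (y + s x)^2 and (y + s x)^4 are read off from it, the odd moments dropping
  out. The integral is a nonnegative one because the change of measure is carried out in
  \<open>ennreal\<close>.\<close>

lemma nn_integral_gaussian_poly4:
  assumes "\<And>x. 0 \<le> a + b * x + c * x\<^sup>2 + d * x ^ 3 + e * x ^ 4"
  shows "(\<integral>\<^sup>+x. ennreal (a + b * x + c * x\<^sup>2 + d * x ^ 3 + e * x ^ 4) \<partial>gaussian) = ennreal (a + c + 3 * e)"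
proof -
  have i: "integrable gaussian (\<lambda>x. x)" using integrable_gaussian_power[of 1] by simp
  have "(\<integral>\<^sup>+x. ennreal (a + b * x + c * x\<^sup>2 + d * x ^ 3 + e * x ^ 4) \<partial>gaussian)
    = ennreal (\<integral>x. a + b * x + c * x\<^sup>2 + d * x ^ 3 + e * x ^ 4 \<partial>gaussian)"
    using assms by (intro nn_integral_eq_integral) (auto intro!: Bochner_Integration.integrable_add integrable_gaussian_power i)
  also have "(\<integral>x. a + b * x + c * x\<^sup>2 + d * x ^ 3 + e * x ^ 4 \<partial>gaussian) = a + c + 3 * e"
    by (simp add: integrable_gaussian_power i gaussian_moments)
  finally show ?thesis .
qed

text \<open>Girsanov's formula in one dimension: completing the square turns the exponential weight
  into a shift of the density.\<close>

lemma nn_integral_gaussian_tilt: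
  assumes [measurable]: "g \<in> borel_measurable borel"
  shows "(\<integral>\<^sup>+x. ennreal (exp (a * x - a\<^sup>2 / 2)) * g x \<partial>gaussian) = (\<integral>\<^sup>+x. g (a + x) \<partial>gaussian)"
proof -
  have "(\<integral>\<^sup>+x. ennreal (exp (a * x - a\<^sup>2 / 2)) * g x \<partial>gaussian)
     = (\<integral>\<^sup>+x. ennreal (std_normal_density x) * (ennreal (exp (a * x - a\<^sup>2 / 2)) * g x) \<partial>lborel)"
    unfolding gaussian_def by (subst nn_integral_density) auto
  also have "\<dots> = (\<integral>\<^sup>+x. ennreal (std_normal_density (x - a)) * g x \<partial>lborel)"
  proof (intro nn_integral_cong)
    fix x
    have "std_normal_density x * exp (a * x - a\<^sup>2 / 2) = std_normal_density (x - a)"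
      by (simp add: std_normal_density_def exp_add[symmetric] exp_diff[symmetric] power2_eq_square algebra_simps add_divide_distrib diff_divide_distrib)
    then show "ennreal (std_normal_density x) * (ennreal (exp (a * x - a\<^sup>2 / 2)) * g x) = ennreal (std_normal_density (x - a)) * g x"
      by (simp add: mult.assoc[symmetric] ennreal_mult''[symmetric])
  qed
  also have "\<dots> = (\<integral>\<^sup>+x. ennreal (std_normal_density x) * g (a + x) \<partial>lborel)"
    by (subst nn_integral_real_affine[where c=1 and t=a]) auto
  also have "\<dots> = (\<integral>\<^sup>+x. g (a + x) \<partial>gaussian)"
    unfolding gaussian_def by (subst nn_integral_density) auto
  finally show ?thesis .
qed

section \<open>Increments of Brownian motion and their independence of the past\<close>

locale brownian =
  fixes M :: "'a measure" and B :: "real \<Rightarrow> 'a \<Rightarrow> real"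
  assumes bm: "brownian_motion M B"
begin

sublocale prob_space M using bm by (simp add: brownian_motion_def)

abbreviation "F \<equiv> natural_filtration M B"

lemma B_measurable: "0 \<le> t \<Longrightarrow> t \<le> 1 \<Longrightarrow> B t \<in> borel_measurable M"
  using bm by (auto simp: brownian_motion_def)

lemma B_0: "\<omega> \<in> space M \<Longrightarrow> B 0 \<omega> = 0"
  using bm by (auto simp: brownian_motion_def)

lemma B_continuous: "\<omega> \<in> space M \<Longrightarrow> continuous_on {0..1} (\<lambda>t. B t \<omega>)"
  using bm by (auto simp: brownian_motion_def)

lemma sets_F_subset: "t \<le> 1 \<Longrightarrow> sets (F t) \<subseteq> sets M"
  by (rule sets_natural_filtration_subset) (auto intro: B_measurable)

lemma F_measurable_M: "f \<in> measurable (F t) L \<Longrightarrow> t \<le> 1 \<Longrightarrow> f \<in> measurable M L"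
  using sets_F_subset[of t] by (auto simp: measurable_def)

text \<open>Scaling to the fixed law \<open>gaussian\<close> lets all later inner integrals run over
  one measure that does not depend on \<open>s\<close> and \<open>t\<close>.\<close>

lemma increment_distr:
  assumes "0 \<le> s" "s < t" "t \<le> 1"
  shows "distr M borel (\<lambda>\<omega>. B t \<omega> - B s \<omega>) = distr gaussian borel (\<lambda>x. sqrt (t - s) * x)"
proof -
  have "distributed M lborel (\<lambda>\<omega>. B t \<omega> - B s \<omega>) (normal_density 0 (sqrt (t - s)))"
    using bm assms by (auto simp: brownian_motion_def)
  then have "distr M lborel (\<lambda>\<omega>. B t \<omega> - B s \<omega>) = density lborel (normal_density 0 (sqrt (t - s)))"
    by (simp add: distributed_def)
  moreover have "distr M lborel (\<lambda>\<omega>. B t \<omega> - B s \<omega>) = distr M borel (\<lambda>\<omega>. B t \<omega> - B s \<omega>)"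
    by (rule distr_cong) auto
  moreover have "distributed gaussian lborel (\<lambda>x. 0 + sqrt (t - s) * x)
      (normal_density (0 + sqrt (t - s) * 0) (\<bar>sqrt (t - s)\<bar> * 1))"
    using assms by (intro gaussian.normal_density_affine)
      (auto simp: distributed_def gaussian_def distr_id2)
  then have "distr gaussian lborel (\<lambda>x. sqrt (t - s) * x) = density lborel (normal_density 0 (sqrt (t - s)))"
    using assms by (simp add: distributed_def)
  moreover have "distr gaussian lborel (\<lambda>x. sqrt (t - s) * x) = distr gaussian borel (\<lambda>x. sqrt (t - s) * x)"
    by (rule distr_cong) auto
  ultimately show ?thesis by simp
qed

lemma increment_indep_set:
  assumes "0 \<le> s" "s < t" "t \<le> 1"
  shows "indep_set (sets (F s)) (sets (vimage_algebra (space M) (\<lambda>\<omega>. B t \<omega> - B s \<omega>) borel))"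
  using bm assms by (auto simp: brownian_motion_def)

lemma increment_measurable: "0 \<le> s \<Longrightarrow> s \<le> t \<Longrightarrow> t \<le> 1 \<Longrightarrow> (\<lambda>\<omega>. B t \<omega> - B s \<omega>) \<in> borel_measurable M"
  by (intro borel_measurable_diff B_measurable) auto

lemma ident_measurable_F: "t \<le> 1 \<Longrightarrow> (\<lambda>\<omega>. \<omega>) \<in> measurable M (F t)"
  by (rule F_measurable_M[OF measurable_ident_sets]) auto

text \<open>The identity map into \<open>F s\<close> makes the whole past one random element, so
  that independence of a sigma-algebra and an increment becomes an equality with a product measure,
  to which Fubini applies.\<close>

lemma increment_pair_distr:
  assumes "0 \<le> s" "s < t" "t \<le> 1"
  defines "Y \<equiv> (\<lambda>\<omega>. B t \<omega> - B s \<omega>)"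
  shows "distr M (F s) (\<lambda>\<omega>. \<omega>) \<Otimes>\<^sub>M distr M borel Y = distr M (F s \<Otimes>\<^sub>M borel) (\<lambda>\<omega>. (\<omega>, Y \<omega>))"
proof -
  have Y: "Y \<in> borel_measurable M" using increment_measurable[of s t] assms by (simp add: Y_def)
  have id: "(\<lambda>\<omega>. \<omega>) \<in> measurable M (F s)" using ident_measurable_F assms by auto
  interpret D: prob_space "distr M borel Y" by (rule prob_space_distr) (rule Y)
  interpret E: prob_space "distr M (F s) (\<lambda>\<omega>. \<omega>)" by (rule prob_space_distr) (rule id)
  show ?thesis
  proof (rule pair_measure_eqI)
    fix A C assume A: "A \<in> sets (distr M (F s) (\<lambda>\<omega>. \<omega>))" and C: "C \<in> sets (distr M borel Y)"
    have A': "A \<in> sets (F s)" "A \<subseteq> space M" using A sets.sets_into_space[of A "F s"] by auto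
    have C': "Y -` C \<inter> space M \<in> sets (vimage_algebra (space M) Y borel)" using C by (simp add: in_vimage_algebra)
    have "prob (A \<inter> (Y -` C \<inter> space M)) = prob A * prob (Y -` C \<inter> space M)"
      by (rule indep_setD[OF increment_indep_set[OF assms(1-3)]]) (use A' C' in \<open>auto simp: Y_def\<close>)
    then have "emeasure M A * emeasure M (Y -` C \<inter> space M) = emeasure M (A \<inter> (Y -` C \<inter> space M))"
      by (simp add: emeasure_eq_measure ennreal_mult)
    moreover have "(\<lambda>\<omega>. (\<omega>, Y \<omega>)) -` (A \<times> C) \<inter> space M = A \<inter> (Y -` C \<inter> space M)" by auto
    moreover have "A \<inter> space M = A" using A' by auto
    ultimately show "emeasure (distr M (F s) (\<lambda>\<omega>. \<omega>)) A * emeasure (distr M borel Y) C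
        = emeasure (distr M (F s \<Otimes>\<^sub>M borel) (\<lambda>\<omega>. (\<omega>, Y \<omega>))) (A \<times> C)"
      using A' C Y id by (simp add: emeasure_distr vimage_def Collect_conj_eq Int_def[symmetric])
  qed (auto intro: E.sigma_finite_measure D.sigma_finite_measure)
qed

lemma increment_indep_var:
  assumes "0 \<le> s" "s < t" "t \<le> 1" and Z: "Z \<in> borel_measurable (F s)"
  shows "indep_var borel Z borel (\<lambda>\<omega>. B t \<omega> - B s \<omega>)"
proof -
  have "sigma_sets (space M) {Z -` A \<inter> space M | A. A \<in> sets borel} \<subseteq> sets (F s)"
    using measurable_sets[OF Z] by (intro sets.sigma_sets_subset[where M="F s", simplified]) auto
  then have "indep_set (sigma_sets (space M) {Z -` A \<inter> space M | A. A \<in> sets borel})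
     (sigma_sets (space M) {(\<lambda>\<omega>. B t \<omega> - B s \<omega>) -` A \<inter> space M | A. A \<in> sets borel})"
    using increment_indep_set[OF assms(1-3)] unfolding indep_set_def sets_vimage_algebra
    by (rule_tac indep_sets_mono_sets) (auto split: bool.splits)
  then show ?thesis
    unfolding indep_var_eq using F_measurable_M[OF Z] increment_measurable[of s t] assms by auto
qed

text \<open>Conditioning without conditional expectations: in a functional of the past and an
  independent increment the past may be frozen and the increment integrated out. For
  \<open>s = t\<close> both sides evaluate \<open>H\<close> at increment 0, since
  \<open>gaussian\<close> has mass 1.\<close>

lemma nn_integral_increment:
  assumes "0 \<le> s" "s \<le> t" "t \<le> 1"
    and H: "(\<lambda>(\<omega>, x). H \<omega> x) \<in> borel_measurable (F s \<Otimes>\<^sub>M borel)"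
  shows "(\<integral>\<^sup>+\<omega>. H \<omega> (B t \<omega> - B s \<omega>) \<partial>M) = (\<integral>\<^sup>+\<omega>. \<integral>\<^sup>+x. H \<omega> (sqrt (t - s) * x) \<partial>gaussian \<partial>M)"
proof (cases "s = t")
  case True
  then show ?thesis by simp
next
  case False
  then have st: "s < t" using assms by simp
  let ?Y = "\<lambda>\<omega>. B t \<omega> - B s \<omega>"
  have Y: "?Y \<in> borel_measurable M" using increment_measurable[of s t] assms by simp
  have id: "(\<lambda>\<omega>. \<omega>) \<in> measurable M (F s)" using ident_measurable_F assms by auto
  note J = increment_pair_distr[OF assms(1) st assms(3)]
  interpret D: prob_space "distr M borel ?Y" by (rule prob_space_distr) (rule Y)
  have "(\<integral>\<^sup>+\<omega>. H \<omega> (?Y \<omega>) \<partial>M) = (\<integral>\<^sup>+z. (case z of (\<omega>, x) \<Rightarrow> H \<omega> x) \<partial>distr M (F s \<Otimes>\<^sub>M borel) (\<lambda>\<omega>. (\<omega>, ?Y \<omega>)))"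
    by (subst nn_integral_distr) (use H in \<open>auto intro!: measurable_Pair id Y\<close>)
  also have "\<dots> = (\<integral>\<^sup>+\<omega>. \<integral>\<^sup>+x. H \<omega> x \<partial>distr M borel ?Y \<partial>distr M (F s) (\<lambda>\<omega>. \<omega>))"
    using H by (subst J[symmetric], subst D.nn_integral_fst[symmetric]) (auto cong: measurable_cong_sets)
  also have "\<dots> = (\<integral>\<^sup>+\<omega>. \<integral>\<^sup>+x. H \<omega> x \<partial>distr gaussian borel (\<lambda>x. sqrt (t - s) * x) \<partial>distr M (F s) (\<lambda>\<omega>. \<omega>))"
    using increment_distr[OF assms(1) st assms(3)] by simp
  also have "\<dots> = (\<integral>\<^sup>+\<omega>. \<integral>\<^sup>+x. H \<omega> x \<partial>distr gaussian borel (\<lambda>x. sqrt (t - s) * x) \<partial>M)"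
  proof -
    interpret G: prob_space "distr gaussian borel (\<lambda>x. sqrt (t - s) * x)" by (rule gaussian.prob_space_distr) simp
    have "(\<lambda>\<omega>. \<integral>\<^sup>+x. H \<omega> x \<partial>distr gaussian borel (\<lambda>x. sqrt (t - s) * x)) \<in> borel_measurable (F s)"
      using H by (intro G.borel_measurable_nn_integral) (auto cong: measurable_cong_sets)
    then show ?thesis by (subst nn_integral_distr[OF id]) auto
  qed
  also have "\<dots> = (\<integral>\<^sup>+\<omega>. \<integral>\<^sup>+x. H \<omega> (sqrt (t - s) * x) \<partial>gaussian \<partial>M)"
  proof (rule nn_integral_cong)
    fix \<omega> assume "\<omega> \<in> space M"
    then have "(\<lambda>x. H \<omega> x) \<in> borel_measurable borel"
      using measurable_compose[OF measurable_Pair1' H] by simp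
    then show "(\<integral>\<^sup>+x. H \<omega> x \<partial>distr gaussian borel (\<lambda>x. sqrt (t - s) * x)) = (\<integral>\<^sup>+x. H \<omega> (sqrt (t - s) * x) \<partial>gaussian)"
      by (subst nn_integral_distr) auto
  qed
  finally show ?thesis .
qed

end

section \<open>The Ito isometry for simple integrands\<close>

context brownian begin

lemma integrable_increment_iff:
  fixes g :: "real \<Rightarrow> real"
  assumes "0 \<le> s" "s \<le> t" "t \<le> 1" and [measurable]: "g \<in> borel_measurable borel"
  shows "integrable M (\<lambda>\<omega>. g (B t \<omega> - B s \<omega>)) \<longleftrightarrow> integrable gaussian (\<lambda>x. g (sqrt (t - s) * x))"
proof (cases "s = t")
  case False
  have "integrable M (\<lambda>\<omega>. g (B t \<omega> - B s \<omega>)) \<longleftrightarrow> integrable (distr M borel (\<lambda>\<omega>. B t \<omega> - B s \<omega>)) g"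
    using increment_measurable[OF assms(1-3)] by (subst integrable_distr_eq) auto
  also have "\<dots> \<longleftrightarrow> integrable gaussian (\<lambda>x. g (sqrt (t - s) * x))"
    using False assms by (subst increment_distr) (auto simp: integrable_distr_eq)
  finally show ?thesis .
qed simp

lemma integral_increment_eq:
  fixes g :: "real \<Rightarrow> real"
  assumes "0 \<le> s" "s \<le> t" "t \<le> 1" and [measurable]: "g \<in> borel_measurable borel"
  shows "(\<integral>\<omega>. g (B t \<omega> - B s \<omega>) \<partial>M) = (\<integral>x. g (sqrt (t - s) * x) \<partial>gaussian)"
proof (cases "s = t")
  case False
  have "(\<integral>\<omega>. g (B t \<omega> - B s \<omega>) \<partial>M) = integral\<^sup>L (distr M borel (\<lambda>\<omega>. B t \<omega> - B s \<omega>)) g"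
    using increment_measurable[OF assms(1-3)] by (subst integral_distr) auto
  also have "\<dots> = (\<integral>x. g (sqrt (t - s) * x) \<partial>gaussian)"
    using False assms by (subst increment_distr) (auto simp: integral_distr)
  finally show ?thesis .
qed (simp add: prob_space)

lemma integrable_increment_power:
  assumes "0 \<le> s" "s \<le> t" "t \<le> 1"
  shows "integrable M (\<lambda>\<omega>. (B t \<omega> - B s \<omega>) ^ k)"
  using integrable_increment_iff[OF assms, of "\<lambda>x. x ^ k"]
  by (simp add: power_mult_distrib integrable_gaussian_power)

lemma integrable_increment:
  assumes "0 \<le> s" "s \<le> t" "t \<le> 1"
  shows "integrable M (\<lambda>\<omega>. B t \<omega> - B s \<omega>)"
  using integrable_increment_power[OF assms, of 1] by simp

lemma increment_moments:
  assumes "0 \<le> s" "s \<le> t" "t \<le> 1"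
  shows "(\<integral>\<omega>. B t \<omega> - B s \<omega> \<partial>M) = 0" "(\<integral>\<omega>. (B t \<omega> - B s \<omega>)\<^sup>2 \<partial>M) = t - s"
    "(\<integral>\<omega>. (B t \<omega> - B s \<omega>) ^ 4 \<partial>M) = 3 * (t - s)\<^sup>2"
  using integral_increment_eq[OF assms, of "\<lambda>x. x ^ 1"] integral_increment_eq[OF assms, of "\<lambda>x. x ^ 2"]
    integral_increment_eq[OF assms, of "\<lambda>x. x ^ 4"] assms gaussian_moments
    power_mult[of "sqrt (t - s)" 2 2]
  by (simp_all add: power_mult_distrib)

lemma integrable_B_power:
  assumes "0 \<le> t" "t \<le> 1"
  shows "integrable M (\<lambda>\<omega>. B t \<omega> ^ k)"
proof -
  have "integrable M (\<lambda>\<omega>. (B t \<omega> - B 0 \<omega>) ^ k)" using integrable_increment_power[of 0 t k] assms by simp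
  then show ?thesis by (rule Bochner_Integration.integrable_cong[THEN iffD1, rotated 2]) (auto simp: B_0)
qed

lemma integrable_B: "0 \<le> t \<Longrightarrow> t \<le> 1 \<Longrightarrow> integrable M (B t)"
  using integrable_B_power[of t 1] by simp

lemma B_moments:
  assumes "0 \<le> t" "t \<le> 1"
  shows "(\<integral>\<omega>. B t \<omega> \<partial>M) = 0" "(\<integral>\<omega>. (B t \<omega>)\<^sup>2 \<partial>M) = t" "(\<integral>\<omega>. B t \<omega> ^ 4 \<partial>M) = 3 * t\<^sup>2"
proof -
  have "(\<integral>\<omega>. B t \<omega> ^ k \<partial>M) = (\<integral>\<omega>. (B t \<omega> - B 0 \<omega>) ^ k \<partial>M)" for k
    by (rule Bochner_Integration.integral_cong) (auto simp: B_0)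
  from this[of 1] this[of 2] this[of 4]
  show "(\<integral>\<omega>. B t \<omega> \<partial>M) = 0" "(\<integral>\<omega>. (B t \<omega>)\<^sup>2 \<partial>M) = t" "(\<integral>\<omega>. B t \<omega> ^ 4 \<partial>M) = 3 * t\<^sup>2"
    using increment_moments[of 0 t] assms by simp_all
qed

text \<open>Applied with \<open>g\<close> the identity, where the increment has mean 0, and with
  \<open>g\<close> the square, where the mean is the length of the interval.\<close>

lemma adapted_times_increment:
  fixes g :: "real \<Rightarrow> real"
  assumes "0 \<le> s" "s \<le> t" "t \<le> 1" and Z: "Z \<in> borel_measurable (F s)" "integrable M Z"
    and [measurable]: "g \<in> borel_measurable borel" and g: "integrable M (\<lambda>\<omega>. g (B t \<omega> - B s \<omega>))"
  shows "has_bochner_integral M (\<lambda>\<omega>. Z \<omega> * g (B t \<omega> - B s \<omega>))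
    ((\<integral>\<omega>. Z \<omega> \<partial>M) * (\<integral>\<omega>. g (B t \<omega> - B s \<omega>) \<partial>M))"
proof (cases "s = t")
  case True
  then show ?thesis using Z by (auto simp: has_bochner_integral_iff prob_space)
next
  case False
  then have "indep_var borel Z borel (\<lambda>\<omega>. B t \<omega> - B s \<omega>)"
    using increment_indep_var[of s t Z] assms by simp
  then have "indep_var borel ((\<lambda>x. x) \<circ> Z) borel (g \<circ> (\<lambda>\<omega>. B t \<omega> - B s \<omega>))"
    by (rule indep_var_compose) auto
  then have "indep_var borel Z borel (\<lambda>\<omega>. g (B t \<omega> - B s \<omega>))" by (simp add: comp_def)
  then show ?thesis
    using indep_var_lebesgue_integral[of Z] indep_var_integrable[of Z] Z g
    by (auto simp: has_bochner_integral_iff)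
qed

lemma integrable_bounded:
  fixes X :: "'a \<Rightarrow> real"
  assumes "X \<in> borel_measurable M" "\<And>\<omega>. \<omega> \<in> space M \<Longrightarrow> \<bar>X \<omega>\<bar> \<le> C"
  shows "integrable M X"
  using assms by (intro integrable_const_bound[where B=C]) auto

lemma integrable_bounded_mult:
  fixes X :: "'a \<Rightarrow> real"
  assumes "X \<in> borel_measurable M" "\<And>\<omega>. \<omega> \<in> space M \<Longrightarrow> \<bar>X \<omega>\<bar> \<le> C" "integrable M Y"
  shows "integrable M (\<lambda>\<omega>. X \<omega> * Y \<omega>)"
proof (rule Bochner_Integration.integrable_bound)
  show "integrable M (\<lambda>\<omega>. C * Y \<omega>)" using assms by simp
  show "(\<lambda>\<omega>. X \<omega> * Y \<omega>) \<in> borel_measurable M" using assms by measurable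
  have "norm (X \<omega> * Y \<omega>) \<le> norm (C * Y \<omega>)" if "\<omega> \<in> space M" for \<omega>
  proof -
    have "\<bar>X \<omega>\<bar> \<le> \<bar>C\<bar>" using assms(2)[OF that] by simp
    then show ?thesis by (simp add: abs_mult mult_right_mono)
  qed
  then show "AE \<omega> in M. norm (X \<omega> * Y \<omega>) \<le> norm (C * Y \<omega>)" by auto
qed

text \<open>If \<open>a <= c\<close>, both weights are known at time \<open>c\<close>. Only the
  square of the increment over the common part of the two intervals contributes; every other term
  contains an increment that begins when everything else is already known, and so has mean
  0.\<close>

lemma elementary_product_aux:
  assumes t: "0 \<le> a" "a \<le> b" "b \<le> 1" "c \<le> d" "d \<le> 1" "a \<le> c"
    and X: "X \<in> borel_measurable (F a)" "\<And>\<omega>. \<omega> \<in> space M \<Longrightarrow> \<bar>X \<omega>\<bar> \<le> C"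
    and Z: "Z \<in> borel_measurable (F c)" "\<And>\<omega>. \<omega> \<in> space M \<Longrightarrow> \<bar>Z \<omega>\<bar> \<le> D"
  shows "has_bochner_integral M (\<lambda>\<omega>. (X \<omega> * (B b \<omega> - B a \<omega>)) * (Z \<omega> * (B d \<omega> - B c \<omega>)))
    ((\<integral>\<omega>. X \<omega> * Z \<omega> \<partial>M) * measure lborel ({a<..b} \<inter> {c<..d}))"
proof -
  have XF: "X \<in> borel_measurable (F c)" using natural_filtration_measurable_mono[OF X(1)] t by simp
  have Y: "(\<lambda>\<omega>. X \<omega> * Z \<omega>) \<in> borel_measurable (F c)" using XF Z(1) by measurable
  have YM: "(\<lambda>\<omega>. X \<omega> * Z \<omega>) \<in> borel_measurable M" using F_measurable_M[OF Y] t by simp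
  have Yb: "\<bar>X \<omega> * Z \<omega>\<bar> \<le> C * D" if "\<omega> \<in> space M" for \<omega>
    using X(2)[OF that] Z(2)[OF that] by (simp add: abs_mult mult_mono)
  have YF: "(\<lambda>\<omega>. X \<omega> * Z \<omega>) \<in> borel_measurable (F u)" if "c \<le> u" for u
    using natural_filtration_measurable_mono[OF Y that] .
  have zero: "has_bochner_integral M (\<lambda>\<omega>. ((X \<omega> * Z \<omega>) * (B q \<omega> - B p \<omega>)) * (B v \<omega> - B u \<omega>)) 0"
    if "0 \<le> p" "p \<le> q" "q \<le> u" "c \<le> u" "u \<le> v" "v \<le> 1" for p q u v
  proof -
    have m[measurable]: "B q \<in> borel_measurable (F u)" "B p \<in> borel_measurable (F u)"
      using that t by (auto intro: measurable_natural_filtration)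
    note [measurable] = YF[OF that(4)]
    have i: "integrable M (\<lambda>\<omega>. (X \<omega> * Z \<omega>) * (B q \<omega> - B p \<omega>))"
      by (rule integrable_bounded_mult[OF YM Yb integrable_increment]) (use that in auto)
    have ad: "(\<lambda>\<omega>. (X \<omega> * Z \<omega>) * (B q \<omega> - B p \<omega>)) \<in> borel_measurable (F u)" by measurable
    have "0 \<le> u" using that t by linarith
    with adapted_times_increment[OF _ that(5,6) ad i, of "\<lambda>x. x"] 
    show ?thesis
      using integrable_increment[of u v] increment_moments(1)[of u v] that by simp
  qed
  show ?thesis
  proof (cases "b \<le> c")
    case True
    then have "{a<..b} \<inter> {c<..d} = {}" by auto
    then show ?thesis using zero[of a b c d] True t by (simp add: ac_simps)
  next
    case False
    \<comment> \<open>For overlapping intervals the product of increments is the square of the one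
      over \<open>{c<..e}\<close>, plus that one times the one over \<open>{e<..f}\<close>, plus the
      one over \<open>{a<..c}\<close> times the one over \<open>{c<..d}\<close>. With
      \<open>e\<close> and \<open>f\<close> the formula is the same whichever interval ends
      first.\<close>
    define e f where "e = min b d" and "f = max b d"
    have ef: "c \<le> e" "e \<le> f" "f \<le> 1" "0 \<le> c" using t False by (auto simp: e_def f_def)
    have Ic: "{a<..b} \<inter> {c<..d} = {c<..e}" using t False by (auto simp: e_def)
    have "has_bochner_integral M (\<lambda>\<omega>. (X \<omega> * Z \<omega>) * (B e \<omega> - B c \<omega>)\<^sup>2) ((\<integral>\<omega>. X \<omega> * Z \<omega> \<partial>M) * (e - c))"
      using adapted_times_increment[of c e "\<lambda>\<omega>. X \<omega> * Z \<omega>" "\<lambda>x. x\<^sup>2"] ef Y integrable_bounded[OF YM Yb]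
        integrable_increment_power[of c e 2] increment_moments(2)[of c e] by simp
    from has_bochner_integral_add[OF has_bochner_integral_add[OF this zero[of c e e f]] zero[of a c c d]]
    have "has_bochner_integral M (\<lambda>\<omega>. (X \<omega> * Z \<omega>) * (B e \<omega> - B c \<omega>)\<^sup>2 + ((X \<omega> * Z \<omega>) * (B e \<omega> - B c \<omega>)) * (B f \<omega> - B e \<omega>)
        + ((X \<omega> * Z \<omega>) * (B c \<omega> - B a \<omega>)) * (B d \<omega> - B c \<omega>)) ((\<integral>\<omega>. X \<omega> * Z \<omega> \<partial>M) * (e - c))"
      using ef t by simp
    moreover have "(X \<omega> * Z \<omega>) * (B e \<omega> - B c \<omega>)\<^sup>2 + ((X \<omega> * Z \<omega>) * (B e \<omega> - B c \<omega>)) * (B f \<omega> - B e \<omega>)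
        + ((X \<omega> * Z \<omega>) * (B c \<omega> - B a \<omega>)) * (B d \<omega> - B c \<omega>)
        = (X \<omega> * (B b \<omega> - B a \<omega>)) * (Z \<omega> * (B d \<omega> - B c \<omega>))" for \<omega>
      by (cases "b \<le> d") (simp_all add: e_def f_def min_def max_def power2_eq_square algebra_simps)
    moreover have "measure lborel ({a<..b} \<inter> {c<..d}) = e - c" unfolding Ic using ef by simp
    ultimately show ?thesis by (simp only:)
  qed
qed

lemma elementary_product:
  assumes t: "0 \<le> a" "a \<le> b" "b \<le> 1" "0 \<le> c" "c \<le> d" "d \<le> 1"
    and X: "X \<in> borel_measurable (F a)" "\<And>\<omega>. \<omega> \<in> space M \<Longrightarrow> \<bar>X \<omega>\<bar> \<le> C"
    and Z: "Z \<in> borel_measurable (F c)" "\<And>\<omega>. \<omega> \<in> space M \<Longrightarrow> \<bar>Z \<omega>\<bar> \<le> D"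
  shows "has_bochner_integral M (\<lambda>\<omega>. (X \<omega> * (B b \<omega> - B a \<omega>)) * (Z \<omega> * (B d \<omega> - B c \<omega>)))
    ((\<integral>\<omega>. X \<omega> * Z \<omega> \<partial>M) * measure lborel ({a<..b} \<inter> {c<..d}))"
proof (cases "a \<le> c")
  case True
  show ?thesis by (rule elementary_product_aux[OF t(1-3,5,6) True X Z])
next
  case False
  with elementary_product_aux[OF t(4-6,2,3) _ Z X] show ?thesis
    by (simp add: ac_simps Int_commute)
qed

text \<open>The intervals may overlap and come in any order: the pairwise covariances are governed
  by the lengths of the intersections, and these are also the integrals of products of indicators.
  So two simple integrands on different grids can be compared without a common refinement.\<close>

lemma ito_isometry_family:
  assumes J: "finite J" and t: "\<And>j. j \<in> J \<Longrightarrow> 0 \<le> a j \<and> a j \<le> b j \<and> b j \<le> 1"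
    and X: "\<And>j. j \<in> J \<Longrightarrow> X j \<in> borel_measurable (F (a j))" "\<And>j. j \<in> J \<Longrightarrow> \<exists>C. \<forall>\<omega>\<in>space M. \<bar>X j \<omega>\<bar> \<le> C"
  shows "(\<integral>\<^sup>+\<omega>. ennreal ((\<Sum>j\<in>J. X j \<omega> * (B (b j) \<omega> - B (a j) \<omega>))\<^sup>2) \<partial>M)
    = (\<integral>\<^sup>+\<omega>. (\<integral>\<^sup>+r\<in>{0..1}. ennreal ((\<Sum>j\<in>J. X j \<omega> * indicator {a j<..b j} r)\<^sup>2) \<partial>lborel) \<partial>M)"
proof -
  let ?m = "\<lambda>i j. measure lborel ({a i<..b i} \<inter> {a j<..b j})"
  have inner: "(\<integral>\<^sup>+r\<in>{0..1}. ennreal ((\<Sum>j\<in>J. X j \<omega> * indicator {a j<..b j} r)\<^sup>2) \<partial>lborel)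
     = ennreal (\<Sum>i\<in>J. \<Sum>j\<in>J. X i \<omega> * X j \<omega> * ?m i j)" 
     and innerpos: "0 \<le> (\<Sum>i\<in>J. \<Sum>j\<in>J. X i \<omega> * X j \<omega> * ?m i j)" for \<omega>
  proof -
    have sq: "(\<Sum>j\<in>J. X j \<omega> * indicator {a j<..b j} r)\<^sup>2
       = (\<Sum>i\<in>J. \<Sum>j\<in>J. X i \<omega> * X j \<omega> * indicator ({a i<..b i} \<inter> {a j<..b j}) r)" for r
      by (simp add: power2_eq_square sum_product indicator_inter_arith ac_simps del: Int_greaterThanAtMost)
    have fin: "emeasure lborel ({a i<..b i} \<inter> {a j<..b j}) < \<infinity>" if "i \<in> J" for i j
    proof -
      have "emeasure lborel ({a i<..b i} \<inter> {a j<..b j}) \<le> emeasure lborel {a i<..b i}"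
        by (rule emeasure_mono) auto
      also have "\<dots> < \<infinity>" using t[OF that] by simp
      finally show ?thesis .
    qed
    have hb: "has_bochner_integral lborel (\<lambda>r. (\<Sum>j\<in>J. X j \<omega> * indicator {a j<..b j} r)\<^sup>2)
       (\<Sum>i\<in>J. \<Sum>j\<in>J. X i \<omega> * X j \<omega> * ?m i j)"
      unfolding sq using fin
      by (intro has_bochner_integral_sum has_bochner_integral_mult_right has_bochner_integral_real_indicator) auto
    have "(\<integral>\<^sup>+r\<in>{0..1}. ennreal ((\<Sum>j\<in>J. X j \<omega> * indicator {a j<..b j} r)\<^sup>2) \<partial>lborel)
      = (\<integral>\<^sup>+r. ennreal ((\<Sum>j\<in>J. X j \<omega> * indicator {a j<..b j} r)\<^sup>2) \<partial>lborel)"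
    proof (rule nn_integral_cong)
      fix r
      have "(\<Sum>j\<in>J. X j \<omega> * indicator {a j<..b j} r) = 0" if "r \<notin> {0..1}"
      proof (rule sum.neutral, safe)
        fix j assume "j \<in> J"
        from t[OF this] that show "X j \<omega> * indicator {a j<..b j} r = 0" by (auto simp: indicator_def)
      qed
      then show "ennreal ((\<Sum>j\<in>J. X j \<omega> * indicator {a j<..b j} r)\<^sup>2) * indicator {0..1} r
         = ennreal ((\<Sum>j\<in>J. X j \<omega> * indicator {a j<..b j} r)\<^sup>2)"
        by (cases "r \<in> {0..1}") simp_all
    qed
    also have "\<dots> = ennreal (\<Sum>i\<in>J. \<Sum>j\<in>J. X i \<omega> * X j \<omega> * ?m i j)"
      using hb by (subst nn_integral_eq_integral) (auto simp: has_bochner_integral_iff)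
    finally show "(\<integral>\<^sup>+r\<in>{0..1}. ennreal ((\<Sum>j\<in>J. X j \<omega> * indicator {a j<..b j} r)\<^sup>2) \<partial>lborel)
     = ennreal (\<Sum>i\<in>J. \<Sum>j\<in>J. X i \<omega> * X j \<omega> * ?m i j)" .
    have "0 \<le> (\<integral>r. (\<Sum>j\<in>J. X j \<omega> * indicator {a j<..b j} r)\<^sup>2 \<partial>lborel)"
      by (rule integral_nonneg_AE) auto
    then show "0 \<le> (\<Sum>i\<in>J. \<Sum>j\<in>J. X i \<omega> * X j \<omega> * ?m i j)"
      using hb by (simp add: has_bochner_integral_integral_eq)
  qed
  have XM: "X j \<in> borel_measurable M" if "j \<in> J" for j
    using F_measurable_M[OF X(1)] that t[OF that] by simp
  have XX: "integrable M (\<lambda>\<omega>. X i \<omega> * X j \<omega>)" if ij: "i \<in> J" "j \<in> J" for i j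
  proof -
    obtain C where C: "\<And>\<omega>. \<omega> \<in> space M \<Longrightarrow> \<bar>X i \<omega>\<bar> \<le> C" using X(2)[OF ij(1)] by auto
    obtain D where D: "\<And>\<omega>. \<omega> \<in> space M \<Longrightarrow> \<bar>X j \<omega>\<bar> \<le> D" using X(2)[OF ij(2)] by auto
    show ?thesis
      by (rule integrable_bounded_mult[OF XM[OF ij(1)] C integrable_bounded[OF XM[OF ij(2)] D]])
  qed
  have "has_bochner_integral M (\<lambda>\<omega>. (\<Sum>j\<in>J. X j \<omega> * (B (b j) \<omega> - B (a j) \<omega>))\<^sup>2)
     (\<Sum>i\<in>J. \<Sum>j\<in>J. (\<integral>\<omega>. X i \<omega> * X j \<omega> \<partial>M) * ?m i j)"
    unfolding power2_eq_square sum_product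
  proof (intro has_bochner_integral_sum)
    fix i j assume ij: "i \<in> J" "j \<in> J"
    obtain C D where "\<And>\<omega>. \<omega> \<in> space M \<Longrightarrow> \<bar>X i \<omega>\<bar> \<le> C" "\<And>\<omega>. \<omega> \<in> space M \<Longrightarrow> \<bar>X j \<omega>\<bar> \<le> D"
      using X(2)[OF ij(1)] X(2)[OF ij(2)] by auto
    then show "has_bochner_integral M (\<lambda>\<omega>. X i \<omega> * (B (b i) \<omega> - B (a i) \<omega>) * (X j \<omega> * (B (b j) \<omega> - B (a j) \<omega>)))
           ((\<integral>\<omega>. X i \<omega> * X j \<omega> \<partial>M) * ?m i j)"
      using ij t X(1) by (intro elementary_product) auto
  qed
  then have "(\<integral>\<^sup>+\<omega>. ennreal ((\<Sum>j\<in>J. X j \<omega> * (B (b j) \<omega> - B (a j) \<omega>))\<^sup>2) \<partial>M)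
      = ennreal (\<Sum>i\<in>J. \<Sum>j\<in>J. (\<integral>\<omega>. X i \<omega> * X j \<omega> \<partial>M) * ?m i j)"
    by (subst nn_integral_eq_integral) (auto simp: has_bochner_integral_iff)
  also have "(\<Sum>i\<in>J. \<Sum>j\<in>J. (\<integral>\<omega>. X i \<omega> * X j \<omega> \<partial>M) * ?m i j)
      = (\<integral>\<omega>. (\<Sum>i\<in>J. \<Sum>j\<in>J. X i \<omega> * X j \<omega> * ?m i j) \<partial>M)"
    using XX by (subst Bochner_Integration.integral_sum, force)+ simp
  also have "ennreal \<dots> = (\<integral>\<^sup>+\<omega>. ennreal (\<Sum>i\<in>J. \<Sum>j\<in>J. X i \<omega> * X j \<omega> * ?m i j) \<partial>M)"
    using XX innerpos by (intro nn_integral_eq_integral[symmetric]) auto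
  finally show ?thesis by (simp add: inner)
qed

lemma simple_integrand_grid:
  assumes "simple_integrand M B n s \<xi>"
  shows "i \<le> j \<Longrightarrow> j \<le> n \<Longrightarrow> s i \<le> s j" "i \<le> n \<Longrightarrow> 0 \<le> s i" "i \<le> n \<Longrightarrow> s i \<le> 1"
proof -
  have m: "s i \<le> s j" if "i \<le> j" "j \<le> n" for i j
    using that
  proof (induct rule: dec_induct)
    case (step k)
    then have "s k \<le> s (Suc k)" using assms by (simp add: simple_integrand_def)
    with step show ?case by simp
  qed simp
  show "i \<le> j \<Longrightarrow> j \<le> n \<Longrightarrow> s i \<le> s j" by (rule m)
  show "i \<le> n \<Longrightarrow> 0 \<le> s i" "i \<le> n \<Longrightarrow> s i \<le> 1" 
    using m[of 0 i] m[of i n] assms by (auto simp: simple_integrand_def)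
qed

lemma simple_ito_1:
  assumes "simple_integrand M B n s \<xi>"
  shows "simple_ito B n s \<xi> 1 \<omega> = (\<Sum>i<n. \<xi> i \<omega> * (B (s (Suc i)) \<omega> - B (s i) \<omega>))"
  unfolding simple_ito_def
  by (intro sum.cong) (use simple_integrand_grid[OF assms] in \<open>auto simp: min_def antisym\<close>)

lemma simple_ito_diff_isometry:
  assumes S: "simple_integrand M B n s \<xi>" and S': "simple_integrand M B n' s' \<xi>'"
  shows "(\<integral>\<^sup>+\<omega>. ennreal ((simple_ito B n s \<xi> 1 \<omega> - simple_ito B n' s' \<xi>' 1 \<omega>)\<^sup>2) \<partial>M)
    = (\<integral>\<^sup>+\<omega>. (\<integral>\<^sup>+r\<in>{0..1}. ennreal ((simple_process n s \<xi> r \<omega> - simple_process n' s' \<xi>' r \<omega>)\<^sup>2) \<partial>lborel) \<partial>M)"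
proof -
  \<comment> \<open>The difference of two simple integrals is a single family over the disjoint
    union of the index sets, with the second family negated.\<close>
  let ?J = "{..<n} <+> {..<n'}"
  let ?a = "case_sum s s'" and ?b = "case_sum (\<lambda>i. s (Suc i)) (\<lambda>i. s' (Suc i))"
  let ?X = "case_sum \<xi> (\<lambda>i \<omega>. - \<xi>' i \<omega>)"
  have eq1: "(\<Sum>j\<in>?J. ?X j \<omega> * (B (?b j) \<omega> - B (?a j) \<omega>)) = simple_ito B n s \<xi> 1 \<omega> - simple_ito B n' s' \<xi>' 1 \<omega>" for \<omega>
    by (subst sum.Plus) (auto simp: simple_ito_1[OF S] simple_ito_1[OF S'] sum_negf comp_def)
  have eq2: "(\<Sum>j\<in>?J. ?X j \<omega> * indicator {?a j<..?b j} r) = simple_process n s \<xi> r \<omega> - simple_process n' s' \<xi>' r \<omega>" for r \<omega>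
    by (subst sum.Plus) (auto simp: simple_process_def sum_negf comp_def)
  show ?thesis
    unfolding eq1[symmetric] eq2[symmetric]
  proof (rule ito_isometry_family)
    fix j assume "j \<in> ?J"
    then show "0 \<le> ?a j \<and> ?a j \<le> ?b j \<and> ?b j \<le> 1"
      using simple_integrand_grid[OF S] simple_integrand_grid[OF S'] by auto
    show "?X j \<in> borel_measurable (F (?a j))" "\<exists>C. \<forall>\<omega>\<in>space M. \<bar>?X j \<omega>\<bar> \<le> C"
      using \<open>j \<in> ?J\<close> S S' by (auto simp: simple_integrand_def)
  qed auto
qed

end

section \<open>Lagged cell averages\<close>

text \<open>A probability space of its own, so that Fubini, Jensen and dominated convergence in the
  time variable need no indicators.\<close>

definition I01 :: "real measure" where
  "I01 = restrict_space lborel {0..1}"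

lemma space_I01 [simp]: "space I01 = {0..1}"
  by (simp add: I01_def space_restrict_space)

lemma sets_I01 [measurable_cong]: "sets I01 = sets (restrict_space borel {0..1})"
  unfolding I01_def by (intro sets_restrict_space_cong) simp

lemma prob_space_I01: "prob_space I01"
  by standard (simp add: I01_def emeasure_restrict_space space_restrict_space)

interpretation I01: prob_space I01 by (rule prob_space_I01)

lemma nn_integral_I01: "(\<integral>\<^sup>+r. f r \<partial>I01) = (\<integral>\<^sup>+r\<in>{0..1}. f r \<partial>lborel)"
  unfolding I01_def by (subst nn_integral_restrict_space) auto

lemma integral_I01:
  fixes f :: "real \<Rightarrow> real"
  shows "(\<integral>r. f r \<partial>I01) = (LINT r:{0..1}|lborel. f r)"
  unfolding I01_def set_lebesgue_integral_def by (subst integral_restrict_space) auto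

lemma integrable_I01_bounded:
  fixes f :: "real \<Rightarrow> real"
  assumes "f \<in> borel_measurable I01" "\<And>x. x \<in> {0..1} \<Longrightarrow> \<bar>f x\<bar> \<le> C"
  shows "integrable I01 f"
  using assms by (intro I01.integrable_const_bound[where B=C]) auto

definition cell :: "nat \<Rightarrow> nat \<Rightarrow> real set" where
  "cell n i = {real i / real n<..real (Suc i) / real n}"

definition cell_avg :: "nat \<Rightarrow> (real \<Rightarrow> real) \<Rightarrow> nat \<Rightarrow> real" where
  "cell_avg n f i = real n * (\<integral>r. indicator (cell n i) r * f r \<partial>I01)"

text \<open>The average over the previous cell is known at the left end of the current one, which
  makes it an adapted weight. The value 0 on the first cell is a filler on a set whose length tends
  to 0.\<close>

definition lag_avg :: "nat \<Rightarrow> (real \<Rightarrow> real) \<Rightarrow> nat \<Rightarrow> real" where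
  "lag_avg n f i = (if i = 0 then 0 else cell_avg n f (i - 1))"

definition lag_step :: "nat \<Rightarrow> (real \<Rightarrow> real) \<Rightarrow> real \<Rightarrow> real" where
  "lag_step n f r = (\<Sum>i<n. lag_avg n f i * indicator (cell n i) r)"

lemma sets_cell [measurable]: "cell n i \<in> sets borel" by (simp add: cell_def)

lemma cell_subset: "i < n \<Longrightarrow> cell n i \<subseteq> {0..1}"
proof -
  assume "i < n"
  then have "real (Suc i) / real n \<le> 1" by simp
  moreover have "0 \<le> real i / real n" by simp
  ultimately show ?thesis by (auto simp only: cell_def greaterThanAtMost_iff atLeastAtMost_iff)
qed

lemma indicator_cell_measurable [measurable]: "(indicator (cell n i) :: real \<Rightarrow> real) \<in> borel_measurable I01"
  unfolding I01_def by (intro measurable_restrict_space1) simp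

lemma integrable_cell:
  fixes f :: "real \<Rightarrow> real"
  assumes [measurable]: "f \<in> borel_measurable I01" and "\<And>x. x \<in> {0..1} \<Longrightarrow> \<bar>f x\<bar> \<le> C"
  shows "integrable I01 (\<lambda>r. indicator (cell n i) r * f r)"
proof (rule integrable_I01_bounded)
  fix x :: real assume "x \<in> {0..1}"
  from assms(2)[OF this] show "\<bar>indicator (cell n i) x * f x\<bar> \<le> C" by (cases "x \<in> cell n i") auto
qed measurable

lemma cell_disjoint:
  assumes "i \<noteq> j" shows "cell n i \<inter> cell n j = {}"
proof -
  have "cell n i \<inter> cell n j = {}" if "i < j" for i j
  proof -
    have "real (Suc i) / real n \<le> real j / real n" using that by (intro divide_right_mono) auto
    then show ?thesis by (auto simp: cell_def)
  qed
  then show ?thesis using assms by (metis Int_commute linorder_neqE_nat)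
qed

lemma cell_cover:
  assumes "0 < r" "r \<le> 1" "0 < n"
  obtains i where "i < n" "r \<in> cell n i"
proof -
  define k where "k = nat \<lceil>real n * r\<rceil>"
  have pos: "0 < real n * r" using assms by simp
  then have k: "real k = of_int \<lceil>real n * r\<rceil>" unfolding k_def by simp
  have k1: "real n * r \<le> real k" "real k < real n * r + 1" unfolding k by linarith+
  have "0 < k" using pos k1(1) by (metis of_nat_0 not_gr_zero not_le)
  have "real n * r \<le> real n" using assms by simp
  then have "k \<le> n" using k1(2) by linarith
  show thesis
  proof (rule that[of "k - 1"])
    show "k - 1 < n" using \<open>0 < k\<close> \<open>k \<le> n\<close> by linarith
    show "r \<in> cell n (k - 1)" using k1 \<open>0 < k\<close> assms by (simp add: cell_def field_simps of_nat_diff)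
  qed
qed

lemma emeasure_cell: "i < n \<Longrightarrow> emeasure I01 (cell n i) = ennreal (1 / real n)"
proof -
  assume "i < n"
  moreover have "real i / real n \<le> real (Suc i) / real n" by (intro divide_right_mono) auto
  moreover have "real (Suc i) / real n - real i / real n = 1 / real n" by (simp add: diff_divide_distrib[symmetric])
  ultimately show ?thesis
    using cell_subset[of i n] unfolding I01_def
    by (subst emeasure_restrict_space) (simp_all add: cell_def del: of_nat_Suc)
qed

lemma measure_cell: "i < n \<Longrightarrow> measure I01 (cell n i) = 1 / real n"
  by (simp add: measure_def emeasure_cell)

lemma sum_cells_single:
  assumes "i < n" "r \<in> cell n i"
  shows "(\<Sum>j<n. c j * indicator (cell n j) r) = (c i :: real)"
proof -
  have "(\<Sum>j<n. c j * indicator (cell n j) r) = (\<Sum>j<n. if j = i then c i else 0)"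
    using assms cell_disjoint[of _ i n] by (intro sum.cong) (auto simp: indicator_def)
  then show ?thesis using assms by simp
qed

lemma lag_step_cell:
  assumes "i < n" "r \<in> cell n i"
  shows "lag_step n f r = lag_avg n f i"
  unfolding lag_step_def by (rule sum_cells_single[OF assms])

lemma cell_avg_bound:
  assumes f: "f \<in> borel_measurable I01" "\<And>x. x \<in> {0..1} \<Longrightarrow> \<bar>f x\<bar> \<le> C" and i: "i < n"
  shows "\<bar>cell_avg n f i\<bar> \<le> C"
proof -
  have n: "0 < real n" using i by simp
  have 0: "0 \<le> C" using f(2)[of 0] by simp
  have "\<bar>\<integral>r. indicator (cell n i) r * f r \<partial>I01\<bar> \<le> (\<integral>r. indicator (cell n i) r * C \<partial>I01)"
  proof (rule integral_abs_bound_integral)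
    show "integrable I01 (\<lambda>r. indicator (cell n i) r * f r)" by (rule integrable_cell[OF f])
    show "integrable I01 (\<lambda>r. indicator (cell n i) r * C)" by (rule integrable_cell[where C=C]) (auto simp: 0)
    fix x assume "x \<in> space I01"
    then show "\<bar>indicator (cell n i) x * f x\<bar> \<le> indicator (cell n i) x * C"
      using f(2) by (cases "x \<in> cell n i") auto
  qed
  also have "\<dots> = C / real n" using measure_cell[OF i] cell_subset[OF i] 
    by (simp add: Int_absorb2)
  finally show ?thesis using n by (simp add: cell_avg_def abs_mult field_simps)
qed

lemma lag_avg_bound:
  assumes f: "f \<in> borel_measurable I01" "\<And>x. x \<in> {0..1} \<Longrightarrow> \<bar>f x\<bar> \<le> C" and i: "i < n"
  shows "\<bar>lag_avg n f i\<bar> \<le> C"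
  using cell_avg_bound[OF f, of "i - 1" n] i f(2)[of 0] by (auto simp: lag_avg_def)

lemma lag_step_bound:
  assumes f: "f \<in> borel_measurable I01" "\<And>x. x \<in> {0..1} \<Longrightarrow> \<bar>f x\<bar> \<le> C" and r: "r \<in> {0..1}"
  shows "\<bar>lag_step n f r\<bar> \<le> C"
proof (cases "r = 0 \<or> n = 0")
  case True
  then have "r \<notin> cell n i" if "i < n" for i using that by (auto simp: cell_def not_less)
  then have "lag_step n f r = 0" unfolding lag_step_def by (intro sum.neutral) auto
  then show ?thesis using f(2)[of 0] by simp
next
  case False
  then obtain i where "i < n" "r \<in> cell n i" using cell_cover[of r n] r by auto
  then show ?thesis using lag_avg_bound[OF f] by (simp add: lag_step_cell)
qed

lemma lag_step_measurable [measurable]: "lag_step n f \<in> borel_measurable borel"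
  unfolding lag_step_def[abs_def] by measurable

lemma lag_step_measurable_I01 [measurable]: "lag_step n f \<in> borel_measurable I01"
  unfolding I01_def by (intro measurable_restrict_space1) simp

text \<open>Each cell average is used on at most one cell, the next, and the lag only drops the last
  average. So the total is at most the sum over the cells of the integrals of
  \<open>|f|\<close>.\<close>

lemma lag_step_contraction:
  assumes f: "f \<in> borel_measurable I01" "\<And>x. x \<in> {0..1} \<Longrightarrow> \<bar>f x\<bar> \<le> C"
  shows "(\<integral>r. \<bar>lag_step n f r\<bar> \<partial>I01) \<le> (\<integral>r. \<bar>f r\<bar> \<partial>I01)"
proof (cases "n = 0")
  case False
  have n: "0 < real n" using False by simp
  have ic: "integrable I01 (\<lambda>r. indicator (cell n i) r * \<bar>f r\<bar>)" for i
    using f by (intro integrable_cell[where C=C]) auto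
  have ind: "integrable I01 (indicator (cell n i) :: real \<Rightarrow> real)" for i
    using integrable_cell[of "\<lambda>_. 1" 1 n i] by simp
  have "(\<integral>r. \<bar>lag_step n f r\<bar> \<partial>I01) \<le> (\<integral>r. (\<Sum>i<n. \<bar>lag_avg n f i\<bar> * indicator (cell n i) r) \<partial>I01)"
  proof (rule integral_mono)
    show "integrable I01 (\<lambda>r. \<bar>lag_step n f r\<bar>)"
      using lag_step_bound[OF f] by (intro integrable_I01_bounded[where C=C]) auto
    show "integrable I01 (\<lambda>r. \<Sum>i<n. \<bar>lag_avg n f i\<bar> * indicator (cell n i) r)"
      by (rule Bochner_Integration.integrable_sum) (use ind in simp)
    show "\<bar>lag_step n f r\<bar> \<le> (\<Sum>i<n. \<bar>lag_avg n f i\<bar> * indicator (cell n i) r)" for r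
      unfolding lag_step_def by (rule order_trans[OF sum_abs]) (intro sum_mono, simp only: abs_mult abs_of_nonneg[OF indicator_pos_le])
  qed
  also have "\<dots> = (\<Sum>i<n. \<bar>lag_avg n f i\<bar> * measure I01 (cell n i))"
  proof (subst Bochner_Integration.integral_sum)
    show "integrable I01 (\<lambda>r. \<bar>lag_avg n f i\<bar> * indicator (cell n i) r)" for i using ind by simp
    show "(\<Sum>i<n. \<integral>r. \<bar>lag_avg n f i\<bar> * indicator (cell n i) r \<partial>I01) = (\<Sum>i<n. \<bar>lag_avg n f i\<bar> * measure I01 (cell n i))"
      using cell_subset by (intro sum.cong) (simp_all add: Int_absorb2)
  qed
  also have "\<dots> = (\<Sum>i<n. \<bar>lag_avg n f i\<bar> / real n)"
    by (intro sum.cong) (auto simp: measure_cell)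
  also have "\<dots> = (\<Sum>i<n - 1. \<bar>cell_avg n f i\<bar> / real n)"
    using False by (cases n) (simp_all add: sum.lessThan_Suc_shift lag_avg_def del: sum.lessThan_Suc)
  also have "\<dots> \<le> (\<Sum>i<n. \<bar>cell_avg n f i\<bar> / real n)"
    by (intro sum_mono2) auto
  also have "\<dots> \<le> (\<Sum>i<n. \<integral>r. indicator (cell n i) r * \<bar>f r\<bar> \<partial>I01)"
  proof (intro sum_mono)
    fix i
    have "\<bar>cell_avg n f i\<bar> / real n = \<bar>\<integral>r. indicator (cell n i) r * f r \<partial>I01\<bar>"
      using n by (simp add: cell_avg_def abs_mult)
    also have "\<dots> \<le> (\<integral>r. \<bar>indicator (cell n i) r * f r\<bar> \<partial>I01)"
      using integral_norm_bound[of I01 "\<lambda>r. indicator (cell n i) r * f r"] by simp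
    finally show "\<bar>cell_avg n f i\<bar> / real n \<le> (\<integral>r. indicator (cell n i) r * \<bar>f r\<bar> \<partial>I01)"
      by (simp add: abs_mult)
  qed
  also have "\<dots> = (\<integral>r. (\<Sum>i<n. \<bar>f r\<bar> * indicator (cell n i) r) \<partial>I01)"
    using ic by (subst Bochner_Integration.integral_sum) (simp_all only: mult.commute[of "\<bar>f _\<bar>"])
  also have "\<dots> \<le> (\<integral>r. \<bar>f r\<bar> \<partial>I01)"
  proof (intro integral_mono)
    show "integrable I01 (\<lambda>r. \<Sum>i<n. \<bar>f r\<bar> * indicator (cell n i) r)"
      unfolding mult.commute[of "\<bar>f _\<bar>"] by (intro Bochner_Integration.integrable_sum ic)
    show "integrable I01 (\<lambda>r. \<bar>f r\<bar>)" using f by (intro integrable_I01_bounded[where C=C]) auto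
    fix r assume "r \<in> space I01"
    show "(\<Sum>i<n. \<bar>f r\<bar> * indicator (cell n i) r) \<le> \<bar>f r\<bar>"
    proof (cases "\<exists>i<n. r \<in> cell n i")
      case True
      then obtain i where "i < n" "r \<in> cell n i" by auto
      from sum_cells_single[OF this, of "\<lambda>_. \<bar>f r\<bar>"] show ?thesis by linarith
    next
      case False
      then have "(\<Sum>i<n. \<bar>f r\<bar> * indicator (cell n i) r) = 0" by (intro sum.neutral) (auto simp: indicator_def)
      then show ?thesis by linarith
    qed
  qed
  finally show ?thesis .
qed (simp add: lag_step_def)

lemma lag_step_diff:
  assumes f: "f \<in> borel_measurable I01" "\<And>x. x \<in> {0..1} \<Longrightarrow> \<bar>f x\<bar> \<le> C"
    and g: "g \<in> borel_measurable I01" "\<And>x. x \<in> {0..1} \<Longrightarrow> \<bar>g x\<bar> \<le> D"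
  shows "lag_step n (\<lambda>x. f x - g x) r = lag_step n f r - lag_step n g r"
proof -
  have ic: "integrable I01 (\<lambda>r. indicator (cell n i) r * f r)" "integrable I01 (\<lambda>r. indicator (cell n i) r * g r)" for i
    by (rule integrable_cell[OF f], assumption) (rule integrable_cell[OF g])
  have "lag_avg n (\<lambda>x. f x - g x) i = lag_avg n f i - lag_avg n g i" for i
    using ic by (simp add: lag_avg_def cell_avg_def right_diff_distrib)
  then show ?thesis by (simp only: lag_step_def sum_subtractf left_diff_distrib)
qed

lemma lag_step_continuous:
  assumes g: "continuous_on UNIV g" "\<And>x. \<bar>g x\<bar> \<le> C" and r: "0 < r" "r \<le> 1"
  shows "(\<lambda>n. lag_step n g r) \<longlonglongrightarrow> g r"
proof (rule LIMSEQ_I)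
  fix e :: real assume e: "0 < e"
  have gb[measurable]: "g \<in> borel_measurable borel" using g(1) by (rule borel_measurable_continuous_onI)
  have gm: "g \<in> borel_measurable I01" unfolding I01_def by (intro measurable_restrict_space1) simp
  have "isCont g r" using g(1) by (simp add: continuous_on_eq_continuous_at)
  then obtain d where d: "0 < d" "\<And>x. \<bar>x - r\<bar> < d \<Longrightarrow> \<bar>g x - g r\<bar> < e / 2"
    using e unfolding continuous_at_eps_delta by (metis half_gt_zero dist_real_def)
  \<comment> \<open>\<open>2 / d\<close> puts the previous cell within distance \<open>d\<close> of
    \<open>r\<close>, that is two cell widths; \<open>1 / r\<close> keeps \<open>r\<close> out of
    the first cell, where the lagged average is only the filler 0.\<close>
  obtain N :: nat where N: "2 / d + 1 / r + 1 < real N" using reals_Archimedean2 by blast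
  show "\<exists>no. \<forall>n\<ge>no. norm (lag_step n g r - g r) < e"
  proof (intro exI[of _ N] allI impI)
    fix n assume "N \<le> n"
    then have n: "2 / d + 1 / r + 1 < real n" using N by linarith
    have pos: "0 < 2 / d" "0 < 1 / r" using d r by simp_all
    then have n1: "2 / d < real n" "1 / r < real n" "0 < real n" using n by linarith+
    obtain i where i: "i < n" "r \<in> cell n i" using cell_cover[of r n] r n1 by auto
    have "i \<noteq> 0"
    proof
      assume "i = 0"
      then have "r \<le> 1 / real n" using i by (simp add: cell_def)
      moreover have "1 / real n < r" using n1 r by (simp add: field_simps)
      ultimately show False by simp
    qed
    then have i': "i - 1 < n" using i by simp
    have "lag_step n g r = cell_avg n g (i - 1)"
      using i \<open>i \<noteq> 0\<close> by (simp add: lag_step_cell lag_avg_def)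
    also have "cell_avg n g (i - 1) - g r = real n * (\<integral>x. indicator (cell n (i - 1)) x * (g x - g r) \<partial>I01)"
    proof -
      have "integrable I01 (\<lambda>x. indicator (cell n (i - 1)) x * g x)"
        using gm g(2) by (intro integrable_cell[where C=C]) auto
      then have "(\<integral>x. indicator (cell n (i - 1)) x * (g x - g r) \<partial>I01)
        = (\<integral>x. indicator (cell n (i - 1)) x * g x \<partial>I01) - measure I01 (cell n (i - 1)) * g r"
        using cell_subset[OF i'] integrable_cell[of "\<lambda>_. g r" "\<bar>g r\<bar>" n "i - 1"] by (simp add: right_diff_distrib Int_absorb2)
      moreover have "real n * (measure I01 (cell n (i - 1)) * g r) = g r" using n1 measure_cell[OF i'] by simp
      ultimately show ?thesis by (simp only: cell_avg_def right_diff_distrib[of "real n"])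
    qed
    also have "\<bar>\<dots>\<bar> \<le> real n * (\<integral>x. indicator (cell n (i - 1)) x * (e / 2) \<partial>I01)"
    proof -
      have b: "\<bar>indicator (cell n (i - 1)) x * (g x - g r)\<bar> \<le> indicator (cell n (i - 1)) x * (e / 2)" for x
      proof (cases "x \<in> cell n (i - 1)")
        case True
        have "2 / real n < d" using n1 d by (simp add: field_simps)
        moreover have "\<bar>x - r\<bar> < 2 / real n"
        proof -
          have "real (i - 1) / real n = real i / real n - 1 / real n" "real (Suc i) / real n = real i / real n + 1 / real n"
            "2 / real n = 1 / real n + 1 / real n"
            using \<open>i \<noteq> 0\<close> by (simp_all add: diff_divide_distrib[symmetric] add_divide_distrib[symmetric] of_nat_diff)
          moreover have "real (Suc (i - 1)) / real n = real i / real n" using \<open>i \<noteq> 0\<close> by simp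
          ultimately show ?thesis using i True unfolding cell_def greaterThanAtMost_iff by linarith
        qed
        ultimately have "\<bar>g x - g r\<bar> < e / 2" using d by simp
        then show ?thesis using True by simp
      qed (simp)
      have "\<bar>\<integral>x. indicator (cell n (i - 1)) x * (g x - g r) \<partial>I01\<bar> \<le> (\<integral>x. indicator (cell n (i - 1)) x * (e / 2) \<partial>I01)"
      proof (rule integral_abs_bound_integral)
        show i2: "integrable I01 (\<lambda>x. indicator (cell n (i - 1)) x * (e / 2))"
          using e by (intro integrable_cell[where C="e / 2"]) auto
        show "integrable I01 (\<lambda>x. indicator (cell n (i - 1)) x * (g x - g r))"
          by (rule Bochner_Integration.integrable_bound[OF i2]) (use b gm e in \<open>auto simp: abs_mult\<close>)
      qed (use b in auto)
      then show ?thesis using n1 by (simp add: abs_mult)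
    qed
    also have "\<dots> = e / 2"
      using n1 cell_subset[OF i'] measure_cell[OF i'] by (simp add: Int_absorb2)
    finally show "norm (lag_step n g r - g r) < e" using e by simp
  qed
qed

text \<open>A measurable function is almost everywhere a limit of continuous ones. Clipping these to
  the bound \<open>C\<close> keeps them continuous and lets dominated convergence give closeness in
  mean.\<close>

lemma continuous_L1_approximation:
  assumes f: "f \<in> borel_measurable borel" "\<And>x. \<bar>f x\<bar> \<le> C" and e: "0 < e"
  obtains g where "continuous_on UNIV g" "\<And>x. \<bar>g x\<bar> \<le> C" "(\<integral>r. \<bar>f r - g r\<bar> \<partial>I01) < (e::real)"
proof -
  have C: "0 \<le> C" using f(2)[of 0] by simp
  have "f \<in> borel_measurable lebesgue" using f(1) by (intro measurable_completion) simp
  then have "f measurable_on UNIV" by (subst measurable_on_iff_borel_measurable) auto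
  then obtain N g where N: "negligible N" and g: "\<And>n. continuous_on UNIV (g n)"
    and lim: "\<And>x. x \<notin> N \<Longrightarrow> (\<lambda>n. g n x) \<longlonglongrightarrow> f x"
    by (auto simp: measurable_on_def)
  define h where "h n x = max (- C) (min C (g n x))" for n x
  have h: "continuous_on UNIV (h n)" "\<bar>h n x\<bar> \<le> C" for n x
    unfolding h_def using g C by (auto intro!: continuous_intros)
  have hm: "h n \<in> borel_measurable I01" and fm: "f \<in> borel_measurable I01" for n
    unfolding I01_def using borel_measurable_continuous_onI[OF h(1)] f(1) by (auto intro: measurable_restrict_space1)
  have "AE x in lebesgue. x \<notin> N" using N by (simp add: negligible_iff_null_sets AE_not_in)
  then have "AE x in lborel. x \<notin> N" by (simp add: AE_completion_iff)
  then have "AE x in I01. x \<notin> N" unfolding I01_def by (subst AE_restrict_space_iff) auto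
  then have "AE x in I01. (\<lambda>n. \<bar>f x - h n x\<bar>) \<longlonglongrightarrow> 0"
  proof (rule AE_mp, intro AE_I2 impI)
    fix x assume "x \<notin> N"
    then have "(\<lambda>n. h n x) \<longlonglongrightarrow> max (- C) (min C (f x))"
      unfolding h_def by (intro tendsto_intros lim)
    also have "max (- C) (min C (f x)) = f x" using f(2)[of x] by linarith
    finally have "(\<lambda>n. \<bar>f x - h n x\<bar>) \<longlonglongrightarrow> \<bar>f x - f x\<bar>" by (intro tendsto_intros)
    then show "(\<lambda>n. \<bar>f x - h n x\<bar>) \<longlonglongrightarrow> 0" by simp
  qed
  then have "(\<lambda>n. \<integral>r. \<bar>f r - h n r\<bar> \<partial>I01) \<longlonglongrightarrow> (\<integral>r. 0 \<partial>I01)"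
  proof (rule integral_dominated_convergence[where w="\<lambda>_. 2 * C", rotated 3])
    show "AE x in I01. norm \<bar>f x - h n x\<bar> \<le> 2 * C" for n
      using f(2) h(2)[of n] by (intro AE_I2) (simp, smt (verit, best))
  qed (use hm fm in auto)
  then have "(\<lambda>n. \<integral>r. \<bar>f r - h n r\<bar> \<partial>I01) \<longlonglongrightarrow> 0" by simp
  then have "eventually (\<lambda>n. (\<integral>r. \<bar>f r - h n r\<bar> \<partial>I01) < e) sequentially"
    using e by (rule order_tendstoD)
  then obtain n where "(\<integral>r. \<bar>f r - h n r\<bar> \<partial>I01) < e" by (auto simp: eventually_sequentially)
  then show thesis using that[of "h n"] h by blast
qed

text \<open>A three-part estimate with a continuous \<open>g\<close> close to \<open>f\<close> in
  mean: the lagged steps of \<open>g\<close> converge pointwise, and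
  \<open>lag_step_contraction\<close> controls those of \<open>f - g\<close> uniformly in
  \<open>n\<close>.\<close>

lemma lag_step_tendsto_L1:
  assumes f: "f \<in> borel_measurable I01" "\<And>x. x \<in> {0..1} \<Longrightarrow> \<bar>f x\<bar> \<le> C"
  shows "(\<lambda>n. \<integral>r. \<bar>lag_step n f r - f r\<bar> \<partial>I01) \<longlonglongrightarrow> 0"
proof (rule LIMSEQ_I)
  fix e :: real assume e: "0 < e"
  have C: "0 \<le> C" using f(2)[of 0] by simp
  \<comment> \<open>The approximation by continuous functions is for a function on the whole line,
    whereas \<open>f\<close> is controlled only on the unit interval.\<close>
  define f' where "f' x = (if x \<in> {0..1} then f x else 0)" for x
  have f': "f' \<in> borel_measurable borel" "\<bar>f' x\<bar> \<le> C" for x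
  proof -
    have "f \<in> borel_measurable (restrict_space borel {0..1})" using f(1) by (simp add: measurable_cong_sets[OF sets_I01 refl])
    then show "f' \<in> borel_measurable borel"
      unfolding f'_def by (intro measurable_If_restrict_space_iff[THEN iffD2]) (auto simp: atLeastAtMost_def atLeast_def atMost_def Int_def)
    show "\<bar>f' x\<bar> \<le> C" using f(2) C by (simp add: f'_def)
  qed
  obtain g where g: "continuous_on UNIV g" "\<And>x. \<bar>g x\<bar> \<le> C" "(\<integral>r. \<bar>f' r - g r\<bar> \<partial>I01) < e / 3"
    using continuous_L1_approximation[OF f', of "e / 3"] e by auto
  have gm[measurable]: "g \<in> borel_measurable I01"
    unfolding I01_def using borel_measurable_continuous_onI[OF g(1)] by (intro measurable_restrict_space1) simp
  note fm[measurable] = f(1)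
  have fg: "(\<integral>r. \<bar>f r - g r\<bar> \<partial>I01) < e / 3"
    using g(3) by (subst Bochner_Integration.integral_cong[OF refl, of _ _ "\<lambda>r. \<bar>f' r - g r\<bar>"]) (auto simp: f'_def)
  have fgb: "\<bar>f x - g x\<bar> \<le> 2 * C" if "x \<in> {0..1}" for x using f(2)[OF that] g(2)[of x] by simp
  have "(\<lambda>n. \<integral>r. \<bar>lag_step n g r - g r\<bar> \<partial>I01) \<longlonglongrightarrow> (\<integral>r. 0 \<partial>I01)"
  proof (rule integral_dominated_convergence[where w="\<lambda>_. 2 * C"])
    have "AE r in lborel. r \<noteq> 0" by (rule AE_lborel_singleton)
    then have "AE r in I01. r \<noteq> 0" unfolding I01_def by (subst AE_restrict_space_iff) auto
    then show "AE r in I01. (\<lambda>n. \<bar>lag_step n g r - g r\<bar>) \<longlonglongrightarrow> 0"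
    proof (rule AE_mp, intro AE_I2 impI)
      fix r assume "r \<in> space I01" "r \<noteq> 0"
      then have "(\<lambda>n. \<bar>lag_step n g r - g r\<bar>) \<longlonglongrightarrow> \<bar>g r - g r\<bar>"
        using lag_step_continuous[OF g(1,2), of r] by (intro tendsto_intros) auto
      then show "(\<lambda>n. \<bar>lag_step n g r - g r\<bar>) \<longlonglongrightarrow> 0" by simp
    qed
    show "AE x in I01. norm \<bar>lag_step n g x - g x\<bar> \<le> 2 * C" for n
      using lag_step_bound[OF gm g(2), of _ n] g(2) by (intro AE_I2) (simp, smt (verit, best))
  qed auto
  then have "(\<lambda>n. \<integral>r. \<bar>lag_step n g r - g r\<bar> \<partial>I01) \<longlonglongrightarrow> 0" by simp
  then obtain N where N: "\<And>n. N \<le> n \<Longrightarrow> (\<integral>r. \<bar>lag_step n g r - g r\<bar> \<partial>I01) < e / 3"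
    using LIMSEQ_D[of _ 0 "e / 3"] e by fastforce
  show "\<exists>no. \<forall>n\<ge>no. norm ((\<integral>r. \<bar>lag_step n f r - f r\<bar> \<partial>I01) - 0) < e"
  proof (intro exI[of _ N] allI impI)
    fix n assume n: "N \<le> n"
    have i1: "integrable I01 (\<lambda>r. \<bar>lag_step n (\<lambda>x. f x - g x) r\<bar>)"
      using lag_step_bound[of "\<lambda>x. f x - g x" "2 * C" _ n] fgb by (intro integrable_I01_bounded[where C="2 * C"]) auto
    have i2: "integrable I01 (\<lambda>r. \<bar>lag_step n g r - g r\<bar>)"
      using lag_step_bound[OF gm g(2), of _ n] g(2) 
      by (intro integrable_I01_bounded[where C="2 * C"]) (auto, smt (verit, best))
    have i3: "integrable I01 (\<lambda>r. \<bar>f r - g r\<bar>)" using fgb by (intro integrable_I01_bounded[where C="2 * C"]) auto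
    have i0: "integrable I01 (\<lambda>r. \<bar>lag_step n f r - f r\<bar>)"
      using lag_step_bound[OF f, of _ n] f(2) by (intro integrable_I01_bounded[where C="2 * C"]) (auto, smt (verit, best))
    have "(\<integral>r. \<bar>lag_step n f r - f r\<bar> \<partial>I01)
        \<le> (\<integral>r. \<bar>lag_step n (\<lambda>x. f x - g x) r\<bar> + \<bar>lag_step n g r - g r\<bar> + \<bar>f r - g r\<bar> \<partial>I01)"
    proof (rule integral_mono)
      fix x assume "x \<in> space I01"
      have "lag_step n (\<lambda>x. f x - g x) x = lag_step n f x - lag_step n g x"
        using lag_step_diff[OF f gm] g(2) by blast
      then show "\<bar>lag_step n f x - f x\<bar> \<le> \<bar>lag_step n (\<lambda>x. f x - g x) x\<bar> + \<bar>lag_step n g x - g x\<bar> + \<bar>f x - g x\<bar>"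
        by linarith
    qed (use i0 i1 i2 i3 in auto)
    also have "\<dots> = (\<integral>r. \<bar>lag_step n (\<lambda>x. f x - g x) r\<bar> \<partial>I01) + (\<integral>r. \<bar>lag_step n g r - g r\<bar> \<partial>I01) + (\<integral>r. \<bar>f r - g r\<bar> \<partial>I01)"
      using i1 i2 i3 by simp
    also have "(\<integral>r. \<bar>lag_step n (\<lambda>x. f x - g x) r\<bar> \<partial>I01) \<le> (\<integral>r. \<bar>f r - g r\<bar> \<partial>I01)"
      using fgb by (intro lag_step_contraction[where C="2 * C"]) auto
    finally have "(\<integral>r. \<bar>lag_step n f r - f r\<bar> \<partial>I01) < e" using N[OF n] fg by simp
    moreover have "0 \<le> (\<integral>r. \<bar>lag_step n f r - f r\<bar> \<partial>I01)" by simp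
    ultimately show "norm ((\<integral>r. \<bar>lag_step n f r - f r\<bar> \<partial>I01) - 0) < e" by simp
  qed
qed

section \<open>Existence and uniqueness of the Ito integral\<close>

lemma ennreal_tendsto_0I:
  fixes f :: "nat \<Rightarrow> ennreal"
  assumes "\<And>e. 0 < e \<Longrightarrow> \<exists>N. \<forall>k\<ge>N. f k \<le> ennreal e"
  shows "f \<longlonglongrightarrow> 0"
proof (rule order_tendstoI)
  fix a :: ennreal assume "0 < a"
  then obtain q :: rat where "0 < ennreal (real_of_rat q)" "ennreal (real_of_rat q) < a"
    using ennreal_rat_dense[of 0 a] by blast
  then obtain x :: real where x: "0 < x" "ennreal x < a" by (metis ennreal_less_zero_iff)
  with assms[of x] show "eventually (\<lambda>k. f k < a) sequentially"
    by (auto simp: eventually_sequentially intro: order.strict_trans1)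
qed simp

lemma ennreal_numeral_mult: "0 \<le> x \<Longrightarrow> numeral n * ennreal x = ennreal (numeral n * x)"
  by (simp add: ennreal_mult)

lemma ennreal_tendsto_0D:
  fixes f :: "nat \<Rightarrow> ennreal"
  assumes "f \<longlonglongrightarrow> 0" "0 < e"
  shows "\<exists>N. \<forall>k\<ge>N. f k \<le> ennreal e"
  using order_tendstoD(2)[OF assms(1), of "ennreal e"] assms(2)
  by (auto simp: eventually_sequentially intro: less_imp_le)

context brownian begin

text \<open>Squared distances stay in \<open>ennreal\<close>, as in \<open>has_ito_integral\<close>,
  so that no integrability has to be carried along. Being squares, they satisfy the triangle
  inequality with factors 2.\<close>

definition sq_dist :: "('a \<Rightarrow> real) \<Rightarrow> ('a \<Rightarrow> real) \<Rightarrow> ennreal" where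
  "sq_dist X Y = (\<integral>\<^sup>+\<omega>. ennreal ((X \<omega> - Y \<omega>)\<^sup>2) \<partial>M)"

definition process_sq_dist :: "(real \<Rightarrow> 'a \<Rightarrow> real) \<Rightarrow> (real \<Rightarrow> 'a \<Rightarrow> real) \<Rightarrow> ennreal" where
  "process_sq_dist \<phi> \<eta> = (\<integral>\<^sup>+\<omega>. (\<integral>\<^sup>+r\<in>{0..1}. ennreal ((\<phi> r \<omega> - \<eta> r \<omega>)\<^sup>2) \<partial>lborel) \<partial>M)"

lemma sq_diff_triangle: "ennreal ((x - z)\<^sup>2) \<le> 2 * ennreal ((x - y)\<^sup>2) + 2 * ennreal ((y - z)\<^sup>2)" for x y z :: real
proof -
  have "(x - z)\<^sup>2 \<le> 2 * (x - y)\<^sup>2 + 2 * (y - z)\<^sup>2"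
    using diff_square_le[of "x - y" "z - y"] by (simp add: power2_commute)
  then have "ennreal ((x - z)\<^sup>2) \<le> ennreal (2 * (x - y)\<^sup>2 + 2 * (y - z)\<^sup>2)" by (rule ennreal_leI)
  then show ?thesis by (simp add: ennreal_plus ennreal_mult)
qed

lemma sq_dist_triangle:
  assumes [measurable]: "X \<in> borel_measurable M" "Y \<in> borel_measurable M" "Z \<in> borel_measurable M"
  shows "sq_dist X Z \<le> 2 * sq_dist X Y + 2 * sq_dist Y Z"
proof -
  have "sq_dist X Z \<le> (\<integral>\<^sup>+\<omega>. 2 * ennreal ((X \<omega> - Y \<omega>)\<^sup>2) + 2 * ennreal ((Y \<omega> - Z \<omega>)\<^sup>2) \<partial>M)"
    unfolding sq_dist_def by (intro nn_integral_mono sq_diff_triangle)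
  also have "\<dots> = 2 * sq_dist X Y + 2 * sq_dist Y Z"
    unfolding sq_dist_def by (simp add: nn_integral_add nn_integral_cmult)
  finally show ?thesis .
qed

lemma process_sq_dist_commute: "process_sq_dist X Y = process_sq_dist Y X"
  by (simp add: process_sq_dist_def power2_commute)

lemma process_sq_dist_triangle:
  assumes [measurable]: "(\<lambda>(\<omega>, r). X r \<omega>) \<in> borel_measurable (M \<Otimes>\<^sub>M I01)" "(\<lambda>(\<omega>, r). Y r \<omega>) \<in> borel_measurable (M \<Otimes>\<^sub>M I01)"
    "(\<lambda>(\<omega>, r). Z r \<omega>) \<in> borel_measurable (M \<Otimes>\<^sub>M I01)"
  shows "process_sq_dist X Z \<le> 2 * process_sq_dist X Y + 2 * process_sq_dist Y Z"
proof -
  have "process_sq_dist X Z \<le> (\<integral>\<^sup>+\<omega>. \<integral>\<^sup>+r. 2 * ennreal ((X r \<omega> - Y r \<omega>)\<^sup>2) + 2 * ennreal ((Y r \<omega> - Z r \<omega>)\<^sup>2) \<partial>I01 \<partial>M)"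
    unfolding process_sq_dist_def nn_integral_I01[symmetric] by (intro nn_integral_mono sq_diff_triangle)
  also have "\<dots> = (\<integral>\<^sup>+\<omega>. 2 * (\<integral>\<^sup>+r. ennreal ((X r \<omega> - Y r \<omega>)\<^sup>2) \<partial>I01) + 2 * (\<integral>\<^sup>+r. ennreal ((Y r \<omega> - Z r \<omega>)\<^sup>2) \<partial>I01) \<partial>M)"
    by (intro nn_integral_cong) (simp add: nn_integral_add nn_integral_cmult)
  also have "\<dots> = 2 * process_sq_dist X Y + 2 * process_sq_dist Y Z"
    unfolding process_sq_dist_def nn_integral_I01[symmetric] by (simp add: nn_integral_add nn_integral_cmult)
  finally show ?thesis .
qed

section \<open>Lagged averages of a bounded progressive control as approximating simple
  integrands\<close>

lemma progressive_joint_measurable: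
  assumes "progressive F \<eta>"
  shows "(\<lambda>(\<omega>, r). \<eta> r \<omega>) \<in> borel_measurable (M \<Otimes>\<^sub>M I01)"
proof -
  have "(\<lambda>(r, \<omega>). \<eta> r \<omega>) \<in> borel_measurable (restrict_space borel {0..1} \<Otimes>\<^sub>M F 1)"
    using assms by (auto simp: progressive_def)
  moreover have "(\<lambda>(\<omega>, r). (r, \<omega>)) \<in> measurable (M \<Otimes>\<^sub>M I01) (restrict_space borel {0..1} \<Otimes>\<^sub>M F 1)"
    unfolding case_prod_beta
  proof (rule measurable_Pair)
    show "snd \<in> measurable (M \<Otimes>\<^sub>M I01) (restrict_space borel {0..1})"
      using measurable_snd[of M I01] by (simp add: measurable_cong_sets[OF refl sets_I01])
    show "fst \<in> measurable (M \<Otimes>\<^sub>M I01) (F 1)"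
      by (rule measurable_compose[OF measurable_fst ident_measurable_F]) simp
  qed
  ultimately have "(\<lambda>z. case (case z of (\<omega>, r) \<Rightarrow> (r, \<omega>)) of (r, \<omega>) \<Rightarrow> \<eta> r \<omega>) \<in> borel_measurable (M \<Otimes>\<^sub>M I01)"
    by (rule measurable_compose[rotated])
  then show ?thesis by (simp add: case_prod_beta)
qed

lemma progressive_section_measurable:
  assumes "progressive F \<eta>" "\<omega> \<in> space M"
  shows "(\<lambda>r. \<eta> r \<omega>) \<in> borel_measurable I01"
  using measurable_compose[OF measurable_Pair1'[OF assms(2)] progressive_joint_measurable[OF assms(1)]] by simp

text \<open>The previous cell lies inside \<open>{0..t}\<close>, with \<open>t\<close> the left end
  of the current one. There progressive measurability gives joint measurability with respect to
  \<open>F t\<close>, and integrating the time out keeps \<open>F t\<close>.\<close>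

lemma lag_avg_adapted:
  assumes \<eta>: "progressive F \<eta>" and i: "i < n"
  shows "(\<lambda>\<omega>. lag_avg n (\<lambda>r. \<eta> r \<omega>) i) \<in> borel_measurable (F (real i / real n))"
proof (cases "i = 0")
  case False
  define t where "t = real i / real n"
  have t: "0 \<le> t" "t \<le> 1" using i by (auto simp: t_def)
  have c: "cell n (i - 1) \<subseteq> {0..t}" 
  proof
    fix x assume "x \<in> cell n (i - 1)"
    then have "real (i - 1) / real n < x" "x \<le> real (Suc (i - 1)) / real n" by (auto simp: cell_def)
    moreover have "0 \<le> real (i - 1) / real n" by simp
    ultimately have "0 \<le> x" "x \<le> t" using False by (linarith, simp add: t_def)
    then show "x \<in> {0..t}" by simp
  qed
  let ?L = "restrict_space lborel {0..t}"
  interpret L: sigma_finite_measure ?L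
    by (rule sigma_finite_measure_restrict_space[OF sigma_finite_lborel]) auto
  have eq: "(\<integral>r. indicator (cell n (i - 1)) r * \<eta> r \<omega> \<partial>I01) = (\<integral>r. indicator (cell n (i - 1)) r * \<eta> r \<omega> \<partial>?L)" for \<omega>
  proof -
    have "indicator {0..1} r * (indicator (cell n (i - 1)) r * \<eta> r \<omega>) = indicator {0..t} r * (indicator (cell n (i - 1)) r * \<eta> r \<omega>)" for r
      using c t by (cases "r \<in> cell n (i - 1)") auto
    note E = this
    show ?thesis unfolding I01_def by (simp add: integral_restrict_space E del: One_nat_def)
  qed
  have "(\<lambda>(r, \<omega>). \<eta> r \<omega>) \<in> borel_measurable (restrict_space borel {0..t} \<Otimes>\<^sub>M F t)"
    using \<eta> t by (auto simp: progressive_def)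
  then have "(\<lambda>z. \<eta> (snd z) (fst z)) \<in> borel_measurable (F t \<Otimes>\<^sub>M restrict_space borel {0..t})"
    using measurable_pair_swap[of "\<lambda>(r, \<omega>). \<eta> r \<omega>"] by (simp add: case_prod_beta)
  moreover have "sets (F t \<Otimes>\<^sub>M restrict_space borel {0..t}) = sets (F t \<Otimes>\<^sub>M ?L)"
    by (intro sets_pair_measure_cong refl sets_restrict_space_cong) simp
  ultimately have [measurable]: "(\<lambda>z. \<eta> (snd z) (fst z)) \<in> borel_measurable (F t \<Otimes>\<^sub>M ?L)"
    by (simp cong: measurable_cong_sets)
  have [measurable]: "(indicator (cell n (i - 1)) :: real \<Rightarrow> real) \<in> borel_measurable ?L"
    by (intro measurable_restrict_space1) simp
  have "(\<lambda>\<omega>. \<integral>r. indicator (cell n (i - 1)) r * \<eta> r \<omega> \<partial>?L) \<in> borel_measurable (F t)"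
    by (rule L.borel_measurable_lebesgue_integral, unfold case_prod_beta) measurable
  then show ?thesis using False unfolding lag_avg_def cell_avg_def eq t_def[symmetric] by simp
qed (simp add: lag_avg_def)

lemma lag_simple_integrand:
  assumes \<eta>: "progressive F \<eta>" "\<And>t \<omega>. t \<in> {0..1} \<Longrightarrow> \<omega> \<in> space M \<Longrightarrow> \<bar>\<eta> t \<omega>\<bar> \<le> C" and n: "0 < n"
  shows "simple_integrand M B n (\<lambda>i. real i / real n) (\<lambda>i \<omega>. lag_avg n (\<lambda>r. \<eta> r \<omega>) i)"
  unfolding simple_integrand_def
proof (intro conjI allI impI exI[of _ C] ballI)
  fix i assume "i < n"
  show "(\<lambda>\<omega>. lag_avg n (\<lambda>r. \<eta> r \<omega>) i) \<in> borel_measurable (F (real i / real n))"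
    by (rule lag_avg_adapted[OF \<eta>(1) \<open>i < n\<close>])
  show "\<bar>lag_avg n (\<lambda>r. \<eta> r \<omega>) i\<bar> \<le> C" if "\<omega> \<in> space M" for \<omega>
    using that \<open>i < n\<close> \<eta>(2) by (intro lag_avg_bound progressive_section_measurable[OF \<eta>(1)]) auto
qed (use n in \<open>auto simp: field_simps\<close>)

lemma simple_process_lag:
  "simple_process n (\<lambda>i. real i / real n) (\<lambda>i \<omega>. lag_avg n (\<lambda>r. \<eta> r \<omega>) i) r \<omega> = lag_step n (\<lambda>r. \<eta> r \<omega>) r"
  by (simp only: simple_process_def lag_step_def cell_def)

lemma simple_process_measurable:
  assumes "simple_integrand M B n s \<xi>"
  shows "(\<lambda>(\<omega>, r). simple_process n s \<xi> r \<omega>) \<in> borel_measurable (M \<Otimes>\<^sub>M I01)"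
proof -
  have [measurable]: "\<xi> i \<in> borel_measurable M" if "i < n" for i
    using assms that simple_integrand_grid(3)[OF assms, of i] by (auto simp: simple_integrand_def intro: F_measurable_M)
  have [measurable]: "(indicator {s i<..s (Suc i)} :: real \<Rightarrow> real) \<in> borel_measurable I01" for i
    unfolding I01_def by (intro measurable_restrict_space1) simp
  show ?thesis unfolding simple_process_def case_prod_beta by measurable
qed

lemma simple_ito_measurable:
  assumes "simple_integrand M B n s \<xi>" "0 \<le> t" "t \<le> 1"
  shows "simple_ito B n s \<xi> t \<in> borel_measurable (F t)"
proof -
  have "(\<lambda>\<omega>. \<xi> i \<omega> * (B (min (s (Suc i)) t) \<omega> - B (min (s i) t) \<omega>)) \<in> borel_measurable (F t)" if i: "i < n" for i
  proof (cases "s i \<le> t")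
    case True
    have "\<xi> i \<in> borel_measurable (F t)"
      using assms i True by (auto simp: simple_integrand_def intro: natural_filtration_measurable_mono)
    moreover have "B (min (s (Suc i)) t) \<in> borel_measurable (F t)" "B (min (s i) t) \<in> borel_measurable (F t)"
      using simple_integrand_grid(2)[OF assms(1), of i] simple_integrand_grid(2)[OF assms(1), of "Suc i"] i assms
      by (auto intro!: measurable_natural_filtration)
    ultimately show ?thesis by measurable
  next
    case False
    moreover have "s i \<le> s (Suc i)" using assms i by (auto simp: simple_integrand_def)
    ultimately show ?thesis by (simp add: min_def)
  qed
  then show ?thesis unfolding simple_ito_def[abs_def] by measurable
qed

text \<open>For bounded functions closeness in mean gives closeness in mean square, at the price of
  a factor \<open>2 * C\<close>.\<close>

lemma sq_integral_bound:
  assumes f: "f \<in> borel_measurable I01" "g \<in> borel_measurable I01"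
    and b: "\<And>x. x \<in> {0..1} \<Longrightarrow> \<bar>f x\<bar> \<le> C" "\<And>x. x \<in> {0..1} \<Longrightarrow> \<bar>g x\<bar> \<le> C"
  shows "(\<integral>\<^sup>+r. ennreal ((f r - g r)\<^sup>2) \<partial>I01) \<le> ennreal (2 * C * (\<integral>r. \<bar>f r - g r\<bar> \<partial>I01))"
proof -
  have d: "\<bar>f x - g x\<bar> \<le> 2 * C" if "x \<in> {0..1}" for x using b[OF that] by linarith
  have C: "0 \<le> C" using b(1)[of 0] by simp
  note [measurable] = f
  have "(\<integral>\<^sup>+r. ennreal ((f r - g r)\<^sup>2) \<partial>I01) \<le> (\<integral>\<^sup>+r. ennreal (2 * C * \<bar>f r - g r\<bar>) \<partial>I01)"
  proof (intro nn_integral_mono ennreal_leI)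
    fix x assume "x \<in> space I01"
    then have "\<bar>f x - g x\<bar> * \<bar>f x - g x\<bar> \<le> (2 * C) * \<bar>f x - g x\<bar>" using d by (intro mult_right_mono) auto
    then show "(f x - g x)\<^sup>2 \<le> 2 * C * \<bar>f x - g x\<bar>" by (simp add: power2_eq_square abs_mult[symmetric])
  qed
  also have "\<dots> = ennreal (\<integral>r. 2 * C * \<bar>f r - g r\<bar> \<partial>I01)"
    using d C by (intro nn_integral_eq_integral Bochner_Integration.integrable_mult_right integrable_I01_bounded[where C="2 * C"]) auto
  finally show ?thesis by simp
qed

text \<open>Convergence holds path by path and passes to the expectation by domination. The index is
  \<open>Suc n\<close> because a grid with no cell does not end at time 1.\<close>

lemma lag_tendsto_L2:
  assumes \<eta>: "progressive F \<eta>" "\<And>t \<omega>. t \<in> {0..1} \<Longrightarrow> \<omega> \<in> space M \<Longrightarrow> \<bar>\<eta> t \<omega>\<bar> \<le> C"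
  shows "(\<lambda>n. process_sq_dist (simple_process (Suc n) (\<lambda>i. real i / real (Suc n)) (\<lambda>i \<omega>. lag_avg (Suc n) (\<lambda>r. \<eta> r \<omega>) i)) \<eta>) \<longlonglongrightarrow> 0"
proof -
  obtain \<omega>0 where "\<omega>0 \<in> space M" using not_empty by auto
  then have C: "0 \<le> C" using \<eta>(2)[of 0 \<omega>0] by auto
  let ?\<phi> = "\<lambda>n. simple_process (Suc n) (\<lambda>i. real i / real (Suc n)) (\<lambda>i \<omega>. lag_avg (Suc n) (\<lambda>r. \<eta> r \<omega>) i)"
  note [measurable] = progressive_joint_measurable[OF \<eta>(1)]
  have [measurable]: "(\<lambda>(\<omega>, r). ?\<phi> n r \<omega>) \<in> borel_measurable (M \<Otimes>\<^sub>M I01)" for n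
    by (rule simple_process_measurable[OF lag_simple_integrand[OF \<eta>]]) auto
  have "(\<lambda>n. \<integral>\<^sup>+\<omega>. \<integral>\<^sup>+r. ennreal ((?\<phi> n r \<omega> - \<eta> r \<omega>)\<^sup>2) \<partial>I01 \<partial>M) \<longlonglongrightarrow> (\<integral>\<^sup>+\<omega>. 0 \<partial>M)"
  proof (rule nn_integral_dominated_convergence[where w="\<lambda>_. ennreal ((2 * C)\<^sup>2)"])
    show "AE \<omega> in M. (\<integral>\<^sup>+r. ennreal ((?\<phi> n r \<omega> - \<eta> r \<omega>)\<^sup>2) \<partial>I01) \<le> ennreal ((2 * C)\<^sup>2)" for n
    proof (rule AE_I2)
      fix \<omega> assume \<omega>: "\<omega> \<in> space M"
      have "(\<integral>\<^sup>+r. ennreal ((?\<phi> n r \<omega> - \<eta> r \<omega>)\<^sup>2) \<partial>I01) \<le> (\<integral>\<^sup>+r. ennreal ((2 * C)\<^sup>2) \<partial>I01)"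
      proof (intro nn_integral_mono ennreal_leI)
        fix r assume "r \<in> space I01"
        then have "\<bar>?\<phi> n r \<omega>\<bar> \<le> C" "\<bar>\<eta> r \<omega>\<bar> \<le> C"
          unfolding simple_process_lag using \<eta>(2) \<omega> progressive_section_measurable[OF \<eta>(1) \<omega>]
          by (auto intro!: lag_step_bound)
        then show "(?\<phi> n r \<omega> - \<eta> r \<omega>)\<^sup>2 \<le> (2 * C)\<^sup>2" using C by (intro abs_le_square_iff[THEN iffD1]) linarith
      qed
      also have "\<dots> = ennreal ((2 * C)\<^sup>2)" using I01.emeasure_space_1 by simp
      finally show "(\<integral>\<^sup>+r. ennreal ((?\<phi> n r \<omega> - \<eta> r \<omega>)\<^sup>2) \<partial>I01) \<le> ennreal ((2 * C)\<^sup>2)" .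
    qed
    show "AE \<omega> in M. (\<lambda>n. \<integral>\<^sup>+r. ennreal ((?\<phi> n r \<omega> - \<eta> r \<omega>)\<^sup>2) \<partial>I01) \<longlonglongrightarrow> 0"
    proof (rule AE_I2)
      fix \<omega> assume \<omega>: "\<omega> \<in> space M"
      note m = progressive_section_measurable[OF \<eta>(1) \<omega>]
      have b: "\<bar>\<eta> r \<omega>\<bar> \<le> C" if "r \<in> {0..1}" for r using \<eta>(2) \<omega> that by blast
      have "(\<lambda>n. ennreal (2 * C * (\<integral>r. \<bar>lag_step (Suc n) (\<lambda>r. \<eta> r \<omega>) r - \<eta> r \<omega>\<bar> \<partial>I01))) \<longlonglongrightarrow> ennreal (2 * C * 0)"
        by (intro tendsto_ennrealI tendsto_mult tendsto_const LIMSEQ_Suc lag_step_tendsto_L1[OF m]) (rule b)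
      then have "(\<lambda>n. ennreal (2 * C * (\<integral>r. \<bar>lag_step (Suc n) (\<lambda>r. \<eta> r \<omega>) r - \<eta> r \<omega>\<bar> \<partial>I01))) \<longlonglongrightarrow> 0" by simp
      then show "(\<lambda>n. \<integral>\<^sup>+r. ennreal ((?\<phi> n r \<omega> - \<eta> r \<omega>)\<^sup>2) \<partial>I01) \<longlonglongrightarrow> 0"
        unfolding simple_process_lag
        by (rule tendsto_sandwich[OF _ _ tendsto_const, rotated 2])
          (auto intro!: always_eventually sq_integral_bound m b lag_step_bound)
    qed
    show "(\<lambda>\<omega>. \<integral>\<^sup>+r. ennreal ((?\<phi> n r \<omega> - \<eta> r \<omega>)\<^sup>2) \<partial>I01) \<in> borel_measurable M" for n by measurable
  qed (auto simp: emeasure_space_1 ennreal_mult_less_top)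
  then show ?thesis unfolding process_sq_dist_def nn_integral_I01 by simp
qed

text \<open>The filtration is not augmented, so the limit must be measurable for \<open>F 1\<close>
  itself and not merely almost surely equal to such a variable. Hence it is built as
  \<open>lim\<close> along an almost surely convergent subsequence, which has a value for every
  outcome.\<close>

lemma L2_complete:
  assumes I: "\<And>k. I k \<in> borel_measurable (F 1)" "\<And>k. integrable M (\<lambda>\<omega>. (I k \<omega>)\<^sup>2)"
    and cauchy: "\<And>e. 0 < e \<Longrightarrow> \<exists>N. \<forall>k\<ge>N. \<forall>l\<ge>N. sq_dist (I k) (I l) \<le> ennreal e"
  obtains X where "X \<in> borel_measurable (F 1)" "(\<lambda>k. sq_dist (I k) X) \<longlonglongrightarrow> 0"
proof -
  have IM[measurable]: "I k \<in> borel_measurable M" for k using F_measurable_M[OF I(1)] by simp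
  have I1: "integrable M (I k)" for k
    by (rule square_integrable_imp_integrable[OF IM I(2)])
  have D2: "integrable M (\<lambda>\<omega>. (I k \<omega> - I l \<omega>)\<^sup>2)" for k l
  proof (rule Bochner_Integration.integrable_bound)
    show "integrable M (\<lambda>\<omega>. 2 * (I k \<omega>)\<^sup>2 + 2 * (I l \<omega>)\<^sup>2)" using I by simp
    have "norm ((x - y)\<^sup>2) \<le> norm (2 * x\<^sup>2 + 2 * y\<^sup>2)" for x y :: real
      using diff_square_le[of x y] by simp
    then show "AE \<omega> in M. norm ((I k \<omega> - I l \<omega>)\<^sup>2) \<le> norm (2 * (I k \<omega>)\<^sup>2 + 2 * (I l \<omega>)\<^sup>2)" by blast
  qed measurable
  have "\<exists>N. \<forall>k\<ge>N. \<forall>l\<ge>N. (LINT \<omega>|M. norm (I k \<omega> - I l \<omega>)) < e" if e: "0 < e" for e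
  proof -
    obtain N where N: "\<And>k l. N \<le> k \<Longrightarrow> N \<le> l \<Longrightarrow> sq_dist (I k) (I l) \<le> ennreal ((e / 2)\<^sup>2)"
      using cauchy[of "(e / 2)\<^sup>2"] e by auto
    have "(LINT \<omega>|M. norm (I k \<omega> - I l \<omega>)) < e" if "N \<le> k" "N \<le> l" for k l
    proof -
      have "ennreal (LINT \<omega>|M. (I k \<omega> - I l \<omega>)\<^sup>2) \<le> ennreal ((e / 2)\<^sup>2)"
        using N[OF that] D2 unfolding sq_dist_def by (subst (asm) nn_integral_eq_integral) auto
      then have le: "(LINT \<omega>|M. (I k \<omega> - I l \<omega>)\<^sup>2) \<le> (e / 2)\<^sup>2" by (subst (asm) ennreal_le_iff) auto
      have "(LINT \<omega>|M. norm (I k \<omega> - I l \<omega>)) \<le> (LINT \<omega>|M. e / 4 + (I k \<omega> - I l \<omega>)\<^sup>2 / e)"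
      proof (rule integral_mono)
        fix \<omega>
        \<comment> \<open>Young's inequality in place of Cauchy-Schwarz: with a second moment of at
          most \<open>(e / 2)^2\<close> the total is at most \<open>e / 4 + e / 4\<close>.\<close>
        have "\<bar>d\<bar> \<le> e / 4 + d\<^sup>2 / e" for d
        proof -
          have "0 \<le> (\<bar>d\<bar> - e / 2)\<^sup>2" by simp
          then have "e * \<bar>d\<bar> \<le> d\<^sup>2 + e\<^sup>2 / 4" by (simp add: power2_diff power_divide ac_simps)
          then show ?thesis using e by (simp add: field_simps power2_eq_square)
        qed
        then show "norm (I k \<omega> - I l \<omega>) \<le> e / 4 + (I k \<omega> - I l \<omega>)\<^sup>2 / e" by simp
      qed (use I1 D2 in auto)
      also have "\<dots> = e / 4 + (LINT \<omega>|M. (I k \<omega> - I l \<omega>)\<^sup>2) / e"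
        using D2 by (simp add: prob_space)
      also have "\<dots> \<le> e / 4 + (e / 2)\<^sup>2 / e" using le e by (intro add_left_mono divide_right_mono) auto
      also have "\<dots> < e" using e by (simp add: power2_eq_square)
      finally show ?thesis .
    qed
    then show ?thesis by blast
  qed
  from cauchy_L1_AE_cauchy_subseq[OF I1 this] obtain r where r: "strict_mono r" "AE \<omega> in M. Cauchy (\<lambda>j. I (r j) \<omega>)" by blast
  define X where "X \<omega> = lim (\<lambda>j. I (r j) \<omega>)" for \<omega>
  have X: "X \<in> borel_measurable (F 1)" unfolding X_def[abs_def] using I(1) by (intro borel_measurable_lim_metric)
  then have XM[measurable]: "X \<in> borel_measurable M" by (rule F_measurable_M) simp
  have lim: "AE \<omega> in M. (\<lambda>j. I (r j) \<omega>) \<longlonglongrightarrow> X \<omega>"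
    using r(2) by eventually_elim (simp add: X_def Cauchy_convergent_iff convergent_LIMSEQ_iff)
  have "(\<lambda>k. sq_dist (I k) X) \<longlonglongrightarrow> 0"
  proof (rule ennreal_tendsto_0I)
    show "\<exists>N. \<forall>k\<ge>N. sq_dist (I k) X \<le> ennreal e" if e: "0 < e" for e
    proof -
      obtain N where N: "\<And>k l. N \<le> k \<Longrightarrow> N \<le> l \<Longrightarrow> sq_dist (I k) (I l) \<le> ennreal e" using cauchy[OF e] by auto
      have "sq_dist (I k) X \<le> ennreal e" if k: "N \<le> k" for k
      proof -
        \<comment> \<open>Fatou's lemma along the subsequence, with \<open>k\<close> fixed, turns
          the Cauchy property into convergence of the full sequence.\<close>
        have "sq_dist (I k) X = (\<integral>\<^sup>+\<omega>. liminf (\<lambda>j. ennreal ((I k \<omega> - I (r j) \<omega>)\<^sup>2)) \<partial>M)"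
          unfolding sq_dist_def
        proof (rule nn_integral_cong_AE)
          show "AE \<omega> in M. ennreal ((I k \<omega> - X \<omega>)\<^sup>2) = liminf (\<lambda>j. ennreal ((I k \<omega> - I (r j) \<omega>)\<^sup>2))"
            using lim
          proof eventually_elim
            case (elim \<omega>)
            then have "(\<lambda>j. ennreal ((I k \<omega> - I (r j) \<omega>)\<^sup>2)) \<longlonglongrightarrow> ennreal ((I k \<omega> - X \<omega>)\<^sup>2)"
              by (intro tendsto_ennrealI tendsto_intros)
            then show ?case by (intro lim_imp_Liminf[symmetric]) auto
          qed
        qed
        also have "\<dots> \<le> liminf (\<lambda>j. sq_dist (I k) (I (r j)))"
          unfolding sq_dist_def by (intro nn_integral_liminf) measurable
        also have "\<dots> \<le> ennreal e"
        proof (rule Liminf_le)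
          show "eventually (\<lambda>j. sq_dist (I k) (I (r j)) \<le> ennreal e) sequentially"
            unfolding eventually_sequentially
          proof (intro exI[of _ N] allI impI)
            fix j assume "N \<le> j"
            then have "N \<le> r j" using seq_suble[OF r(1), of j] by linarith
            then show "sq_dist (I k) (I (r j)) \<le> ennreal e" using N k by blast
          qed
        qed simp
        finally show ?thesis .
      qed
      then show ?thesis by blast
    qed
  qed
  then show thesis using that X by blast
qed


lemma simple_integrand_bounded:
  assumes "simple_integrand M B n s \<xi>" "i < n"
  obtains C where "\<And>\<omega>. \<omega> \<in> space M \<Longrightarrow> \<bar>\<xi> i \<omega>\<bar> \<le> C"
proof -
  have "\<exists>C. \<forall>\<omega>\<in>space M. \<bar>\<xi> i \<omega>\<bar> \<le> C" using assms unfolding simple_integrand_def by blast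
  then show thesis using that by blast
qed

lemma admissible_controlE:
  assumes "\<eta> \<in> admissible_controls M B"
  obtains C where "0 \<le> C" "progressive F \<eta>" "\<And>t \<omega>. t \<in> {0..1} \<Longrightarrow> \<omega> \<in> space M \<Longrightarrow> \<bar>\<eta> t \<omega>\<bar> \<le> C"
proof -
  obtain C where p: "progressive F \<eta>" and C: "\<forall>t\<in>{0..1}. \<forall>\<omega>\<in>space M. \<bar>\<eta> t \<omega>\<bar> \<le> C"
    using assms unfolding admissible_controls_def by blast
  then have "\<bar>\<eta> t \<omega>\<bar> \<le> max 0 C" if "t \<in> {0..1}" "\<omega> \<in> space M" for t \<omega>
    using that by (simp add: le_max_iff_disj)
  then show thesis using that[of "max 0 C"] p by simp
qed

lemma simple_ito_square_integrable:
  assumes "simple_integrand M B n s \<xi>"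
  shows "integrable M (\<lambda>\<omega>. (simple_ito B n s \<xi> 1 \<omega>)\<^sup>2)"
proof -
  have "integrable M (\<lambda>\<omega>. (\<xi> i \<omega> * (B (s (Suc i)) \<omega> - B (s i) \<omega>)) * (\<xi> j \<omega> * (B (s (Suc j)) \<omega> - B (s j) \<omega>)))"
    if ij: "i < n" "j < n" for i j
  proof -
    obtain C where C: "\<And>\<omega>. \<omega> \<in> space M \<Longrightarrow> \<bar>\<xi> i \<omega>\<bar> \<le> C" using simple_integrand_bounded[OF assms ij(1)] by blast
    obtain D where D: "\<And>\<omega>. \<omega> \<in> space M \<Longrightarrow> \<bar>\<xi> j \<omega>\<bar> \<le> D" using simple_integrand_bounded[OF assms ij(2)] by blast
    have m: "\<xi> i \<in> borel_measurable (F (s i))" "\<xi> j \<in> borel_measurable (F (s j))"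
      using assms ij by (auto simp: simple_integrand_def)
    note g = simple_integrand_grid[OF assms]
    show ?thesis
      by (rule has_bochner_integral_iff[THEN iffD1, THEN conjunct1, OF elementary_product[OF _ _ _ _ _ _ m(1) C m(2) D]])
        (use ij in \<open>auto intro!: g\<close>)
  qed
  then show ?thesis
    unfolding simple_ito_1[OF assms] power2_eq_square sum_product
    by (intro Bochner_Integration.integrable_sum) auto
qed

lemma simple_ito_sq_dist:
  assumes "simple_integrand M B n s \<xi>" "simple_integrand M B n' s' \<xi>'"
  shows "sq_dist (simple_ito B n s \<xi> 1) (simple_ito B n' s' \<xi>' 1)
    = process_sq_dist (simple_process n s \<xi>) (simple_process n' s' \<xi>')"
  unfolding sq_dist_def process_sq_dist_def by (rule simple_ito_diff_isometry[OF assms])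

lemma has_ito_integral_1_iff:
  "has_ito_integral M B \<eta> 1 X \<longleftrightarrow> X \<in> borel_measurable (F 1) \<and>
     (\<exists>n s \<xi>. (\<forall>k. simple_integrand M B (n k) (s k) (\<xi> k)) \<and>
        (\<lambda>k. process_sq_dist (simple_process (n k) (s k) (\<xi> k)) \<eta>) \<longlonglongrightarrow> 0 \<and>
        (\<lambda>k. sq_dist (simple_ito B (n k) (s k) (\<xi> k) 1) X) \<longlonglongrightarrow> 0)"
  unfolding has_ito_integral_def process_sq_dist_def sq_dist_def ..

text \<open>\<open>ito_integral\<close> is an arbitrary choice; it is existence that makes the
  chosen variable satisfy its defining property.\<close>

lemma ito_integral_exists:
  assumes \<eta>: "\<eta> \<in> admissible_controls M B"
  shows "has_ito_integral M B \<eta> 1 (ito_integral M B \<eta> 1)"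
proof -
  obtain C where p: "progressive F \<eta>" and C: "\<And>t \<omega>. t \<in> {0..1} \<Longrightarrow> \<omega> \<in> space M \<Longrightarrow> \<bar>\<eta> t \<omega>\<bar> \<le> C"
    by (rule admissible_controlE[OF \<eta>]) blast
  define s where "s k = (\<lambda>i. real i / real (Suc k))" for k
  define \<xi> where "\<xi> k = (\<lambda>i \<omega>. lag_avg (Suc k) (\<lambda>r. \<eta> r \<omega>) i)" for k
  let ?\<phi> = "\<lambda>k. simple_process (Suc k) (s k) (\<xi> k)" and ?I = "\<lambda>k. simple_ito B (Suc k) (s k) (\<xi> k) 1"
  have S: "simple_integrand M B (Suc k) (s k) (\<xi> k)" for k
    unfolding s_def \<xi>_def by (rule lag_simple_integrand[OF p C]) auto
  have a: "(\<lambda>k. process_sq_dist (?\<phi> k) \<eta>) \<longlonglongrightarrow> 0"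
    unfolding s_def \<xi>_def by (rule lag_tendsto_L2[OF p C])
  obtain X where X: "X \<in> borel_measurable (F 1)" "(\<lambda>k. sq_dist (?I k) X) \<longlonglongrightarrow> 0"
  proof (rule L2_complete[of ?I])
    show "?I k \<in> borel_measurable (F 1)" for k by (rule simple_ito_measurable[OF S]) auto
    show "integrable M (\<lambda>\<omega>. (?I k \<omega>)\<^sup>2)" for k by (rule simple_ito_square_integrable[OF S])
    fix e :: real assume "0 < e"
    then obtain N where N: "\<And>k. N \<le> k \<Longrightarrow> process_sq_dist (?\<phi> k) \<eta> \<le> ennreal (e / 4)"
      using ennreal_tendsto_0D[OF a, of "e / 4"] by auto
    show "\<exists>N. \<forall>k\<ge>N. \<forall>l\<ge>N. sq_dist (?I k) (?I l) \<le> ennreal e"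
    proof (intro exI[of _ N] allI impI)
      fix k l assume kl: "N \<le> k" "N \<le> l"
      have "sq_dist (?I k) (?I l) = process_sq_dist (?\<phi> k) (?\<phi> l)" by (rule simple_ito_sq_dist[OF S S])
      also have "\<dots> \<le> 2 * process_sq_dist (?\<phi> k) \<eta> + 2 * process_sq_dist \<eta> (?\<phi> l)"
        by (rule process_sq_dist_triangle[OF simple_process_measurable[OF S] progressive_joint_measurable[OF p] simple_process_measurable[OF S]])
      also have "\<dots> \<le> 2 * ennreal (e / 4) + 2 * ennreal (e / 4)"
        using N[OF kl(1)] N[OF kl(2)] by (intro add_mono mult_left_mono) (auto simp: process_sq_dist_commute)
      also have "\<dots> = ennreal e" using \<open>0 < e\<close> by (simp add: ennreal_numeral_mult ennreal_plus[symmetric] del: ennreal_plus)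
      finally show "sq_dist (?I k) (?I l) \<le> ennreal e" by simp
    qed
  qed blast
  have "has_ito_integral M B \<eta> 1 X"
    unfolding has_ito_integral_1_iff using X S a by blast
  then show ?thesis unfolding ito_integral_def by (rule someI[of "has_ito_integral M B \<eta> 1"])
qed

text \<open>Whatever variable was chosen, it comes with an approximating sequence of its own, and
  the isometry compares that sequence with the given simple integrand. Two uses of the triangle
  inequality give the factor 4. A vanishing right-hand side makes this a uniqueness
  statement.\<close>

lemma ito_integral_approximation:
  assumes \<eta>: "\<eta> \<in> admissible_controls M B" and S: "simple_integrand M B n s \<xi>"
  shows "sq_dist (simple_ito B n s \<xi> 1) (ito_integral M B \<eta> 1) \<le> 4 * process_sq_dist (simple_process n s \<xi>) \<eta>"
proof (rule ennreal_le_epsilon)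
  fix e :: real assume e: "0 < e"
  have p: "progressive F \<eta>" using \<eta> by (auto simp: admissible_controls_def)
  let ?X = "ito_integral M B \<eta> 1" and ?\<phi> = "simple_process n s \<xi>" and ?I = "simple_ito B n s \<xi> 1"
  obtain n' s' \<xi>' where X: "?X \<in> borel_measurable (F 1)" and S': "\<And>k. simple_integrand M B (n' k) (s' k) (\<xi>' k)"
    and a: "(\<lambda>k. process_sq_dist (simple_process (n' k) (s' k) (\<xi>' k)) \<eta>) \<longlonglongrightarrow> 0"
    and b: "(\<lambda>k. sq_dist (simple_ito B (n' k) (s' k) (\<xi>' k) 1) ?X) \<longlonglongrightarrow> 0"
    using ito_integral_exists[OF \<eta>] unfolding has_ito_integral_1_iff by blast
  obtain N where N: "\<And>k. N \<le> k \<Longrightarrow> process_sq_dist (simple_process (n' k) (s' k) (\<xi>' k)) \<eta> \<le> ennreal (e / 8)"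
    using ennreal_tendsto_0D[OF a, of "e / 8"] e by auto
  obtain N' where N': "\<And>k. N' \<le> k \<Longrightarrow> sq_dist (simple_ito B (n' k) (s' k) (\<xi>' k) 1) ?X \<le> ennreal (e / 4)"
    using ennreal_tendsto_0D[OF b, of "e / 4"] e by auto
  define k where "k = max N N'"
  let ?\<psi> = "simple_process (n' k) (s' k) (\<xi>' k)" and ?J = "simple_ito B (n' k) (s' k) (\<xi>' k) 1"
  have m: "?I \<in> borel_measurable M" "?J \<in> borel_measurable M" "?X \<in> borel_measurable M"
    using F_measurable_M[OF simple_ito_measurable[OF S]] F_measurable_M[OF simple_ito_measurable[OF S']] F_measurable_M[OF X] by auto
  have "sq_dist ?I ?J = process_sq_dist ?\<phi> ?\<psi>" by (rule simple_ito_sq_dist[OF S S'])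
  also have "\<dots> \<le> 2 * process_sq_dist ?\<phi> \<eta> + 2 * process_sq_dist \<eta> ?\<psi>"
    by (rule process_sq_dist_triangle[OF simple_process_measurable[OF S] progressive_joint_measurable[OF p] simple_process_measurable[OF S']])
  also have "\<dots> \<le> 2 * process_sq_dist ?\<phi> \<eta> + 2 * ennreal (e / 8)"
    using N[of k] by (intro add_mono mult_left_mono) (auto simp: process_sq_dist_commute k_def)
  finally have IJ: "sq_dist ?I ?J \<le> 2 * process_sq_dist ?\<phi> \<eta> + 2 * ennreal (e / 8)" .
  have "sq_dist ?I ?X \<le> 2 * sq_dist ?I ?J + 2 * sq_dist ?J ?X" by (rule sq_dist_triangle[OF m])
  also have "\<dots> \<le> 2 * (2 * process_sq_dist ?\<phi> \<eta> + 2 * ennreal (e / 8)) + 2 * ennreal (e / 4)"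
    using N'[of k] IJ by (intro add_mono mult_left_mono) (auto simp: k_def)
  also have "\<dots> = 4 * process_sq_dist ?\<phi> \<eta> + (4 * ennreal (e / 8) + 2 * ennreal (e / 4))"
    by (simp add: distrib_left mult.assoc[symmetric] add.assoc)
  also have "4 * ennreal (e / 8) + 2 * ennreal (e / 4) = ennreal e"
    using e by (simp add: ennreal_numeral_mult ennreal_plus[symmetric] del: ennreal_plus)
  finally show "sq_dist ?I ?X \<le> 4 * process_sq_dist ?\<phi> \<eta> + ennreal e" by simp
qed

lemma ito_integral_measurable:
  "\<eta> \<in> admissible_controls M B \<Longrightarrow> ito_integral M B \<eta> 1 \<in> borel_measurable (F 1)"
  using ito_integral_exists[of \<eta>] by (simp add: has_ito_integral_def)

text \<open>The control is its own approximation, so the bound of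
  \<open>ito_integral_approximation\<close> is 0, and mean square distance 0 is almost sure
  equality.\<close>

lemma ito_integral_simple:
  assumes \<eta>: "\<eta> \<in> admissible_controls M B" and S: "simple_integrand M B n s \<xi>"
    and eq: "\<And>r \<omega>. r \<in> {0..1} \<Longrightarrow> \<omega> \<in> space M \<Longrightarrow> \<eta> r \<omega> = simple_process n s \<xi> r \<omega>"
  shows "AE \<omega> in M. ito_integral M B \<eta> 1 \<omega> = simple_ito B n s \<xi> 1 \<omega>"
proof -
  have "ennreal ((simple_process n s \<xi> r \<omega> - \<eta> r \<omega>)\<^sup>2) * indicator {0..1} r = 0" if "\<omega> \<in> space M" for r \<omega>
    using eq[of r \<omega>] that by (cases "r \<in> {0..1}") simp_all
  note E = this
  have "(\<integral>\<^sup>+r\<in>{0..1}. ennreal ((simple_process n s \<xi> r \<omega> - \<eta> r \<omega>)\<^sup>2) \<partial>lborel) = 0" if "\<omega> \<in> space M" for \<omega>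
    by (subst nn_integral_cong[OF E[OF that]]) simp
  then have "process_sq_dist (simple_process n s \<xi>) \<eta> = (\<integral>\<^sup>+\<omega>. 0 \<partial>M)"
    unfolding process_sq_dist_def by (rule nn_integral_cong)
  then have "sq_dist (simple_ito B n s \<xi> 1) (ito_integral M B \<eta> 1) = 0"
    using ito_integral_approximation[OF \<eta> S] by simp
  moreover have [measurable]: "simple_ito B n s \<xi> 1 \<in> borel_measurable M" "ito_integral M B \<eta> 1 \<in> borel_measurable M"
    using F_measurable_M[OF simple_ito_measurable[OF S]] F_measurable_M[OF ito_integral_measurable[OF \<eta>]] by auto
  ultimately have "AE \<omega> in M. ennreal ((simple_ito B n s \<xi> 1 \<omega> - ito_integral M B \<eta> 1 \<omega>)\<^sup>2) = 0"
    unfolding sq_dist_def by (subst (asm) nn_integral_0_iff_AE) auto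
  then show ?thesis by eventually_elim simp
qed

end

section \<open>Exponentials of simple integrands\<close>

context brownian begin

text \<open>Explicit at every time \<open>t\<close>, also inside a cell, whereas the Ito integral
  behind \<open>stoch_exp\<close> is a separate choice for each \<open>t\<close>.\<close>

definition simple_exp :: "nat \<Rightarrow> (nat \<Rightarrow> real) \<Rightarrow> (nat \<Rightarrow> 'a \<Rightarrow> real) \<Rightarrow> real \<Rightarrow> 'a \<Rightarrow> real" where
  "simple_exp n s \<xi> t \<omega> = exp (simple_ito B n s \<xi> t \<omega>
     - 1 / 2 * (\<Sum>i<n. (\<xi> i \<omega>)\<^sup>2 * (min (s (Suc i)) t - min (s i) t)))"

lemma simple_exp_pos [simp]: "0 < simple_exp n s \<xi> t \<omega>" "0 \<le> simple_exp n s \<xi> t \<omega>"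
  by (simp_all add: simple_exp_def)

context
  fixes n :: nat and s :: "nat \<Rightarrow> real" and \<xi> :: "nat \<Rightarrow> 'a \<Rightarrow> real"
  assumes S: "simple_integrand M B n s \<xi>"
begin

lemma integrand_measurable: "i < n \<Longrightarrow> s i \<le> t \<Longrightarrow> \<xi> i \<in> borel_measurable (F t)"
  using S natural_filtration_measurable_mono[of "\<xi> i" M B "s i" borel t] by (simp add: simple_integrand_def)

lemma simple_exp_measurable:
  assumes "0 \<le> t" "t \<le> 1"
  shows "simple_exp n s \<xi> t \<in> borel_measurable (F t)"
proof -
  have "(\<lambda>\<omega>. (\<xi> i \<omega>)\<^sup>2 * (min (s (Suc i)) t - min (s i) t)) \<in> borel_measurable (F t)" if i: "i < n" for i
  proof (cases "s i \<le> t")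
    case True
    note [measurable] = integrand_measurable[OF i True]
    show ?thesis by measurable
  next
    case False
    moreover have "s i \<le> s (Suc i)" using S i by (simp add: simple_integrand_def)
    ultimately show ?thesis by (simp add: min_def)
  qed
  with simple_ito_measurable[OF S assms] show ?thesis
    unfolding simple_exp_def[abs_def] by measurable
qed

lemma simple_exp_measurable_M: "0 \<le> t \<Longrightarrow> t \<le> 1 \<Longrightarrow> simple_exp n s \<xi> t \<in> borel_measurable M"
  by (rule F_measurable_M[OF simple_exp_measurable])

lemma simple_exp_0: "simple_exp n s \<xi> 0 \<omega> = 1"
proof -
  have "min (s i) 0 = 0" if "i \<le> n" for i using simple_integrand_grid(2)[OF S that] by simp
  then have "simple_ito B n s \<xi> 0 \<omega> = 0" "(\<Sum>i<n. (\<xi> i \<omega>)\<^sup>2 * (min (s (Suc i)) 0 - min (s i) 0)) = 0"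
    unfolding simple_ito_def by (auto intro!: sum.neutral)
  then show ?thesis by (simp add: simple_exp_def)
qed

lemma simple_exp_step:
  assumes i: "i < n" and ab: "s i \<le> a" "a \<le> b" "b \<le> s (Suc i)"
  shows "simple_exp n s \<xi> b \<omega> = simple_exp n s \<xi> a \<omega> * exp (\<xi> i \<omega> * (B b \<omega> - B a \<omega>) - (\<xi> i \<omega>)\<^sup>2 / 2 * (b - a))"
proof -
  \<comment> \<open>Between \<open>a\<close> and \<open>b\<close> the cells before \<open>i\<close>
    are complete and those after \<open>i\<close> have not begun, so only the summand of cell
    \<open>i\<close> changes.\<close>
  have m: "min (s (Suc j)) b = min (s (Suc j)) a \<and> min (s j) b = min (s j) a" if "j < i" for j
    using simple_integrand_grid(1)[OF S, of "Suc j" i] simple_integrand_grid(1)[OF S, of j i] that i ab by (simp add: min_def)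
  have m': "min (s (Suc j)) b = b \<and> min (s j) b = b \<and> min (s (Suc j)) a = a \<and> min (s j) a = a" if "i < j" "j < n" for j
    using simple_integrand_grid(1)[OF S, of "Suc i" j] simple_integrand_grid(1)[OF S, of "Suc i" "Suc j"] that i ab by (simp add: min_def)
  have m'': "min (s (Suc i)) b = b" "min (s i) b = s i" "min (s (Suc i)) a = a" "min (s i) a = s i"
    using ab by (simp_all add: min_def)
  have "simple_ito B n s \<xi> b \<omega> - simple_ito B n s \<xi> a \<omega> = (\<Sum>j<n. if j = i then \<xi> i \<omega> * (B b \<omega> - B a \<omega>) else 0)"
    unfolding simple_ito_def sum_subtractf[symmetric]
  proof (rule sum.cong)
    fix j assume "j \<in> {..<n}"
    then consider "j < i" | "j = i" | "i < j" "j < n" by force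
    then show "\<xi> j \<omega> * (B (min (s (Suc j)) b) \<omega> - B (min (s j) b) \<omega>) - \<xi> j \<omega> * (B (min (s (Suc j)) a) \<omega> - B (min (s j) a) \<omega>)
       = (if j = i then \<xi> i \<omega> * (B b \<omega> - B a \<omega>) else 0)"
      by cases (use m m' in \<open>simp_all add: m'' right_diff_distrib\<close>)
  qed simp
  then have 1: "simple_ito B n s \<xi> b \<omega> - simple_ito B n s \<xi> a \<omega> = \<xi> i \<omega> * (B b \<omega> - B a \<omega>)" using i by simp
  have "(\<Sum>i<n. (\<xi> i \<omega>)\<^sup>2 * (min (s (Suc i)) b - min (s i) b)) - (\<Sum>i<n. (\<xi> i \<omega>)\<^sup>2 * (min (s (Suc i)) a - min (s i) a))
     = (\<Sum>j<n. if j = i then (\<xi> i \<omega>)\<^sup>2 * (b - a) else 0)"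
    unfolding sum_subtractf[symmetric]
  proof (rule sum.cong)
    fix j assume "j \<in> {..<n}"
    then consider "j < i" | "j = i" | "i < j" "j < n" by force
    then show "(\<xi> j \<omega>)\<^sup>2 * (min (s (Suc j)) b - min (s j) b) - (\<xi> j \<omega>)\<^sup>2 * (min (s (Suc j)) a - min (s j) a)
       = (if j = i then (\<xi> i \<omega>)\<^sup>2 * (b - a) else 0)"
      by cases (use m m' in \<open>simp_all add: m'' right_diff_distrib\<close>)
  qed simp
  then have 2: "(\<Sum>i<n. (\<xi> i \<omega>)\<^sup>2 * (min (s (Suc i)) b - min (s i) b)) - (\<Sum>i<n. (\<xi> i \<omega>)\<^sup>2 * (min (s (Suc i)) a - min (s i) a))
     = (\<xi> i \<omega>)\<^sup>2 * (b - a)" using i by simp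
  show ?thesis
    unfolding simple_exp_def exp_add[symmetric] using 1 2 by (intro arg_cong[where f=exp]) linarith
qed

text \<open>Girsanov's theorem inside one cell: with \<open>simple_exp\<close> at time
  \<open>b\<close> as density, the increment from \<open>a\<close> to \<open>b\<close> is, given the
  past of \<open>a\<close>, normal with mean \<open>\<xi> i * (b - a)\<close> and variance
  \<open>b - a\<close>.\<close>

lemma simple_exp_tilt:
  assumes i: "i < n" and ab: "s i \<le> a" "a \<le> b" "b \<le> s (Suc i)"
    and f: "(\<lambda>(\<omega>, x). f \<omega> x) \<in> borel_measurable (F a \<Otimes>\<^sub>M borel)"
  shows "(\<integral>\<^sup>+\<omega>. ennreal (simple_exp n s \<xi> b \<omega>) * f \<omega> (B b \<omega> - B a \<omega>) \<partial>M)
    = (\<integral>\<^sup>+\<omega>. ennreal (simple_exp n s \<xi> a \<omega>) * (\<integral>\<^sup>+x. f \<omega> (\<xi> i \<omega> * (b - a) + sqrt (b - a) * x) \<partial>gaussian) \<partial>M)"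
proof -
  have t: "0 \<le> a" "a \<le> 1" "b \<le> 1"
    using simple_integrand_grid[OF S, of i] simple_integrand_grid[OF S, of "Suc i"] i ab by auto
  have [measurable]: "\<xi> i \<in> borel_measurable (F a)" by (rule integrand_measurable[OF i ab(1)])
  note [measurable] = simple_exp_measurable[OF t(1,2)] f
  let ?H = "\<lambda>\<omega> x. ennreal (simple_exp n s \<xi> a \<omega>) * (ennreal (exp (\<xi> i \<omega> * x - (\<xi> i \<omega>)\<^sup>2 / 2 * (b - a))) * f \<omega> x)"
  have "(\<integral>\<^sup>+\<omega>. ennreal (simple_exp n s \<xi> b \<omega>) * f \<omega> (B b \<omega> - B a \<omega>) \<partial>M) = (\<integral>\<^sup>+\<omega>. ?H \<omega> (B b \<omega> - B a \<omega>) \<partial>M)"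
    by (intro nn_integral_cong) (simp add: simple_exp_step[OF i ab] ennreal_mult mult.assoc)
  also have "\<dots> = (\<integral>\<^sup>+\<omega>. \<integral>\<^sup>+x. ?H \<omega> (sqrt (b - a) * x) \<partial>gaussian \<partial>M)"
    by (rule nn_integral_increment[OF t(1) ab(2) t(3)]) measurable
  also have "\<dots> = (\<integral>\<^sup>+\<omega>. ennreal (simple_exp n s \<xi> a \<omega>) * (\<integral>\<^sup>+x. f \<omega> (\<xi> i \<omega> * (b - a) + sqrt (b - a) * x) \<partial>gaussian) \<partial>M)"
  proof (rule nn_integral_cong)
    fix \<omega> assume \<omega>: "\<omega> \<in> space M"
    have [measurable]: "f \<omega> \<in> borel_measurable borel"
      using measurable_compose[OF measurable_Pair1' f] \<omega> by simp
    \<comment> \<open>The drift over the interval in units of the standard deviation, so that the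
      one-dimensional tilt applies to the standard normal variable.\<close>
    define \<alpha> where "\<alpha> = \<xi> i \<omega> * sqrt (b - a)"
    have sq: "sqrt (b - a) * sqrt (b - a) = b - a" using ab by simp
    then have \<alpha>2: "\<alpha>\<^sup>2 / 2 = (\<xi> i \<omega>)\<^sup>2 / 2 * (b - a)" using ab by (simp add: \<alpha>_def power_mult_distrib)
    have "(\<integral>\<^sup>+x. ?H \<omega> (sqrt (b - a) * x) \<partial>gaussian) = ennreal (simple_exp n s \<xi> a \<omega>) *
       (\<integral>\<^sup>+x. ennreal (exp (\<alpha> * x - \<alpha>\<^sup>2 / 2)) * f \<omega> (sqrt (b - a) * x) \<partial>gaussian)"
      unfolding \<alpha>2 unfolding \<alpha>_def by (subst nn_integral_cmult) (auto simp: mult.assoc)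
    also have "(\<integral>\<^sup>+x. ennreal (exp (\<alpha> * x - \<alpha>\<^sup>2 / 2)) * f \<omega> (sqrt (b - a) * x) \<partial>gaussian)
       = (\<integral>\<^sup>+x. f \<omega> (sqrt (b - a) * (\<alpha> + x)) \<partial>gaussian)"
      by (rule nn_integral_gaussian_tilt) measurable
    also have "\<dots> = (\<integral>\<^sup>+x. f \<omega> (\<xi> i \<omega> * (b - a) + sqrt (b - a) * x) \<partial>gaussian)"
    proof -
      have "sqrt (b - a) * \<alpha> = \<xi> i \<omega> * (b - a)" using ab by (simp add: \<alpha>_def mult.left_commute)
      then show ?thesis by (simp add: distrib_left)
    qed
    finally show "(\<integral>\<^sup>+x. ?H \<omega> (sqrt (b - a) * x) \<partial>gaussian)
      = ennreal (simple_exp n s \<xi> a \<omega>) * (\<integral>\<^sup>+x. f \<omega> (\<xi> i \<omega> * (b - a) + sqrt (b - a) * x) \<partial>gaussian)" .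
  qed
  finally show ?thesis .
qed

text \<open>Induction over the grid moves the time from \<open>t\<close> to 1 one cell at a time. In
  each cell the tilt is applied to a functional that ignores the increment, so that only the mass 1
  of \<open>gaussian\<close> remains of the inner integral.\<close>

lemma simple_exp_martingale:
  assumes t: "0 \<le> t" "t \<le> 1" and Y: "Y \<in> borel_measurable (F t)"
  shows "(\<integral>\<^sup>+\<omega>. ennreal (simple_exp n s \<xi> 1 \<omega>) * Y \<omega> \<partial>M) = (\<integral>\<^sup>+\<omega>. ennreal (simple_exp n s \<xi> t \<omega>) * Y \<omega> \<partial>M)"
proof -
  have "(\<integral>\<^sup>+\<omega>. ennreal (simple_exp n s \<xi> (max t (s k)) \<omega>) * Y \<omega> \<partial>M) = (\<integral>\<^sup>+\<omega>. ennreal (simple_exp n s \<xi> t \<omega>) * Y \<omega> \<partial>M)"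
    if "k \<le> n" for k
    using that
  proof (induction k)
    case 0
    have "max t (s 0) = t" using S t by (simp add: simple_integrand_def max_def)
    then show ?case by simp
  next
    case (Suc k)
    then have IH: "(\<integral>\<^sup>+\<omega>. ennreal (simple_exp n s \<xi> (max t (s k)) \<omega>) * Y \<omega> \<partial>M) = (\<integral>\<^sup>+\<omega>. ennreal (simple_exp n s \<xi> t \<omega>) * Y \<omega> \<partial>M)"
      and k: "k < n" by simp_all
    have sk: "s k \<le> s (Suc k)" using S k by (simp add: simple_integrand_def)
    show ?case
    proof (cases "s (Suc k) \<le> t")
      case True
      then show ?thesis using IH sk by (simp add: max_def)
    next
      case False
      define a b where "a = max t (s k)" and "b = s (Suc k)"
      have ab: "s k \<le> a" "a \<le> b" "b \<le> s (Suc k)" "t \<le> a" using False sk by (auto simp: a_def b_def)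
      have [measurable]: "Y \<in> borel_measurable (F a)" by (rule natural_filtration_measurable_mono[OF Y ab(4)])
      have "(\<integral>\<^sup>+\<omega>. ennreal (simple_exp n s \<xi> b \<omega>) * Y \<omega> \<partial>M) = (\<integral>\<^sup>+\<omega>. ennreal (simple_exp n s \<xi> a \<omega>) * Y \<omega> \<partial>M)"
        using simple_exp_tilt[OF k ab(1-3), of "\<lambda>\<omega> x. Y \<omega>"] by simp
      moreover have "max t (s (Suc k)) = b" using False by (simp add: b_def)
      ultimately show ?thesis using IH by (simp add: a_def)
    qed
  qed
  from this[of n] show ?thesis using S t by (simp add: simple_integrand_def max_def)
qed

lemma nn_integral_simple_exp:
  assumes t: "0 \<le> t" "t \<le> 1"
  shows "(\<integral>\<^sup>+\<omega>. ennreal (simple_exp n s \<xi> t \<omega>) \<partial>M) = 1"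
  using simple_exp_martingale[OF t, of "\<lambda>_. 1"] simple_exp_martingale[of 0 "\<lambda>_. 1"]
  by (simp add: simple_exp_0 emeasure_space_1)

lemma sum_cells: 
  assumes "0 \<le> t" "t \<le> 1"
  shows "(\<Sum>i<n. min (s (Suc i)) t - min (s i) t) = t"
  using sum_lessThan_telescope[of "\<lambda>i. min (s i) t" n] S assms by (simp add: simple_integrand_def min_def)

lemma cell_length_nonneg: "i < n \<Longrightarrow> 0 \<le> min (s (Suc i)) t - min (s i) t"
  using S by (auto simp: simple_integrand_def min_def)

text \<open>Given the past of \<open>a\<close>, the variable \<open>B b - v\<close> is normal under
  the tilted law with mean \<open>B a - v + \<xi> i * (b - a)\<close> and variance
  \<open>b - a\<close>. The fourth moment below has the same reason, y^4 + 6 d y^2 + 3 d^2 being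
  that of a normal variable with mean y and variance d.\<close>

lemma simple_exp_second_moment_step:
  assumes i: "i < n" and ab: "s i \<le> a" "a \<le> b" "b \<le> s (Suc i)"
  shows "(\<integral>\<^sup>+\<omega>. ennreal (simple_exp n s \<xi> b \<omega> * (B b \<omega> - v)\<^sup>2) \<partial>M)
    = (\<integral>\<^sup>+\<omega>. ennreal (simple_exp n s \<xi> a \<omega> * ((B a \<omega> - v + \<xi> i \<omega> * (b - a))\<^sup>2 + (b - a))) \<partial>M)"
proof -
  have t: "0 \<le> a" using simple_integrand_grid[OF S, of i] i ab by auto
  have [measurable]: "B a \<in> borel_measurable (F a)" by (rule measurable_natural_filtration) (use t in auto)
  have "(\<integral>\<^sup>+\<omega>. ennreal (simple_exp n s \<xi> b \<omega> * (B b \<omega> - v)\<^sup>2) \<partial>M)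
     = (\<integral>\<^sup>+\<omega>. ennreal (simple_exp n s \<xi> b \<omega>) * (\<lambda>\<omega> x. ennreal ((B a \<omega> + x - v)\<^sup>2)) \<omega> (B b \<omega> - B a \<omega>) \<partial>M)"
    by (simp add: ennreal_mult)
  also have "\<dots> = (\<integral>\<^sup>+\<omega>. ennreal (simple_exp n s \<xi> a \<omega>) * (\<integral>\<^sup>+x. ennreal ((B a \<omega> + (\<xi> i \<omega> * (b - a) + sqrt (b - a) * x) - v)\<^sup>2) \<partial>gaussian) \<partial>M)"
    by (rule simple_exp_tilt[OF i ab]) measurable
  also have "\<dots> = (\<integral>\<^sup>+\<omega>. ennreal (simple_exp n s \<xi> a \<omega> * ((B a \<omega> - v + \<xi> i \<omega> * (b - a))\<^sup>2 + (b - a))) \<partial>M)"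
  proof (rule nn_integral_cong)
    fix \<omega>
    let ?y = "B a \<omega> - v + \<xi> i \<omega> * (b - a)" and ?\<sigma> = "sqrt (b - a)"
    have \<sigma>: "?\<sigma>\<^sup>2 = b - a" using ab by simp
    have eq: "(B a \<omega> + (\<xi> i \<omega> * (b - a) + ?\<sigma> * x) - v)\<^sup>2 = ?y\<^sup>2 + 2 * ?y * ?\<sigma> * x + ?\<sigma>\<^sup>2 * x\<^sup>2 + 0 * x ^ 3 + 0 * x ^ 4" for x
      by (simp add: power2_eq_square algebra_simps)
    have "(\<integral>\<^sup>+x. ennreal ((B a \<omega> + (\<xi> i \<omega> * (b - a) + ?\<sigma> * x) - v)\<^sup>2) \<partial>gaussian) = ennreal (?y\<^sup>2 + ?\<sigma>\<^sup>2 + 3 * 0)"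
      unfolding eq by (rule nn_integral_gaussian_poly4) (simp only: eq[symmetric] zero_le_power2)
    then show "ennreal (simple_exp n s \<xi> a \<omega>) * (\<integral>\<^sup>+x. ennreal ((B a \<omega> + (\<xi> i \<omega> * (b - a) + ?\<sigma> * x) - v)\<^sup>2) \<partial>gaussian)
      = ennreal (simple_exp n s \<xi> a \<omega> * (?y\<^sup>2 + (b - a)))"
      using ab by (simp add: \<sigma> ennreal_mult)
  qed
  finally show ?thesis .
qed

lemma simple_exp_fourth_moment_step:
  assumes i: "i < n" and ab: "s i \<le> a" "a \<le> b" "b \<le> s (Suc i)"
  shows "(\<integral>\<^sup>+\<omega>. ennreal (simple_exp n s \<xi> b \<omega> * (B b \<omega> - v) ^ 4) \<partial>M)
    = (\<integral>\<^sup>+\<omega>. ennreal (simple_exp n s \<xi> a \<omega> * ((B a \<omega> - v + \<xi> i \<omega> * (b - a)) ^ 4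
        + 6 * (b - a) * (B a \<omega> - v + \<xi> i \<omega> * (b - a))\<^sup>2 + 3 * (b - a)\<^sup>2)) \<partial>M)"
proof -
  have t: "0 \<le> a" using simple_integrand_grid[OF S, of i] i ab by auto
  have [measurable]: "B a \<in> borel_measurable (F a)" by (rule measurable_natural_filtration) (use t in auto)
  have "(\<integral>\<^sup>+\<omega>. ennreal (simple_exp n s \<xi> b \<omega> * (B b \<omega> - v) ^ 4) \<partial>M)
     = (\<integral>\<^sup>+\<omega>. ennreal (simple_exp n s \<xi> b \<omega>) * (\<lambda>\<omega> x. ennreal ((B a \<omega> + x - v) ^ 4)) \<omega> (B b \<omega> - B a \<omega>) \<partial>M)"
    by (simp add: ennreal_mult)
  also have "\<dots> = (\<integral>\<^sup>+\<omega>. ennreal (simple_exp n s \<xi> a \<omega>) * (\<integral>\<^sup>+x. ennreal ((B a \<omega> + (\<xi> i \<omega> * (b - a) + sqrt (b - a) * x) - v) ^ 4) \<partial>gaussian) \<partial>M)"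
    by (rule simple_exp_tilt[OF i ab]) measurable
  also have "\<dots> = (\<integral>\<^sup>+\<omega>. ennreal (simple_exp n s \<xi> a \<omega> * ((B a \<omega> - v + \<xi> i \<omega> * (b - a)) ^ 4
        + 6 * (b - a) * (B a \<omega> - v + \<xi> i \<omega> * (b - a))\<^sup>2 + 3 * (b - a)\<^sup>2)) \<partial>M)"
  proof (rule nn_integral_cong)
    fix \<omega>
    let ?y = "B a \<omega> - v + \<xi> i \<omega> * (b - a)" and ?\<sigma> = "sqrt (b - a)"
    have \<sigma>: "?\<sigma>\<^sup>2 = b - a" using ab by simp
    have \<sigma>4: "?\<sigma> ^ 4 = (b - a)\<^sup>2" using power_mult[of ?\<sigma> 2 2] by (simp add: \<sigma>)
    have eq: "(B a \<omega> + (\<xi> i \<omega> * (b - a) + ?\<sigma> * x) - v) ^ 4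
      = ?y ^ 4 + 4 * ?y ^ 3 * ?\<sigma> * x + 6 * ?y\<^sup>2 * ?\<sigma>\<^sup>2 * x\<^sup>2 + 4 * ?y * ?\<sigma> ^ 3 * x ^ 3 + ?\<sigma> ^ 4 * x ^ 4" for x
    proof -
      have "B a \<omega> + (\<xi> i \<omega> * (b - a) + ?\<sigma> * x) - v = ?y + ?\<sigma> * x" by simp
      moreover have "(y + z) ^ 4 = y ^ 4 + 4 * y ^ 3 * z + 6 * y\<^sup>2 * z\<^sup>2 + 4 * y * z ^ 3 + z ^ 4" for y z :: real
        by (simp add: power4_eq_xxxx power3_eq_cube power2_eq_square algebra_simps)
      ultimately show ?thesis by (simp only: power_mult_distrib mult.assoc)
    qed
    have "(\<integral>\<^sup>+x. ennreal ((B a \<omega> + (\<xi> i \<omega> * (b - a) + ?\<sigma> * x) - v) ^ 4) \<partial>gaussian) = ennreal (?y ^ 4 + 6 * ?y\<^sup>2 * ?\<sigma>\<^sup>2 + 3 * ?\<sigma> ^ 4)"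
      unfolding eq by (rule nn_integral_gaussian_poly4) (unfold eq[symmetric], simp)
    then show "ennreal (simple_exp n s \<xi> a \<omega>) * (\<integral>\<^sup>+x. ennreal ((B a \<omega> + (\<xi> i \<omega> * (b - a) + ?\<sigma> * x) - v) ^ 4) \<partial>gaussian)
      = ennreal (simple_exp n s \<xi> a \<omega> * (?y ^ 4 + 6 * (b - a) * ?y\<^sup>2 + 3 * (b - a)\<^sup>2))"
      unfolding \<sigma> \<sigma>4 by (simp only: ennreal_mult'[OF simple_exp_pos(2)] mult.commute[of _ "b - a"] mult.assoc mult.left_commute[of _ "b - a"])
  qed
  finally show ?thesis .
qed

end

text \<open>Let I be the integral of the integrand and Q that of its square. Then 4 (I - Q/2) = (4 I
  - 16 Q/2) + 6 Q, so the fourth power is the exponential for \<open>4 * \<xi>\<close>, of mean 1,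
  times \<open>exp (6 * Q)\<close>. The bound does not depend on the grid, which gives uniform
  integrability in the passage to the limit.\<close>

lemma simple_exp_fourth_power:
  assumes S: "simple_integrand M B n s \<xi>" and C: "\<And>i \<omega>. i < n \<Longrightarrow> \<omega> \<in> space M \<Longrightarrow> \<bar>\<xi> i \<omega>\<bar> \<le> C" and t: "0 \<le> t" "t \<le> 1"
  shows "(\<integral>\<^sup>+\<omega>. ennreal (simple_exp n s \<xi> t \<omega> ^ 4) \<partial>M) \<le> ennreal (exp (6 * C\<^sup>2))"
proof -
  let ?\<zeta> = "\<lambda>i \<omega>. 4 * \<xi> i \<omega>"
  have S4: "simple_integrand M B n s ?\<zeta>"
    unfolding simple_integrand_def
  proof (intro conjI allI impI)
    fix i assume "i < n"
    then have "\<xi> i \<in> borel_measurable (F (s i))" using S by (simp add: simple_integrand_def)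
    then show "?\<zeta> i \<in> borel_measurable (F (s i))" by measurable
    show "\<exists>C. \<forall>\<omega>\<in>space M. \<bar>?\<zeta> i \<omega>\<bar> \<le> C" using C[OF \<open>i < n\<close>] by (intro exI[of _ "4 * C"]) (auto simp: abs_mult)
  qed (use S in \<open>auto simp: simple_integrand_def\<close>)
  note [measurable] = simple_exp_measurable_M[OF S4 t]
  have "(\<integral>\<^sup>+\<omega>. ennreal (simple_exp n s \<xi> t \<omega> ^ 4) \<partial>M) \<le> (\<integral>\<^sup>+\<omega>. ennreal (exp (6 * C\<^sup>2)) * ennreal (simple_exp n s ?\<zeta> t \<omega>) \<partial>M)"
  proof (rule nn_integral_mono)
    fix \<omega> assume \<omega>: "\<omega> \<in> space M"
    define I where "I = simple_ito B n s \<xi> t \<omega>"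
    define Q where "Q = (\<Sum>i<n. (\<xi> i \<omega>)\<^sup>2 * (min (s (Suc i)) t - min (s i) t))"
    have "Q \<le> (\<Sum>i<n. C\<^sup>2 * (min (s (Suc i)) t - min (s i) t))"
      unfolding Q_def using C \<omega> abs_le_square_iff[of "\<xi> _ \<omega>" C] cell_length_nonneg[OF S]
      by (intro sum_mono mult_right_mono) (auto intro: order_trans[OF _ abs_ge_self])
    also have "\<dots> = C\<^sup>2 * t" using sum_cells[OF S t] by (simp add: sum_distrib_left[symmetric])
    also have "\<dots> \<le> C\<^sup>2 * 1" using t by (intro mult_left_mono) auto
    finally have Q: "Q \<le> C\<^sup>2" by simp
    have "simple_exp n s \<xi> t \<omega> ^ 4 = exp (4 * (I - 1 / 2 * Q))"
      using exp_of_nat_mult[of 4 "I - 1 / 2 * Q"] by (simp add: simple_exp_def I_def Q_def)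
    also have "\<dots> = exp (6 * Q) * exp (4 * I - 1 / 2 * (16 * Q))" by (simp add: exp_add[symmetric])
    also have "exp (4 * I - 1 / 2 * (16 * Q)) = simple_exp n s ?\<zeta> t \<omega>"
      by (simp add: simple_exp_def simple_ito_def I_def Q_def sum_distrib_left power_mult_distrib mult.assoc)
    also have "exp (6 * Q) * simple_exp n s ?\<zeta> t \<omega> \<le> exp (6 * C\<^sup>2) * simple_exp n s ?\<zeta> t \<omega>"
      using Q by (intro mult_right_mono) auto
    finally show "ennreal (simple_exp n s \<xi> t \<omega> ^ 4) \<le> ennreal (exp (6 * C\<^sup>2)) * ennreal (simple_exp n s ?\<zeta> t \<omega>)"
      by (simp add: ennreal_mult[symmetric] ennreal_leI)
  qed
  also have "\<dots> = ennreal (exp (6 * C\<^sup>2))"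
    by (subst nn_integral_cmult) (auto simp: nn_integral_simple_exp[OF S4 t])
  finally show ?thesis .
qed

end

section \<open>The payoff identity\<close>

lemma integral_abs_le:
  fixes f :: "'a \<Rightarrow> real"
  assumes "integrable M f" "integrable M g" "\<And>x. x \<in> space M \<Longrightarrow> \<bar>f x\<bar> \<le> g x"
  shows "\<bar>\<integral>x. f x \<partial>M\<bar> \<le> (\<integral>x. g x \<partial>M)"
proof -
  have "\<bar>\<integral>x. f x \<partial>M\<bar> \<le> (\<integral>x. \<bar>f x\<bar> \<partial>M)" using integral_norm_bound[of M f] by simp
  also have "\<dots> \<le> (\<integral>x. g x \<partial>M)" using assms by (intro integral_mono) auto
  finally show ?thesis .
qed

lemma integral_sum_cells:
  "(\<integral>r. (\<Sum>i<n. c i * indicator (cell n i) r) \<partial>I01) = (\<Sum>i<n. c i / real n)"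
  "integrable I01 (\<lambda>r. \<Sum>i<n. c i * indicator (cell n i) r)" for c :: "nat \<Rightarrow> real"
proof -
  have i: "integrable I01 (\<lambda>r. c i * indicator (cell n i) r)" for i
    using integrable_cell[of "\<lambda>_. c i" "\<bar>c i\<bar>" n i] by (simp add: mult.commute)
  then show "integrable I01 (\<lambda>r. \<Sum>i<n. c i * indicator (cell n i) r)" by (intro Bochner_Integration.integrable_sum)
  have "(\<integral>r. (\<Sum>i<n. c i * indicator (cell n i) r) \<partial>I01) = (\<Sum>i<n. \<integral>r. c i * indicator (cell n i) r \<partial>I01)"
    by (rule Bochner_Integration.integral_sum) (rule i)
  also have "\<dots> = (\<Sum>i<n. c i / real n)"
  proof (rule sum.cong)
    fix i assume "i \<in> {..<n}"
    then show "(\<integral>r. c i * indicator (cell n i) r \<partial>I01) = c i / real n"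
      using measure_cell[of i n] cell_subset[of i n] by (simp add: Int_absorb2)
  qed simp
  finally show "(\<integral>r. (\<Sum>i<n. c i * indicator (cell n i) r) \<partial>I01) = (\<Sum>i<n. c i / real n)" .
qed

lemma lag_step_integral_tendsto:
  assumes f: "f \<in> borel_measurable I01" "\<And>x. x \<in> {0..1} \<Longrightarrow> \<bar>f x\<bar> \<le> C"
    and g: "g \<in> borel_measurable I01" "\<And>x. x \<in> {0..1} \<Longrightarrow> \<bar>g x\<bar> \<le> D"
  shows "(\<lambda>n. \<integral>r. lag_step n f r * g r \<partial>I01) \<longlonglongrightarrow> (\<integral>r. f r * g r \<partial>I01)"
proof (rule LIM_zero_cancel, rule tendsto_rabs_zero_cancel, rule tendsto_sandwich[where f="\<lambda>_. 0"])
  note [measurable] = f(1) g(1)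
  have C: "0 \<le> C" "0 \<le> D" using f(2)[of 0] g(2)[of 0] by auto
  show "(\<lambda>n. D * (\<integral>r. \<bar>lag_step n f r - f r\<bar> \<partial>I01)) \<longlonglongrightarrow> 0"
    using tendsto_mult[OF tendsto_const lag_step_tendsto_L1[OF f], of D] by simp
  show "eventually (\<lambda>n. \<bar>(\<integral>r. lag_step n f r * g r \<partial>I01) - (\<integral>r. f r * g r \<partial>I01)\<bar> \<le> D * (\<integral>r. \<bar>lag_step n f r - f r\<bar> \<partial>I01)) sequentially"
  proof (intro always_eventually allI)
    fix n
    have b: "\<bar>lag_step n f x - f x\<bar> \<le> 2 * C" if "x \<in> {0..1}" for x
      using lag_step_bound[OF f that, of n] f(2)[OF that] by linarith
    have i: "integrable I01 (\<lambda>r. lag_step n f r * g r)" "integrable I01 (\<lambda>r. f r * g r)"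
      using lag_step_bound[OF f, of _ n] f(2) g(2) C
      by (auto intro!: integrable_I01_bounded[where C="C * D"] mult_mono simp: abs_mult)
    have "(\<integral>r. lag_step n f r * g r \<partial>I01) - (\<integral>r. f r * g r \<partial>I01) = (\<integral>r. (lag_step n f r - f r) * g r \<partial>I01)"
      using i by (simp add: left_diff_distrib)
    also have "\<bar>\<dots>\<bar> \<le> (\<integral>r. D * \<bar>lag_step n f r - f r\<bar> \<partial>I01)"
    proof (rule integral_abs_le)
      show "integrable I01 (\<lambda>r. (lag_step n f r - f r) * g r)" using i by (simp add: left_diff_distrib)
      show "integrable I01 (\<lambda>r. D * \<bar>lag_step n f r - f r\<bar>)"
        using b by (intro Bochner_Integration.integrable_mult_right integrable_I01_bounded[where C="2 * C"]) auto
      fix x assume "x \<in> space I01"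
      then show "\<bar>(lag_step n f x - f x) * g x\<bar> \<le> D * \<bar>lag_step n f x - f x\<bar>"
        using g(2)[of x] by (simp add: abs_mult mult.commute[of _ "\<bar>g x\<bar>"] mult_right_mono)
    qed
    finally show "\<bar>(\<integral>r. lag_step n f r * g r \<partial>I01) - (\<integral>r. f r * g r \<partial>I01)\<bar> \<le> D * (\<integral>r. \<bar>lag_step n f r - f r\<bar> \<partial>I01)" by simp
  qed
qed auto

text \<open>The integral against \<open>lag_step\<close> has \<open>b\<close> at the running time,
  the sums have it at the left ends of the cells. These differ by at most one cell width, so uniform
  continuity closes the gap.\<close>

lemma lag_sum_tendsto:
  assumes f: "f \<in> borel_measurable I01" "\<And>x. x \<in> {0..1} \<Longrightarrow> \<bar>f x\<bar> \<le> C"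
    and b: "continuous_on {0..1} b"
  shows "(\<lambda>n. \<Sum>i<n. lag_avg n f i * b (real i / real n) / real n) \<longlonglongrightarrow> (\<integral>r. f r * b r \<partial>I01)"
proof -
  have C: "0 \<le> C" using f(2)[of 0] by auto
  have bm[measurable]: "b \<in> borel_measurable I01"
    using borel_measurable_continuous_on_restrict[OF b] by (simp add: measurable_cong_sets[OF sets_I01 refl])
  obtain D where D: "\<And>x. x \<in> {0..1} \<Longrightarrow> \<bar>b x\<bar> \<le> D"
    using compact_imp_bounded[OF compact_continuous_image[OF b]] unfolding bounded_iff by fastforce
  have unif: "uniformly_continuous_on {0..1} b" by (rule compact_uniformly_continuous[OF b]) simp
  have "(\<lambda>n. (\<Sum>i<n. lag_avg n f i * b (real i / real n) / real n) - (\<integral>r. lag_step n f r * b r \<partial>I01)) \<longlonglongrightarrow> 0"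
  proof (rule LIMSEQ_I)
    fix e :: real assume e: "0 < e"
    \<comment> \<open>Dividing by \<open>C + 1\<close> instead of \<open>C\<close> covers the case
      \<open>C = 0\<close>.\<close>
    define e' where "e' = e / (2 * (C + 1))"
    have "0 < C * e + e * 2" using e C by (intro add_nonneg_pos) auto
    then have e': "0 < e'" "C * e' < e" using e C by (auto simp: e'_def field_simps)
    obtain d where d: "0 < d" "\<And>x y. x \<in> {0..1} \<Longrightarrow> y \<in> {0..1} \<Longrightarrow> \<bar>y - x\<bar> < d \<Longrightarrow> \<bar>b y - b x\<bar> < e'"
      using unif e'(1) unfolding uniformly_continuous_on_def dist_real_def by metis
    obtain N :: nat where N: "1 / d < real N" using reals_Archimedean2 by blast
    show "\<exists>no. \<forall>n\<ge>no. norm ((\<Sum>i<n. lag_avg n f i * b (real i / real n) / real n) - (\<integral>r. lag_step n f r * b r \<partial>I01) - 0) < e"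
    proof (intro exI[of _ N] allI impI)
      fix n assume "N \<le> n"
      then have n: "1 / d < real n" using N by linarith
      then have n0: "0 < n" using d(1) by (metis less_numeral_extra(3) of_nat_0 gr0I less_trans zero_less_divide_1_iff)
      let ?s = "\<lambda>r. \<Sum>i<n. (lag_avg n f i * b (real i / real n)) * indicator (cell n i) r"
      have i: "integrable I01 (\<lambda>r. lag_step n f r * b r)"
        using lag_step_bound[OF f, of _ n] D C
        by (auto intro!: integrable_I01_bounded[where C="C * D"] mult_mono simp: abs_mult)
      have "(\<Sum>i<n. lag_avg n f i * b (real i / real n) / real n) - (\<integral>r. lag_step n f r * b r \<partial>I01)
        = (\<integral>r. ?s r - lag_step n f r * b r \<partial>I01)"
        using i by (simp only: Bochner_Integration.integral_diff integral_sum_cells)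
      also have "\<bar>\<dots>\<bar> \<le> (\<integral>r. C * e' \<partial>I01)"
      proof (rule integral_abs_le)
        show "integrable I01 (\<lambda>r. ?s r - lag_step n f r * b r)"
          by (rule Bochner_Integration.integrable_diff[OF integral_sum_cells(2) i])
        fix x assume x: "x \<in> space I01"
        show "\<bar>?s x - lag_step n f x * b x\<bar> \<le> C * e'"
        proof (cases "x = 0")
          case True
          then have "x \<notin> cell n i" for i by (auto simp: cell_def not_less)
          then have "?s x = 0" "lag_step n f x = 0" unfolding lag_step_def by (auto intro!: sum.neutral)
          then show ?thesis using C e' by simp
        next
          case False
          then obtain i where i: "i < n" "x \<in> cell n i" using cell_cover[of x n] x n0 by auto
          have "\<bar>lag_avg n f i\<bar> \<le> C" by (rule lag_avg_bound[OF f i(1)])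
          moreover have "\<bar>b (real i / real n) - b x\<bar> \<le> e'"
          proof (rule less_imp_le, rule d(2))
            have "1 / real n < d" using n d n0 by (simp add: field_simps)
            moreover have "real (Suc i) / real n = real i / real n + 1 / real n" by (simp add: add_divide_distrib)
            ultimately show "\<bar>real i / real n - x\<bar> < d" using i(2) unfolding cell_def greaterThanAtMost_iff by linarith
          qed (use x i(1) in auto)
          moreover have "?s x - lag_step n f x * b x = lag_avg n f i * (b (real i / real n) - b x)"
            unfolding sum_cells_single[OF i] lag_step_cell[OF i] by (simp add: right_diff_distrib)
          ultimately show ?thesis using C by (simp add: abs_mult mult_mono)
        qed
      qed simp
      finally show "norm ((\<Sum>i<n. lag_avg n f i * b (real i / real n) / real n) - (\<integral>r. lag_step n f r * b r \<partial>I01) - 0) < e"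
        using e' I01.prob_space by simp
    qed
  qed
  from tendsto_add[OF this lag_step_integral_tendsto[OF f bm D]] show ?thesis by simp
qed

lemma lag_square_sum_tendsto:
  assumes f: "f \<in> borel_measurable I01" "\<And>x. x \<in> {0..1} \<Longrightarrow> \<bar>f x\<bar> \<le> C"
  shows "(\<lambda>n. \<Sum>i<n. (lag_avg n f i)\<^sup>2 / real n) \<longlonglongrightarrow> (\<integral>r. (f r)\<^sup>2 \<partial>I01)"
proof -
  note [measurable] = f(1)
  have C: "0 \<le> C" using f(2)[of 0] by auto
  have sq: "(\<Sum>i<n. (lag_avg n f i)\<^sup>2 / real n) = (\<integral>r. (lag_step n f r)\<^sup>2 \<partial>I01)" for n
    unfolding integral_sum_cells(1)[symmetric]
  proof (rule Bochner_Integration.integral_cong)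
    fix x
    show "(\<Sum>i<n. (lag_avg n f i)\<^sup>2 * indicator (cell n i) x) = (lag_step n f x)\<^sup>2"
    proof (cases "\<exists>i<n. x \<in> cell n i")
      case True
      then obtain i where i: "i < n" "x \<in> cell n i" by auto
      show ?thesis unfolding sum_cells_single[OF i] lag_step_cell[OF i] ..
    next
      case False
      then have "(\<Sum>i<n. (lag_avg n f i)\<^sup>2 * indicator (cell n i) x) = 0" "lag_step n f x = 0"
        unfolding lag_step_def by (auto intro!: sum.neutral)
      then show ?thesis by (simp only:) simp
    qed
  qed simp
  have "(\<lambda>n. \<integral>r. (lag_step n f r)\<^sup>2 - (f r)\<^sup>2 \<partial>I01) \<longlonglongrightarrow> 0"
  proof (rule tendsto_rabs_zero_cancel, rule tendsto_sandwich[where f="\<lambda>_. 0"])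
    show "(\<lambda>n. 2 * C * (\<integral>r. \<bar>lag_step n f r - f r\<bar> \<partial>I01)) \<longlonglongrightarrow> 0"
      using tendsto_mult[OF tendsto_const lag_step_tendsto_L1[OF f], of "2 * C"] by simp
    show "eventually (\<lambda>n. \<bar>\<integral>r. (lag_step n f r)\<^sup>2 - (f r)\<^sup>2 \<partial>I01\<bar> \<le> 2 * C * (\<integral>r. \<bar>lag_step n f r - f r\<bar> \<partial>I01)) sequentially"
    proof (intro always_eventually allI)
      fix n
      have b: "\<bar>lag_step n f x - f x\<bar> \<le> 2 * C" "\<bar>lag_step n f x + f x\<bar> \<le> 2 * C" if "x \<in> {0..1}" for x
        using lag_step_bound[OF f that, of n] f(2)[OF that] by linarith+
      have f2: "(lag_step n f x)\<^sup>2 - (f x)\<^sup>2 = (lag_step n f x + f x) * (lag_step n f x - f x)" for x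
        by (simp add: power2_eq_square algebra_simps)
      have "\<bar>\<integral>r. (lag_step n f r)\<^sup>2 - (f r)\<^sup>2 \<partial>I01\<bar> \<le> (\<integral>r. 2 * C * \<bar>lag_step n f r - f r\<bar> \<partial>I01)"
        unfolding f2
      proof (rule integral_abs_le)
        show "integrable I01 (\<lambda>r. 2 * C * \<bar>lag_step n f r - f r\<bar>)"
          using b by (intro Bochner_Integration.integrable_mult_right integrable_I01_bounded[where C="2 * C"]) auto
        show "integrable I01 (\<lambda>x. (lag_step n f x + f x) * (lag_step n f x - f x))"
          using b C by (intro integrable_I01_bounded[where C="2 * C * (2 * C)"]) (auto simp: abs_mult intro!: mult_mono[of _ "2 * C" _ "2 * C", simplified])
        fix x assume "x \<in> space I01"
        then show "\<bar>(lag_step n f x + f x) * (lag_step n f x - f x)\<bar> \<le> 2 * C * \<bar>lag_step n f x - f x\<bar>"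
          using b(2)[of x] by (simp add: abs_mult mult_right_mono)
      qed
      then show "\<bar>\<integral>r. (lag_step n f r)\<^sup>2 - (f r)\<^sup>2 \<partial>I01\<bar> \<le> 2 * C * (\<integral>r. \<bar>lag_step n f r - f r\<bar> \<partial>I01)" by simp
    qed
  qed auto
  moreover have i: "integrable I01 (\<lambda>r. (lag_step n f r)\<^sup>2)" "integrable I01 (\<lambda>r. (f r)\<^sup>2)" for n
    using lag_step_bound[OF f, of _ n] f(2) C
    by (auto intro!: integrable_I01_bounded[where C="C\<^sup>2"] simp: power2_le_iff_abs_le)
  ultimately have "(\<lambda>n. (\<integral>r. (lag_step n f r)\<^sup>2 \<partial>I01) - (\<integral>r. (f r)\<^sup>2 \<partial>I01)) \<longlonglongrightarrow> 0" by simp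
  then show ?thesis unfolding sq by (rule LIM_zero_cancel)
qed

text \<open>Bounded second moments make the differences uniformly integrable; this takes the place
  of a dominating variable, which is not at hand for the exponentials.\<close>

lemma (in prob_space) expectation_tendsto:
  fixes Z :: "nat \<Rightarrow> 'a \<Rightarrow> real"
  assumes [measurable]: "\<And>k. Z k \<in> borel_measurable M" "Z' \<in> borel_measurable M"
    and lim: "AE \<omega> in M. (\<lambda>k. Z k \<omega>) \<longlonglongrightarrow> Z' \<omega>"
    and K: "\<And>k. (\<integral>\<^sup>+\<omega>. ennreal ((Z k \<omega>)\<^sup>2) \<partial>M) \<le> ennreal K"
  shows "integrable M (\<lambda>\<omega>. (Z' \<omega>)\<^sup>2)" "integrable M Z'" "\<And>k. integrable M (Z k)"
    "(\<lambda>k. \<integral>\<omega>. Z k \<omega> \<partial>M) \<longlonglongrightarrow> (\<integral>\<omega>. Z' \<omega> \<partial>M)"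
proof -
  have Zk2: "integrable M (\<lambda>\<omega>. (Z k \<omega>)\<^sup>2)" for k
    using K[of k] by (intro integrableI_bounded) (auto intro: le_less_trans)
  then show Zk: "integrable M (Z k)" for k by (rule square_integrable_imp_integrable[rotated]) simp
  have "(\<integral>\<^sup>+\<omega>. ennreal ((Z' \<omega>)\<^sup>2) \<partial>M) = (\<integral>\<^sup>+\<omega>. liminf (\<lambda>k. ennreal ((Z k \<omega>)\<^sup>2)) \<partial>M)"
  proof (rule nn_integral_cong_AE)
    show "AE \<omega> in M. ennreal ((Z' \<omega>)\<^sup>2) = liminf (\<lambda>k. ennreal ((Z k \<omega>)\<^sup>2))"
      using lim
    proof eventually_elim
      case (elim \<omega>)
      then have "(\<lambda>k. ennreal ((Z k \<omega>)\<^sup>2)) \<longlonglongrightarrow> ennreal ((Z' \<omega>)\<^sup>2)" by (intro tendsto_ennrealI tendsto_intros)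
      then show ?case by (intro lim_imp_Liminf[symmetric]) auto
    qed
  qed
  also have "\<dots> \<le> liminf (\<lambda>k. \<integral>\<^sup>+\<omega>. ennreal ((Z k \<omega>)\<^sup>2) \<partial>M)" by (intro nn_integral_liminf) measurable
  also have "\<dots> \<le> ennreal K" using K by (intro Liminf_le) (auto intro: always_eventually)
  finally have K': "(\<integral>\<^sup>+\<omega>. ennreal ((Z' \<omega>)\<^sup>2) \<partial>M) \<le> ennreal K" .
  then show Z2: "integrable M (\<lambda>\<omega>. (Z' \<omega>)\<^sup>2)"
    by (intro integrableI_bounded) (auto intro: le_less_trans)
  then show Z': "integrable M Z'" by (rule square_integrable_imp_integrable[rotated]) simp
  \<comment> \<open>\<open>ennreal\<close> sends negative numbers to 0, so a negative
    \<open>K\<close> stands for the bound 0.\<close>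
  define L where "L = max K 0"
  have L: "0 \<le> L" "(\<integral>\<omega>. (Z k \<omega>)\<^sup>2 \<partial>M) \<le> L" "(\<integral>\<omega>. (Z' \<omega>)\<^sup>2 \<partial>M) \<le> L" for k
  proof -
    show "0 \<le> L" by (simp add: L_def)
    have eq: "ennreal K = ennreal L" by (cases "0 \<le> K") (auto simp: L_def max_def ennreal_neg)
    show "(\<integral>\<omega>. (Z k \<omega>)\<^sup>2 \<partial>M) \<le> L"
      using K[of k] Zk2[of k] \<open>0 \<le> L\<close> unfolding eq by (subst (asm) nn_integral_eq_integral) auto
    show "(\<integral>\<omega>. (Z' \<omega>)\<^sup>2 \<partial>M) \<le> L"
      using K' Z2 \<open>0 \<le> L\<close> unfolding eq by (subst (asm) nn_integral_eq_integral) auto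
  qed
  show "(\<lambda>k. \<integral>\<omega>. Z k \<omega> \<partial>M) \<longlonglongrightarrow> (\<integral>\<omega>. Z' \<omega> \<partial>M)"
  proof (rule LIMSEQ_I)
    fix e :: real assume e: "0 < e"
    \<comment> \<open>Beyond the level \<open>A\<close> the difference is at most its square divided
      by \<open>A\<close>, which has mean at most \<open>4 * L / A <= e / 2\<close>. The
      \<open>+ 1\<close> keeps \<open>A\<close> positive for \<open>L = 0\<close>.\<close>
    define A where "A = (4 * L + 1) * 2 / e"
    have A: "0 < A" using e L(1) by (auto simp: A_def)
    have "(\<lambda>k. \<integral>\<omega>. min \<bar>Z k \<omega> - Z' \<omega>\<bar> A \<partial>M) \<longlonglongrightarrow> (\<integral>\<omega>. 0 \<partial>M)"
    proof (rule integral_dominated_convergence[where w="\<lambda>_. A"])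
      show "AE \<omega> in M. (\<lambda>k. min \<bar>Z k \<omega> - Z' \<omega>\<bar> A) \<longlonglongrightarrow> 0"
        using lim
      proof eventually_elim
        case (elim \<omega>)
        then have "(\<lambda>k. min \<bar>Z k \<omega> - Z' \<omega>\<bar> A) \<longlonglongrightarrow> min \<bar>Z' \<omega> - Z' \<omega>\<bar> A" by (intro tendsto_intros)
        then show ?case using A by simp
      qed
      show "AE \<omega> in M. norm (min \<bar>Z k \<omega> - Z' \<omega>\<bar> A) \<le> A" for k using A by auto
    qed auto
    then obtain N where N: "\<And>k. N \<le> k \<Longrightarrow> (\<integral>\<omega>. min \<bar>Z k \<omega> - Z' \<omega>\<bar> A \<partial>M) < e / 2"
      using LIMSEQ_D[of _ 0 "e / 2"] e by (fastforce simp: abs_less_iff)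
    show "\<exists>no. \<forall>k\<ge>no. norm ((\<integral>\<omega>. Z k \<omega> \<partial>M) - (\<integral>\<omega>. Z' \<omega> \<partial>M)) < e"
    proof (intro exI[of _ N] allI impI)
      fix k assume "N \<le> k"
      have im: "integrable M (\<lambda>\<omega>. min \<bar>Z k \<omega> - Z' \<omega>\<bar> A)"
        using Zk Z' by (intro integrable_min) auto
      have "\<bar>(\<integral>\<omega>. Z k \<omega> - Z' \<omega> \<partial>M)\<bar> \<le> (\<integral>\<omega>. min \<bar>Z k \<omega> - Z' \<omega>\<bar> A + (2 * (Z k \<omega>)\<^sup>2 + 2 * (Z' \<omega>)\<^sup>2) / A \<partial>M)"
      proof (rule integral_abs_le)
        show "integrable M (\<lambda>\<omega>. Z k \<omega> - Z' \<omega>)" using Zk Z' by simp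
        show "integrable M (\<lambda>\<omega>. min \<bar>Z k \<omega> - Z' \<omega>\<bar> A + (2 * (Z k \<omega>)\<^sup>2 + 2 * (Z' \<omega>)\<^sup>2) / A)"
          using im Zk2 Z2 by simp
        fix \<omega>
        have "\<bar>x - y\<bar> \<le> min \<bar>x - y\<bar> A + (2 * x\<^sup>2 + 2 * y\<^sup>2) / A" for x y :: real
        proof (cases "\<bar>x - y\<bar> \<le> A")
          case False
          then have "A * \<bar>x - y\<bar> \<le> \<bar>x - y\<bar> * \<bar>x - y\<bar>" by (intro mult_right_mono) auto
          also have "\<dots> = (x - y)\<^sup>2" by (simp add: power2_eq_square)
          also have "\<dots> \<le> 2 * x\<^sup>2 + 2 * y\<^sup>2" by (rule diff_square_le)
          finally have "\<bar>x - y\<bar> \<le> (2 * x\<^sup>2 + 2 * y\<^sup>2) / A" using A by (simp add: field_simps)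
          then show ?thesis using A by (simp add: min_def)
        qed (use A in simp)
        then show "\<bar>Z k \<omega> - Z' \<omega>\<bar> \<le> min \<bar>Z k \<omega> - Z' \<omega>\<bar> A + (2 * (Z k \<omega>)\<^sup>2 + 2 * (Z' \<omega>)\<^sup>2) / A" .
      qed
      also have "\<dots> = (\<integral>\<omega>. min \<bar>Z k \<omega> - Z' \<omega>\<bar> A \<partial>M) + (2 * (\<integral>\<omega>. (Z k \<omega>)\<^sup>2 \<partial>M) + 2 * (\<integral>\<omega>. (Z' \<omega>)\<^sup>2 \<partial>M)) / A"
        using im Zk2 Z2 by simp
      also have "\<dots> < e / 2 + (2 * L + 2 * L) / A"
        using N[OF \<open>N \<le> k\<close>] L(2)[of k] L(3) A by (intro add_less_le_mono divide_right_mono) auto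
      also have "(2 * L + 2 * L) / A \<le> e / 2" using e L(1) by (simp add: A_def field_simps)
      finally show "norm ((\<integral>\<omega>. Z k \<omega> \<partial>M) - (\<integral>\<omega>. Z' \<omega> \<partial>M)) < e" using Zk Z' by simp
    qed
  qed
qed

context brownian begin

lemma integrable_mult_sq:
  fixes X Y :: "'a \<Rightarrow> real"
  assumes [measurable]: "X \<in> borel_measurable M" "Y \<in> borel_measurable M"
    and i: "integrable M (\<lambda>\<omega>. (X \<omega>)\<^sup>2)" "integrable M (\<lambda>\<omega>. (Y \<omega>)\<^sup>2)"
  shows "integrable M (\<lambda>\<omega>. X \<omega> * Y \<omega>)"
proof (rule Bochner_Integration.integrable_bound)
  show "integrable M (\<lambda>\<omega>. (X \<omega>)\<^sup>2 + (Y \<omega>)\<^sup>2)" using i by simp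
  have "norm (x * y) \<le> norm (x\<^sup>2 + y\<^sup>2)" for x y :: real
  proof -
    have "\<bar>x\<bar> * \<bar>y\<bar> \<le> x\<^sup>2 + y\<^sup>2" by (rule mult_le_square_sum)
    also have "\<dots> \<le> \<bar>x\<^sup>2 + y\<^sup>2\<bar>" by (rule abs_ge_self)
    finally show ?thesis by (simp only: real_norm_def abs_mult)
  qed
  then show "AE \<omega> in M. norm (X \<omega> * Y \<omega>) \<le> norm ((X \<omega>)\<^sup>2 + (Y \<omega>)\<^sup>2)" by blast
qed measurable

lemma integrable_B_shift_power:
  assumes "0 \<le> t" "t \<le> 1"
  shows "integrable M (\<lambda>\<omega>. (B t \<omega> - v) ^ k)"
proof -
  have "(B t \<omega> - v) ^ k = (\<Sum>j\<le>k. of_nat (k choose j) * B t \<omega> ^ j * (- v) ^ (k - j))" for \<omega>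
    using binomial_ring[of "B t \<omega>" "- v" k] by simp
  then show ?thesis using integrable_B_power[OF assms] by simp
qed

lemma simple_integrand_uniform_bound:
  assumes "simple_integrand M B n s \<xi>"
  obtains C where "0 \<le> C" "\<And>i \<omega>. i < n \<Longrightarrow> \<omega> \<in> space M \<Longrightarrow> \<bar>\<xi> i \<omega>\<bar> \<le> C"
proof -
  have "\<forall>i. \<exists>C. i < n \<longrightarrow> (\<forall>\<omega>\<in>space M. \<bar>\<xi> i \<omega>\<bar> \<le> C)" using assms unfolding simple_integrand_def by blast
  then obtain c where c: "\<And>i \<omega>. i < n \<Longrightarrow> \<omega> \<in> space M \<Longrightarrow> \<bar>\<xi> i \<omega>\<bar> \<le> c i" by metis
  show thesis
  proof (rule that[of "\<Sum>i<n. \<bar>c i\<bar>"])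
    fix i \<omega> assume i: "i < n" and "\<omega> \<in> space M"
    then have "\<bar>\<xi> i \<omega>\<bar> \<le> \<bar>c i\<bar>" using c[of i \<omega>] by simp
    also have "\<dots> \<le> (\<Sum>i<n. \<bar>c i\<bar>)" using i by (intro member_le_sum) auto
    finally show "\<bar>\<xi> i \<omega>\<bar> \<le> (\<Sum>i<n. \<bar>c i\<bar>)" .
  qed (simp add: sum_nonneg)
qed

section \<open>Discrete Ito formula for the squared distance to v\<close>

context
  fixes n :: nat and s :: "nat \<Rightarrow> real" and \<xi> :: "nat \<Rightarrow> 'a \<Rightarrow> real"
  assumes S: "simple_integrand M B n s \<xi>"
begin

lemma integrable_simple_exp_power4:
  assumes t: "0 \<le> t" "t \<le> 1"
  shows "integrable M (\<lambda>\<omega>. simple_exp n s \<xi> t \<omega> ^ 4)"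
proof -
  note [measurable] = simple_exp_measurable_M[OF S t]
  obtain C where "0 \<le> C" and C: "\<And>i \<omega>. i < n \<Longrightarrow> \<omega> \<in> space M \<Longrightarrow> \<bar>\<xi> i \<omega>\<bar> \<le> C"
    by (rule simple_integrand_uniform_bound[OF S]) blast
  have "(\<integral>\<^sup>+\<omega>. ennreal (simple_exp n s \<xi> t \<omega> ^ 4) \<partial>M) < \<infinity>"
    by (rule le_less_trans[OF simple_exp_fourth_power[OF S C t]]) auto
  then show ?thesis by (intro integrableI_bounded) auto
qed

lemma integrable_simple_exp_power2:
  assumes t: "0 \<le> t" "t \<le> 1"
  shows "integrable M (\<lambda>\<omega>. (simple_exp n s \<xi> t \<omega>)\<^sup>2)"
proof (rule Bochner_Integration.integrable_bound)
  note [measurable] = simple_exp_measurable_M[OF S t]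
  show "integrable M (\<lambda>\<omega>. 1 + simple_exp n s \<xi> t \<omega> ^ 4)" using integrable_simple_exp_power4[OF t] by simp
  have "x\<^sup>2 \<le> 1 + x ^ 4" for x :: real
  proof -
    have "2 * x\<^sup>2 \<le> 1 + (x\<^sup>2)\<^sup>2" using sum_squares_bound[of 1 "x\<^sup>2"] by simp
    moreover have "(x\<^sup>2)\<^sup>2 = x ^ 4" using power_mult[of x 2 2] by simp
    moreover have "0 \<le> x\<^sup>2" by simp
    ultimately show ?thesis by linarith
  qed
  then show "AE \<omega> in M. norm ((simple_exp n s \<xi> t \<omega>)\<^sup>2) \<le> norm (1 + simple_exp n s \<xi> t \<omega> ^ 4)" by simp
  show "(\<lambda>\<omega>. (simple_exp n s \<xi> t \<omega>)\<^sup>2) \<in> borel_measurable M" by measurable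
qed

lemma integrable_simple_exp_mult:
  assumes t: "0 \<le> t" "t \<le> 1" and Y: "Y \<in> borel_measurable M" "integrable M (\<lambda>\<omega>. (Y \<omega>)\<^sup>2)"
  shows "integrable M (\<lambda>\<omega>. simple_exp n s \<xi> t \<omega> * Y \<omega>)"
  by (rule integrable_mult_sq[OF simple_exp_measurable_M[OF S t] Y(1) integrable_simple_exp_power2[OF t] Y(2)])

text \<open>The martingale property is known for nonnegative functionals, so the positive and
  negative parts of \<open>Y\<close> are moved separately.\<close>

lemma simple_exp_martingale_real:
  assumes t: "0 \<le> t" "t \<le> 1" and Y: "Y \<in> borel_measurable (F t)" "integrable M (\<lambda>\<omega>. (Y \<omega>)\<^sup>2)"
  shows "(\<integral>\<omega>. simple_exp n s \<xi> 1 \<omega> * Y \<omega> \<partial>M) = (\<integral>\<omega>. simple_exp n s \<xi> t \<omega> * Y \<omega> \<partial>M)"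
proof -
  note [measurable] = Y(1)
  have YM: "Y \<in> borel_measurable M" by (rule F_measurable_M[OF Y(1) t(2)])
  have "(\<integral>\<omega>. simple_exp n s \<xi> u \<omega> * Y \<omega> \<partial>M)
     = enn2real (\<integral>\<^sup>+\<omega>. ennreal (simple_exp n s \<xi> u \<omega>) * ennreal (Y \<omega>) \<partial>M) - enn2real (\<integral>\<^sup>+\<omega>. ennreal (simple_exp n s \<xi> u \<omega>) * ennreal (- Y \<omega>) \<partial>M)"
    if "0 \<le> u" "u \<le> 1" for u
    using integrable_simple_exp_mult[OF that YM Y(2)]
    by (simp add: real_lebesgue_integral_def ennreal_mult'[symmetric])
  from this[of 1] this[of t] show ?thesis
    using simple_exp_martingale[OF S t, of "\<lambda>\<omega>. ennreal (Y \<omega>)"] simple_exp_martingale[OF S t, of "\<lambda>\<omega>. ennreal (- Y \<omega>)"] t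
    by simp
qed

text \<open>Across a cell of length D the tilted mean of (B - v)^2 grows by the mean of 2 \<xi> (B -
  v) D + \<xi>^2 D^2 + D, with B at the left end. The first term is minus twice the gain from
  trading at price B. The sum telescopes, the lengths add up to 1, and the terms with D^2 are the
  discretisation error.\<close>

lemma simple_payoff_identity:
  "(\<integral>\<omega>. simple_exp n s \<xi> 1 \<omega> * (\<Sum>i<n. \<xi> i \<omega> * (v - B (s i) \<omega>) * (s (Suc i) - s i)) \<partial>M)
     + 1 / 2 * (\<integral>\<omega>. simple_exp n s \<xi> 1 \<omega> * (B 1 \<omega> - v)\<^sup>2 \<partial>M)
   = (v\<^sup>2 + 1) / 2 + 1 / 2 * (\<integral>\<omega>. simple_exp n s \<xi> 1 \<omega> * (\<Sum>i<n. (\<xi> i \<omega>)\<^sup>2 * (s (Suc i) - s i)\<^sup>2) \<partial>M)"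
proof -
  obtain C where C0: "0 \<le> C" and C: "\<And>i \<omega>. i < n \<Longrightarrow> \<omega> \<in> space M \<Longrightarrow> \<bar>\<xi> i \<omega>\<bar> \<le> C"
    by (rule simple_integrand_uniform_bound[OF S]) blast
  let ?L = "simple_exp n s \<xi>" and ?D = "\<lambda>i. s (Suc i) - s i"
  have g: "0 \<le> s i" "s i \<le> 1" if "i \<le> n" for i using simple_integrand_grid[OF S] that by auto
  have B2: "integrable M (\<lambda>\<omega>. ((B t \<omega> - v)\<^sup>2)\<^sup>2)" if "0 \<le> t" "t \<le> 1" for t
    using integrable_B_shift_power[OF that, of v 4] power_mult[of _ 2 2] by simp
  have LB: "integrable M (\<lambda>\<omega>. ?L u \<omega> * (B t \<omega> - v)\<^sup>2)" if "0 \<le> t" "t \<le> 1" "0 \<le> u" "u \<le> 1" for t u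
    using that B2 B_measurable by (intro integrable_simple_exp_mult) auto
  have L: "integrable M (\<lambda>\<omega>. ?L u \<omega>)" "(\<integral>\<omega>. ?L u \<omega> \<partial>M) = 1" if "0 \<le> u" "u \<le> 1" for u
  proof -
    show i: "integrable M (\<lambda>\<omega>. ?L u \<omega>)" using integrable_simple_exp_mult[OF that, of "\<lambda>_. 1"] by simp
    show "(\<integral>\<omega>. ?L u \<omega> \<partial>M) = 1"
      using nn_integral_simple_exp[OF S that] i by (subst (asm) nn_integral_eq_integral) auto
  qed
  have step: "2 * (\<integral>\<omega>. ?L 1 \<omega> * (\<xi> i \<omega> * (v - B (s i) \<omega>) * ?D i) \<partial>M)
      = (\<integral>\<omega>. ?L (s i) \<omega> * (B (s i) \<omega> - v)\<^sup>2 \<partial>M) - (\<integral>\<omega>. ?L (s (Suc i)) \<omega> * (B (s (Suc i)) \<omega> - v)\<^sup>2 \<partial>M)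
        + ?D i + (\<integral>\<omega>. ?L 1 \<omega> * ((\<xi> i \<omega>)\<^sup>2 * (?D i)\<^sup>2) \<partial>M)"
    and int: "integrable M (\<lambda>\<omega>. ?L 1 \<omega> * (\<xi> i \<omega> * (v - B (s i) \<omega>) * ?D i))"
      "integrable M (\<lambda>\<omega>. ?L 1 \<omega> * ((\<xi> i \<omega>)\<^sup>2 * (?D i)\<^sup>2))"
    if i: "i < n" for i
  proof -
    have a: "0 \<le> s i" "s i \<le> 1" "0 \<le> s (Suc i)" "s (Suc i) \<le> 1" using g i by auto
    have sm: "s i \<le> s (Suc i)" using S i by (simp add: simple_integrand_def)
    have xm[measurable]: "\<xi> i \<in> borel_measurable (F (s i))" "B (s i) \<in> borel_measurable (F (s i))"
      using S i a by (auto simp: simple_integrand_def intro: measurable_natural_filtration)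
    have xM[measurable]: "\<xi> i \<in> borel_measurable M" "B (s i) \<in> borel_measurable M"
      by (rule F_measurable_M[OF xm(1) a(2)], rule F_measurable_M[OF xm(2) a(2)])
    have Cb: "\<bar>\<xi> i \<omega>\<bar> \<le> C" if "\<omega> \<in> space M" for \<omega> by (rule C[OF i that])
    have "\<bar>(\<xi> i \<omega>)\<^sup>2 * (?D i)\<^sup>2\<bar> \<le> C\<^sup>2 * (?D i)\<^sup>2" if "\<omega> \<in> space M" for \<omega>
      using abs_le_square_iff[of "\<xi> i \<omega>" C] Cb[OF that] C0 by (simp add: abs_mult mult_right_mono)
    then have x2: "integrable M (\<lambda>\<omega>. ((\<xi> i \<omega>)\<^sup>2 * (?D i)\<^sup>2)\<^sup>2)"
      using abs_le_square_iff[of "(\<xi> i _)\<^sup>2 * (?D i)\<^sup>2" "C\<^sup>2 * (?D i)\<^sup>2"]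
      by (intro integrable_bounded[where C="(C\<^sup>2 * (?D i)\<^sup>2)\<^sup>2"]) (auto simp: abs_mult)
    have "integrable M (\<lambda>\<omega>. (\<xi> i \<omega> * ?D i)\<^sup>2 * (B (s i) \<omega> - v)\<^sup>2)"
    proof (rule integrable_bounded_mult)
      show "integrable M (\<lambda>\<omega>. (B (s i) \<omega> - v)\<^sup>2)" by (rule integrable_B_shift_power[OF a(1,2)])
      fix \<omega> assume "\<omega> \<in> space M"
      then have "\<bar>\<xi> i \<omega> * ?D i\<bar> \<le> \<bar>C * ?D i\<bar>" using Cb C0 by (simp add: abs_mult mult_right_mono)
      then show "\<bar>(\<xi> i \<omega> * ?D i)\<^sup>2\<bar> \<le> (C * ?D i)\<^sup>2" by (simp add: abs_le_square_iff)
    qed measurable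
    then have y2: "integrable M (\<lambda>\<omega>. (\<xi> i \<omega> * (v - B (s i) \<omega>) * ?D i)\<^sup>2)"
      by (simp add: power_mult_distrib power2_commute[of v] ac_simps)
    show i1: "integrable M (\<lambda>\<omega>. ?L 1 \<omega> * (\<xi> i \<omega> * (v - B (s i) \<omega>) * ?D i))"
      and i2: "integrable M (\<lambda>\<omega>. ?L 1 \<omega> * ((\<xi> i \<omega>)\<^sup>2 * (?D i)\<^sup>2))"
      by (rule integrable_simple_exp_mult[OF _ _ _ y2], simp, simp, measurable, rule integrable_simple_exp_mult[OF _ _ _ x2]) auto
    have j1: "integrable M (\<lambda>\<omega>. ?L (s i) \<omega> * (\<xi> i \<omega> * (v - B (s i) \<omega>) * ?D i))"
      by (rule integrable_simple_exp_mult[OF a(1,2) _ y2]) measurable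
    have j2: "integrable M (\<lambda>\<omega>. ?L (s i) \<omega> * ((\<xi> i \<omega>)\<^sup>2 * (?D i)\<^sup>2))"
      by (rule integrable_simple_exp_mult[OF a(1,2) _ x2]) measurable
    \<comment> \<open>The moment formula of a cell has the density at its left end; the martingale
      property moves this to time 1, so that all cells share one density.\<close>
    have m1: "(\<integral>\<omega>. ?L 1 \<omega> * (\<xi> i \<omega> * (v - B (s i) \<omega>) * ?D i) \<partial>M) = (\<integral>\<omega>. ?L (s i) \<omega> * (\<xi> i \<omega> * (v - B (s i) \<omega>) * ?D i) \<partial>M)"
      by (rule simple_exp_martingale_real[OF a(1,2) _ y2]) measurable
    have m2: "(\<integral>\<omega>. ?L 1 \<omega> * ((\<xi> i \<omega>)\<^sup>2 * (?D i)\<^sup>2) \<partial>M) = (\<integral>\<omega>. ?L (s i) \<omega> * ((\<xi> i \<omega>)\<^sup>2 * (?D i)\<^sup>2) \<partial>M)"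
      by (rule simple_exp_martingale_real[OF a(1,2) _ x2]) measurable
    have ex: "?L (s i) \<omega> * ((B (s i) \<omega> - v + \<xi> i \<omega> * ?D i)\<^sup>2 + ?D i)
      = ?L (s i) \<omega> * (B (s i) \<omega> - v)\<^sup>2 - 2 * (?L (s i) \<omega> * (\<xi> i \<omega> * (v - B (s i) \<omega>) * ?D i))
        + ?D i * ?L (s i) \<omega> + ?L (s i) \<omega> * ((\<xi> i \<omega>)\<^sup>2 * (?D i)\<^sup>2)" for \<omega>
      by (simp add: power2_eq_square algebra_simps)
    have "integrable M (\<lambda>\<omega>. ?L (s i) \<omega> * ((B (s i) \<omega> - v + \<xi> i \<omega> * ?D i)\<^sup>2 + ?D i))"
      unfolding ex using LB[OF a(1,2) a(1,2)] j1 j2 L(1)[OF a(1,2)] by auto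
    then have "ennreal (\<integral>\<omega>. ?L (s i) \<omega> * ((B (s i) \<omega> - v + \<xi> i \<omega> * ?D i)\<^sup>2 + ?D i) \<partial>M)
      = (\<integral>\<^sup>+\<omega>. ennreal (?L (s i) \<omega> * ((B (s i) \<omega> - v + \<xi> i \<omega> * ?D i)\<^sup>2 + ?D i)) \<partial>M)"
      using sm by (intro nn_integral_eq_integral[symmetric]) auto
    also have "\<dots> = (\<integral>\<^sup>+\<omega>. ennreal (?L (s (Suc i)) \<omega> * (B (s (Suc i)) \<omega> - v)\<^sup>2) \<partial>M)"
      using simple_exp_second_moment_step[OF S i order_refl sm order_refl, of v] by simp
    also have "\<dots> = ennreal (\<integral>\<omega>. ?L (s (Suc i)) \<omega> * (B (s (Suc i)) \<omega> - v)\<^sup>2 \<partial>M)"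
      using LB[OF a(3,4) a(3,4)] by (intro nn_integral_eq_integral) auto
    finally have "(\<integral>\<omega>. ?L (s i) \<omega> * ((B (s i) \<omega> - v + \<xi> i \<omega> * ?D i)\<^sup>2 + ?D i) \<partial>M)
       = (\<integral>\<omega>. ?L (s (Suc i)) \<omega> * (B (s (Suc i)) \<omega> - v)\<^sup>2 \<partial>M)"
      using sm by (subst (asm) ennreal_inj) (auto intro!: integral_nonneg_AE)
    also have "(\<integral>\<omega>. ?L (s i) \<omega> * ((B (s i) \<omega> - v + \<xi> i \<omega> * ?D i)\<^sup>2 + ?D i) \<partial>M)
       = (\<integral>\<omega>. ?L (s i) \<omega> * (B (s i) \<omega> - v)\<^sup>2 \<partial>M) - 2 * (\<integral>\<omega>. ?L (s i) \<omega> * (\<xi> i \<omega> * (v - B (s i) \<omega>) * ?D i) \<partial>M)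
        + ?D i + (\<integral>\<omega>. ?L (s i) \<omega> * ((\<xi> i \<omega>)\<^sup>2 * (?D i)\<^sup>2) \<partial>M)"
      unfolding ex using LB[OF a(1,2) a(1,2)] j1 j2 L[OF a(1,2)] by simp
    finally show "2 * (\<integral>\<omega>. ?L 1 \<omega> * (\<xi> i \<omega> * (v - B (s i) \<omega>) * ?D i) \<partial>M)
      = (\<integral>\<omega>. ?L (s i) \<omega> * (B (s i) \<omega> - v)\<^sup>2 \<partial>M) - (\<integral>\<omega>. ?L (s (Suc i)) \<omega> * (B (s (Suc i)) \<omega> - v)\<^sup>2 \<partial>M)
        + ?D i + (\<integral>\<omega>. ?L 1 \<omega> * ((\<xi> i \<omega>)\<^sup>2 * (?D i)\<^sup>2) \<partial>M)"
      unfolding m1 m2 by simp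
  qed
  let ?g = "\<lambda>i. \<integral>\<omega>. ?L (s i) \<omega> * (B (s i) \<omega> - v)\<^sup>2 \<partial>M"
  have s01: "s 0 = 0" "s n = 1" using S by (auto simp: simple_integrand_def)
  have "2 * (\<integral>\<omega>. ?L 1 \<omega> * (\<Sum>i<n. \<xi> i \<omega> * (v - B (s i) \<omega>) * ?D i) \<partial>M)
     = (\<Sum>i<n. 2 * (\<integral>\<omega>. ?L 1 \<omega> * (\<xi> i \<omega> * (v - B (s i) \<omega>) * ?D i) \<partial>M))"
  proof -
    have "(\<integral>\<omega>. ?L 1 \<omega> * (\<Sum>i<n. \<xi> i \<omega> * (v - B (s i) \<omega>) * ?D i) \<partial>M)
       = (\<Sum>i<n. \<integral>\<omega>. ?L 1 \<omega> * (\<xi> i \<omega> * (v - B (s i) \<omega>) * ?D i) \<partial>M)"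
      unfolding sum_distrib_left by (rule Bochner_Integration.integral_sum) (use int(1) in auto)
    then show ?thesis by (simp only: sum_distrib_left)
  qed
  also have "\<dots> = (\<Sum>i<n. ?g i - ?g (Suc i) + ?D i + (\<integral>\<omega>. ?L 1 \<omega> * ((\<xi> i \<omega>)\<^sup>2 * (?D i)\<^sup>2) \<partial>M))"
    by (intro sum.cong refl step) simp
  also have "\<dots> = ?g 0 - ?g n + (s n - s 0) + (\<Sum>i<n. \<integral>\<omega>. ?L 1 \<omega> * ((\<xi> i \<omega>)\<^sup>2 * (?D i)\<^sup>2) \<partial>M)"
    by (simp only: sum.distrib sum_lessThan_telescope sum_lessThan_telescope'[of ?g])
  also have "(\<Sum>i<n. \<integral>\<omega>. ?L 1 \<omega> * ((\<xi> i \<omega>)\<^sup>2 * (?D i)\<^sup>2) \<partial>M) = (\<integral>\<omega>. ?L 1 \<omega> * (\<Sum>i<n. (\<xi> i \<omega>)\<^sup>2 * (?D i)\<^sup>2) \<partial>M)"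
    unfolding sum_distrib_left by (rule Bochner_Integration.integral_sum[symmetric]) (use int(2) in auto)
  also have "?g 0 = (\<integral>\<omega>. v\<^sup>2 \<partial>M)"
    by (rule Bochner_Integration.integral_cong) (auto simp: s01 B_0 simple_exp_0[OF S])
  finally have eq: "2 * (\<integral>\<omega>. ?L 1 \<omega> * (\<Sum>i<n. \<xi> i \<omega> * (v - B (s i) \<omega>) * ?D i) \<partial>M)
     = v\<^sup>2 - ?g n + 1 + (\<integral>\<omega>. ?L 1 \<omega> * (\<Sum>i<n. (\<xi> i \<omega>)\<^sup>2 * (?D i)\<^sup>2) \<partial>M)" by (simp add: prob_space s01)
  have "2 * a = p - b + 1 + c \<Longrightarrow> a + 1 / 2 * b = (p + 1) / 2 + 1 / 2 * c" for a b c p :: real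
    by (simp add: field_simps)
  from this[OF eq] show ?thesis unfolding s01 .
qed

end

end

text \<open>The Cauchy-Schwarz inequality, applied twice.\<close>

lemma mean_power4:
  fixes a :: "nat \<Rightarrow> real"
  assumes n: "0 < n"
  shows "(\<Sum>i<n. a i / real n) ^ 4 \<le> (\<Sum>i<n. a i ^ 4 / real n)"
proof -
  have sq: "(\<Sum>i<n. b i / real n)\<^sup>2 \<le> (\<Sum>i<n. (b i)\<^sup>2 / real n)" for b :: "nat \<Rightarrow> real"
  proof -
    have "(\<Sum>i<n. b i)\<^sup>2 \<le> (\<Sum>i<n. (b i)\<^sup>2) * card {..<n}" by (rule sum_squared_le_sum_of_squares)
    then show ?thesis using n by (simp add: sum_divide_distrib[symmetric] power_divide power2_eq_square[of "real n"] field_simps)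
  qed
  have "(\<Sum>i<n. a i / real n) ^ 4 = ((\<Sum>i<n. a i / real n)\<^sup>2)\<^sup>2" by simp
  also have "\<dots> \<le> (\<Sum>i<n. (a i)\<^sup>2 / real n)\<^sup>2" by (intro power_mono sq) simp
  also have "\<dots> \<le> (\<Sum>i<n. ((a i)\<^sup>2)\<^sup>2 / real n)" by (rule sq)
  finally show ?thesis by simp
qed

lemma power4_diff_bound: "(x - y) ^ 4 \<le> 8 * (x ^ 4 + y ^ 4)" for x y :: real
proof -
  have sq: "(x - y)\<^sup>2 \<le> 2 * (x\<^sup>2 + y\<^sup>2)" for x y :: real
    using diff_square_le[of x y] by simp
  have sq': "(x + y)\<^sup>2 \<le> 2 * (x\<^sup>2 + y\<^sup>2)" for x y :: real
    using sq[of x "- y"] by simp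
  have "(x - y) ^ 4 = ((x - y)\<^sup>2)\<^sup>2" by simp
  also have "\<dots> \<le> (2 * (x\<^sup>2 + y\<^sup>2))\<^sup>2" by (intro power_mono sq) simp
  also have "\<dots> = 4 * (x\<^sup>2 + y\<^sup>2)\<^sup>2" by (simp add: power2_eq_square algebra_simps)
  also have "\<dots> \<le> 4 * (2 * ((x\<^sup>2)\<^sup>2 + (y\<^sup>2)\<^sup>2))" by (intro mult_left_mono sq') simp
  finally show ?thesis by simp
qed

lemma power4_commute: "(x - y) ^ 4 = (y - x) ^ 4" for x y :: real
  using arg_cong[OF power2_commute[of x y], of "\<lambda>z. z\<^sup>2"] by simp

context brownian begin

lemma progressive_cong:
  assumes "\<And>t \<omega>. t \<in> {0..1} \<Longrightarrow> \<omega> \<in> space M \<Longrightarrow> X t \<omega> = Y t \<omega>"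
  shows "progressive F X \<longleftrightarrow> progressive F Y"
proof -
  have "(\<lambda>(s, \<omega>). X s \<omega>) \<in> borel_measurable (restrict_space borel {0..t} \<Otimes>\<^sub>M F t)
    \<longleftrightarrow> (\<lambda>(s, \<omega>). Y s \<omega>) \<in> borel_measurable (restrict_space borel {0..t} \<Otimes>\<^sub>M F t)" if "t \<in> {0..1}" for t
    by (rule measurable_cong) (use that assms in \<open>auto simp: space_pair_measure space_restrict_space\<close>)
  then show ?thesis by (simp add: progressive_def)
qed

text \<open>Adapted with continuous paths, hence progressive. Time is rounded down to multiples of
  1/(n+1) and clipped to \<open>{0..t}\<close>: a countable range gives joint measurability, and
  only values of \<open>B\<close> up to time \<open>t\<close> occur.\<close>

lemma progressive_B: "progressive F B"
  unfolding progressive_def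
proof
  fix t :: real assume t: "t \<in> {0..1}"
  let ?N = "restrict_space borel {0..t} \<Otimes>\<^sub>M F t"
  define q where "q n x = max 0 (min (real_of_int \<lfloor>real (Suc n) * x\<rfloor> / real (Suc n)) t)" for n :: nat and x
  have q01: "0 \<le> q n x" "q n x \<le> t" for n x using t by (auto simp: q_def)
  show "(\<lambda>(s, \<omega>). B s \<omega>) \<in> borel_measurable ?N"
  proof (rule borel_measurable_LIMSEQ_metric)
    fix n
    have "fst \<in> borel_measurable ?N" by (rule measurable_compose[OF measurable_fst measurable_restrict_space1]) simp
    then have "(\<lambda>z. \<lfloor>real (Suc n) * fst z\<rfloor>) \<in> measurable ?N (count_space UNIV)" by measurable
    moreover have "(\<lambda>z. B (max 0 (min (real_of_int i / real (Suc n)) t)) (snd z)) \<in> borel_measurable ?N" for i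
      by (rule measurable_compose[OF measurable_snd measurable_natural_filtration]) (use t in auto)
    ultimately show "(\<lambda>z. B (q n (fst z)) (snd z)) \<in> borel_measurable ?N"
      unfolding q_def by (rule measurable_compose_countable[rotated])
  next
    fix z assume "z \<in> space ?N"
    then obtain x \<omega> where z: "z = (x, \<omega>)" and x: "0 \<le> x" "x \<le> t" and \<omega>: "\<omega> \<in> space M"
      by (cases z) (auto simp: space_pair_measure space_restrict_space)
    have "(\<lambda>n. q n x) \<longlonglongrightarrow> x"
    proof (rule LIMSEQ_I)
      fix e :: real assume "0 < e"
      then obtain N where N: "1 / real (Suc N) < e" using nat_approx_posE by blast
      show "\<exists>no. \<forall>n\<ge>no. norm (q n x - x) < e"
      proof (intro exI[of _ N] allI impI)
        fix n assume "N \<le> n"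
        then have "1 / real (Suc n) \<le> 1 / real (Suc N)" by (simp add: field_simps)
        moreover have "real_of_int \<lfloor>real (Suc n) * x\<rfloor> / real (Suc n) \<le> x"
          using of_int_floor_le[of "real (Suc n) * x"] by (simp add: field_simps)
        moreover have "x - 1 / real (Suc n) < real_of_int \<lfloor>real (Suc n) * x\<rfloor> / real (Suc n)"
        proof -
          have "real (Suc n) * x - 1 < real_of_int \<lfloor>real (Suc n) * x\<rfloor>" by linarith
          then have "(real (Suc n) * x - 1) / real (Suc n) < real_of_int \<lfloor>real (Suc n) * x\<rfloor> / real (Suc n)"
            by (intro divide_strict_right_mono) auto
          then show ?thesis by (simp add: diff_divide_distrib)
        qed
        ultimately show "norm (q n x - x) < e" using N x unfolding q_def by simp
      qed
    qed
    moreover have "q n x \<in> {0..1}" for n using q01[of n x] t by auto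
    ultimately have "(\<lambda>n. B (q n x) \<omega>) \<longlonglongrightarrow> B x \<omega>"
      using x t by (intro continuous_on_tendsto_compose[OF B_continuous[OF \<omega>]]) auto
    then show "(\<lambda>n. B (q n (fst z)) (snd z)) \<longlonglongrightarrow> (case z of (s, \<omega>) \<Rightarrow> B s \<omega>)" by (simp add: z)
  qed
qed

lemma along_back_price: "0 \<le> t \<Longrightarrow> along B back_price t \<omega> = B t \<omega>"
  by (simp add: along_def back_price_def path_upto_def)

lemma back_price_pricing_rule: "back_price \<in> pricing_rules M B"
  using progressive_B progressive_cong[of "along B back_price" B] by (auto simp: pricing_rules_def along_back_price)

section \<open>Passage from simple integrands to a bounded control\<close>

context
  fixes \<eta> :: "real \<Rightarrow> 'a \<Rightarrow> real" and C :: real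
  assumes adm: "\<eta> \<in> admissible_controls M B"
    and C0: "0 \<le> C" and C: "\<And>t \<omega>. t \<in> {0..1} \<Longrightarrow> \<omega> \<in> space M \<Longrightarrow> \<bar>\<eta> t \<omega>\<bar> \<le> C"
begin

private lemma p: "progressive F \<eta>"
  using adm by (simp add: admissible_controls_def)

private definition \<xi> where "\<xi> k i \<omega> = lag_avg (Suc k) (\<lambda>r. \<eta> r \<omega>) i"
private definition s where "s k i = real i / real (Suc k)"
private abbreviation "I k \<equiv> simple_ito B (Suc k) (s k) (\<xi> k) 1"
private abbreviation "L k \<equiv> simple_exp (Suc k) (s k) (\<xi> k) 1"
private definition Y where "Y v k \<omega> = (\<Sum>i<Suc k. \<xi> k i \<omega> * (v - B (s k i) \<omega>) * (s k (Suc i) - s k i))"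

private lemma S: "simple_integrand M B (Suc k) (s k) (\<xi> k)"
  unfolding s_def[abs_def] \<xi>_def[abs_def] by (rule lag_simple_integrand[OF p C]) auto

private lemma \<xi>_bound: "i < Suc k \<Longrightarrow> \<omega> \<in> space M \<Longrightarrow> \<bar>\<xi> k i \<omega>\<bar> \<le> C"
  unfolding \<xi>_def by (rule lag_avg_bound[OF progressive_section_measurable[OF p]]) (use C in auto)

private lemma s_diff: "s k (Suc i) - s k i = 1 / real (Suc k)"
  by (simp add: s_def diff_divide_distrib[symmetric])

private lemma s_01: "i \<le> Suc k \<Longrightarrow> 0 \<le> s k i" "i \<le> Suc k \<Longrightarrow> s k i \<le> 1"
  using simple_integrand_grid[OF S] by auto

private lemma L_eq: "L k \<omega> = exp (I k \<omega> - 1 / 2 * (\<Sum>i<Suc k. (\<xi> k i \<omega>)\<^sup>2 / real (Suc k)))"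
proof -
  have "(\<Sum>i<Suc k. (\<xi> k i \<omega>)\<^sup>2 * (min (s k (Suc i)) 1 - min (s k i) 1)) = (\<Sum>i<Suc k. (\<xi> k i \<omega>)\<^sup>2 / real (Suc k))"
  proof (rule sum.cong)
    fix i assume i: "i \<in> {..<Suc k}"
    have "min (s k (Suc i)) 1 = s k (Suc i)" "min (s k i) 1 = s k i" using i s_01(2)[of i k] s_01(2)[of "Suc i" k] by auto
    then show "(\<xi> k i \<omega>)\<^sup>2 * (min (s k (Suc i)) 1 - min (s k i) 1) = (\<xi> k i \<omega>)\<^sup>2 / real (Suc k)"
      by (simp only: s_diff) simp
  qed simp
  then show ?thesis by (simp only: simple_exp_def)
qed

text \<open>The exponentials call for almost sure convergence of the integrals, which mean square
  convergence supplies along a subsequence.\<close>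

private lemma ito_subsequence:
  obtains r where "strict_mono r" "AE \<omega> in M. (\<lambda>j. I (r j) \<omega>) \<longlonglongrightarrow> ito_integral M B \<eta> 1 \<omega>"
proof -
  let ?X = "ito_integral M B \<eta> 1"
  have [measurable]: "I k \<in> borel_measurable M" "?X \<in> borel_measurable M" for k
    using F_measurable_M[OF simple_ito_measurable[OF S]] F_measurable_M[OF ito_integral_measurable[OF adm]] by auto
  have d: "(\<lambda>k. sq_dist (I k) ?X) \<longlonglongrightarrow> 0"
  proof (rule tendsto_sandwich[OF _ _ tendsto_const])
    show "(\<lambda>k. 4 * process_sq_dist (simple_process (Suc k) (s k) (\<xi> k)) \<eta>) \<longlonglongrightarrow> 0"
      using ennreal_tendsto_cmult[OF _ lag_tendsto_L2[OF p C], of 4] unfolding s_def[abs_def] \<xi>_def[abs_def] by simp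
    show "eventually (\<lambda>k. sq_dist (I k) ?X \<le> 4 * process_sq_dist (simple_process (Suc k) (s k) (\<xi> k)) \<eta>) sequentially"
      using ito_integral_approximation[OF adm S] by (intro always_eventually) auto
  qed auto
  \<comment> \<open>From \<open>N\<close> on the squared differences have finite mean, so they are
    integrable and converge to 0 in mean, which yields the subsequence.\<close>
  obtain N where N: "\<And>k. N \<le> k \<Longrightarrow> sq_dist (I k) ?X \<le> ennreal 1" using ennreal_tendsto_0D[OF d, of 1] by auto
  define u where "u k \<omega> = (I (k + N) \<omega> - ?X \<omega>)\<^sup>2" for k \<omega>
  have um[measurable]: "u k \<in> borel_measurable M" for k unfolding u_def[abs_def] by measurable
  have ui: "integrable M (u k)" for k
    using N[of "k + N"] by (intro integrableI_bounded) (auto simp: u_def sq_dist_def intro: le_less_trans)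
  have "(\<lambda>k. ennreal (\<integral>\<omega>. norm (u k \<omega>) \<partial>M)) \<longlonglongrightarrow> ennreal 0"
  proof -
    have "ennreal (\<integral>\<omega>. norm (u k \<omega>) \<partial>M) = sq_dist (I (k + N)) ?X" for k
      unfolding sq_dist_def using ui[of k] unfolding u_def[abs_def] by (subst nn_integral_eq_integral[symmetric]) auto
    then show ?thesis using LIMSEQ_ignore_initial_segment[OF d, of N] by simp
  qed
  then have "(\<lambda>k. \<integral>\<omega>. norm (u k \<omega>) \<partial>M) \<longlonglongrightarrow> 0"
    by (subst (asm) tendsto_ennreal_iff) auto
  then obtain r where r: "strict_mono r" "AE \<omega> in M. (\<lambda>j. u (r j) \<omega>) \<longlonglongrightarrow> 0"
    using tendsto_L1_AE_subseq[of M u] ui by blast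
  show thesis
  proof (rule that[of "\<lambda>j. r j + N"])
    show "strict_mono (\<lambda>j. r j + N)" using r(1) by (auto simp: strict_mono_def)
    show "AE \<omega> in M. (\<lambda>j. I (r j + N) \<omega>) \<longlonglongrightarrow> ?X \<omega>"
      using r(2)
    proof eventually_elim
      case (elim \<omega>)
      then have "(\<lambda>j. sqrt (u (r j) \<omega>)) \<longlonglongrightarrow> sqrt 0" by (intro tendsto_intros)
      then have "(\<lambda>j. \<bar>I (r j + N) \<omega> - ?X \<omega>\<bar>) \<longlonglongrightarrow> 0" by (simp add: u_def)
      then show ?case by (rule LIM_zero_cancel[OF tendsto_rabs_zero_cancel])
    qed
  qed
qed

private lemma Y_eq: "Y v k \<omega> = (\<Sum>i<Suc k. lag_avg (Suc k) (\<lambda>r. \<eta> r \<omega>) i * (v - B (real i / real (Suc k)) \<omega>) / real (Suc k))"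
  unfolding Y_def s_diff unfolding \<xi>_def s_def by simp

private lemma Y_tendsto:
  assumes \<omega>: "\<omega> \<in> space M"
  shows "(\<lambda>k. Y v k \<omega>) \<longlonglongrightarrow> (\<integral>t. (v - B t \<omega>) * \<eta> t \<omega> \<partial>I01)"
proof -
  have "(\<lambda>n. \<Sum>i<n. lag_avg n (\<lambda>r. \<eta> r \<omega>) i * (v - B (real i / real n) \<omega>) / real n) \<longlonglongrightarrow> (\<integral>r. \<eta> r \<omega> * (v - B r \<omega>) \<partial>I01)"
    using C \<omega> B_continuous[OF \<omega>]
    by (intro lag_sum_tendsto[OF progressive_section_measurable[OF p \<omega>]] continuous_intros) auto
  from LIMSEQ_Suc[OF this] show ?thesis unfolding Y_eq by (simp add: mult.commute)
qed

private lemma L_tendsto: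
  assumes r: "strict_mono r" "AE \<omega> in M. (\<lambda>j. I (r j) \<omega>) \<longlonglongrightarrow> ito_integral M B \<eta> 1 \<omega>"
  shows "AE \<omega> in M. (\<lambda>j. L (r j) \<omega>) \<longlonglongrightarrow> stoch_exp M B \<eta> 1 \<omega>"
proof -
  have q: "(\<lambda>j. \<Sum>i<Suc (r j). (\<xi> (r j) i \<omega>)\<^sup>2 / real (Suc (r j))) \<longlonglongrightarrow> (\<integral>t. (\<eta> t \<omega>)\<^sup>2 \<partial>I01)" if \<omega>: "\<omega> \<in> space M" for \<omega>
  proof -
    have "(\<lambda>n. \<Sum>i<n. (lag_avg n (\<lambda>r. \<eta> r \<omega>) i)\<^sup>2 / real n) \<longlonglongrightarrow> (\<integral>t. (\<eta> t \<omega>)\<^sup>2 \<partial>I01)"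
      using C \<omega> by (intro lag_square_sum_tendsto[OF progressive_section_measurable[OF p \<omega>]]) auto
    from LIMSEQ_subseq_LIMSEQ[OF LIMSEQ_Suc[OF this] r(1)] show ?thesis by (simp add: \<xi>_def comp_def)
  qed
  show ?thesis
    using r(2) AE_space
  proof eventually_elim
    case (elim \<omega>)
    have "(LINT s:{0..1}|lborel. \<bar>\<eta> s \<omega>\<bar>\<^sup>2) = (\<integral>t. (\<eta> t \<omega>)\<^sup>2 \<partial>I01)" by (simp add: integral_I01)
    then show ?case
      unfolding L_eq stoch_exp_def using elim(1) q[OF elim(2)] by (simp only:) (intro tendsto_intros)
  qed
qed

private lemma [measurable]: "L k \<in> borel_measurable M" 
  by (rule simple_exp_measurable_M[OF S]) auto

private lemma [measurable]: "Y v k \<in> borel_measurable M"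
proof -
  have "\<xi> k i \<in> borel_measurable M \<and> B (s k i) \<in> borel_measurable M" if "i < Suc k" for i
    using S[of k] that s_01[of i k] F_measurable_M[of "\<xi> k i" "s k i"] by (auto simp: simple_integrand_def intro: B_measurable)
  then show ?thesis unfolding Y_def[abs_def] by (intro borel_measurable_sum borel_measurable_times borel_measurable_diff) auto
qed

lemma stoch_exp_measurable: "stoch_exp M B \<eta> 1 \<in> borel_measurable M"
proof -
  note [measurable] = F_measurable_M[OF ito_integral_measurable[OF adm] order_refl] progressive_joint_measurable[OF p]
  have "stoch_exp M B \<eta> 1 = (\<lambda>\<omega>. exp (ito_integral M B \<eta> 1 \<omega> - 1 / 2 * (\<integral>t. (\<eta> t \<omega>)\<^sup>2 \<partial>I01)))"
    by (intro ext) (simp add: stoch_exp_def integral_I01)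
  moreover have "(\<lambda>\<omega>. \<integral>t. (\<eta> t \<omega>)\<^sup>2 \<partial>I01) \<in> borel_measurable M"
    by (intro I01.borel_measurable_lebesgue_integral) (simp add: case_prod_beta)
  ultimately show ?thesis by simp
qed

private lemma payoff_integral_measurable: "(\<lambda>\<omega>. \<integral>t. (v - B t \<omega>) * \<eta> t \<omega> \<partial>I01) \<in> borel_measurable M"
proof -
  note [measurable] = progressive_joint_measurable[OF p] progressive_joint_measurable[OF progressive_B]
  show ?thesis by (intro I01.borel_measurable_lebesgue_integral) (simp add: case_prod_beta)
qed

private lemma B_shift4: 
  assumes "0 \<le> t" "t \<le> 1"
  shows "(\<integral>\<omega>. (v - B t \<omega>) ^ 4 \<partial>M) \<le> 8 * (v ^ 4 + 3)"
proof -
  have "(\<integral>\<omega>. (v - B t \<omega>) ^ 4 \<partial>M) \<le> (\<integral>\<omega>. 8 * (v ^ 4 + B t \<omega> ^ 4) \<partial>M)"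
  proof (rule integral_mono)
    show "integrable M (\<lambda>\<omega>. (v - B t \<omega>) ^ 4)"
      using integrable_B_shift_power[OF assms, of v 4] by (simp only: power4_commute[of v])
    show "integrable M (\<lambda>\<omega>. 8 * (v ^ 4 + B t \<omega> ^ 4))" using integrable_B_power[OF assms, of 4] by simp
  qed (rule power4_diff_bound)
  also have "\<dots> = 8 * (v ^ 4 + 3 * t\<^sup>2)" using integrable_B_power[OF assms, of 4] by (simp add: prob_space B_moments[OF assms])
  also have "\<dots> \<le> 8 * (v ^ 4 + 3)" using assms power_le_one[of t 2] by simp
  finally show ?thesis .
qed

text \<open>The fourth power of an average over cells is at most the average of the fourth powers,
  and those have moments that are bounded uniformly in time.\<close>

private lemma Y_power4: "(\<integral>\<^sup>+\<omega>. ennreal (Y v k \<omega> ^ 4) \<partial>M) \<le> ennreal (C ^ 4 * (8 * (v ^ 4 + 3)))"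
proof -
  have i: "integrable M (\<lambda>\<omega>. (v - B (s k i) \<omega>) ^ 4)" if "i < Suc k" for i
    using integrable_B_shift_power[OF s_01, of i k v 4] that by (simp add: power4_commute[of v])
  have "(\<integral>\<^sup>+\<omega>. ennreal (Y v k \<omega> ^ 4) \<partial>M) \<le> (\<integral>\<^sup>+\<omega>. ennreal (\<Sum>i<Suc k. C ^ 4 * (v - B (s k i) \<omega>) ^ 4 / real (Suc k)) \<partial>M)"
  proof (intro nn_integral_mono ennreal_leI)
    fix \<omega> assume \<omega>: "\<omega> \<in> space M"
    have "Y v k \<omega> = (\<Sum>i<Suc k. (\<xi> k i \<omega> * (v - B (s k i) \<omega>)) / real (Suc k))" unfolding Y_def s_diff by simp
    then have "Y v k \<omega> ^ 4 \<le> (\<Sum>i<Suc k. (\<xi> k i \<omega> * (v - B (s k i) \<omega>)) ^ 4 / real (Suc k))"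
      using mean_power4[of "Suc k" "\<lambda>i. \<xi> k i \<omega> * (v - B (s k i) \<omega>)"] by simp
    also have "\<dots> \<le> (\<Sum>i<Suc k. C ^ 4 * (v - B (s k i) \<omega>) ^ 4 / real (Suc k))"
    proof (intro sum_mono divide_right_mono)
      fix i assume "i \<in> {..<Suc k}"
      then have "\<bar>\<xi> k i \<omega>\<bar> ^ 4 \<le> C ^ 4" using \<xi>_bound[of i k \<omega>] \<omega> by (intro power_mono) auto
      then have "\<xi> k i \<omega> ^ 4 \<le> C ^ 4" by (simp add: power_even_abs)
      then show "(\<xi> k i \<omega> * (v - B (s k i) \<omega>)) ^ 4 \<le> C ^ 4 * (v - B (s k i) \<omega>) ^ 4"
        unfolding power_mult_distrib by (rule mult_right_mono) simp
    qed simp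
    finally show "Y v k \<omega> ^ 4 \<le> (\<Sum>i<Suc k. C ^ 4 * (v - B (s k i) \<omega>) ^ 4 / real (Suc k))" .
  qed
  also have "\<dots> = ennreal (\<integral>\<omega>. (\<Sum>i<Suc k. C ^ 4 * (v - B (s k i) \<omega>) ^ 4 / real (Suc k)) \<partial>M)"
  proof (rule nn_integral_eq_integral)
    show "integrable M (\<lambda>\<omega>. \<Sum>i<Suc k. C ^ 4 * (v - B (s k i) \<omega>) ^ 4 / real (Suc k))"
      using i by (intro Bochner_Integration.integrable_sum) auto
    show "AE \<omega> in M. 0 \<le> (\<Sum>i<Suc k. C ^ 4 * (v - B (s k i) \<omega>) ^ 4 / real (Suc k))"
      using C0 by (intro AE_I2 sum_nonneg) simp
  qed
  also have "\<dots> \<le> ennreal (C ^ 4 * (8 * (v ^ 4 + 3)))"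
  proof (rule ennreal_leI)
    have "(\<integral>\<omega>. (\<Sum>i<Suc k. C ^ 4 * (v - B (s k i) \<omega>) ^ 4 / real (Suc k)) \<partial>M)
       = (\<Sum>i<Suc k. C ^ 4 * (\<integral>\<omega>. (v - B (s k i) \<omega>) ^ 4 \<partial>M) / real (Suc k))"
      using i by (subst Bochner_Integration.integral_sum) auto
    also have "\<dots> \<le> (\<Sum>i<Suc k. C ^ 4 * (8 * (v ^ 4 + 3)) / real (Suc k))"
      using C0 s_01[of _ k] by (intro sum_mono divide_right_mono mult_left_mono B_shift4) auto
    also have "\<dots> = C ^ 4 * (8 * (v ^ 4 + 3))" by (simp only: sum_constant) simp
    finally show "(\<integral>\<omega>. (\<Sum>i<Suc k. C ^ 4 * (v - B (s k i) \<omega>) ^ 4 / real (Suc k)) \<partial>M) \<le> C ^ 4 * (8 * (v ^ 4 + 3))" .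
  qed
  finally show ?thesis .
qed

private lemma L_power4: "(\<integral>\<^sup>+\<omega>. ennreal (L k \<omega> ^ 4) \<partial>M) \<le> ennreal (exp (6 * C\<^sup>2))"
  by (rule simple_exp_fourth_power[OF S \<xi>_bound]) auto

text \<open>Fourth moments of the two factors bound the second moment of the product, and uniform
  second moments are the hypothesis of \<open>expectation_tendsto\<close>.\<close>

private lemma product_second_moment:
  assumes [measurable]: "Z \<in> borel_measurable M" and Z: "(\<integral>\<^sup>+\<omega>. ennreal (Z \<omega> ^ 4) \<partial>M) \<le> ennreal K" and K: "0 \<le> K"
  shows "(\<integral>\<^sup>+\<omega>. ennreal ((L k \<omega> * Z \<omega>)\<^sup>2) \<partial>M) \<le> ennreal (exp (6 * C\<^sup>2) + K)"
proof -
  have "(\<integral>\<^sup>+\<omega>. ennreal ((L k \<omega> * Z \<omega>)\<^sup>2) \<partial>M) \<le> (\<integral>\<^sup>+\<omega>. ennreal (L k \<omega> ^ 4) + ennreal (Z \<omega> ^ 4) \<partial>M)"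
  proof (intro nn_integral_mono)
    fix \<omega>
    have "(x * y)\<^sup>2 \<le> x ^ 4 + y ^ 4" for x y :: real
      using mult_le_square_sum[of "x\<^sup>2" "y\<^sup>2"] by (simp add: power_mult_distrib)
    then have "ennreal ((L k \<omega> * Z \<omega>)\<^sup>2) \<le> ennreal (L k \<omega> ^ 4 + Z \<omega> ^ 4)" by (rule ennreal_leI)
    also have "\<dots> = ennreal (L k \<omega> ^ 4) + ennreal (Z \<omega> ^ 4)" by (rule ennreal_plus) auto
    finally show "ennreal ((L k \<omega> * Z \<omega>)\<^sup>2) \<le> ennreal (L k \<omega> ^ 4) + ennreal (Z \<omega> ^ 4)" .
  qed
  also have "\<dots> = (\<integral>\<^sup>+\<omega>. ennreal (L k \<omega> ^ 4) \<partial>M) + (\<integral>\<^sup>+\<omega>. ennreal (Z \<omega> ^ 4) \<partial>M)" by (rule nn_integral_add) measurable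
  also have "\<dots> \<le> ennreal (exp (6 * C\<^sup>2)) + ennreal K" using L_power4 Z by (rule add_mono)
  finally show ?thesis using K by (simp add: ennreal_plus)
qed

text \<open>All limits are taken along one subsequence on which the exponentials converge almost
  surely. The discretisation error in \<open>simple_payoff_identity\<close> is of order
  \<open>1 / Suc k\<close>, since the squared weights are bounded by \<open>C^2\<close> and there
  are \<open>Suc k\<close> cells of length \<open>1 / Suc k\<close>.\<close>

lemma stoch_exp_payoff:
  shows "integrable M (stoch_exp M B \<eta> 1)" "integrable M (\<lambda>\<omega>. (stoch_exp M B \<eta> 1 \<omega>)\<^sup>2)"
    "(\<integral>\<omega>. stoch_exp M B \<eta> 1 \<omega> \<partial>M) = 1"
    "integrable M (\<lambda>\<omega>. stoch_exp M B \<eta> 1 \<omega> * (B 1 \<omega> - v)\<^sup>2)"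
    "integrable M (\<lambda>\<omega>. stoch_exp M B \<eta> 1 \<omega> * (\<integral>t. (v - B t \<omega>) * \<eta> t \<omega> \<partial>I01))"
    "(\<integral>\<omega>. stoch_exp M B \<eta> 1 \<omega> * (\<integral>t. (v - B t \<omega>) * \<eta> t \<omega> \<partial>I01) \<partial>M)
      = (v\<^sup>2 + 1) / 2 - 1 / 2 * (\<integral>\<omega>. stoch_exp M B \<eta> 1 \<omega> * (B 1 \<omega> - v)\<^sup>2 \<partial>M)"
proof -
  obtain r where r: "strict_mono r" "AE \<omega> in M. (\<lambda>j. I (r j) \<omega>) \<longlonglongrightarrow> ito_integral M B \<eta> 1 \<omega>"
    by (rule ito_subsequence)
  let ?M = "stoch_exp M B \<eta> 1" and ?Y = "\<lambda>\<omega>. \<integral>t. (v - B t \<omega>) * \<eta> t \<omega> \<partial>I01"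
  note lim = L_tendsto[OF r]
  note [measurable] = stoch_exp_measurable payoff_integral_measurable
  have [measurable]: "B 1 \<in> borel_measurable M" by (rule B_measurable) auto
  \<comment> \<open>The second moment of the product with the exponential asks for the fourth power
    of \<open>(B 1 - v)^2\<close>, hence for an eighth moment.\<close>
  have W: "(\<integral>\<^sup>+\<omega>. ennreal (((B 1 \<omega> - v)\<^sup>2) ^ 4) \<partial>M) = ennreal (\<integral>\<omega>. (B 1 \<omega> - v) ^ 8 \<partial>M)"
    using integrable_B_shift_power[of 1 v 8] by (subst nn_integral_eq_integral) (simp_all add: power_mult[symmetric])
  have W0: "0 \<le> (\<integral>\<omega>. (B 1 \<omega> - v) ^ 8 \<partial>M)" by (rule integral_nonneg_AE) simp
  have "(\<integral>\<^sup>+\<omega>. ennreal ((L (r k) \<omega>)\<^sup>2) \<partial>M) \<le> ennreal (exp (6 * C\<^sup>2) + 1)" for k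
    using product_second_moment[of "\<lambda>_. 1" 1 "r k"] by (simp add: emeasure_space_1)
  note M1 = expectation_tendsto[OF _ stoch_exp_measurable lim this, simplified]
  show "integrable M ?M" "integrable M (\<lambda>\<omega>. (?M \<omega>)\<^sup>2)" by (rule M1)+
  have Li: "integrable M (L k)" "(\<integral>\<omega>. L k \<omega> \<partial>M) = 1" for k
  proof -
    show i: "integrable M (L k)" using integrable_simple_exp_mult[OF S, of 1 "\<lambda>_. 1" k] by simp
    have "ennreal (\<integral>\<omega>. L k \<omega> \<partial>M) = 1"
      using nn_integral_simple_exp[OF S, of 1 k] nn_integral_eq_integral[OF i] by simp
    then show "(\<integral>\<omega>. L k \<omega> \<partial>M) = 1" by simp
  qed
  then show "(\<integral>\<omega>. ?M \<omega> \<partial>M) = 1" using M1(4) by (simp add: LIMSEQ_const_iff)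
  have limW: "AE \<omega> in M. (\<lambda>j. L (r j) \<omega> * (B 1 \<omega> - v)\<^sup>2) \<longlonglongrightarrow> ?M \<omega> * (B 1 \<omega> - v)\<^sup>2"
    using lim by eventually_elim (intro tendsto_intros)
  note W1 = expectation_tendsto[OF _ _ limW product_second_moment[OF _ eq_refl[OF W] W0]]
  show "integrable M (\<lambda>\<omega>. ?M \<omega> * (B 1 \<omega> - v)\<^sup>2)" by (rule W1) measurable
  have limY: "AE \<omega> in M. (\<lambda>j. L (r j) \<omega> * Y v (r j) \<omega>) \<longlonglongrightarrow> ?M \<omega> * ?Y \<omega>"
    using lim AE_space
  proof eventually_elim
    case (elim \<omega>)
    have "(\<lambda>j. Y v (r j) \<omega>) \<longlonglongrightarrow> ?Y \<omega>"
      using LIMSEQ_subseq_LIMSEQ[OF Y_tendsto[OF elim(2)] r(1)] by (simp add: comp_def)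
    then show ?case using elim(1) by (intro tendsto_intros)
  qed
  have K0: "0 \<le> C ^ 4 * (8 * (v ^ 4 + 3))" using C0 by simp
  note Y1 = expectation_tendsto[OF _ _ limY product_second_moment[OF _ Y_power4 K0]]
  show "integrable M (\<lambda>\<omega>. ?M \<omega> * ?Y \<omega>)" by (rule Y1) measurable
  let ?R = "\<lambda>k. \<integral>\<omega>. L k \<omega> * (\<Sum>i<Suc k. (\<xi> k i \<omega>)\<^sup>2 * (s k (Suc i) - s k i)\<^sup>2) \<partial>M"
  have id: "(\<integral>\<omega>. L k \<omega> * Y v k \<omega> \<partial>M) + 1 / 2 * (\<integral>\<omega>. L k \<omega> * (B 1 \<omega> - v)\<^sup>2 \<partial>M) = (v\<^sup>2 + 1) / 2 + 1 / 2 * ?R k" for k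
    using simple_payoff_identity[OF S, of k v] unfolding Y_def .
  have R: "?R \<longlonglongrightarrow> 0"
  proof (rule tendsto_sandwich[OF _ _ tendsto_const])
    have b: "0 \<le> (\<Sum>i<Suc k. (\<xi> k i \<omega>)\<^sup>2 * (s k (Suc i) - s k i)\<^sup>2)"
      "(\<Sum>i<Suc k. (\<xi> k i \<omega>)\<^sup>2 * (s k (Suc i) - s k i)\<^sup>2) \<le> C\<^sup>2 / real (Suc k)" if \<omega>: "\<omega> \<in> space M" for k \<omega>
    proof -
      show "0 \<le> (\<Sum>i<Suc k. (\<xi> k i \<omega>)\<^sup>2 * (s k (Suc i) - s k i)\<^sup>2)" by (intro sum_nonneg) auto
      have "(\<Sum>i<Suc k. (\<xi> k i \<omega>)\<^sup>2 * (s k (Suc i) - s k i)\<^sup>2) \<le> (\<Sum>i<Suc k. C\<^sup>2 * (1 / real (Suc k))\<^sup>2)"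
        unfolding s_diff using \<xi>_bound[OF _ \<omega>] abs_le_square_iff[of "\<xi> k _ \<omega>" C] C0
        by (intro sum_mono mult_right_mono) auto
      also have "\<dots> = C\<^sup>2 / real (Suc k)" by (simp only: sum_constant card_lessThan) (simp add: power2_eq_square)
      finally show "(\<Sum>i<Suc k. (\<xi> k i \<omega>)\<^sup>2 * (s k (Suc i) - s k i)\<^sup>2) \<le> C\<^sup>2 / real (Suc k)" .
    qed
    show "eventually (\<lambda>k. 0 \<le> ?R k) sequentially"
      using b by (intro always_eventually allI integral_nonneg_AE AE_I2 mult_nonneg_nonneg) auto
    show "eventually (\<lambda>k. ?R k \<le> C\<^sup>2 / real (Suc k)) sequentially"
    proof (intro always_eventually allI)
      fix k
      have "?R k \<le> (\<integral>\<omega>. L k \<omega> * (C\<^sup>2 / real (Suc k)) \<partial>M)"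
      proof (rule integral_mono_AE')
        show "integrable M (\<lambda>\<omega>. L k \<omega> * (C\<^sup>2 / real (Suc k)))" using Li by simp
        show "AE \<omega> in M. L k \<omega> * (\<Sum>i<Suc k. (\<xi> k i \<omega>)\<^sup>2 * (s k (Suc i) - s k i)\<^sup>2) \<le> L k \<omega> * (C\<^sup>2 / real (Suc k))"
          using b by (intro AE_I2 mult_left_mono) auto
        show "AE \<omega> in M. 0 \<le> L k \<omega> * (C\<^sup>2 / real (Suc k))" by simp
      qed
      then show "?R k \<le> C\<^sup>2 / real (Suc k)" using Li by simp
    qed
    show "(\<lambda>k. C\<^sup>2 / real (Suc k)) \<longlonglongrightarrow> 0" by (rule LIMSEQ_Suc[OF lim_const_over_n])
  qed
  have "(\<lambda>j. (\<integral>\<omega>. L (r j) \<omega> * Y v (r j) \<omega> \<partial>M) + 1 / 2 * (\<integral>\<omega>. L (r j) \<omega> * (B 1 \<omega> - v)\<^sup>2 \<partial>M))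
      \<longlonglongrightarrow> (\<integral>\<omega>. ?M \<omega> * ?Y \<omega> \<partial>M) + 1 / 2 * (\<integral>\<omega>. ?M \<omega> * (B 1 \<omega> - v)\<^sup>2 \<partial>M)"
    by (intro tendsto_intros Y1(4) W1(4)) measurable
  moreover have "(\<lambda>j. (v\<^sup>2 + 1) / 2 + 1 / 2 * ?R (r j)) \<longlonglongrightarrow> (v\<^sup>2 + 1) / 2 + 1 / 2 * 0"
    using LIMSEQ_subseq_LIMSEQ[OF R r(1)] by (intro tendsto_intros) (simp add: comp_def)
  ultimately have "(\<integral>\<omega>. ?M \<omega> * ?Y \<omega> \<partial>M) + 1 / 2 * (\<integral>\<omega>. ?M \<omega> * (B 1 \<omega> - v)\<^sup>2 \<partial>M) = (v\<^sup>2 + 1) / 2 + 1 / 2 * 0"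
    unfolding id by (rule LIMSEQ_unique)
  moreover have "a + 1 / 2 * b = c + 1 / 2 * 0 \<Longrightarrow> a = c - 1 / 2 * b" for a b c :: real by simp
  ultimately show "(\<integral>\<omega>. ?M \<omega> * ?Y \<omega> \<partial>M) = (v\<^sup>2 + 1) / 2 - 1 / 2 * (\<integral>\<omega>. ?M \<omega> * (B 1 \<omega> - v)\<^sup>2 \<partial>M)" by blast
qed

end

section \<open>Payoffs against the price that equals the order flow\<close>

lemma payoff_integrand_eq: "(LINT t:{0..1}|lborel. (v - along B back_price t \<omega>) * \<eta> t \<omega>) = (\<integral>t. (v - B t \<omega>) * \<eta> t \<omega> \<partial>I01)"
  unfolding integral_I01 set_lebesgue_integral_def
  by (intro Bochner_Integration.integral_cong) (auto simp: along_back_price split: split_indicator)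

lemma payoff_back_price:
  assumes adm: "\<eta> \<in> admissible_controls M B"
  shows "payoff M B (along B back_price) v \<eta>
    = (v\<^sup>2 + 1) / 2 - 1 / 2 * (\<integral>\<omega>. stoch_exp M B \<eta> 1 \<omega> * (B 1 \<omega> - v)\<^sup>2 \<partial>M)"
proof -
  obtain C where C: "0 \<le> C" "progressive F \<eta>" "\<And>t \<omega>. t \<in> {0..1} \<Longrightarrow> \<omega> \<in> space M \<Longrightarrow> \<bar>\<eta> t \<omega>\<bar> \<le> C"
    by (rule admissible_controlE[OF adm]) blast
  note [measurable] = progressive_joint_measurable[OF C(2)] progressive_joint_measurable[OF progressive_B] stoch_exp_measurable[OF adm C(1,3)]
  have "payoff M B (along B back_price) v \<eta> = (\<integral>\<omega>. (\<integral>t. (v - B t \<omega>) * \<eta> t \<omega> \<partial>I01) \<partial>density M (\<lambda>\<omega>. ennreal (stoch_exp M B \<eta> 1 \<omega>)))"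
    unfolding payoff_def girsanov_def payoff_integrand_eq ..
  also have "\<dots> = (\<integral>\<omega>. stoch_exp M B \<eta> 1 \<omega> *\<^sub>R (\<integral>t. (v - B t \<omega>) * \<eta> t \<omega> \<partial>I01) \<partial>M)"
    by (rule integral_density) (measurable, simp add: stoch_exp_def)
  finally show ?thesis using stoch_exp_payoff(6)[OF adm C(1,3), of v] by simp
qed

text \<open>Boundedness of the control and the inequality \<open>x * y <= x^2 + y^2\<close> reduce
  integrability under the new measure to second moments, under \<open>M\<close>, of the exponential
  and of \<open>B t - v\<close>.\<close>

lemma payoff_exists_back_price:
  assumes adm: "\<eta> \<in> admissible_controls M B"
  shows "payoff_exists M B (along B back_price) v \<eta>"
proof -
  obtain C where C: "0 \<le> C" "progressive F \<eta>" "\<And>t \<omega>. t \<in> {0..1} \<Longrightarrow> \<omega> \<in> space M \<Longrightarrow> \<bar>\<eta> t \<omega>\<bar> \<le> C"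
    by (rule admissible_controlE[OF adm]) blast
  note [measurable] = progressive_joint_measurable[OF C(2)] progressive_joint_measurable[OF progressive_B] stoch_exp_measurable[OF adm C(1,3)]
  let ?E = "stoch_exp M B \<eta> 1" and ?G = "girsanov M B \<eta>"
  have sG[measurable_cong]: "sets ?G = sets M" by (simp add: girsanov_def)
  interpret P: pair_sigma_finite M I01 by standard
  have f: "(\<lambda>(\<omega>, t). (v - B t \<omega>) * \<eta> t \<omega>) \<in> borel_measurable (M \<Otimes>\<^sub>M I01)" by measurable
  then have fG: "(\<lambda>(\<omega>, t). (v - B t \<omega>) * \<eta> t \<omega>) \<in> borel_measurable (?G \<Otimes>\<^sub>M I01)" by measurable
  have "integrable (?G \<Otimes>\<^sub>M I01) (\<lambda>(\<omega>, t). (v - B t \<omega>) * \<eta> t \<omega>)"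
  proof (rule integrableI_bounded[OF fG])
    have "(\<integral>\<^sup>+z. ennreal (norm (case z of (\<omega>, t) \<Rightarrow> (v - B t \<omega>) * \<eta> t \<omega>)) \<partial>(?G \<Otimes>\<^sub>M I01))
      = (\<integral>\<^sup>+\<omega>. \<integral>\<^sup>+t. ennreal \<bar>(v - B t \<omega>) * \<eta> t \<omega>\<bar> \<partial>I01 \<partial>?G)"
      using fG by (subst I01.nn_integral_fst[symmetric]) (auto simp: case_prod_beta)
    also have "\<dots> = (\<integral>\<^sup>+\<omega>. ennreal (?E \<omega>) * (\<integral>\<^sup>+t. ennreal \<bar>(v - B t \<omega>) * \<eta> t \<omega>\<bar> \<partial>I01) \<partial>M)"
      unfolding girsanov_def by (subst nn_integral_density) auto
    also have "\<dots> = (\<integral>\<^sup>+\<omega>. (\<integral>\<^sup>+t. ennreal (?E \<omega>) * ennreal \<bar>(v - B t \<omega>) * \<eta> t \<omega>\<bar> \<partial>I01) \<partial>M)"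
      by (intro nn_integral_cong nn_integral_cmult[symmetric]) measurable
    also have "\<dots> \<le> (\<integral>\<^sup>+\<omega>. (\<integral>\<^sup>+t. ennreal (C * ((?E \<omega>)\<^sup>2 + (B t \<omega> - v)\<^sup>2)) \<partial>I01) \<partial>M)"
    proof (intro nn_integral_mono)
      fix \<omega> t assume \<omega>: "\<omega> \<in> space M" and t: "t \<in> space I01"
      have e: "0 \<le> ?E \<omega>" by (simp add: stoch_exp_def)
      have "?E \<omega> * \<bar>B t \<omega> - v\<bar> \<le> (?E \<omega>)\<^sup>2 + (B t \<omega> - v)\<^sup>2"
        using mult_le_square_sum[of "?E \<omega>" "B t \<omega> - v"] e by simp
      then have "C * (?E \<omega> * \<bar>B t \<omega> - v\<bar>) \<le> C * ((?E \<omega>)\<^sup>2 + (B t \<omega> - v)\<^sup>2)" using C(1) by (intro mult_left_mono)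
      moreover have "?E \<omega> * \<bar>(v - B t \<omega>) * \<eta> t \<omega>\<bar> \<le> C * (?E \<omega> * \<bar>B t \<omega> - v\<bar>)"
      proof -
        have "\<bar>\<eta> t \<omega>\<bar> * (?E \<omega> * \<bar>B t \<omega> - v\<bar>) \<le> C * (?E \<omega> * \<bar>B t \<omega> - v\<bar>)"
          using C(3)[of t \<omega>] \<omega> t e by (intro mult_right_mono) auto
        then show ?thesis by (simp add: abs_mult abs_minus_commute ac_simps)
      qed
      ultimately show "ennreal (?E \<omega>) * ennreal \<bar>(v - B t \<omega>) * \<eta> t \<omega>\<bar> \<le> ennreal (C * ((?E \<omega>)\<^sup>2 + (B t \<omega> - v)\<^sup>2))"
        by (simp add: ennreal_mult'[OF e, symmetric] ennreal_leI)
    qed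
    also have "\<dots> = (\<integral>\<^sup>+t. (\<integral>\<^sup>+\<omega>. ennreal (C * ((?E \<omega>)\<^sup>2 + (B t \<omega> - v)\<^sup>2)) \<partial>M) \<partial>I01)"
      by (rule P.Fubini'[symmetric]) measurable
    also have "\<dots> \<le> (\<integral>\<^sup>+t. ennreal (C * ((\<integral>\<omega>. (?E \<omega>)\<^sup>2 \<partial>M) + (1 + v\<^sup>2))) \<partial>I01)"
    proof (rule nn_integral_mono)
      fix t assume "t \<in> space I01"
      then have t: "0 \<le> t" "t \<le> 1" by auto
      have e2: "integrable M (\<lambda>\<omega>. (?E \<omega>)\<^sup>2)" by (rule stoch_exp_payoff(2)[OF adm C(1,3)])
      have "(\<integral>\<^sup>+\<omega>. ennreal (C * ((?E \<omega>)\<^sup>2 + (B t \<omega> - v)\<^sup>2)) \<partial>M) = ennreal (\<integral>\<omega>. C * ((?E \<omega>)\<^sup>2 + (B t \<omega> - v)\<^sup>2) \<partial>M)"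
        using e2 integrable_B_shift_power[OF t, of v 2] C(1) by (intro nn_integral_eq_integral) auto
      also have "(\<integral>\<omega>. C * ((?E \<omega>)\<^sup>2 + (B t \<omega> - v)\<^sup>2) \<partial>M) = C * ((\<integral>\<omega>. (?E \<omega>)\<^sup>2 \<partial>M) + (\<integral>\<omega>. (B t \<omega> - v)\<^sup>2 \<partial>M))"
        using e2 integrable_B_shift_power[OF t, of v 2] by simp
      also have "(\<integral>\<omega>. (B t \<omega> - v)\<^sup>2 \<partial>M) = t + v\<^sup>2"
        using integrable_B[OF t] integrable_B_power[OF t, of 2] by (simp add: power2_diff prob_space B_moments[OF t])
      finally show "(\<integral>\<^sup>+\<omega>. ennreal (C * ((?E \<omega>)\<^sup>2 + (B t \<omega> - v)\<^sup>2)) \<partial>M) \<le> ennreal (C * ((\<integral>\<omega>. (?E \<omega>)\<^sup>2 \<partial>M) + (1 + v\<^sup>2)))"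
        using t C(1) by (auto intro!: ennreal_leI mult_left_mono)
    qed
    also have "\<dots> < \<infinity>" using I01.emeasure_space_1 by simp
    finally show "(\<integral>\<^sup>+z. ennreal (norm (case z of (\<omega>, t) \<Rightarrow> (v - B t \<omega>) * \<eta> t \<omega>)) \<partial>(?G \<Otimes>\<^sub>M I01)) < \<infinity>" .
  qed
  moreover have "integrable (?G \<Otimes>\<^sub>M I01) (\<lambda>(\<omega>, t). (v - B t \<omega>) * \<eta> t \<omega>)
     \<longleftrightarrow> integrable (?G \<Otimes>\<^sub>M I01) (\<lambda>(\<omega>, t). (v - along B back_price t \<omega>) * \<eta> t \<omega>)"
    by (rule Bochner_Integration.integrable_cong) (auto simp: space_pair_measure along_back_price)
  ultimately show ?thesis unfolding payoff_exists_def I01_def by simp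
qed

lemma simple_process_square_integral:
  assumes S: "simple_integrand M B n s \<xi>"
  shows "(\<integral>r. (simple_process n s \<xi> r \<omega>)\<^sup>2 \<partial>I01) = (\<Sum>i<n. (\<xi> i \<omega>)\<^sup>2 * (s (Suc i) - s i))"
proof -
  let ?A = "\<lambda>i. {s i<..s (Suc i)}"
  have dis: "?A i \<inter> ?A j = {}" if "i < n" "j < n" "i \<noteq> j" for i j
  proof -
    have "?A i \<inter> ?A j = {}" if "i < j" "j < n" for i j
      using simple_integrand_grid(1)[OF S, of "Suc i" j] that by auto
    then show ?thesis using \<open>i \<noteq> j\<close> that by (metis Int_commute linorder_neqE_nat)
  qed
  have sq: "(simple_process n s \<xi> r \<omega>)\<^sup>2 = (\<Sum>i<n. (\<xi> i \<omega>)\<^sup>2 * indicator (?A i) r)" for r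
  proof (cases "\<exists>i<n. r \<in> ?A i")
    case True
    then obtain i where i: "i < n" "r \<in> ?A i" by auto
    have one: "(\<Sum>j<n. c j * indicator (?A j) r) = c i" for c :: "nat \<Rightarrow> real"
    proof -
      have "(\<Sum>j<n. c j * indicator (?A j) r) = (\<Sum>j<n. if j = i then c i else 0)"
      proof (rule sum.cong)
        fix j assume "j \<in> {..<n}"
        then have "r \<notin> ?A j" if "j \<noteq> i" using dis[of i j] i that by blast
        then show "c j * indicator (?A j) r = (if j = i then c i else 0)" using i by auto
      qed simp
      then show ?thesis using i by simp
    qed
    show ?thesis unfolding simple_process_def one ..
  next
    case False
    then have "(\<Sum>j<n. c j * indicator (?A j) r) = 0" for c :: "nat \<Rightarrow> real" by (intro sum.neutral) auto
    then show ?thesis unfolding simple_process_def by (simp only:) simp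
  qed
  have ind: "integrable I01 (indicator (?A i) :: real \<Rightarrow> real)" for i
  proof (rule integrable_I01_bounded[where C=1])
    show "(indicator (?A i) :: real \<Rightarrow> real) \<in> borel_measurable I01" unfolding I01_def by (intro measurable_restrict_space1) simp
  qed (auto split: split_indicator)
  have "(\<integral>r. (simple_process n s \<xi> r \<omega>)\<^sup>2 \<partial>I01) = (\<Sum>i<n. \<integral>r. (\<xi> i \<omega>)\<^sup>2 * indicator (?A i) r \<partial>I01)"
    unfolding sq by (rule Bochner_Integration.integral_sum) (use ind in simp)
  also have "\<dots> = (\<Sum>i<n. (\<xi> i \<omega>)\<^sup>2 * (s (Suc i) - s i))"
  proof (rule sum.cong)
    fix i assume i: "i \<in> {..<n}"
    have g: "0 \<le> s i" "s i \<le> s (Suc i)" "s (Suc i) \<le> 1" using simple_integrand_grid[OF S] i by auto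
    then have "?A i \<subseteq> {0..1}" by auto
    then have "emeasure I01 (?A i) = ennreal (s (Suc i) - s i)"
      using g unfolding I01_def by (subst emeasure_restrict_space) auto
    then show "(\<integral>r. (\<xi> i \<omega>)\<^sup>2 * indicator (?A i) r \<partial>I01) = (\<xi> i \<omega>)\<^sup>2 * (s (Suc i) - s i)"
      using \<open>?A i \<subseteq> {0..1}\<close> g by (simp add: measure_def Int_absorb2)
  qed simp
  finally show ?thesis .
qed

text \<open>For a control that is already simple the choice behind \<open>stoch_exp\<close> is
  almost surely the explicit exponential, so the law induced by the strategy below can be computed
  without limits.\<close>

lemma stoch_exp_simple:
  assumes \<eta>: "\<eta> \<in> admissible_controls M B" and S: "simple_integrand M B n s \<xi>"
    and eq: "\<And>r \<omega>. r \<in> {0..1} \<Longrightarrow> \<omega> \<in> space M \<Longrightarrow> \<eta> r \<omega> = simple_process n s \<xi> r \<omega>"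
  shows "AE \<omega> in M. stoch_exp M B \<eta> 1 \<omega> = simple_exp n s \<xi> 1 \<omega>"
proof -
  have "AE \<omega> in M. ito_integral M B \<eta> 1 \<omega> = simple_ito B n s \<xi> 1 \<omega>"
    by (rule ito_integral_simple[OF \<eta> S]) (rule eq)
  then show ?thesis using AE_space
  proof eventually_elim
    case (elim \<omega>)
    have "(LINT r:{0..1}|lborel. \<bar>\<eta> r \<omega>\<bar>\<^sup>2) = (\<integral>r. (simple_process n s \<xi> r \<omega>)\<^sup>2 \<partial>I01)"
      unfolding integral_I01[symmetric] using elim(2) by (intro Bochner_Integration.integral_cong) (auto simp: eq)
    also have "\<dots> = (\<Sum>i<n. (\<xi> i \<omega>)\<^sup>2 * (s (Suc i) - s i))" by (rule simple_process_square_integral[OF S])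
    also have "\<dots> = (\<Sum>i<n. (\<xi> i \<omega>)\<^sup>2 * (min (s (Suc i)) 1 - min (s i) 1))"
      by (intro sum.cong) (use simple_integrand_grid(3)[OF S] in \<open>auto simp: min_absorb1\<close>)
    finally show ?case using elim(1) by (simp add: stoch_exp_def simple_exp_def)
  qed
qed

end

section \<open>The truncated bridge on a geometric grid\<close>

locale truncated_bridge = brownian M B for M :: "'a measure" and B +
  fixes q K :: real and n :: nat
  assumes q: "0 < q" "q < 1" and K: "0 < K"
begin

text \<open>For \<open>i < n\<close> cell i has length (1-q) q^(i+1). Times the slope this is 1-q,
  the relative contraction towards v, and it is the time that lowers the posterior variance from q^i
  to q^(i+1). The lengths add up to q (1 - q^n); one idle cell fills the rest until time 1.\<close>

definition grid :: "nat \<Rightarrow> real" where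
  "grid i = (if i \<le> n then q * (1 - q ^ i) else 1)"

definition slope :: "nat \<Rightarrow> real" where
  "slope i = 1 / q ^ Suc i"

text \<open>The rule reads the path alone, never \<open>v\<close>, so that the log-likelihood stays
  quadratic in \<open>v\<close>. The condition \<open>i < n\<close> silences the last cell.\<close>

definition good :: "nat \<Rightarrow> (real \<Rightarrow> real) \<Rightarrow> real" where
  "good i x = (if i < n \<and> (\<forall>j\<le>i. \<bar>x (grid j)\<bar> \<le> K) then 1 else 0)"

definition strategy :: "real \<Rightarrow> real \<Rightarrow> (real \<Rightarrow> real) \<Rightarrow> real" where
  "strategy v t x = (\<Sum>i<Suc n. good i x * slope i * (v - x (grid i)) * indicator {grid i<..grid (Suc i)} t)"

definition G :: "nat \<Rightarrow> 'a \<Rightarrow> real" where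
  "G i \<omega> = good i (\<lambda>s. B s \<omega>)"

definition ctrl :: "real \<Rightarrow> nat \<Rightarrow> 'a \<Rightarrow> real" where
  "ctrl v i \<omega> = G i \<omega> * slope i * (v - B (grid i) \<omega>)"

lemma q_power: "0 < q ^ i" "q ^ i \<le> 1"
  using q by (simp_all add: power_le_one)

lemma grid_0: "grid 0 = 0" and grid_last: "grid (Suc n) = 1"
  by (simp_all add: grid_def)

lemma grid_diff: "i < n \<Longrightarrow> grid (Suc i) - grid i = (1 - q) * q ^ Suc i"
  by (simp add: grid_def algebra_simps)

lemma grid_diff_last: "grid (Suc n) - grid n = (1 - q) + q ^ Suc n"
  by (simp add: grid_def algebra_simps)

lemma grid_mono_step: "i < Suc n \<Longrightarrow> grid i \<le> grid (Suc i)"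
proof -
  assume "i < Suc n"
  then consider "i < n" | "i = n" by linarith
  then show ?thesis
  proof cases
    case 1
    have "0 \<le> (1 - q) * q ^ Suc i" using q by simp
    then show ?thesis using grid_diff[OF 1] by linarith
  next
    case 2
    have "0 \<le> (1 - q) + q ^ Suc n" using q by simp
    then show ?thesis using grid_diff_last 2 by simp
  qed
qed

lemma grid_mono: "i \<le> j \<Longrightarrow> j \<le> Suc n \<Longrightarrow> grid i \<le> grid j"
proof (induct rule: dec_induct)
  case (step k)
  then show ?case using grid_mono_step[of k] by linarith
qed simp

lemma grid_01: "i \<le> Suc n \<Longrightarrow> 0 \<le> grid i" "i \<le> Suc n \<Longrightarrow> grid i \<le> 1"
  using grid_mono[of 0 i] grid_mono[of i "Suc n"] by (simp_all add: grid_0 grid_last)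

lemma slope_pos: "0 < slope i" using q by (simp add: slope_def)

lemma slope_diff: "i < n \<Longrightarrow> slope i * (grid (Suc i) - grid i) = 1 - q"
  using q by (simp add: grid_diff slope_def)

lemma G_01: "0 \<le> G i \<omega>" "G i \<omega> \<le> 1" "G i \<omega> = 0 \<or> G i \<omega> = 1"
  by (simp_all add: G_def good_def)

lemma G_last: "G n \<omega> = 0"
  by (simp add: G_def good_def)

lemma G_antimono: "i \<le> j \<Longrightarrow> G j \<omega> = 1 \<Longrightarrow> G i \<omega> = 1"
  by (auto simp: G_def good_def split: if_splits)

lemma G_bound: "G i \<omega> = 1 \<Longrightarrow> \<bar>B (grid i) \<omega>\<bar> \<le> K"
  by (auto simp: G_def good_def split: if_splits)

lemma B_grid_measurable: "i < Suc n \<Longrightarrow> grid i \<le> t \<Longrightarrow> B (grid i) \<in> borel_measurable (F t)"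
  using grid_01[of i] by (intro measurable_natural_filtration) auto

lemma G_measurable: "i < Suc n \<Longrightarrow> grid i \<le> t \<Longrightarrow> G i \<in> borel_measurable (F t)"
proof -
  assume i: "i < Suc n" "grid i \<le> t"
  have [measurable]: "B (grid j) \<in> borel_measurable (F t)" if "j \<le> i" for j
    using grid_mono[of j i] that i by (intro B_grid_measurable) auto
  have "Measurable.pred (F t) (\<lambda>\<omega>. \<forall>j\<in>{..i}. \<bar>B (grid j) \<omega>\<bar> \<le> K)"
    by (intro pred_intros_finite) (auto simp: )
  then have "Measurable.pred (F t) (\<lambda>\<omega>. i < n \<and> (\<forall>j\<le>i. \<bar>B (grid j) \<omega>\<bar> \<le> K))" by (simp add: Ball_def)
  then show ?thesis unfolding G_def[abs_def] good_def by measurable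
qed

lemma ctrl_bound: "\<bar>ctrl v i \<omega>\<bar> \<le> slope i * (\<bar>v\<bar> + K)"
proof -
  have "\<bar>v - B (grid i) \<omega>\<bar> \<le> \<bar>v\<bar> + K" if "G i \<omega> = 1" using G_bound[OF that] by linarith
  then show ?thesis using G_01(3)[of i \<omega>] slope_pos[of i] K by (auto simp: ctrl_def abs_mult intro!: mult_left_mono)
qed

lemma ctrl_simple_integrand: "simple_integrand M B (Suc n) grid (ctrl v)"
  unfolding simple_integrand_def
proof (intro conjI allI impI exI ballI)
  fix i assume i: "i < Suc n"
  note [measurable] = B_grid_measurable[OF i order_refl] G_measurable[OF i order_refl]
  show "ctrl v i \<in> borel_measurable (F (grid i))" unfolding ctrl_def[abs_def] by measurable
  show "\<bar>ctrl v i \<omega>\<bar> \<le> slope i * (\<bar>v\<bar> + K)" for \<omega> by (rule ctrl_bound)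
qed (use grid_0 grid_last grid_mono_step in auto)

lemma along_strategy:
  assumes "0 \<le> t"
  shows "along B (strategy v) t \<omega> = simple_process (Suc n) grid (ctrl v) t \<omega>"
  unfolding along_def strategy_def simple_process_def
proof (rule sum.cong)
  fix i assume i: "i \<in> {..<Suc n}"
  show "good i (path_upto B t \<omega>) * slope i * (v - path_upto B t \<omega> (grid i)) * indicator {grid i<..grid (Suc i)} t
     = ctrl v i \<omega> * indicator {grid i<..grid (Suc i)} t"
  \<comment> \<open>Beyond \<open>t\<close> the restricted path is \<open>undefined\<close>, but the
    indicator removes every cell that starts at \<open>t\<close> or later.\<close>
  proof (cases "grid i < t")
    case True
    have "path_upto B t \<omega> (grid j) = B (grid j) \<omega>" if "j \<le> i" for j
      using grid_mono[of j i] grid_01[of j] that i True by (simp add: path_upto_def)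
    then show ?thesis by (simp add: ctrl_def G_def good_def)
  qed (simp add: indicator_def)
qed simp

lemma strategy_joint_measurable:
  assumes t: "t \<in> {0..1}"
  shows "(\<lambda>(v, s, \<omega>). along B (strategy v) s \<omega>)
    \<in> borel_measurable (borel \<Otimes>\<^sub>M (restrict_space borel {0..t} \<Otimes>\<^sub>M F t))"
proof -
  let ?N = "borel \<Otimes>\<^sub>M (restrict_space borel {0..t} \<Otimes>\<^sub>M F t)"
  have m: "(\<lambda>z. ctrl (fst z) i (snd (snd z)) * indicator {grid i<..grid (Suc i)} (fst (snd z))) \<in> borel_measurable ?N" if i: "i < Suc n" for i
  proof (cases "grid i \<le> t")
    case True
    note B_grid_measurable[OF i True, measurable] G_measurable[OF i True, measurable]
    have [measurable]: "fst \<in> borel_measurable (restrict_space borel {0..t} \<Otimes>\<^sub>M F t)"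
      by (rule measurable_compose[OF measurable_fst measurable_restrict_space1]) simp
    show ?thesis unfolding ctrl_def by measurable
  next
    \<comment> \<open>A cell that begins after \<open>t\<close> contributes 0 up to time
      \<open>t\<close>; its weight, not yet known at \<open>t\<close>, is never looked at.\<close>
    case False
    have "(\<lambda>z. 0) \<in> borel_measurable ?N" by simp
    then show ?thesis
      by (rule measurable_cong[THEN iffD1, rotated]) (use False in \<open>auto simp: space_pair_measure space_restrict_space\<close>)
  qed
  have "(\<lambda>z. \<Sum>i<Suc n. ctrl (fst z) i (snd (snd z)) * indicator {grid i<..grid (Suc i)} (fst (snd z))) \<in> borel_measurable ?N"
    by (intro borel_measurable_sum m) auto
  then show ?thesis
    by (rule measurable_cong[THEN iffD1, rotated])
      (auto simp: space_pair_measure space_restrict_space along_strategy simple_process_def)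
qed

lemma strategy_admissible: "along B (strategy v) \<in> admissible_controls M B"
  unfolding admissible_controls_def progressive_def
proof (intro CollectI conjI ballI exI)
  fix t :: real assume t: "t \<in> {0..1}"
  have "(\<lambda>z. case (v, z) of (v, s, \<omega>) \<Rightarrow> along B (strategy v) s \<omega>) \<in> borel_measurable (restrict_space borel {0..t} \<Otimes>\<^sub>M F t)"
    by (rule measurable_compose[OF _ strategy_joint_measurable[OF t]]) simp
  then show "(\<lambda>(s, \<omega>). along B (strategy v) s \<omega>) \<in> borel_measurable (restrict_space borel {0..t} \<Otimes>\<^sub>M F t)"
    by simp
  fix \<omega>
  have "\<bar>along B (strategy v) t \<omega>\<bar> = \<bar>\<Sum>i<Suc n. ctrl v i \<omega> * indicator {grid i<..grid (Suc i)} t\<bar>"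
    using t by (subst along_strategy) (simp_all only: simple_process_def atLeastAtMost_iff)
  also have "\<dots> \<le> (\<Sum>i<Suc n. \<bar>ctrl v i \<omega> * indicator {grid i<..grid (Suc i)} t\<bar>)" by (rule sum_abs)
  also have "\<dots> \<le> (\<Sum>i<Suc n. slope i * (\<bar>v\<bar> + K))"
  proof (rule sum_mono)
    fix i
    have "\<bar>ctrl v i \<omega> * indicator {grid i<..grid (Suc i)} t\<bar> \<le> \<bar>ctrl v i \<omega>\<bar>" by (simp add: abs_mult split: split_indicator)
    then show "\<bar>ctrl v i \<omega> * indicator {grid i<..grid (Suc i)} t\<bar> \<le> slope i * (\<bar>v\<bar> + K)" using ctrl_bound order_trans by blast
  qed
  finally show "\<bar>along B (strategy v) t \<omega>\<bar> \<le> (\<Sum>i<Suc n. slope i * (\<bar>v\<bar> + K))" .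
qed

lemma stoch_exp_strategy:
  "AE \<omega> in M. stoch_exp M B (along B (strategy v)) 1 \<omega> = simple_exp (Suc n) grid (ctrl v) 1 \<omega>"
  by (rule stoch_exp_simple[OF strategy_admissible ctrl_simple_integrand]) (simp add: along_strategy)

definition lik :: "real \<Rightarrow> real \<Rightarrow> 'a \<Rightarrow> real" where
  "lik v t = simple_exp (Suc n) grid (ctrl v) t"

lemma girsanov_strategy: "girsanov M B (along B (strategy v)) = density M (\<lambda>\<omega>. ennreal (lik v 1 \<omega>))"
  unfolding girsanov_def
proof (rule density_cong)
  obtain C where C: "0 \<le> C" "progressive F (along B (strategy v))" "\<And>t \<omega>. t \<in> {0..1} \<Longrightarrow> \<omega> \<in> space M \<Longrightarrow> \<bar>along B (strategy v) t \<omega>\<bar> \<le> C"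
    by (rule admissible_controlE[OF strategy_admissible[of v]]) blast
  show "(\<lambda>\<omega>. ennreal (stoch_exp M B (along B (strategy v)) 1 \<omega>)) \<in> borel_measurable M"
    using stoch_exp_measurable[OF strategy_admissible C(1,3)] by simp
  show "(\<lambda>\<omega>. ennreal (lik v 1 \<omega>)) \<in> borel_measurable M"
    using simple_exp_measurable_M[OF ctrl_simple_integrand[of v], of 1] by (simp add: lik_def)
  show "AE \<omega> in M. ennreal (stoch_exp M B (along B (strategy v)) 1 \<omega>) = ennreal (lik v 1 \<omega>)"
    using stoch_exp_strategy[of v]
    by (auto simp: lik_def elim!: eventually_mono)
qed

lemma payoff_strategy:
  "payoff M B (along B back_price) v (along B (strategy v)) = (v\<^sup>2 + 1) / 2 - 1 / 2 * (\<integral>\<omega>. lik v 1 \<omega> * (B 1 \<omega> - v)\<^sup>2 \<partial>M)"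
proof -
  obtain C where C: "0 \<le> C" "progressive F (along B (strategy v))" "\<And>t \<omega>. t \<in> {0..1} \<Longrightarrow> \<omega> \<in> space M \<Longrightarrow> \<bar>along B (strategy v) t \<omega>\<bar> \<le> C"
    by (rule admissible_controlE[OF strategy_admissible[of v]]) blast
  note [measurable] = stoch_exp_measurable[OF strategy_admissible C(1,3)] simple_exp_measurable_M[OF ctrl_simple_integrand[of v], of 1, simplified]
    B_measurable[of 1, simplified]
  have "(\<integral>\<omega>. stoch_exp M B (along B (strategy v)) 1 \<omega> * (B 1 \<omega> - v)\<^sup>2 \<partial>M) = (\<integral>\<omega>. lik v 1 \<omega> * (B 1 \<omega> - v)\<^sup>2 \<partial>M)"
    unfolding lik_def
  proof (rule integral_cong_AE)
    show "AE \<omega> in M. stoch_exp M B (along B (strategy v)) 1 \<omega> * (B 1 \<omega> - v)\<^sup>2 = simple_exp (Suc n) grid (ctrl v) 1 \<omega> * (B 1 \<omega> - v)\<^sup>2"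
      using stoch_exp_strategy[of v]
      by (auto elim!: eventually_mono)
  qed measurable
  then show ?thesis unfolding payoff_back_price[OF strategy_admissible] by simp
qed

end

section \<open>The rational price\<close>

context truncated_bridge begin

definition cell_time :: "nat \<Rightarrow> real \<Rightarrow> real" where
  "cell_time i t = min (grid (Suc i)) t - min (grid i) t"

definition cell_inc :: "nat \<Rightarrow> real \<Rightarrow> 'a \<Rightarrow> real" where
  "cell_inc i t \<omega> = B (min (grid (Suc i)) t) \<omega> - B (min (grid i) t) \<omega>"

text \<open>The Kalman gain. With prior variance q^i, drift (v - b)/a for a = q^(i+1), and elapsed
  time d in the cell, the posterior mean moves by a / (a q + d) times the increment of the order
  flow.\<close>

definition gain :: "nat \<Rightarrow> real \<Rightarrow> real" where
  "gain i t = q ^ Suc i / (q ^ Suc (Suc i) + cell_time i t)"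

definition price :: "real \<Rightarrow> 'a \<Rightarrow> real" where
  "price t \<omega> = (\<Sum>i<Suc n. G i \<omega> * gain i t * cell_inc i t \<omega>)"

lemma cell_time_nonneg: "i < Suc n \<Longrightarrow> 0 \<le> cell_time i t"
  using grid_mono_step[of i] by (auto simp: cell_time_def min_def)

lemma cell_time_le: "i < Suc n \<Longrightarrow> cell_time i t \<le> grid (Suc i) - grid i"
  using grid_mono_step[of i] by (auto simp: cell_time_def min_def)

lemma cell_before:
  assumes "i < Suc n" "t \<le> grid i"
  shows "cell_time i t = 0" "cell_inc i t \<omega> = 0"
proof -
  have "t \<le> grid (Suc i)" using grid_mono_step[of i] assms by simp
  then show "cell_time i t = 0" "cell_inc i t \<omega> = 0" using assms by (simp_all add: cell_time_def cell_inc_def min_absorb2)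
qed

lemma cell_after: "i < Suc n \<Longrightarrow> grid (Suc i) \<le> t \<Longrightarrow> cell_time i t = grid (Suc i) - grid i"
   "i < Suc n \<Longrightarrow> grid (Suc i) \<le> t \<Longrightarrow> cell_inc i t \<omega> = B (grid (Suc i)) \<omega> - B (grid i) \<omega>"
  using grid_mono_step[of i] by (auto simp: cell_time_def cell_inc_def min_def)

text \<open>At the end of the cell d = (1-q) a, so the denominator a q + d is a again: the posterior
  mean has then moved exactly as far as the order flow.\<close>

lemma gain_full: "i < n \<Longrightarrow> grid (Suc i) \<le> t \<Longrightarrow> gain i t = 1"
proof -
  assume i: "i < n" "grid (Suc i) \<le> t"
  have "q ^ Suc (Suc i) + cell_time i t = q ^ Suc i"
    using cell_after(1)[of i t] i grid_diff[OF i(1)] by (simp add: algebra_simps)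
  moreover have "q ^ Suc i \<noteq> 0" using q by simp
  ultimately show ?thesis unfolding gain_def by (metis divide_self)
qed

lemma gain_bounds:
  assumes i: "i < n"
  shows "1 \<le> gain i t" "gain i t \<le> 1 / q"
proof -
  have d: "0 \<le> cell_time i t" "cell_time i t \<le> (1 - q) * q ^ Suc i"
    using cell_time_nonneg[of i t] cell_time_le[of i t] grid_diff[OF i] i by auto
  have p: "0 < q ^ Suc (Suc i)" "0 < q ^ Suc i" by (rule q_power)+
  have "(1 - q) * q ^ Suc i = q ^ Suc i - q ^ Suc (Suc i)" by (simp add: algebra_simps)
  then have le: "q ^ Suc (Suc i) + cell_time i t \<le> q ^ Suc i" using d(2) by linarith
  then show "1 \<le> gain i t" unfolding gain_def using d p by (subst le_divide_eq_1_pos) auto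
  have "q ^ Suc i / (q ^ Suc (Suc i) + cell_time i t) \<le> q ^ Suc i / q ^ Suc (Suc i)"
    using d p by (intro divide_left_mono mult_pos_pos) auto
  then show "gain i t \<le> 1 / q" unfolding gain_def using p q by simp
qed

text \<open>Completing the square: a Gaussian law of \<open>v\<close> stays Gaussian under the likelihood of each cell,
  and as long as the order flow is within the bounds its mean is the order flow itself.\<close>

lemma log_posterior:
  assumes \<omega>: "\<omega> \<in> space M" and k: "k \<le> Suc n"
  shows "\<exists>g>0. \<exists>c. (\<forall>v. v\<^sup>2 / 2 - (\<Sum>i<k. ctrl v i \<omega> * cell_inc i t \<omega> - 1 / 2 * ((ctrl v i \<omega>)\<^sup>2 * cell_time i t))
      = (v - (\<Sum>i<k. G i \<omega> * gain i t * cell_inc i t \<omega>))\<^sup>2 / (2 * g) + c)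
    \<and> (G k \<omega> = 1 \<and> grid k \<le> t \<longrightarrow> g = q ^ k \<and> (\<Sum>i<k. G i \<omega> * gain i t * cell_inc i t \<omega>) = B (grid k) \<omega>)"
  using k
proof (induction k)
  case 0
  show ?case by (rule exI[of _ 1]) (simp add: grid_0 B_0[OF \<omega>])
next
  case (Suc k)
  then have k: "k < Suc n" by simp
  let ?E = "\<lambda>k v. \<Sum>i<k. ctrl v i \<omega> * cell_inc i t \<omega> - 1 / 2 * ((ctrl v i \<omega>)\<^sup>2 * cell_time i t)"
  let ?R = "\<lambda>k. \<Sum>i<k. G i \<omega> * gain i t * cell_inc i t \<omega>"
  obtain g c where g: "0 < g" and eq: "\<And>v. v\<^sup>2 / 2 - ?E k v = (v - ?R k)\<^sup>2 / (2 * g) + c"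
    and gk: "G k \<omega> = 1 \<Longrightarrow> grid k \<le> t \<Longrightarrow> g = q ^ k \<and> ?R k = B (grid k) \<omega>"
    using Suc.IH k by auto
  \<comment> \<open>A stopped cell and a cell not yet begun add nothing to the sums, and for both
    the claim about the next grid point is void: \<open>G (Suc k)\<close> is not 1, or
    \<open>grid (Suc k)\<close> lies beyond \<open>t\<close>. Only an active cell needs a
    computation.\<close>
  consider "G k \<omega> = 0" | "t < grid k" | "G k \<omega> = 1" "grid k \<le> t" using G_01(3)[of k \<omega>] by fastforce
  then show ?case
  proof cases
    case 1
    then have "?E (Suc k) v = ?E k v" "?R (Suc k) = ?R k" for v by (simp_all add: ctrl_def)
    moreover have "G (Suc k) \<omega> \<noteq> 1" using G_antimono[of k "Suc k" \<omega>] 1 by auto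
    ultimately show ?thesis
      by (rule_tac exI[of _ g], rule_tac conjI[OF g], rule_tac exI[of _ c]) (simp only: eq, blast)
  next
    case 2
    then have "?E (Suc k) v = ?E k v" "?R (Suc k) = ?R k" for v using cell_before[OF k, of t] by simp_all
    moreover have "\<not> grid (Suc k) \<le> t" using 2 grid_mono_step[OF k] by linarith
    ultimately show ?thesis
      by (rule_tac exI[of _ g], rule_tac conjI[OF g], rule_tac exI[of _ c]) (simp only: eq, blast)
  next
    case 3
    then have kn: "k < n" using G_last[of \<omega>] k by (cases "k = n") auto
    define b x d a D where "b = B (grid k) \<omega>" and "x = cell_inc k t \<omega>" and "d = cell_time k t"
      and "a = q ^ Suc k" and "D = a * q + d"
    have gR: "g = q ^ k" "?R k = b" using gk 3 by (auto simp: b_def)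
    have a: "0 < a" "a * q = q ^ Suc (Suc k)" "q ^ k = a / q" using q q_power(1)[of "Suc k"] by (auto simp: a_def)
    have d: "0 \<le> d" using cell_time_nonneg[OF k] by (simp add: d_def)
    have D: "0 < D" using a(1) q d unfolding D_def by (intro add_pos_nonneg mult_pos_pos) auto
    have gain: "gain k t = a / D" unfolding gain_def D_def a(2)[symmetric] a_def d_def ..
    have ctrl: "ctrl v k \<omega> = (v - b) / a" for v using 3 by (simp add: ctrl_def slope_def a_def b_def)
    \<comment> \<open>Completing the square in \<open>u = v - b\<close>: the prior variance
      \<open>a / q\<close> becomes \<open>a^2 / D\<close>, and the remaining
      \<open>x^2 / (2 * D)\<close> is free of \<open>v\<close> and joins the constant.\<close>
    have sq: "u\<^sup>2 / (2 * (a / q)) - u / a * x + 1 / 2 * ((u / a)\<^sup>2 * d) = (u - a / D * x)\<^sup>2 / (2 * (a\<^sup>2 / D)) + (- (x\<^sup>2 / (2 * D)))" for u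
    proof -
      have "(u - a / D * x)\<^sup>2 / (2 * (a\<^sup>2 / D)) = u\<^sup>2 * D / (2 * a\<^sup>2) - u * x / a + x\<^sup>2 / (2 * D)"
        using a(1) D by (simp add: field_simps power2_eq_square)
      moreover have "u\<^sup>2 * D / (2 * a\<^sup>2) = u\<^sup>2 / (2 * (a / q)) + 1 / 2 * ((u / a)\<^sup>2 * d)"
        using a(1) q unfolding D_def by (simp add: field_simps power2_eq_square)
      ultimately show ?thesis by simp
    qed
    have RS: "?R (Suc k) = b + a / D * x" using gR 3 gain by (simp add: x_def)
    have new: "v\<^sup>2 / 2 - ?E (Suc k) v = (v - ?R (Suc k))\<^sup>2 / (2 * (a\<^sup>2 / D)) + (c - x\<^sup>2 / (2 * D))" for v
    proof -
      have "v\<^sup>2 / 2 - ?E (Suc k) v = (v\<^sup>2 / 2 - ?E k v) - (v - b) / a * x + 1 / 2 * (((v - b) / a)\<^sup>2 * d)"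
        by (simp add: ctrl x_def[symmetric] d_def[symmetric])
      also have "\<dots> = (v - b)\<^sup>2 / (2 * (a / q)) - (v - b) / a * x + 1 / 2 * (((v - b) / a)\<^sup>2 * d) + c"
        unfolding eq gR a(3) by simp
      also have "\<dots> = (v - b - a / D * x)\<^sup>2 / (2 * (a\<^sup>2 / D)) + (- (x\<^sup>2 / (2 * D))) + c"
        unfolding sq ..
      finally show ?thesis unfolding RS by (simp add: diff_diff_eq)
    qed
    have "a\<^sup>2 / D = q ^ Suc k \<and> ?R (Suc k) = B (grid (Suc k)) \<omega>" if "grid (Suc k) \<le> t"
    proof -
      have g1: "a / D = 1" using gain_full[OF kn that] gain by simp
      then have "a\<^sup>2 / D = q ^ Suc k" by (simp add: power2_eq_square a_def)
      moreover have "x = B (grid (Suc k)) \<omega> - b" using cell_after(2)[OF k that] by (simp add: x_def b_def)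
      ultimately show ?thesis unfolding RS g1 by simp
    qed
    moreover have "0 < a\<^sup>2 / D" using a D by simp
    ultimately show ?thesis using new by blast
  qed
qed

lemma lik_eq: "lik v t \<omega> = exp (\<Sum>i<Suc n. ctrl v i \<omega> * cell_inc i t \<omega> - 1 / 2 * ((ctrl v i \<omega>)\<^sup>2 * cell_time i t))"
  by (simp only: lik_def simple_exp_def simple_ito_def cell_inc_def cell_time_def sum_subtractf sum_distrib_left)

lemma lik_pos [simp]: "0 < lik v t \<omega>" "0 \<le> lik v t \<omega>"
  by (simp_all add: lik_def)

lemma posterior:
  assumes \<omega>: "\<omega> \<in> space M"
  obtains \<sigma> Z where "0 < \<sigma>" "\<And>v. std_normal_density v * lik v t \<omega> = Z * normal_density (price t \<omega>) \<sigma> v"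
proof -
  obtain g c where g: "0 < g" and eq: "\<And>v. v\<^sup>2 / 2 - (\<Sum>i<Suc n. ctrl v i \<omega> * cell_inc i t \<omega> - 1 / 2 * ((ctrl v i \<omega>)\<^sup>2 * cell_time i t))
      = (v - price t \<omega>)\<^sup>2 / (2 * g) + c"
    using log_posterior[OF \<omega> order_refl, of t] unfolding price_def by auto
  show thesis
  \<comment> \<open>A normal density of variance \<open>g\<close> carries the factor
    \<open>1 / sqrt g\<close>, which the exponential lacks; hence \<open>sqrt g\<close> in the
    normalising constant.\<close>
  proof (rule that[of "sqrt g" "exp (- c) * sqrt g"])
    fix v
    let ?E = "\<Sum>i<Suc n. ctrl v i \<omega> * cell_inc i t \<omega> - 1 / 2 * ((ctrl v i \<omega>)\<^sup>2 * cell_time i t)"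
    have "- v\<^sup>2 / 2 + ?E = - (v - price t \<omega>)\<^sup>2 / (2 * g) + - c" using eq[of v] by simp
    then have "exp (- v\<^sup>2 / 2) * exp ?E = exp (- (v - price t \<omega>)\<^sup>2 / (2 * g)) * exp (- c)" by (simp only: exp_add[symmetric])
    then show "std_normal_density v * lik v t \<omega> = exp (- c) * sqrt g * normal_density (price t \<omega>) (sqrt g) v"
      using g unfolding lik_eq by (simp add: normal_density_def real_sqrt_mult field_simps)
  qed (use g in simp)
qed

text \<open>Bayes' formula with the denominator multiplied out, the form in which it is later
  integrated over the paths.\<close>

lemma posterior_mean:
  assumes \<omega>: "\<omega> \<in> space M" and m: "(\<lambda>v. lik v t \<omega>) \<in> borel_measurable borel"
  shows "integrable gaussian (\<lambda>v. lik v t \<omega>)" "integrable gaussian (\<lambda>v. v * lik v t \<omega>)"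
    "(\<integral>v. v * lik v t \<omega> \<partial>gaussian) = price t \<omega> * (\<integral>v. lik v t \<omega> \<partial>gaussian)"
proof -
  note [measurable] = m
  obtain \<sigma> Z where \<sigma>: "0 < \<sigma>" and eq: "\<And>v. std_normal_density v * lik v t \<omega> = Z * normal_density (price t \<omega>) \<sigma> v"
    by (rule posterior[OF \<omega>, of t]) blast
  have eq': "std_normal_density v * (v * lik v t \<omega>) = Z * (normal_density (price t \<omega>) \<sigma> v * v)" for v
    using eq[of v] by (simp add: ac_simps)
  show "integrable gaussian (\<lambda>v. lik v t \<omega>)"
    using \<sigma> by (subst integrable_gaussian_iff) (simp_all add: eq)
  show "integrable gaussian (\<lambda>v. v * lik v t \<omega>)"
    using integrable_normal_moment_nz_1[OF \<sigma>] by (subst integrable_gaussian_iff) (simp_all add: eq')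
  show "(\<integral>v. v * lik v t \<omega> \<partial>gaussian) = price t \<omega> * (\<integral>v. lik v t \<omega> \<partial>gaussian)"
    using \<sigma> by (simp add: integral_gaussian_eq eq eq' integral_normal_moment_nz_1)
qed

lemma term_measurable:
  assumes i: "i < Suc n" and t: "t \<le> 1"
  shows "(\<lambda>(v, \<omega>). ctrl v i \<omega> * cell_inc i t \<omega> - 1 / 2 * ((ctrl v i \<omega>)\<^sup>2 * cell_time i t)) \<in> borel_measurable (borel \<Otimes>\<^sub>M F t)"
    and "(\<lambda>\<omega>. G i \<omega> * gain i t * cell_inc i t \<omega>) \<in> borel_measurable (F t)"
proof -
  have "(\<lambda>(v, \<omega>). ctrl v i \<omega> * cell_inc i t \<omega> - 1 / 2 * ((ctrl v i \<omega>)\<^sup>2 * cell_time i t)) \<in> borel_measurable (borel \<Otimes>\<^sub>M F t)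
    \<and> (\<lambda>\<omega>. G i \<omega> * gain i t * cell_inc i t \<omega>) \<in> borel_measurable (F t)"
  proof (cases "grid i \<le> t")
    case True
    note [measurable] = B_grid_measurable[OF i True] G_measurable[OF i True]
    have "0 \<le> grid i" "grid i \<le> grid (Suc i)" using grid_01[of i] grid_mono_step[of i] i by auto
    then have [measurable]: "B (min (grid (Suc i)) t) \<in> borel_measurable (F t)" "B (min (grid i) t) \<in> borel_measurable (F t)"
      using True by (auto intro!: measurable_natural_filtration)
    show ?thesis unfolding ctrl_def cell_inc_def by measurable
  next
    case False
    then show ?thesis using cell_before[OF i, of t] by simp
  qed
  then show "(\<lambda>(v, \<omega>). ctrl v i \<omega> * cell_inc i t \<omega> - 1 / 2 * ((ctrl v i \<omega>)\<^sup>2 * cell_time i t)) \<in> borel_measurable (borel \<Otimes>\<^sub>M F t)"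
    and "(\<lambda>\<omega>. G i \<omega> * gain i t * cell_inc i t \<omega>) \<in> borel_measurable (F t)" by auto
qed

lemma lik_joint_measurable:
  assumes "t \<le> 1"
  shows "(\<lambda>(v, \<omega>). lik v t \<omega>) \<in> borel_measurable (borel \<Otimes>\<^sub>M F t)"
proof -
  have "(\<lambda>z. \<Sum>i<Suc n. case z of (v, \<omega>) \<Rightarrow> ctrl v i \<omega> * cell_inc i t \<omega> - 1 / 2 * ((ctrl v i \<omega>)\<^sup>2 * cell_time i t)) \<in> borel_measurable (borel \<Otimes>\<^sub>M F t)"
    using term_measurable(1) assms by (intro borel_measurable_sum) auto
  then show ?thesis unfolding lik_eq case_prod_beta by measurable
qed

lemma pair_ident_measurable:
  "t \<le> 1 \<Longrightarrow> (\<lambda>z. z) \<in> measurable (gaussian \<Otimes>\<^sub>M M) (borel \<Otimes>\<^sub>M F t)"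
proof -
  assume t: "t \<le> 1"
  have "(\<lambda>z. (fst z, snd z)) \<in> measurable (gaussian \<Otimes>\<^sub>M M) (borel \<Otimes>\<^sub>M F t)"
    using measurable_fst[of gaussian M] measurable_compose[OF measurable_snd ident_measurable_F[OF t], of gaussian]
    by (intro measurable_Pair) (auto cong: measurable_cong_sets)
  then show ?thesis by simp
qed

lemma lik_pair_measurable [measurable]:
  assumes "t \<le> 1"
  shows "(\<lambda>(v, \<omega>). lik v t \<omega>) \<in> borel_measurable (gaussian \<Otimes>\<^sub>M M)"
  using measurable_compose[OF pair_ident_measurable[OF assms] lik_joint_measurable[OF assms]] by simp

lemma price_measurable: "t \<le> 1 \<Longrightarrow> price t \<in> borel_measurable (F t)"
  unfolding price_def[abs_def] by (intro borel_measurable_sum term_measurable(2)) auto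

lemma price_progressive: "progressive F price"
  unfolding progressive_def
proof
  fix t :: real assume t: "t \<in> {0..1}"
  let ?N = "restrict_space borel {0..t} \<Otimes>\<^sub>M F t"
  have BP: "(\<lambda>(s, \<omega>). B s \<omega>) \<in> borel_measurable ?N" using progressive_B t by (auto simp: progressive_def)
  have fst[measurable]: "fst \<in> borel_measurable ?N"
    by (rule measurable_compose[OF measurable_fst measurable_restrict_space1]) simp
  have Bmin: "(\<lambda>z. B (min a (fst z)) (snd z)) \<in> borel_measurable ?N" if "0 \<le> a" for a
  proof -
    have "(\<lambda>z. (min a (fst z), snd z)) \<in> measurable ?N ?N"
    proof (rule measurable_Pair)
      show "(\<lambda>z. min a (fst z)) \<in> measurable ?N (restrict_space borel {0..t})"
        using that by (intro measurable_restrict_space2) (auto simp: space_pair_measure space_restrict_space)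
    qed measurable
    from measurable_compose[OF this BP] show ?thesis by simp
  qed
  have m: "(\<lambda>z. G i (snd z) * gain i (fst z) * cell_inc i (fst z) (snd z)) \<in> borel_measurable ?N" if i: "i < Suc n" for i
  proof (cases "grid i \<le> t")
    case True
    note [measurable] = G_measurable[OF i True]
    have "0 \<le> grid i" "0 \<le> grid (Suc i)" using grid_01[of i] grid_01[of "Suc i"] i by auto
    note [measurable] = Bmin[OF this(1)] Bmin[OF this(2)]
    show ?thesis unfolding gain_def cell_time_def cell_inc_def by measurable
  next
    case False
    have "(\<lambda>z. 0) \<in> borel_measurable ?N" by simp
    then show ?thesis
      by (rule measurable_cong[THEN iffD1, rotated])
        (use False cell_before[OF i] in \<open>auto simp: space_pair_measure space_restrict_space\<close>)
  qed
  then have "(\<lambda>z. \<Sum>i<Suc n. G i (snd z) * gain i (fst z) * cell_inc i (fst z) (snd z)) \<in> borel_measurable ?N"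
    by (intro borel_measurable_sum) auto
  then show "(\<lambda>(s, \<omega>). price s \<omega>) \<in> borel_measurable ?N" by (simp add: price_def case_prod_beta)
qed

section \<open>Distance between the order flow and the rational price without drift\<close>

lemma price_residual:
  assumes \<omega>: "\<omega> \<in> space M" and t: "0 \<le> t" "t \<le> 1"
  shows "B t \<omega> - price t \<omega> = (\<Sum>i<Suc n. (1 - G i \<omega> * gain i t) * cell_inc i t \<omega>)"
proof -
  have "(\<Sum>i<Suc n. cell_inc i t \<omega>) = B (min (grid (Suc n)) t) \<omega> - B (min (grid 0) t) \<omega>"
    unfolding cell_inc_def by (rule sum_lessThan_telescope)
  also have "\<dots> = B t \<omega>" using t by (simp add: grid_0 grid_last B_0[OF \<omega>])
  finally show ?thesis by (simp only: price_def left_diff_distrib sum_subtractf mult_1)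
qed

text \<open>For fixed \<open>t\<close> the gains are numbers, so the difference is a simple
  stochastic integral and the isometry applies. The squared weight is at most
  \<open>((1 - q) / q)^2\<close> on active cells and at most 1 on stopped ones, where some squared
  grid value exceeds \<open>K^2\<close>; the idle last cell contributes at most its length.\<close>

lemma price_distance:
  assumes t: "0 \<le> t" "t \<le> 1"
  shows "(\<integral>\<^sup>+\<omega>. ennreal ((B t \<omega> - price t \<omega>)\<^sup>2) \<partial>M) \<le> ennreal (((1 - q) / q)\<^sup>2 + real n / K\<^sup>2 + (1 - grid n))"
proof -
  \<comment> \<open>For a cell that begins after \<open>t\<close> both ends are cut down to
    \<open>t\<close>, a time at which \<open>G i\<close> is not yet known. The value 0 keeps the
    weight adapted, and the increment vanishes anyway.\<close>
  define X where "X i \<omega> = (if grid i \<le> t then 1 - G i \<omega> * gain i t else 0)" for i \<omega>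
  let ?a = "\<lambda>i. min (grid i) t" and ?b = "\<lambda>i. min (grid (Suc i)) t"
  let ?d = "((1 - q) / q)\<^sup>2"
  have "(\<integral>\<^sup>+\<omega>. ennreal ((B t \<omega> - price t \<omega>)\<^sup>2) \<partial>M)
     = (\<integral>\<^sup>+\<omega>. ennreal ((\<Sum>i\<in>{..<Suc n}. X i \<omega> * (B (?b i) \<omega> - B (?a i) \<omega>))\<^sup>2) \<partial>M)"
  proof (rule nn_integral_cong)
    fix \<omega> assume \<omega>: "\<omega> \<in> space M"
    have "(\<Sum>i<Suc n. (1 - G i \<omega> * gain i t) * cell_inc i t \<omega>) = (\<Sum>i<Suc n. X i \<omega> * (B (?b i) \<omega> - B (?a i) \<omega>))"
      by (rule sum.cong) (auto simp: X_def cell_before cell_inc_def[symmetric])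
    then show "ennreal ((B t \<omega> - price t \<omega>)\<^sup>2) = ennreal ((\<Sum>i\<in>{..<Suc n}. X i \<omega> * (B (?b i) \<omega> - B (?a i) \<omega>))\<^sup>2)"
      by (simp only: price_residual[OF \<omega> t])
  qed
  also have "\<dots> = (\<integral>\<^sup>+\<omega>. (\<integral>\<^sup>+r\<in>{0..1}. ennreal ((\<Sum>i\<in>{..<Suc n}. X i \<omega> * indicator {?a i<..?b i} r)\<^sup>2) \<partial>lborel) \<partial>M)"
  proof (rule ito_isometry_family)
    fix i assume i: "i \<in> {..<Suc n}"
    show "0 \<le> ?a i \<and> ?a i \<le> ?b i \<and> ?b i \<le> 1"
      using grid_01[of i] grid_01[of "Suc i"] grid_mono_step[of i] i t by (auto simp: min_def)
    show "X i \<in> borel_measurable (F (?a i))"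
    proof (cases "grid i \<le> t")
      case True
      then have [measurable]: "G i \<in> borel_measurable (F (?a i))" using i by (intro G_measurable) auto
      show ?thesis unfolding X_def[abs_def] if_P[OF True] by measurable
    qed (simp add: X_def[abs_def])
    show "\<exists>C. \<forall>\<omega>\<in>space M. \<bar>X i \<omega>\<bar> \<le> C"
    proof (intro exI ballI)
      fix \<omega>
      show "\<bar>X i \<omega>\<bar> \<le> 1 + \<bar>gain i t\<bar>" using G_01(3)[of i \<omega>] by (auto simp: X_def)
    qed
  qed simp
  also have "\<dots> \<le> (\<integral>\<^sup>+\<omega>. (\<integral>\<^sup>+r. ennreal (?d + (\<Sum>j<n. (B (grid j) \<omega>)\<^sup>2) / K\<^sup>2) + ennreal (indicator {grid n<..1} r) \<partial>I01) \<partial>M)"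
    unfolding nn_integral_I01[symmetric]
  proof (intro nn_integral_mono)
    fix \<omega> r
    let ?e = "?d + (\<Sum>j<n. (B (grid j) \<omega>)\<^sup>2) / K\<^sup>2"
    have e0: "0 \<le> ?e" by (intro add_nonneg_nonneg divide_nonneg_nonneg sum_nonneg) auto
    have "(\<Sum>i<Suc n. X i \<omega> * indicator {?a i<..?b i} r)\<^sup>2 \<le> ?e + indicator {grid n<..1} r"
    proof (cases "\<exists>i<Suc n. r \<in> {?a i<..?b i}")
      case False
      then have "(\<Sum>i<Suc n. X i \<omega> * indicator {?a i<..?b i} r) = 0" by (intro sum.neutral) auto
      then show ?thesis using e0 by (simp only:) simp
    next
      case True
      then obtain i where i: "i < Suc n" "r \<in> {?a i<..?b i}" by auto
      have "(\<Sum>j<Suc n. X j \<omega> * indicator {?a j<..?b j} r) = (\<Sum>j<Suc n. if j = i then X i \<omega> else 0)"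
      proof (rule sum.cong)
        fix j assume j: "j \<in> {..<Suc n}"
        have "r \<notin> {?a j<..?b j}" if "j \<noteq> i"
        proof -
          consider "j < i" | "i < j" using \<open>j \<noteq> i\<close> by linarith
          then show ?thesis
          proof cases
            case 1
            then have "grid (Suc j) \<le> grid i" using i by (intro grid_mono) auto
            then show ?thesis using i by auto
          next
            case 2
            then have "grid (Suc i) \<le> grid j" using j by (intro grid_mono) auto
            then show ?thesis using i by auto
          qed
        qed
        then show "X j \<omega> * indicator {?a j<..?b j} r = (if j = i then X i \<omega> else 0)" using i by auto
      qed simp
      then have S: "(\<Sum>j<Suc n. X j \<omega> * indicator {?a j<..?b j} r) = X i \<omega>" using i by simp
      show ?thesis
      proof (cases "i = n")
        case True
        have "X i \<omega> = 0 \<or> X i \<omega> = 1" using True by (simp add: X_def G_last)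
        then have "(X i \<omega>)\<^sup>2 \<le> 1" by auto
        moreover have "r \<in> {grid n<..1}"
        proof -
          have "grid n < t" using i True by (auto simp: min_def split: if_splits)
          then show ?thesis using i True t by (auto simp: min_def grid_last split: if_splits)
        qed
        ultimately show ?thesis unfolding S using e0 by simp
      next
        case False
        then have i_n: "i < n" using i by simp
        have "(X i \<omega>)\<^sup>2 \<le> ?e"
        proof (cases "G i \<omega> = 1")
          case True
          have "\<bar>1 - gain i t\<bar> \<le> (1 - q) / q"
            using gain_bounds[OF i_n, of t] q by (simp add: abs_if diff_divide_distrib)
          then have "(X i \<omega>)\<^sup>2 \<le> ?d" using q by (auto simp: X_def True abs_le_square_iff[symmetric])
          moreover have "0 \<le> (\<Sum>j<n. (B (grid j) \<omega>)\<^sup>2) / K\<^sup>2" by (intro divide_nonneg_nonneg sum_nonneg) auto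
          ultimately show ?thesis by linarith
        next
          case False
          \<comment> \<open>Chebyshev's inequality before taking means: on a stopped cell the sum of
            all squared grid values divided by \<open>K^2\<close> is at least 1 and so bounds the
            squared weight. Its mean is at most \<open>real n / K^2\<close>.\<close>
          then obtain j where j: "j \<le> i" "K < \<bar>B (grid j) \<omega>\<bar>" using i_n by (auto simp: G_def good_def split: if_splits)
          have "K\<^sup>2 \<le> (B (grid j) \<omega>)\<^sup>2" using j(2) K by (simp add: abs_le_square_iff[symmetric])
          also have "\<dots> \<le> (\<Sum>j<n. (B (grid j) \<omega>)\<^sup>2)" using j i_n by (intro member_le_sum) auto
          finally have "1 \<le> (\<Sum>j<n. (B (grid j) \<omega>)\<^sup>2) / K\<^sup>2" using K by simp
          moreover have "(X i \<omega>)\<^sup>2 \<le> 1" using False G_01(3)[of i \<omega>] by (auto simp: X_def)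
          moreover have "0 \<le> ?d" by simp
          ultimately show ?thesis by linarith
        qed
        then show ?thesis unfolding S by (auto split: split_indicator)
      qed
    qed
    then have "ennreal ((\<Sum>i<Suc n. X i \<omega> * indicator {?a i<..?b i} r)\<^sup>2) \<le> ennreal (?e + indicator {grid n<..1} r)" by (rule ennreal_leI)
    also have "\<dots> = ennreal ?e + ennreal (indicator {grid n<..1} r)" by (rule ennreal_plus[OF e0]) simp
    finally show "ennreal ((\<Sum>i<Suc n. X i \<omega> * indicator {?a i<..?b i} r)\<^sup>2) \<le> ennreal ?e + ennreal (indicator {grid n<..1} r)" .
  qed
  also have "\<dots> = (\<integral>\<^sup>+\<omega>. ennreal (?d + (\<Sum>j<n. (B (grid j) \<omega>)\<^sup>2) / K\<^sup>2) + ennreal (1 - grid n) \<partial>M)"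
  proof (rule nn_integral_cong)
    fix \<omega>
    have "(indicator {grid n<..1} :: real \<Rightarrow> real) \<in> borel_measurable I01" unfolding I01_def by (intro measurable_restrict_space1) simp
    note [measurable] = this
    have "(\<integral>\<^sup>+r. ennreal (indicator {grid n<..1} r) \<partial>I01) = (\<integral>\<^sup>+r. indicator {grid n<..1} r \<partial>lborel)"
      unfolding nn_integral_I01 using grid_01[of n] by (intro nn_integral_cong) (auto split: split_indicator)
    also have "\<dots> = ennreal (1 - grid n)" using grid_01[of n] by simp
    finally show "(\<integral>\<^sup>+r. ennreal (?d + (\<Sum>j<n. (B (grid j) \<omega>)\<^sup>2) / K\<^sup>2) + ennreal (indicator {grid n<..1} r) \<partial>I01)
       = ennreal (?d + (\<Sum>j<n. (B (grid j) \<omega>)\<^sup>2) / K\<^sup>2) + ennreal (1 - grid n)"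
      using I01.emeasure_space_1 by (simp add: nn_integral_add)
  qed
  also have "\<dots> = ennreal (\<integral>\<omega>. ?d + (\<Sum>j<n. (B (grid j) \<omega>)\<^sup>2) / K\<^sup>2 + (1 - grid n) \<partial>M)"
  proof -
    have "integrable M (\<lambda>\<omega>. (B (grid j) \<omega>)\<^sup>2)" if "j < n" for j
      using grid_01[of j] that by (intro integrable_B_power) auto
    then have "integrable M (\<lambda>\<omega>. \<Sum>j<n. (B (grid j) \<omega>)\<^sup>2)" by (intro Bochner_Integration.integrable_sum) auto
    then have "integrable M (\<lambda>\<omega>. ?d + (\<Sum>j<n. (B (grid j) \<omega>)\<^sup>2) / K\<^sup>2 + (1 - grid n))" by simp
    moreover have "0 \<le> ?d + (\<Sum>j<n. (B (grid j) \<omega>)\<^sup>2) / K\<^sup>2" "0 \<le> 1 - grid n" for \<omega>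
      using grid_01[of n] by (auto intro!: add_nonneg_nonneg divide_nonneg_nonneg sum_nonneg)
    ultimately show ?thesis by (subst nn_integral_eq_integral[symmetric]) (auto simp: ennreal_plus simp del: ennreal_plus[symmetric])
  qed
  also have "\<dots> \<le> ennreal (?d + real n / K\<^sup>2 + (1 - grid n))"
  proof (rule ennreal_leI)
    have g: "0 \<le> grid j" "grid j \<le> 1" if "j < n" for j using grid_01[of j] that by auto
    have i: "integrable M (\<lambda>\<omega>. (B (grid j) \<omega>)\<^sup>2)" if "j < n" for j
      using g[OF that] by (intro integrable_B_power)
    have "(\<integral>\<omega>. ?d + (\<Sum>j<n. (B (grid j) \<omega>)\<^sup>2) / K\<^sup>2 + (1 - grid n) \<partial>M) = ?d + (\<Sum>j<n. grid j) / K\<^sup>2 + (1 - grid n)"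
    proof -
      have "integrable M (\<lambda>\<omega>. \<Sum>j<n. (B (grid j) \<omega>)\<^sup>2)" using i by (intro Bochner_Integration.integrable_sum) auto
      moreover have "(\<integral>\<omega>. (\<Sum>j<n. (B (grid j) \<omega>)\<^sup>2) \<partial>M) = (\<Sum>j<n. grid j)"
        using i g by (subst Bochner_Integration.integral_sum) (auto simp: B_moments(2))
      ultimately show ?thesis by (simp add: prob_space)
    qed
    also have "(\<Sum>j<n. grid j) \<le> (\<Sum>j<n. 1)" using g by (intro sum_mono) auto
    finally show "(\<integral>\<omega>. ?d + (\<Sum>j<n. (B (grid j) \<omega>)\<^sup>2) / K\<^sup>2 + (1 - grid n) \<partial>M) \<le> ?d + real n / K\<^sup>2 + (1 - grid n)"
      by (simp add: divide_right_mono)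
  qed
  finally show ?thesis .
qed

end

text \<open>The density is positive everywhere, so a Gaussian null set is a Lebesgue null set, and a
  nonempty open set is not one. Conditions on the support of \<open>V\<close> thus range over the
  whole line.\<close>

lemma measure_support_gaussian: "measure_support gaussian = UNIV"
proof -
  have "0 < emeasure gaussian U" if U': "open U" "x \<in> U" for x and U :: "real set"
  proof (rule ccontr)
    assume "\<not> 0 < emeasure gaussian U"
    then have "emeasure gaussian U = 0" by simp
    moreover have U: "U \<in> sets borel" using that by simp
    ultimately have "(\<integral>\<^sup>+x. ennreal (std_normal_density x) * indicator U x \<partial>lborel) = 0"
      by (simp add: gaussian_def emeasure_density)
    then have "AE x in lborel. ennreal (std_normal_density x) * indicator U x = 0"
      using U by (subst (asm) nn_integral_0_iff_AE) auto
    then have "AE x in lborel. x \<notin> U"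
    proof eventually_elim
      case (elim x)
      have "0 < std_normal_density x" by (rule normal_density_pos) simp
      then show ?case using elim by (cases "x \<in> U") simp_all
    qed
    then have "emeasure lborel U = 0" using U by (subst (asm) AE_iff_measurable[OF _ refl]) auto
    moreover obtain e where e: "0 < e" "ball x e \<subseteq> U" by (rule openE[OF U'])
    then have "emeasure lborel {x - e<..<x + e} \<le> emeasure lborel U"
      using U by (intro emeasure_mono) (auto simp: ball_eq_greaterThanLessThan)
    ultimately show False using e(1) by simp
  qed
  then show ?thesis by (auto simp: measure_support_def)
qed

section \<open>The joint law of value and order flow, and the conditional mean of the value\<close>

context truncated_bridge begin

text \<open>The joint law of value and order flow under the strategy, written as a density on a
  product so that Fubini applies.\<close>

definition J :: "(real \<times> 'a) measure" where
  "J = density (gaussian \<Otimes>\<^sub>M M) (\<lambda>(v, \<omega>). ennreal (lik v 1 \<omega>))"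

lemma sets_J [simp, measurable_cong]: "sets J = sets (gaussian \<Otimes>\<^sub>M M)"
  and space_J [simp]: "space J = UNIV \<times> space M"
  by (simp_all add: J_def space_pair_measure)

lemma gaussian_M_pair: "pair_sigma_finite gaussian M" by standard

interpretation GM: pair_sigma_finite gaussian M by (rule gaussian_M_pair)

lemma lik_section_measurable: "t \<le> 1 \<Longrightarrow> lik v t \<in> borel_measurable (F t)"
  using measurable_compose[OF measurable_Pair1' lik_joint_measurable, of v t] by simp

lemma lik_section_measurable_M: "t \<le> 1 \<Longrightarrow> lik v t \<in> borel_measurable M"
  by (rule F_measurable_M[OF lik_section_measurable])

lemma nn_integral_lik: "0 \<le> t \<Longrightarrow> t \<le> 1 \<Longrightarrow> (\<integral>\<^sup>+\<omega>. ennreal (lik v t \<omega>) \<partial>M) = 1"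
  unfolding lik_def by (rule nn_integral_simple_exp[OF ctrl_simple_integrand])

lemma lik_martingale:
  "0 \<le> t \<Longrightarrow> t \<le> 1 \<Longrightarrow> Y \<in> borel_measurable (F t) \<Longrightarrow>
    (\<integral>\<^sup>+\<omega>. ennreal (lik v 1 \<omega>) * Y \<omega> \<partial>M) = (\<integral>\<^sup>+\<omega>. ennreal (lik v t \<omega>) * Y \<omega> \<partial>M)"
  unfolding lik_def by (rule simple_exp_martingale[OF ctrl_simple_integrand])

text \<open>Joint measurability of the likelihood in the value and the path makes the laws for the
  single values a kernel, and their Gaussian mixture a density with respect to the product.\<close>

lemma joint_law_eq: "joint_law M B gaussian strategy = J"
proof -
  let ?N = "borel \<Otimes>\<^sub>M M :: (real \<times> 'a) measure"
  let ?\<kappa> = "\<lambda>v. distr (density M (\<lambda>\<omega>. ennreal (lik v 1 \<omega>))) ?N (\<lambda>\<omega>. (v, \<omega>))"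
  have L1[measurable]: "(\<lambda>(v, \<omega>). lik v 1 \<omega>) \<in> borel_measurable (gaussian \<Otimes>\<^sub>M M)" by (rule lik_pair_measurable) simp
  have L2[measurable]: "lik v 1 \<in> borel_measurable M" for v by (rule lik_section_measurable_M) simp
  have sN: "sets ?N = sets (gaussian \<Otimes>\<^sub>M M)" by (intro sets_pair_measure_cong) simp_all
  have em: "emeasure (?\<kappa> v) A = (\<integral>\<^sup>+\<omega>. ennreal (lik v 1 \<omega>) * indicator A (v, \<omega>) \<partial>M)" if A: "A \<in> sets ?N" for v A
  proof -
    have "emeasure (?\<kappa> v) A = (\<integral>\<^sup>+z. indicator A z \<partial>?\<kappa> v)" by (rule nn_integral_indicator[symmetric]) (use A in simp)
    also have "\<dots> = (\<integral>\<^sup>+\<omega>. indicator A (v, \<omega>) \<partial>density M (\<lambda>\<omega>. ennreal (lik v 1 \<omega>)))"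
    proof (rule nn_integral_distr)
      show "(\<lambda>\<omega>. (v, \<omega>)) \<in> measurable (density M (\<lambda>\<omega>. ennreal (lik v 1 \<omega>))) ?N"
        using measurable_Pair1'[of v borel M] by simp
      show "indicator A \<in> borel_measurable (distr (density M (\<lambda>\<omega>. ennreal (lik v 1 \<omega>))) ?N (\<lambda>\<omega>. (v, \<omega>)))"
        using A by (intro borel_measurable_indicator) simp
    qed
    also have "\<dots> = (\<integral>\<^sup>+\<omega>. ennreal (lik v 1 \<omega>) * indicator A (v, \<omega>) \<partial>M)"
    proof (rule nn_integral_density)
      show "(\<lambda>\<omega>. indicator A (v, \<omega>) :: ennreal) \<in> borel_measurable M"
        using A by (intro measurable_compose[OF measurable_Pair1' borel_measurable_indicator]) auto
    qed measurable
    finally show ?thesis .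
  qed
  have "prob_space (?\<kappa> v)" for v
  proof
    have "emeasure (?\<kappa> v) (space ?N) = (\<integral>\<^sup>+\<omega>. ennreal (lik v 1 \<omega>) * indicator (space ?N) (v, \<omega>) \<partial>M)" by (rule em) auto
    also have "\<dots> = (\<integral>\<^sup>+\<omega>. ennreal (lik v 1 \<omega>) \<partial>M)" by (intro nn_integral_cong) (simp add: space_pair_measure)
    finally show "emeasure (?\<kappa> v) (space (?\<kappa> v)) = 1" by (simp add: nn_integral_lik)
  qed
  then have sub: "subprob_space (?\<kappa> v)" for v by (rule prob_space_imp_subprob_space)
  have km: "?\<kappa> \<in> measurable gaussian (subprob_algebra ?N)"
  proof (rule measurable_subprob_algebra)
    fix A assume A: "A \<in> sets ?N"
    then have [measurable]: "A \<in> sets (gaussian \<Otimes>\<^sub>M M)" unfolding sN .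
    show "(\<lambda>v. emeasure (?\<kappa> v) A) \<in> borel_measurable gaussian"
      unfolding em[OF A] by measurable
  qed (use sub in auto)
  have "joint_law M B gaussian strategy = gaussian \<bind> ?\<kappa>"
  proof -
    have "restrict_space gaussian UNIV = gaussian"
      by (rule measure_eqI) (auto simp: sets_restrict_space emeasure_restrict_space)
    then show ?thesis unfolding joint_law_def measure_support_gaussian girsanov_strategy by simp
  qed
  also have "\<dots> = J"
  proof (rule measure_eqI)
    have sb: "sets (gaussian \<bind> ?\<kappa>) = sets ?N" by (rule sets_bind[OF _ ]) auto
    show "sets (gaussian \<bind> ?\<kappa>) = sets J" by (rule trans[OF sb trans[OF sN sets_J[symmetric]]])
    fix A assume "A \<in> sets (gaussian \<bind> ?\<kappa>)"
    then have A: "A \<in> sets ?N" unfolding sb .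
    then have [measurable]: "A \<in> sets (gaussian \<Otimes>\<^sub>M M)" unfolding sN .
    have "emeasure (gaussian \<bind> ?\<kappa>) A = (\<integral>\<^sup>+v. emeasure (?\<kappa> v) A \<partial>gaussian)"
      using km A by (intro emeasure_bind) auto
    also have "\<dots> = (\<integral>\<^sup>+v. (\<integral>\<^sup>+\<omega>. (case (v, \<omega>) of (v, \<omega>) \<Rightarrow> ennreal (lik v 1 \<omega>)) * indicator A (v, \<omega>) \<partial>M) \<partial>gaussian)" by (simp add: em[OF A])
    also have "\<dots> = (\<integral>\<^sup>+z. (case z of (v, \<omega>) \<Rightarrow> ennreal (lik v 1 \<omega>)) * indicator A z \<partial>(gaussian \<Otimes>\<^sub>M M))"
      by (rule nn_integral_fst) measurable
    also have "\<dots> = emeasure J A" unfolding J_def by (rule emeasure_density[symmetric]) measurable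
    finally show "emeasure (gaussian \<bind> ?\<kappa>) A = emeasure J A" .
  qed
  finally show ?thesis .
qed

lemma prob_space_J: "prob_space J"
proof
  have [measurable]: "(\<lambda>(v, \<omega>). lik v 1 \<omega>) \<in> borel_measurable (gaussian \<Otimes>\<^sub>M M)" by (rule lik_pair_measurable) simp
  have "emeasure J (space J) = (\<integral>\<^sup>+z. (case z of (v, \<omega>) \<Rightarrow> ennreal (lik v 1 \<omega>)) * indicator (space (gaussian \<Otimes>\<^sub>M M)) z \<partial>(gaussian \<Otimes>\<^sub>M M))"
    unfolding J_def space_density by (rule emeasure_density) measurable
  also have "\<dots> = (\<integral>\<^sup>+z. (case z of (v, \<omega>) \<Rightarrow> ennreal (lik v 1 \<omega>)) \<partial>(gaussian \<Otimes>\<^sub>M M))"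
    by (intro nn_integral_cong) (simp add: indicator_def)
  also have "\<dots> = (\<integral>\<^sup>+v. (\<integral>\<^sup>+\<omega>. (case (v, \<omega>) of (v, \<omega>) \<Rightarrow> ennreal (lik v 1 \<omega>)) \<partial>M) \<partial>gaussian)"
    by (rule nn_integral_fst[symmetric]) measurable
  finally show "emeasure J (space J) = 1" by (simp add: nn_integral_lik)
qed

lemma integrable_lik_value:
  assumes t: "0 \<le> t" "t \<le> 1"
  shows "integrable (gaussian \<Otimes>\<^sub>M M) (\<lambda>(v, \<omega>). lik v t \<omega> * v)"
proof (rule integrableI_bounded)
  note [measurable] = lik_pair_measurable[OF t(2)] lik_section_measurable_M[OF t(2)]
  show "(\<lambda>(v, \<omega>). lik v t \<omega> * v) \<in> borel_measurable (gaussian \<Otimes>\<^sub>M M)" by measurable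
  have "(\<integral>\<^sup>+z. ennreal (norm (case z of (v, \<omega>) \<Rightarrow> lik v t \<omega> * v)) \<partial>(gaussian \<Otimes>\<^sub>M M))
    = (\<integral>\<^sup>+v. \<integral>\<^sup>+\<omega>. ennreal (norm (case (v, \<omega>) of (v, \<omega>) \<Rightarrow> lik v t \<omega> * v)) \<partial>M \<partial>gaussian)"
    by (rule nn_integral_fst[symmetric]) measurable
  also have "\<dots> = (\<integral>\<^sup>+v. ennreal \<bar>v\<bar> * (\<integral>\<^sup>+\<omega>. ennreal (lik v t \<omega>) \<partial>M) \<partial>gaussian)"
    by (intro nn_integral_cong) (simp add: abs_mult nn_integral_cmult[symmetric] ennreal_mult mult.commute)
  also have "\<dots> = (\<integral>\<^sup>+v. ennreal \<bar>v\<bar> \<partial>gaussian)" by (simp add: nn_integral_lik[OF t])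
  also have "\<dots> < \<infinity>"
    using integrable_gaussian_power[of 1] by (simp add: integrable_iff_bounded)
  finally show "(\<integral>\<^sup>+z. ennreal (norm (case z of (v, \<omega>) \<Rightarrow> lik v t \<omega> * v)) \<partial>(gaussian \<Otimes>\<^sub>M M)) < \<infinity>" .
qed

lemma posterior_mean_pointwise:
  assumes t: "t \<le> 1" and \<omega>: "\<omega> \<in> space M"
  shows "integrable gaussian (\<lambda>v. lik v t \<omega>)" "integrable gaussian (\<lambda>v. v * lik v t \<omega>)"
    "(\<integral>v. v * lik v t \<omega> \<partial>gaussian) = price t \<omega> * (\<integral>v. lik v t \<omega> \<partial>gaussian)"
proof -
  have "(\<lambda>v. lik v t \<omega>) \<in> borel_measurable borel"
    using measurable_compose[OF measurable_Pair2' lik_joint_measurable[OF t]] \<omega> by simp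
  then show "integrable gaussian (\<lambda>v. lik v t \<omega>)" "integrable gaussian (\<lambda>v. v * lik v t \<omega>)"
    "(\<integral>v. v * lik v t \<omega> \<partial>gaussian) = price t \<omega> * (\<integral>v. lik v t \<omega> \<partial>gaussian)"
    by (rule posterior_mean[OF \<omega>])+
qed

text \<open>Conditional Jensen: for each path, \<open>price\<close> times the mass of the likelihood
  is the integral of \<open>v\<close> against it, hence at most the integral of \<open>|v|\<close>.
  For \<open>s = 1\<close> the martingale property first takes the likelihood back to time
  \<open>t\<close>.\<close>

lemma integrable_lik_price:
  assumes t: "0 \<le> t" "t \<le> 1" and s: "s = t \<or> s = 1"
  shows "integrable (gaussian \<Otimes>\<^sub>M M) (\<lambda>(v, \<omega>). lik v s \<omega> * price t \<omega>)"
proof -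
  have s1: "s \<le> 1" using s t by auto
  note [measurable] = price_measurable[OF t(2)]
  have pM[measurable]: "price t \<in> borel_measurable M" by (rule F_measurable_M) (use t in measurable)
  note [measurable] = lik_pair_measurable[OF t(2)] lik_pair_measurable[OF s1] lik_pair_measurable[of 1, simplified]
    lik_section_measurable_M[OF t(2)] lik_section_measurable_M[OF s1]
  have st: "(\<integral>\<^sup>+\<omega>. ennreal (lik v s \<omega>) * ennreal \<bar>price t \<omega>\<bar> \<partial>M) = (\<integral>\<^sup>+\<omega>. ennreal (lik v t \<omega>) * ennreal \<bar>price t \<omega>\<bar> \<partial>M)" for v
    using s lik_martingale[OF t, of "\<lambda>\<omega>. ennreal \<bar>price t \<omega>\<bar>" v] by auto
  show ?thesis
  proof (rule integrableI_bounded)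
    show "(\<lambda>(v, \<omega>). lik v s \<omega> * price t \<omega>) \<in> borel_measurable (gaussian \<Otimes>\<^sub>M M)" by measurable
    have "(\<integral>\<^sup>+z. ennreal (norm (case z of (v, \<omega>) \<Rightarrow> lik v s \<omega> * price t \<omega>)) \<partial>(gaussian \<Otimes>\<^sub>M M))
      = (\<integral>\<^sup>+v. \<integral>\<^sup>+\<omega>. ennreal (norm (case (v, \<omega>) of (v, \<omega>) \<Rightarrow> lik v s \<omega> * price t \<omega>)) \<partial>M \<partial>gaussian)"
      by (rule nn_integral_fst[symmetric]) measurable
    also have "\<dots> = (\<integral>\<^sup>+v. \<integral>\<^sup>+\<omega>. ennreal (lik v s \<omega>) * ennreal \<bar>price t \<omega>\<bar> \<partial>M \<partial>gaussian)"
      by (intro nn_integral_cong) (simp add: abs_mult ennreal_mult)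
    also have "\<dots> = (\<integral>\<^sup>+v. \<integral>\<^sup>+\<omega>. ennreal (lik v t \<omega> * \<bar>price t \<omega>\<bar>) \<partial>M \<partial>gaussian)"
      unfolding st by (simp add: ennreal_mult)
    also have "\<dots> = (\<integral>\<^sup>+\<omega>. \<integral>\<^sup>+v. ennreal (lik v t \<omega> * \<bar>price t \<omega>\<bar>) \<partial>gaussian \<partial>M)"
      by (rule GM.Fubini'[symmetric]) measurable
    also have "\<dots> \<le> (\<integral>\<^sup>+\<omega>. \<integral>\<^sup>+v. ennreal (norm (lik v t \<omega> * v)) \<partial>gaussian \<partial>M)"
    proof (rule nn_integral_mono)
      fix \<omega> assume \<omega>: "\<omega> \<in> space M"
      note pm = posterior_mean_pointwise[OF t(2) \<omega>]
      have "(\<integral>\<^sup>+v. ennreal (lik v t \<omega> * \<bar>price t \<omega>\<bar>) \<partial>gaussian) = ennreal (\<integral>v. lik v t \<omega> * \<bar>price t \<omega>\<bar> \<partial>gaussian)"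
        using pm(1) by (intro nn_integral_eq_integral) auto
      also have "(\<integral>v. lik v t \<omega> * \<bar>price t \<omega>\<bar> \<partial>gaussian) = \<bar>price t \<omega> * (\<integral>v. lik v t \<omega> \<partial>gaussian)\<bar>"
        by (simp add: abs_mult mult.commute abs_of_nonneg integral_nonneg_AE)
      also have "\<dots> = \<bar>\<integral>v. v * lik v t \<omega> \<partial>gaussian\<bar>" by (simp only: pm(3))
      also have "\<dots> \<le> (\<integral>v. norm (lik v t \<omega> * v) \<partial>gaussian)"
        using integral_norm_bound[of gaussian "\<lambda>v. v * lik v t \<omega>"] by (simp add: mult.commute)
      also have "ennreal \<dots> = (\<integral>\<^sup>+v. ennreal (norm (lik v t \<omega> * v)) \<partial>gaussian)"
        using pm(2) by (intro nn_integral_eq_integral[symmetric]) (auto simp: mult.commute)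
      finally show "(\<integral>\<^sup>+v. ennreal (lik v t \<omega> * \<bar>price t \<omega>\<bar>) \<partial>gaussian) \<le> (\<integral>\<^sup>+v. ennreal (norm (lik v t \<omega> * v)) \<partial>gaussian)"
        by (auto intro: ennreal_leI)
    qed
    also have "\<dots> = (\<integral>\<^sup>+v. \<integral>\<^sup>+\<omega>. ennreal (norm (lik v t \<omega> * v)) \<partial>M \<partial>gaussian)"
      by (rule GM.Fubini') measurable
    also have "\<dots> = (\<integral>\<^sup>+v. \<integral>\<^sup>+\<omega>. ennreal (norm (case (v, \<omega>) of (v, \<omega>) \<Rightarrow> lik v t \<omega> * v)) \<partial>M \<partial>gaussian)" by simp
    also have "\<dots> = (\<integral>\<^sup>+z. ennreal (norm (case z of (v, \<omega>) \<Rightarrow> lik v t \<omega> * v)) \<partial>(gaussian \<Otimes>\<^sub>M M))"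
      by (rule nn_integral_fst) measurable
    also have "\<dots> < \<infinity>" using integrable_lik_value[OF t] by (simp add: integrable_iff_bounded)
    finally show "(\<integral>\<^sup>+z. ennreal (norm (case z of (v, \<omega>) \<Rightarrow> lik v s \<omega> * price t \<omega>)) \<partial>(gaussian \<Otimes>\<^sub>M M)) < \<infinity>" .
  qed
qed

text \<open>Supplies the square integrability that \<open>simple_exp_martingale_real\<close> asks
  for. It is inherited from the order flow, from which the price has a finite mean square
  distance.\<close>

lemma integrable_price_square:
  assumes t: "0 \<le> t" "t \<le> 1"
  shows "integrable M (\<lambda>\<omega>. (price t \<omega>)\<^sup>2)"
proof (rule Bochner_Integration.integrable_bound)
  have pM[measurable]: "price t \<in> borel_measurable M" "B t \<in> borel_measurable M"
    using F_measurable_M[OF price_measurable[OF t(2)] t(2)] B_measurable[OF t] by auto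
  have "integrable M (\<lambda>\<omega>. (B t \<omega> - price t \<omega>)\<^sup>2)"
    using price_distance[OF t] by (intro integrableI_bounded) (auto intro: le_less_trans)
  then show "integrable M (\<lambda>\<omega>. 2 * (B t \<omega> - price t \<omega>)\<^sup>2 + 2 * (B t \<omega>)\<^sup>2)"
    using integrable_B_power[OF t, of 2] by simp
  show "(\<lambda>\<omega>. (price t \<omega>)\<^sup>2) \<in> borel_measurable M" by measurable
  have "norm (y\<^sup>2) \<le> norm (2 * (x - y)\<^sup>2 + 2 * x\<^sup>2)" for x y :: real
  proof -
    have "y\<^sup>2 \<le> 2 * (x - y)\<^sup>2 + 2 * x\<^sup>2" using diff_square_le[of "x - y" x] by simp
    then show ?thesis by simp
  qed
  then show "AE \<omega> in M. norm ((price t \<omega>)\<^sup>2) \<le> norm (2 * (B t \<omega> - price t \<omega>)\<^sup>2 + 2 * (B t \<omega>)\<^sup>2)" by blast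
qed

text \<open>The defining property of the conditional expectation. For each \<open>v\<close>, on an
  event of \<open>F t\<close>, the martingale property replaces the likelihood at time 1 by the one
  at time \<open>t\<close>; after exchanging the integrals, Bayes' formula makes the inner integral
  vanish path by path.\<close>

lemma posterior_orthogonality:
  assumes t: "0 \<le> t" "t \<le> 1" and A: "A \<in> sets (F t)"
  shows "(\<integral>(v, \<omega>). indicator A \<omega> * (lik v 1 \<omega> * v) \<partial>(gaussian \<Otimes>\<^sub>M M)) = (\<integral>(v, \<omega>). indicator A \<omega> * (lik v 1 \<omega> * price t \<omega>) \<partial>(gaussian \<Otimes>\<^sub>M M))"
proof -
  note [measurable] = A price_measurable[OF t(2)]
  have AM[measurable]: "A \<in> sets M" using A sets_F_subset[OF t(2)] by blast
  have ind: "(\<lambda>(v, \<omega>). indicator A \<omega> :: real) \<in> borel_measurable (gaussian \<Otimes>\<^sub>M M)" by measurable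
  have mult: "integrable (gaussian \<Otimes>\<^sub>M M) (\<lambda>(v, \<omega>). indicator A \<omega> * f v \<omega>)" if "integrable (gaussian \<Otimes>\<^sub>M M) (\<lambda>(v, \<omega>). f v \<omega>)"
    for f :: "real \<Rightarrow> 'a \<Rightarrow> real"
  proof -
    have "UNIV \<times> A \<in> sets (gaussian \<Otimes>\<^sub>M M)" by measurable
    from integrable_mult_indicator[OF this that]
    have "integrable (gaussian \<Otimes>\<^sub>M M) (\<lambda>z. indicator A (snd z) * f (fst z) (snd z))"
      by (simp add: case_prod_beta indicator_times)
    then show ?thesis unfolding case_prod_beta .
  qed
  note iv = mult[OF integrable_lik_value[OF t]] mult[OF integrable_lik_value[of 1, simplified]]
  note ip = mult[OF integrable_lik_price[OF t, of t, simplified]] mult[OF integrable_lik_price[OF t, of 1, simplified]]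
  let ?f = "\<lambda>s v \<omega>. indicator A \<omega> * (lik v s \<omega> * v) - indicator A \<omega> * (lik v s \<omega> * price t \<omega>)"
  have i: "integrable (gaussian \<Otimes>\<^sub>M M) (\<lambda>(v, \<omega>). ?f 1 v \<omega>)" "integrable (gaussian \<Otimes>\<^sub>M M) (\<lambda>(v, \<omega>). ?f t v \<omega>)"
    using Bochner_Integration.integrable_diff[OF iv(1) ip(1)] Bochner_Integration.integrable_diff[OF iv(2) ip(2)]
    unfolding case_prod_beta by auto
  have mart: "(\<integral>\<omega>. ?f 1 v \<omega> \<partial>M) = (\<integral>\<omega>. ?f t v \<omega> \<partial>M)" for v
  proof -
    let ?Y = "\<lambda>\<omega>. indicator A \<omega> * (v - price t \<omega>)"
    have Ym: "?Y \<in> borel_measurable (F t)" by measurable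
    have YM: "?Y \<in> borel_measurable M" by (rule F_measurable_M[OF Ym t(2)])
    have "integrable M (\<lambda>\<omega>. (?Y \<omega>)\<^sup>2)"
    proof (rule Bochner_Integration.integrable_bound)
      show "integrable M (\<lambda>\<omega>. 2 * v\<^sup>2 + 2 * (price t \<omega>)\<^sup>2)" using integrable_price_square[OF t] by simp
      show "(\<lambda>\<omega>. (?Y \<omega>)\<^sup>2) \<in> borel_measurable M" using YM by measurable
      have "norm ((indicator A \<omega> * (v - x))\<^sup>2) \<le> norm (2 * v\<^sup>2 + 2 * x\<^sup>2)" for \<omega> x
      proof -
        have "(v - x)\<^sup>2 \<le> 2 * v\<^sup>2 + 2 * x\<^sup>2" by (rule diff_square_le)
        then show ?thesis by (simp split: split_indicator)
      qed
      then show "AE \<omega> in M. norm ((?Y \<omega>)\<^sup>2) \<le> norm (2 * v\<^sup>2 + 2 * (price t \<omega>)\<^sup>2)" by blast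
    qed
    from simple_exp_martingale_real[OF ctrl_simple_integrand[of v] t Ym this]
    have "(\<integral>\<omega>. lik v 1 \<omega> * ?Y \<omega> \<partial>M) = (\<integral>\<omega>. lik v t \<omega> * ?Y \<omega> \<partial>M)" unfolding lik_def .
    then show ?thesis by (simp add: algebra_simps)
  qed
  have "(\<integral>z. (case z of (v, \<omega>) \<Rightarrow> ?f 1 v \<omega>) \<partial>(gaussian \<Otimes>\<^sub>M M)) = (\<integral>v. \<integral>\<omega>. ?f 1 v \<omega> \<partial>M \<partial>gaussian)"
    using GM.integral_fst'[OF i(1)] by simp
  also have "\<dots> = (\<integral>v. \<integral>\<omega>. ?f t v \<omega> \<partial>M \<partial>gaussian)" unfolding mart ..
  also have "\<dots> = (\<integral>\<omega>. \<integral>v. ?f t v \<omega> \<partial>gaussian \<partial>M)" by (rule GM.Fubini_integral[symmetric]) (rule i(2))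
  also have "\<dots> = (\<integral>\<omega>. 0 \<partial>M)"
  proof (rule Bochner_Integration.integral_cong)
    fix \<omega> assume \<omega>: "\<omega> \<in> space M"
    note pm = posterior_mean_pointwise[OF t(2) \<omega>]
    have "(\<integral>v. ?f t v \<omega> \<partial>gaussian) = (\<integral>v. indicator A \<omega> * (v * lik v t \<omega> - price t \<omega> * lik v t \<omega>) \<partial>gaussian)"
      by (intro Bochner_Integration.integral_cong) (simp_all add: algebra_simps)
    also have "\<dots> = indicator A \<omega> * ((\<integral>v. v * lik v t \<omega> \<partial>gaussian) - price t \<omega> * (\<integral>v. lik v t \<omega> \<partial>gaussian))"
      using pm(1,2) by simp
    also have "\<dots> = 0" by (simp add: pm(3))
    finally show "(\<integral>v. ?f t v \<omega> \<partial>gaussian) = 0" .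
  qed simp
  finally have "(\<integral>z. (case z of (v, \<omega>) \<Rightarrow> ?f 1 v \<omega>) \<partial>(gaussian \<Otimes>\<^sub>M M)) = 0" by simp
  then show ?thesis using iv(2) ip(2) unfolding case_prod_beta by (subst (asm) Bochner_Integration.integral_diff) auto
qed

lemma rational_price_price: "rational_price M B gaussian strategy price"
  unfolding rational_price_def joint_law_eq
proof (intro conjI ballI price_progressive)
  fix t :: real assume "t \<in> {0..1}"
  then have t: "0 \<le> t" "t \<le> 1" by auto
  interpret J: prob_space J by (rule prob_space_J)
  let ?H = "natural_filtration J (\<lambda>s y. B s (snd y)) t"
  have pu: "path_upto (\<lambda>s y. B s (snd y)) t z = path_upto B t (snd z)" for z :: "real \<times> 'a"
    by (simp add: path_upto_def)
  have sub: "subalgebra J ?H"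
    unfolding subalgebra_def
  proof
    show "sets ?H \<subseteq> sets J"
    proof (rule sets_natural_filtration_subset)
      fix s assume s: "0 \<le> s" "s \<le> t"
      have [measurable]: "B s \<in> borel_measurable M" using s t by (intro B_measurable) auto
      show "(\<lambda>y. B s (snd y)) \<in> borel_measurable J" by measurable
    qed simp
  qed simp
  interpret H: finite_measure_subalgebra J ?H by unfold_locales (rule sub)
  \<comment> \<open>Events generated by the order flow on the product space are cylinders over
    events of \<open>F t\<close>.\<close>
  have Hset: "\<exists>A0\<in>sets (F t). A = UNIV \<times> A0" if "A \<in> sets ?H" for A
  proof -
    obtain P where P: "P \<in> sets (Pi\<^sub>M {0..t} (\<lambda>_. borel))" "A = path_upto (\<lambda>s y. B s (snd y)) t -` P \<inter> space J"
    proof -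
      have "path_upto (\<lambda>s y. B s (snd y)) t \<in> space J \<rightarrow> space (Pi\<^sub>M {0..t} (\<lambda>_. borel))"
        by (auto simp: path_upto_def space_PiM)
      then show thesis using that \<open>A \<in> sets ?H\<close> unfolding natural_filtration_def by (auto simp: sets_vimage_algebra2)
    qed
    have "A = UNIV \<times> (path_upto B t -` P \<inter> space M)" unfolding P(2) by (auto simp: pu)
    moreover have "path_upto B t -` P \<inter> space M \<in> sets (F t)"
      unfolding natural_filtration_def by (rule in_vimage_algebra[OF P(1)])
    ultimately show ?thesis by blast
  qed
  have snd: "snd \<in> measurable ?H (F t)"
    unfolding natural_filtration_def[of M]
  proof (rule measurable_vimage_algebra2)
    show "snd \<in> space ?H \<rightarrow> space M" by auto
    have "path_upto (\<lambda>s y. B s (snd y)) t \<in> measurable ?H (Pi\<^sub>M {0..t} (\<lambda>_. borel))"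
      unfolding natural_filtration_def by (rule measurable_vimage_algebra1) (auto simp: path_upto_def space_PiM)
    then show "(\<lambda>z. path_upto B t (snd z)) \<in> measurable ?H (Pi\<^sub>M {0..t} (\<lambda>_. borel))"
      by (simp add: pu[abs_def])
  qed
  note L1[measurable] = lik_pair_measurable[of 1, simplified]
  have pM[measurable]: "price t \<in> borel_measurable M" by (rule F_measurable_M[OF price_measurable[OF t(2)] t(2)])
  have L0: "AE z in gaussian \<Otimes>\<^sub>M M. 0 \<le> (case z of (v, \<omega>) \<Rightarrow> lik v 1 \<omega>)" by (auto simp: case_prod_beta)
  have Jd: "J = density (gaussian \<Otimes>\<^sub>M M) (\<lambda>z. ennreal (case z of (v, \<omega>) \<Rightarrow> lik v 1 \<omega>))"
    unfolding J_def by (rule arg_cong2[where f=density]) auto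
  have "AE z in J. real_cond_exp J ?H fst z = price t (snd z)"
  proof (rule H.real_cond_exp_charact)
    show "(\<lambda>z. price t (snd z)) \<in> borel_measurable ?H"
      by (rule measurable_compose[OF snd price_measurable[OF t(2)]])
    show "integrable J fst"
      unfolding Jd by (subst integrable_density[OF _ _ L0]) (use integrable_lik_value[of 1, unfolded case_prod_beta] in \<open>auto simp: case_prod_beta\<close>)
    show "integrable J (\<lambda>z. price t (snd z))"
      unfolding Jd by (subst integrable_density[OF _ _ L0]) (use integrable_lik_price[OF t, of 1, unfolded case_prod_beta] in \<open>auto simp: case_prod_beta\<close>)
    fix A assume "A \<in> sets ?H"
    then obtain A0 where A0: "A0 \<in> sets (F t)" and A: "A = UNIV \<times> A0" using Hset by blast
    have [measurable]: "A0 \<in> sets M" using A0 sets_F_subset[OF t(2)] by blast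
    have ind: "indicator A z = (indicator A0 (snd z) :: real)" for z by (cases z) (simp add: A indicator_def)
    have eq: "(LINT z:A|J. f z) = (\<integral>(v, \<omega>). indicator A0 \<omega> * (lik v 1 \<omega> * f (v, \<omega>)) \<partial>(gaussian \<Otimes>\<^sub>M M))"
      if [measurable]: "f \<in> borel_measurable (gaussian \<Otimes>\<^sub>M M)" for f :: "real \<times> 'a \<Rightarrow> real"
      unfolding set_lebesgue_integral_def ind Jd
      by (subst integral_density[OF _ _ L0]) (measurable, simp add: case_prod_unfold mult.left_commute)
    show "(LINT z:A|J. fst z) = (LINT z:A|J. price t (snd z))"
      using posterior_orthogonality[OF t A0] by (simp add: eq)
  qed
  then show "AE z in J. price t (snd z) = real_cond_exp J ?H fst z" by eventually_elim simp
qed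

lemma price_distance_integral:
  "(\<integral>\<^sup>+\<omega>. (\<integral>\<^sup>+t\<in>{0..1}. ennreal (\<bar>along B back_price t \<omega> - price t \<omega>\<bar>\<^sup>2) \<partial>lborel) \<partial>M)
    \<le> ennreal (((1 - q) / q)\<^sup>2 + real n / K\<^sup>2 + (1 - grid n))"
proof -
  interpret P: pair_sigma_finite M I01 by standard
  note [measurable] = progressive_joint_measurable[OF progressive_B] progressive_joint_measurable[OF price_progressive]
  have "(\<integral>\<^sup>+\<omega>. (\<integral>\<^sup>+t\<in>{0..1}. ennreal (\<bar>along B back_price t \<omega> - price t \<omega>\<bar>\<^sup>2) \<partial>lborel) \<partial>M)
    = (\<integral>\<^sup>+\<omega>. \<integral>\<^sup>+t. ennreal ((B t \<omega> - price t \<omega>)\<^sup>2) \<partial>I01 \<partial>M)"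
    unfolding nn_integral_I01[symmetric] by (intro nn_integral_cong) (simp add: along_back_price)
  also have "\<dots> = (\<integral>\<^sup>+t. \<integral>\<^sup>+\<omega>. ennreal ((B t \<omega> - price t \<omega>)\<^sup>2) \<partial>M \<partial>I01)"
    by (rule P.Fubini'[symmetric]) measurable
  also have "\<dots> \<le> (\<integral>\<^sup>+t. ennreal (((1 - q) / q)\<^sup>2 + real n / K\<^sup>2 + (1 - grid n)) \<partial>I01)"
    by (intro nn_integral_mono price_distance) auto
  also have "\<dots> = ennreal (((1 - q) / q)\<^sup>2 + real n / K\<^sup>2 + (1 - grid n))"
    using I01.emeasure_space_1 by simp
  finally show ?thesis .
qed

end

section \<open>Loss of the truncated bridge\<close>

context truncated_bridge begin

lemma grid_B_shift_integrable:
  assumes "i \<le> Suc n"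
  shows "integrable M (\<lambda>\<omega>. (B (grid i) \<omega> - v) ^ k)"
  using grid_01[OF assms] by (intro integrable_B_shift_power)

lemma lik_integrable_mult:
  assumes "i \<le> Suc n" "Z \<in> borel_measurable M" "integrable M (\<lambda>\<omega>. (Z \<omega>)\<^sup>2)"
  shows "integrable M (\<lambda>\<omega>. lik v (grid i) \<omega> * Z \<omega>)"
  unfolding lik_def by (rule integrable_simple_exp_mult[OF ctrl_simple_integrand grid_01[OF assms(1)] assms(2,3)])

lemma lik_power_integrable:
  assumes "i \<le> Suc n" "j \<le> Suc n"
  shows "integrable M (\<lambda>\<omega>. lik v (grid i) \<omega> * (B (grid j) \<omega> - u) ^ k)"
proof (rule lik_integrable_mult[OF assms(1)])
  have [measurable]: "B (grid j) \<in> borel_measurable M" using grid_01[OF assms(2)] by (rule B_measurable)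
  show "(\<lambda>\<omega>. (B (grid j) \<omega> - u) ^ k) \<in> borel_measurable M" by measurable
  show "integrable M (\<lambda>\<omega>. ((B (grid j) \<omega> - u) ^ k)\<^sup>2)"
    using grid_B_shift_integrable[OF assms(2), of u "k * 2"] by (simp add: power_mult)
qed

lemma lik_integral:
  assumes "i \<le> Suc n"
  shows "integrable M (lik v (grid i))" "(\<integral>\<omega>. lik v (grid i) \<omega> \<partial>M) = 1"
proof -
  show i: "integrable M (lik v (grid i))" using lik_integrable_mult[OF assms, of "\<lambda>_. 1" v] by simp
  have "ennreal (\<integral>\<omega>. lik v (grid i) \<omega> \<partial>M) = 1"
    using nn_integral_lik[OF grid_01[OF assms], of v] nn_integral_eq_integral[OF i] by simp
  then show "(\<integral>\<omega>. lik v (grid i) \<omega> \<partial>M) = 1" by simp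
qed

definition mom2 :: "real \<Rightarrow> nat \<Rightarrow> real" where
  "mom2 v i = (\<integral>\<omega>. lik v (grid i) \<omega> * (B (grid i) \<omega> - v)\<^sup>2 \<partial>M)"

definition mom4 :: "real \<Rightarrow> nat \<Rightarrow> real" where
  "mom4 v i = (\<integral>\<omega>. lik v (grid i) \<omega> * (B (grid i) \<omega> - v) ^ 4 \<partial>M)"

text \<open>The conditional mean of \<open>B (grid (Suc i)) - v\<close> given the past of
  \<open>grid i\<close>, under the law with density \<open>lik v 1\<close>.\<close>

abbreviation "pull v i \<omega> \<equiv> B (grid i) \<omega> - v + ctrl v i \<omega> * (grid (Suc i) - grid i)"

lemma pull_eq: "i < n \<Longrightarrow> pull v i \<omega> = (1 - (1 - q) * G i \<omega>) * (B (grid i) \<omega> - v)"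
proof -
  assume i: "i < n"
  have "ctrl v i \<omega> * (grid (Suc i) - grid i) = (slope i * (grid (Suc i) - grid i)) * (G i \<omega> * (v - B (grid i) \<omega>))"
    by (simp add: ctrl_def ac_simps)
  also have "\<dots> = (1 - q) * (G i \<omega> * (v - B (grid i) \<omega>))" by (simp only: slope_diff[OF i])
  finally show ?thesis by (simp add: algebra_simps)
qed

text \<open>Active or stopped, the drift never leads away from \<open>v\<close>; so the moments of
  the distance to \<open>v\<close> grow at most as they do without drift.\<close>

lemma pull_le: "i < Suc n \<Longrightarrow> \<bar>pull v i \<omega>\<bar> \<le> \<bar>B (grid i) \<omega> - v\<bar>"
proof (cases "i = n")
  case True
  then show ?thesis by (simp add: ctrl_def G_last)
next
  case False
  assume "i < Suc n"
  then have i: "i < n" using False by simp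
  have "\<bar>1 - (1 - q) * G i \<omega>\<bar> \<le> 1" using G_01(3)[of i \<omega>] q by auto
  then show ?thesis unfolding pull_eq[OF i] abs_mult by (intro mult_left_le_one_le) auto
qed

lemma ctrl_measurable_M: "i < Suc n \<Longrightarrow> ctrl v i \<in> borel_measurable M"
  using F_measurable_M[OF integrand_measurable[OF ctrl_simple_integrand _ order_refl], of i v] grid_01[of i] by simp

lemma mom2_step:
  assumes i: "i < Suc n"
  shows "mom2 v (Suc i) = (\<integral>\<omega>. lik v (grid i) \<omega> * ((pull v i \<omega>)\<^sup>2 + (grid (Suc i) - grid i)) \<partial>M)"
proof -
  have [measurable]: "B (grid i) \<in> borel_measurable M" "B (grid (Suc i)) \<in> borel_measurable M"
    "lik v (grid i) \<in> borel_measurable M" "lik v (grid (Suc i)) \<in> borel_measurable M" "ctrl v i \<in> borel_measurable M"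
    using grid_01[of i] grid_01[of "Suc i"] i by (auto intro: B_measurable lik_section_measurable_M ctrl_measurable_M)
  show ?thesis
    unfolding mom2_def
    using simple_exp_second_moment_step[OF ctrl_simple_integrand[of v] i order_refl grid_mono_step[OF i] order_refl, of v]
      grid_mono_step[OF i]
    by (subst (1 2) integral_eq_nn_integral) (auto simp: lik_def[symmetric])
qed

lemma mom4_step:
  assumes i: "i < Suc n"
  shows "mom4 v (Suc i) = (\<integral>\<omega>. lik v (grid i) \<omega> * ((pull v i \<omega>) ^ 4 + 6 * (grid (Suc i) - grid i) * (pull v i \<omega>)\<^sup>2
    + 3 * (grid (Suc i) - grid i)\<^sup>2) \<partial>M)"
proof -
  have [measurable]: "B (grid i) \<in> borel_measurable M" "B (grid (Suc i)) \<in> borel_measurable M"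
    "lik v (grid i) \<in> borel_measurable M" "lik v (grid (Suc i)) \<in> borel_measurable M" "ctrl v i \<in> borel_measurable M"
    using grid_01[of i] grid_01[of "Suc i"] i by (auto intro: B_measurable lik_section_measurable_M ctrl_measurable_M)
  show ?thesis
    unfolding mom4_def
    using simple_exp_fourth_moment_step[OF ctrl_simple_integrand[of v] i order_refl grid_mono_step[OF i] order_refl, of v]
      grid_mono_step[OF i]
    by (subst (1 2) integral_eq_nn_integral) (auto simp: lik_def[symmetric])
qed

lemma mom2_bound: "i \<le> Suc n \<Longrightarrow> mom2 v i \<le> v\<^sup>2 + grid i"
proof (induction i)
  case 0
  have "mom2 v 0 = (\<integral>\<omega>. v\<^sup>2 \<partial>M)"
    unfolding mom2_def lik_def grid_0
    by (rule Bochner_Integration.integral_cong) (auto simp: simple_exp_0[OF ctrl_simple_integrand] B_0)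
  then show ?case by (simp add: prob_space grid_0)
next
  case (Suc i)
  then have i: "i < Suc n" by simp
  let ?D = "grid (Suc i) - grid i"
  have "mom2 v (Suc i) \<le> (\<integral>\<omega>. lik v (grid i) \<omega> * (B (grid i) \<omega> - v)\<^sup>2 + ?D * lik v (grid i) \<omega> \<partial>M)"
    unfolding mom2_step[OF i]
  proof (rule integral_mono_AE')
    show "integrable M (\<lambda>\<omega>. lik v (grid i) \<omega> * (B (grid i) \<omega> - v)\<^sup>2 + ?D * lik v (grid i) \<omega>)"
      using lik_power_integrable[of i i v v 2] lik_integral(1)[of i v] i by simp
    have "lik v (grid i) \<omega> * ((pull v i \<omega>)\<^sup>2 + ?D) \<le> lik v (grid i) \<omega> * ((B (grid i) \<omega> - v)\<^sup>2 + ?D)" for \<omega>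
      using pull_le[OF i, where v=v and \<omega>=\<omega>] by (intro mult_left_mono add_right_mono) (simp_all add: abs_le_square_iff)
    then show "AE \<omega> in M. lik v (grid i) \<omega> * ((pull v i \<omega>)\<^sup>2 + ?D) \<le> lik v (grid i) \<omega> * (B (grid i) \<omega> - v)\<^sup>2 + ?D * lik v (grid i) \<omega>"
      by (simp add: algebra_simps)
    show "AE \<omega> in M. 0 \<le> lik v (grid i) \<omega> * (B (grid i) \<omega> - v)\<^sup>2 + ?D * lik v (grid i) \<omega>"
      using grid_mono_step[OF i] by auto
  qed
  also have "\<dots> = mom2 v i + ?D"
    using lik_power_integrable[of i i v v 2] lik_integral[of i v] i by (simp add: mom2_def)
  finally show ?case using Suc by simp
qed

text \<open>A cell of length D <= 1 adds at most 6 D (v^2 + 1) + 3 D^2, by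
  \<open>mom2_bound\<close>; this is at most D (6 v^2 + 9).\<close>

lemma mom4_bound: "i \<le> Suc n \<Longrightarrow> mom4 v i \<le> v ^ 4 + grid i * (6 * v\<^sup>2 + 9)"
proof (induction i)
  case 0
  have "mom4 v 0 = (\<integral>\<omega>. v ^ 4 \<partial>M)"
    unfolding mom4_def lik_def grid_0
    by (rule Bochner_Integration.integral_cong) (auto simp: simple_exp_0[OF ctrl_simple_integrand] B_0)
  then show ?case by (simp add: prob_space grid_0)
next
  case (Suc i)
  then have i: "i < Suc n" by simp
  let ?D = "grid (Suc i) - grid i"
  have D: "0 \<le> ?D" "?D \<le> 1" using grid_mono_step[OF i] grid_01[of i] grid_01[of "Suc i"] i by auto
  have "mom4 v (Suc i) \<le> (\<integral>\<omega>. lik v (grid i) \<omega> * (B (grid i) \<omega> - v) ^ 4 + 6 * ?D * (lik v (grid i) \<omega> * (B (grid i) \<omega> - v)\<^sup>2) + 3 * ?D\<^sup>2 * lik v (grid i) \<omega> \<partial>M)"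
    unfolding mom4_step[OF i]
  proof (rule integral_mono_AE')
    show "integrable M (\<lambda>\<omega>. lik v (grid i) \<omega> * (B (grid i) \<omega> - v) ^ 4 + 6 * ?D * (lik v (grid i) \<omega> * (B (grid i) \<omega> - v)\<^sup>2) + 3 * ?D\<^sup>2 * lik v (grid i) \<omega>)"
      using lik_power_integrable[of i i v v 2] lik_power_integrable[of i i v v 4] lik_integral(1)[of i v] i by simp
    have "lik v (grid i) \<omega> * ((pull v i \<omega>) ^ 4 + 6 * ?D * (pull v i \<omega>)\<^sup>2 + 3 * ?D\<^sup>2)
       \<le> lik v (grid i) \<omega> * ((B (grid i) \<omega> - v) ^ 4 + 6 * ?D * (B (grid i) \<omega> - v)\<^sup>2 + 3 * ?D\<^sup>2)" for \<omega>
    proof -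
      have "(pull v i \<omega>)\<^sup>2 \<le> (B (grid i) \<omega> - v)\<^sup>2" using pull_le[OF i, where v=v and \<omega>=\<omega>] by (simp add: abs_le_square_iff)
      moreover from power_mono[OF this, of 2] have "(pull v i \<omega>) ^ 4 \<le> (B (grid i) \<omega> - v) ^ 4" by simp
      ultimately show ?thesis using D by (intro mult_left_mono add_mono) auto
    qed
    then show "AE \<omega> in M. lik v (grid i) \<omega> * ((pull v i \<omega>) ^ 4 + 6 * ?D * (pull v i \<omega>)\<^sup>2 + 3 * ?D\<^sup>2)
       \<le> lik v (grid i) \<omega> * (B (grid i) \<omega> - v) ^ 4 + 6 * ?D * (lik v (grid i) \<omega> * (B (grid i) \<omega> - v)\<^sup>2) + 3 * ?D\<^sup>2 * lik v (grid i) \<omega>"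
      by (simp only: distrib_left mult.assoc mult.left_commute mult.commute) simp
    show "AE \<omega> in M. 0 \<le> lik v (grid i) \<omega> * (B (grid i) \<omega> - v) ^ 4 + 6 * ?D * (lik v (grid i) \<omega> * (B (grid i) \<omega> - v)\<^sup>2) + 3 * ?D\<^sup>2 * lik v (grid i) \<omega>"
      using D by auto
  qed
  also have "\<dots> = mom4 v i + 6 * ?D * mom2 v i + 3 * ?D\<^sup>2"
    using lik_power_integrable[of i i v v 2] lik_power_integrable[of i i v v 4] lik_integral[of i v] i by (simp add: mom2_def mom4_def)
  also have "\<dots> \<le> mom4 v i + 6 * ?D * (v\<^sup>2 + 1) + 3 * ?D"
  proof -
    have "mom2 v i \<le> v\<^sup>2 + 1" using mom2_bound[of i v] grid_01[of i] i by simp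
    then have "6 * ?D * mom2 v i \<le> 6 * ?D * (v\<^sup>2 + 1)" using D by (intro mult_left_mono) auto
    moreover have "?D\<^sup>2 \<le> ?D" using D by (simp add: power2_eq_square mult_left_le)
    moreover from this have "3 * ?D\<^sup>2 \<le> 3 * ?D" by simp
    ultimately show ?thesis by (intro add_mono order_refl)
  qed
  also have "\<dots> = mom4 v i + ?D * (6 * v\<^sup>2 + 9)" by (simp add: algebra_simps)
  finally show ?case using Suc by (simp add: algebra_simps)
qed

text \<open>At an earlier grid point the martingale property lets the likelihood of that point take
  over. Then \<open>B^4 <= 8 * ((B - v)^4 + v^4)\<close>, and \<open>mom4_bound\<close>
  applies.\<close>

lemma lik_B4:
  assumes "j \<le> i" "i \<le> Suc n"
  shows "(\<integral>\<omega>. lik v (grid i) \<omega> * B (grid j) \<omega> ^ 4 \<partial>M) \<le> 8 * (2 * v ^ 4 + 6 * v\<^sup>2 + 9)"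
proof -
  have j: "j \<le> Suc n" using assms by simp
  have Bm: "(\<lambda>\<omega>. B (grid j) \<omega> ^ 4) \<in> borel_measurable (F (grid k))" if "j \<le> k" "k \<le> Suc n" for k
  proof -
    have [measurable]: "B (grid j) \<in> borel_measurable (F (grid k))"
      using grid_01[OF j] grid_mono[OF that] by (intro measurable_natural_filtration)
    show ?thesis by measurable
  qed
  have B8: "integrable M (\<lambda>\<omega>. (B (grid j) \<omega> ^ 4)\<^sup>2)"
    using integrable_B_power[OF grid_01[OF j], of 8] by simp
  note mart = simple_exp_martingale_real[OF ctrl_simple_integrand[of v] grid_01 Bm B8, folded lik_def]
  have "(\<integral>\<omega>. lik v (grid i) \<omega> * B (grid j) \<omega> ^ 4 \<partial>M) = (\<integral>\<omega>. lik v (grid j) \<omega> * B (grid j) \<omega> ^ 4 \<partial>M)"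
    using mart[of i] mart[of j] assms j by simp
  also have "\<dots> \<le> (\<integral>\<omega>. 8 * (lik v (grid j) \<omega> * (B (grid j) \<omega> - v) ^ 4) + 8 * v ^ 4 * lik v (grid j) \<omega> \<partial>M)"
  proof (rule integral_mono)
    show "integrable M (\<lambda>\<omega>. lik v (grid j) \<omega> * B (grid j) \<omega> ^ 4)" using lik_power_integrable[OF j j, of v 0 4] by simp
    show "integrable M (\<lambda>\<omega>. 8 * (lik v (grid j) \<omega> * (B (grid j) \<omega> - v) ^ 4) + 8 * v ^ 4 * lik v (grid j) \<omega>)"
      using lik_power_integrable[OF j j, of v v 4] lik_integral(1)[OF j, of v] by simp
    fix \<omega>
    have "B (grid j) \<omega> ^ 4 \<le> 8 * ((B (grid j) \<omega> - v) ^ 4 + v ^ 4)"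
      using power4_diff_bound[of "B (grid j) \<omega> - v" "- v"] by simp
    then have "lik v (grid j) \<omega> * B (grid j) \<omega> ^ 4 \<le> lik v (grid j) \<omega> * (8 * ((B (grid j) \<omega> - v) ^ 4 + v ^ 4))"
      by (intro mult_left_mono) auto
    then show "lik v (grid j) \<omega> * B (grid j) \<omega> ^ 4 \<le> 8 * (lik v (grid j) \<omega> * (B (grid j) \<omega> - v) ^ 4) + 8 * v ^ 4 * lik v (grid j) \<omega>"
      by (simp add: algebra_simps)
  qed
  also have "\<dots> = 8 * mom4 v j + 8 * v ^ 4"
    using lik_power_integrable[OF j j, of v v 4] lik_integral[OF j, of v] by (simp add: mom4_def)
  also have "\<dots> \<le> 8 * (2 * v ^ 4 + 6 * v\<^sup>2 + 9)"
  proof -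
    have "grid j * (6 * v\<^sup>2 + 9) \<le> 1 * (6 * v\<^sup>2 + 9)" using grid_01[OF j] by (intro mult_right_mono) auto
    then show ?thesis using mom4_bound[OF j, of v] by simp
  qed
  finally show ?thesis .
qed

text \<open>The polynomial adds the bound 8 (2 v^4 + 6 v^2 + 9) of \<open>lik_B4\<close> to the
  bound v^4 + 6 v^2 + 9 of \<open>mom4_bound\<close>. One such sum arises for each of at most
  \<open>n\<close> grid points at which the order flow may have left the bounds, and
  \<open>2 * K^2\<close> comes from the inequality on stopped paths.\<close>

definition trunc_err :: "real \<Rightarrow> real" where
  "trunc_err v = real n * (17 * v ^ 4 + 54 * v\<^sup>2 + 81) / (2 * K\<^sup>2)"

lemma trunc_err_nonneg: "0 \<le> trunc_err v"
  unfolding trunc_err_def by (intro divide_nonneg_nonneg mult_nonneg_nonneg) auto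

text \<open>On a cell the control contracts the distance to \<open>v\<close> by the factor \<open>q\<close>, unless the truncation is active.\<close>

lemma mom2_contraction:
  assumes i: "i < n"
  shows "mom2 v (Suc i) \<le> q\<^sup>2 * mom2 v i + (1 - q) * q ^ Suc i + trunc_err v"
proof -
  let ?D = "grid (Suc i) - grid i" and ?L = "lik v (grid i)" and ?y = "\<lambda>\<omega>. B (grid i) \<omega> - v"
  have i': "i < Suc n" "i \<le> Suc n" using i by auto
  have D: "0 \<le> ?D" using grid_mono_step[OF i'(1)] by simp
  let ?r = "\<lambda>\<omega>. \<Sum>j<Suc i. ?L \<omega> * B (grid j) \<omega> ^ 4 + ?L \<omega> * ?y \<omega> ^ 4"
  have ri: "integrable M (\<lambda>\<omega>. ?L \<omega> * B (grid j) \<omega> ^ 4 + ?L \<omega> * ?y \<omega> ^ 4)" if "j < Suc i" for j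
    using lik_power_integrable[of i j v 0 4] lik_power_integrable[of i i v v 4] i that by simp
  have li: "integrable M ?L" "integrable M (\<lambda>\<omega>. ?L \<omega> * (?y \<omega>)\<^sup>2)" "integrable M ?r"
    using lik_integral(1)[OF i'(2), of v] lik_power_integrable[OF i'(2,2), of v v 2] ri
    by (auto intro!: Bochner_Integration.integrable_sum simp del: sum.lessThan_Suc)
  have "mom2 v (Suc i) \<le> (\<integral>\<omega>. q\<^sup>2 * (?L \<omega> * (?y \<omega>)\<^sup>2) + ?D * ?L \<omega> + ?r \<omega> / (2 * K\<^sup>2) \<partial>M)"
    unfolding mom2_step[OF i'(1)]
  proof (rule integral_mono_AE')
    show "integrable M (\<lambda>\<omega>. q\<^sup>2 * (?L \<omega> * (?y \<omega>)\<^sup>2) + ?D * ?L \<omega> + ?r \<omega> / (2 * K\<^sup>2))"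
      using li by (simp del: sum.lessThan_Suc)
    have r0: "0 \<le> ?r \<omega>" for \<omega> by (intro sum_nonneg add_nonneg_nonneg mult_nonneg_nonneg) auto
    show "AE \<omega> in M. 0 \<le> q\<^sup>2 * (?L \<omega> * (?y \<omega>)\<^sup>2) + ?D * ?L \<omega> + ?r \<omega> / (2 * K\<^sup>2)"
      using D r0 by (intro AE_I2 add_nonneg_nonneg mult_nonneg_nonneg divide_nonneg_nonneg) auto
    have "?L \<omega> * ((pull v i \<omega>)\<^sup>2 + ?D) \<le> q\<^sup>2 * (?L \<omega> * (?y \<omega>)\<^sup>2) + ?D * ?L \<omega> + ?r \<omega> / (2 * K\<^sup>2)" for \<omega>
    proof (cases "G i \<omega> = 1")
      case True
      then have "pull v i \<omega> = q * ?y \<omega>" unfolding pull_eq[OF i] by simp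
      then have "?L \<omega> * ((pull v i \<omega>)\<^sup>2 + ?D) = q\<^sup>2 * (?L \<omega> * (?y \<omega>)\<^sup>2) + ?D * ?L \<omega>"
        by (simp only: power_mult_distrib distrib_left mult.left_commute mult.commute)
      moreover have "0 \<le> ?r \<omega> / (2 * K\<^sup>2)" using r0 by (intro divide_nonneg_nonneg) auto
      ultimately show ?thesis by linarith
    next
      case False
      then have "pull v i \<omega> = ?y \<omega>" unfolding pull_eq[OF i] using G_01(3)[of i \<omega>] by auto
      then have 1: "?L \<omega> * ((pull v i \<omega>)\<^sup>2 + ?D) = ?L \<omega> * (?y \<omega>)\<^sup>2 + ?D * ?L \<omega>"
        by (simp only: distrib_left mult.commute)
      \<comment> \<open>No probability of stopping is estimated: since some grid value B_j exceeds K
        in modulus, 2 K^2 y^2 <= 2 B_j^2 y^2 <= B_j^4 + y^4 with y = B - v. Summing over all grid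
        points up to \<open>i\<close> removes the dependence on \<open>j\<close>.\<close>
      obtain j where j: "j \<le> i" "K < \<bar>B (grid j) \<omega>\<bar>" using False i by (auto simp: G_def good_def split: if_splits)
      have "K\<^sup>2 \<le> (B (grid j) \<omega>)\<^sup>2" using j(2) K by (simp add: abs_le_square_iff[symmetric])
      then have "K\<^sup>2 * (?y \<omega>)\<^sup>2 \<le> (B (grid j) \<omega>)\<^sup>2 * (?y \<omega>)\<^sup>2" by (rule mult_right_mono) simp
      moreover have "2 * ((B (grid j) \<omega>)\<^sup>2 * (?y \<omega>)\<^sup>2) \<le> B (grid j) \<omega> ^ 4 + ?y \<omega> ^ 4"
        using sum_squares_bound[of "(B (grid j) \<omega>)\<^sup>2" "(?y \<omega>)\<^sup>2"] by (simp add: mult.assoc)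
      ultimately have "2 * K\<^sup>2 * (?y \<omega>)\<^sup>2 \<le> B (grid j) \<omega> ^ 4 + ?y \<omega> ^ 4" by linarith
      then have "?L \<omega> * (2 * K\<^sup>2 * (?y \<omega>)\<^sup>2) \<le> ?L \<omega> * (B (grid j) \<omega> ^ 4 + ?y \<omega> ^ 4)" by (rule mult_left_mono) simp
      also have "\<dots> = ?L \<omega> * B (grid j) \<omega> ^ 4 + ?L \<omega> * ?y \<omega> ^ 4" by (rule distrib_left)
      also have "\<dots> \<le> ?r \<omega>" using j(1) by (intro member_le_sum) auto
      finally have "(2 * K\<^sup>2) * (?L \<omega> * (?y \<omega>)\<^sup>2) \<le> ?r \<omega>" by (simp only: mult.left_commute)
      then have "?L \<omega> * (?y \<omega>)\<^sup>2 \<le> ?r \<omega> / (2 * K\<^sup>2)" using K by (subst pos_le_divide_eq) (simp_all only: mult.commute, simp)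
      moreover have "0 \<le> q\<^sup>2 * (?L \<omega> * (?y \<omega>)\<^sup>2)" by simp
      ultimately show ?thesis unfolding 1 by linarith
    qed
    then show "AE \<omega> in M. ?L \<omega> * ((pull v i \<omega>)\<^sup>2 + ?D) \<le> q\<^sup>2 * (?L \<omega> * (?y \<omega>)\<^sup>2) + ?D * ?L \<omega> + ?r \<omega> / (2 * K\<^sup>2)" by blast
  qed
  also have "\<dots> = q\<^sup>2 * mom2 v i + ?D + (\<integral>\<omega>. ?r \<omega> \<partial>M) / (2 * K\<^sup>2)"
    using li lik_integral(2)[OF i'(2), of v] by (simp add: mom2_def del: sum.lessThan_Suc)
  also have "(\<integral>\<omega>. ?r \<omega> \<partial>M) \<le> real n * (17 * v ^ 4 + 54 * v\<^sup>2 + 81)"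
  proof -
    have "(\<integral>\<omega>. ?r \<omega> \<partial>M) = (\<Sum>j<Suc i. \<integral>\<omega>. ?L \<omega> * B (grid j) \<omega> ^ 4 + ?L \<omega> * ?y \<omega> ^ 4 \<partial>M)"
      by (rule Bochner_Integration.integral_sum) (use ri in auto)
    also have "\<dots> \<le> (\<Sum>j<Suc i. 17 * v ^ 4 + 54 * v\<^sup>2 + 81)"
    proof (rule sum_mono)
      fix j assume "j \<in> {..<Suc i}"
      then have j: "j \<le> i" by simp
      have "(\<integral>\<omega>. ?L \<omega> * B (grid j) \<omega> ^ 4 + ?L \<omega> * ?y \<omega> ^ 4 \<partial>M) = (\<integral>\<omega>. ?L \<omega> * B (grid j) \<omega> ^ 4 \<partial>M) + mom4 v i"
        using lik_power_integrable[of i j v 0 4] lik_power_integrable[of i i v v 4] i j by (simp add: mom4_def)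
      moreover have "grid i * (6 * v\<^sup>2 + 9) \<le> 1 * (6 * v\<^sup>2 + 9)" using grid_01[OF i'(2)] by (intro mult_right_mono) auto
      ultimately show "(\<integral>\<omega>. ?L \<omega> * B (grid j) \<omega> ^ 4 + ?L \<omega> * ?y \<omega> ^ 4 \<partial>M) \<le> 17 * v ^ 4 + 54 * v\<^sup>2 + 81"
        using lik_B4[OF j i'(2), of v] mom4_bound[OF i'(2), of v] by simp
    qed
    also have "\<dots> = real (Suc i) * (17 * v ^ 4 + 54 * v\<^sup>2 + 81)" by (simp only: sum_constant card_lessThan)
    also have "\<dots> \<le> real n * (17 * v ^ 4 + 54 * v\<^sup>2 + 81)" using i by (intro mult_right_mono) auto
    finally show ?thesis .
  qed
  finally show ?thesis unfolding trunc_err_def grid_diff[OF i] by (simp add: divide_right_mono)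
qed

lemma mom2_decay: "i \<le> n \<Longrightarrow> mom2 v i \<le> q ^ i * (v\<^sup>2 + 1) + real i * trunc_err v"
proof (induction i)
  case 0
  then show ?case using mom2_bound[of 0 v] by (simp add: grid_0)
next
  case (Suc i)
  let ?e = "trunc_err v"
  have "mom2 v (Suc i) \<le> q\<^sup>2 * mom2 v i + (1 - q) * q ^ Suc i + ?e"
    using Suc.prems by (intro mom2_contraction) simp
  also have "\<dots> \<le> q\<^sup>2 * (q ^ i * (v\<^sup>2 + 1) + real i * ?e) + (1 - q) * q ^ Suc i + ?e"
    using Suc by (intro add_right_mono mult_left_mono) auto
  \<comment> \<open>The noise \<open>(1 - q) * q ^ Suc i\<close> of the cell exactly restores the 1,
    because q + (1 - q) = 1; the part with v^2 even gains a factor q.\<close>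
  also have "\<dots> = q ^ Suc i * (q * v\<^sup>2 + 1) + (q\<^sup>2 * (real i * ?e) + ?e)"
    by (simp add: power2_eq_square algebra_simps)
  also have "\<dots> \<le> q ^ Suc i * (v\<^sup>2 + 1) + (1 * (real i * ?e) + ?e)"
  proof (intro add_mono mult_left_mono mult_right_mono order_refl)
    show "q * v\<^sup>2 \<le> v\<^sup>2" using q by (intro mult_left_le_one_le) auto
    show "q\<^sup>2 \<le> 1" using q by (simp add: power_le_one)
  qed (use q trunc_err_nonneg in auto)
  finally show ?case by (simp add: algebra_simps)
qed

text \<open>The idle last cell leaves the conditional mean where it is and adds its whole length as
  variance.\<close>

lemma terminal_loss:
  "(\<integral>\<omega>. lik v 1 \<omega> * (B 1 \<omega> - v)\<^sup>2 \<partial>M) \<le> q ^ n * (v\<^sup>2 + 1) + real n * trunc_err v + ((1 - q) + q ^ Suc n)"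
proof -
  have n: "n < Suc n" "n \<le> Suc n" by simp_all
  have "(\<integral>\<omega>. lik v 1 \<omega> * (B 1 \<omega> - v)\<^sup>2 \<partial>M) = mom2 v (Suc n)" by (simp add: mom2_def grid_last)
  also have "\<dots> = (\<integral>\<omega>. lik v (grid n) \<omega> * (B (grid n) \<omega> - v)\<^sup>2 + (grid (Suc n) - grid n) * lik v (grid n) \<omega> \<partial>M)"
    unfolding mom2_step[OF n(1)] by (intro Bochner_Integration.integral_cong) (simp_all add: ctrl_def G_last algebra_simps)
  also have "\<dots> = mom2 v n + (grid (Suc n) - grid n)"
    using lik_power_integrable[OF n(2,2), of v v 2] lik_integral[OF n(2), of v] by (simp add: mom2_def)
  also have "\<dots> \<le> q ^ n * (v\<^sup>2 + 1) + real n * trunc_err v + ((1 - q) + q ^ Suc n)"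
    using mom2_decay[OF order_refl, of v] unfolding grid_diff_last by simp
  finally show ?thesis .
qed

text \<open>With Gaussian moments 1 and 3 the mean of v^2 + 1 is 2, and that of 17 v^4 + 54 v^2 + 81
  is 51 + 54 + 81 = 186, halved by the 2 in \<open>trunc_err\<close>. The factor 1/2 in front of the
  loss is given away.\<close>

lemma expected_loss:
  "(\<integral>\<^sup>+v. ennreal (1 / 2 * (\<integral>\<omega>. lik v 1 \<omega> * (B 1 \<omega> - v)\<^sup>2 \<partial>M)) \<partial>gaussian)
    \<le> ennreal (2 * q ^ n + 93 * (real n)\<^sup>2 / K\<^sup>2 + ((1 - q) + q ^ Suc n))"
proof -
  let ?g = "\<lambda>v. q ^ n * (v\<^sup>2 + 1) + real n * trunc_err v + ((1 - q) + q ^ Suc n)"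
  have g0: "0 \<le> ?g v" for v using q trunc_err_nonneg[of v] by (intro add_nonneg_nonneg mult_nonneg_nonneg) auto
  have gi: "integrable gaussian ?g"
    unfolding trunc_err_def by (simp add: integrable_gaussian_power)
  have "(\<integral>\<^sup>+v. ennreal (1 / 2 * (\<integral>\<omega>. lik v 1 \<omega> * (B 1 \<omega> - v)\<^sup>2 \<partial>M)) \<partial>gaussian) \<le> (\<integral>\<^sup>+v. ennreal (?g v) \<partial>gaussian)"
  proof (intro nn_integral_mono ennreal_leI)
    fix v
    show "1 / 2 * (\<integral>\<omega>. lik v 1 \<omega> * (B 1 \<omega> - v)\<^sup>2 \<partial>M) \<le> ?g v" using terminal_loss[of v] g0[of v] by linarith
  qed
  also have "\<dots> = ennreal (\<integral>v. ?g v \<partial>gaussian)" using gi g0 by (intro nn_integral_eq_integral) auto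
  also have "(\<integral>v. ?g v \<partial>gaussian) = 2 * q ^ n + 93 * (real n)\<^sup>2 / K\<^sup>2 + ((1 - q) + q ^ Suc n)"
  proof -
    define c where "c = (real n)\<^sup>2 / (2 * K\<^sup>2)"
    have "real n * trunc_err v = c * (17 * v ^ 4 + 54 * v\<^sup>2 + 81)" for v
      by (simp add: trunc_err_def c_def power2_eq_square)
    then have "?g v = (q ^ n + (1 - q) + q ^ Suc n + 81 * c) + (q ^ n + 54 * c) * v\<^sup>2 + 17 * c * v ^ 4" for v
      by (simp add: algebra_simps)
    then have "(\<integral>v. ?g v \<partial>gaussian) = (q ^ n + (1 - q) + q ^ Suc n + 81 * c) + (q ^ n + 54 * c) * 1 + 17 * c * 3"
      by (simp add: integrable_gaussian_power gaussian_moments)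
    moreover have "186 * c = 93 * (real n)\<^sup>2 / K\<^sup>2" by (simp add: c_def)
    ultimately show ?thesis by simp
  qed
  finally show ?thesis .
qed

section \<open>Approximate equilibria and the choice of the parameters\<close>

lemma strategy_in_admissible_strategies: "strategy \<in> admissible_strategies M B gaussian"
  unfolding admissible_strategies_def measure_support_gaussian
proof (intro CollectI conjI ballI)
  fix t :: real assume t: "t \<in> {0..1}"
  have "sets (restrict_space borel (UNIV :: real set)) = sets borel" by (simp add: sets_restrict_space)
  then have "sets (restrict_space borel (UNIV :: real set) \<Otimes>\<^sub>M (restrict_space borel {0..t} \<Otimes>\<^sub>M F t)) = sets (borel \<Otimes>\<^sub>M (restrict_space borel {0..t} \<Otimes>\<^sub>M F t))"
    by (intro sets_pair_measure_cong refl)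
  then show "(\<lambda>(v, s, \<omega>). along B (strategy v) s \<omega>) \<in> borel_measurable (restrict_space borel UNIV \<Otimes>\<^sub>M (restrict_space borel {0..t} \<Otimes>\<^sub>M F t))"
    using strategy_joint_measurable[OF t] by (simp cong: measurable_cong_sets)
qed (rule strategy_admissible)

text \<open>Half the mean of \<open>(B 1 - v)^2\<close> serves twice: it bounds the gap between the
  best payoff and that of the strategy, and it is the distance of the latter from
  \<open>(v^2 + 1) / 2\<close>. So one estimate gives both optimality and closeness of the
  values.\<close>

lemma equilibrium:
  assumes e: "2 * q ^ n + 93 * (real n)\<^sup>2 / K\<^sup>2 + ((1 - q) + q ^ Suc n) \<le> \<epsilon>"
    "((1 - q) / q)\<^sup>2 + real n / K\<^sup>2 + (1 - grid n) \<le> \<epsilon>\<^sup>2"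
  shows "(back_price, strategy) \<in> eps_equilibria M B gaussian \<epsilon>"
    "(\<integral>\<^sup>+v\<in>measure_support gaussian. ennreal \<bar>(v\<^sup>2 + 1) / 2 - payoff M B (along B back_price) v (along B (strategy v))\<bar> \<partial>gaussian) \<le> ennreal \<epsilon>"
proof -
  let ?L = "\<lambda>v. 1 / 2 * (\<integral>\<omega>. lik v 1 \<omega> * (B 1 \<omega> - v)\<^sup>2 \<partial>M)"
  have L0: "0 \<le> ?L v" for v by (intro mult_nonneg_nonneg integral_nonneg_AE) auto
  have loss: "(\<integral>\<^sup>+v. ennreal (?L v) \<partial>gaussian) \<le> ennreal \<epsilon>"
    using expected_loss ennreal_leI[OF e(1)] by (rule order_trans)
  show "(back_price, strategy) \<in> eps_equilibria M B gaussian \<epsilon>"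
    unfolding eps_equilibria_def
  proof (intro CollectI case_prodI conjI ballI exI[of _ price])
    show "back_price \<in> pricing_rules M B" by (rule back_price_pricing_rule)
    show "strategy \<in> admissible_strategies M B gaussian" by (rule strategy_in_admissible_strategies)
    show "payoff_exists M B (along B back_price) v \<eta>" if "\<eta> \<in> admissible_controls M B" for v \<eta>
      using that by (rule payoff_exists_back_price)
    show "rational_price M B gaussian strategy price" by (rule rational_price_price)
    show "(\<integral>\<^sup>+\<omega>. (\<integral>\<^sup>+t\<in>{0..1}. ennreal (\<bar>along B back_price t \<omega> - price t \<omega>\<bar>\<^sup>2) \<partial>lborel) \<partial>M) \<le> ennreal (\<epsilon>\<^sup>2)"
      using price_distance_integral ennreal_leI[OF e(2)] by (rule order_trans)
    have "e2ennreal ((SUP \<eta>\<in>admissible_controls M B. ereal (payoff M B (along B back_price) v \<eta>))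
        - ereal (payoff M B (along B back_price) v (along B (strategy v)))) \<le> ennreal (?L v)" for v
    proof -
      have "(SUP \<eta>\<in>admissible_controls M B. ereal (payoff M B (along B back_price) v \<eta>)) \<le> ereal ((v\<^sup>2 + 1) / 2)"
      proof (rule SUP_least)
        fix \<eta> assume adm: "\<eta> \<in> admissible_controls M B"
        have "0 \<le> (\<integral>\<omega>. stoch_exp M B \<eta> 1 \<omega> * (B 1 \<omega> - v)\<^sup>2 \<partial>M)"
          by (intro integral_nonneg_AE AE_I2 mult_nonneg_nonneg) (auto simp: stoch_exp_def)
        then have "payoff M B (along B back_price) v \<eta> \<le> (v\<^sup>2 + 1) / 2"
          unfolding payoff_back_price[OF adm] by linarith
        then show "ereal (payoff M B (along B back_price) v \<eta>) \<le> ereal ((v\<^sup>2 + 1) / 2)" by (simp only: ereal_less_eq)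
      qed
      then have "(SUP \<eta>\<in>admissible_controls M B. ereal (payoff M B (along B back_price) v \<eta>))
        - ereal (payoff M B (along B back_price) v (along B (strategy v)))
        \<le> ereal ((v\<^sup>2 + 1) / 2) - ereal (payoff M B (along B back_price) v (along B (strategy v)))"
        by (intro ereal_minus_mono) auto
      also have "\<dots> = ereal (?L v)" by (simp add: payoff_strategy)
      finally have "e2ennreal ((SUP \<eta>\<in>admissible_controls M B. ereal (payoff M B (along B back_price) v \<eta>))
        - ereal (payoff M B (along B back_price) v (along B (strategy v)))) \<le> e2ennreal (ereal (?L v))"
        by (rule e2ennreal_mono)
      then show ?thesis by (simp only: ennreal_def[symmetric] e2ennreal_ereal)
    qed
    then have "(\<integral>\<^sup>+v. e2ennreal ((SUP \<eta>\<in>admissible_controls M B. ereal (payoff M B (along B back_price) v \<eta>))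
        - ereal (payoff M B (along B back_price) v (along B (strategy v)))) \<partial>gaussian) \<le> (\<integral>\<^sup>+v. ennreal (?L v) \<partial>gaussian)"
      by (intro nn_integral_mono)
    then show "(\<integral>\<^sup>+v. e2ennreal ((SUP \<eta>\<in>admissible_controls M B. ereal (payoff M B (along B back_price) v \<eta>))
        - ereal (payoff M B (along B back_price) v (along B (strategy v)))) \<partial>gaussian) \<le> ennreal \<epsilon>"
      using loss by (rule order_trans)
  qed
  have "(\<integral>\<^sup>+v\<in>measure_support gaussian. ennreal \<bar>(v\<^sup>2 + 1) / 2 - payoff M B (along B back_price) v (along B (strategy v))\<bar> \<partial>gaussian)
    = (\<integral>\<^sup>+v. ennreal (?L v) \<partial>gaussian)"
    using L0 unfolding measure_support_gaussian by (intro nn_integral_cong) (simp add: payoff_strategy)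
  then show "(\<integral>\<^sup>+v\<in>measure_support gaussian. ennreal \<bar>(v\<^sup>2 + 1) / 2 - payoff M B (along B back_price) v (along B (strategy v))\<bar> \<partial>gaussian) \<le> ennreal \<epsilon>"
    using loss by simp
qed

end

text \<open>The order of choice matters: \<open>q\<close> close to 1, then \<open>n\<close> with
  \<open>q ^ n\<close> small, then \<open>K\<close> large compared with \<open>n\<close>, because
  the cost of stopping grows with the number of grid points.\<close>

lemma (in brownian) equilibrium_exists:
  assumes \<epsilon>: "0 < \<epsilon>"
  obtains \<theta> where "(back_price, \<theta>) \<in> eps_equilibria M B gaussian \<epsilon>"
    "(\<integral>\<^sup>+v\<in>measure_support gaussian. ennreal \<bar>(v\<^sup>2 + 1) / 2 - payoff M B (along B back_price) v (along B (\<theta> v))\<bar> \<partial>gaussian) \<le> ennreal \<epsilon>"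
proof -
  \<comment> \<open>One tolerance for both conditions: each of the two sums splits into three parts
    of at most \<open>m / 8\<close>.\<close>
  define m where "m = min \<epsilon> (\<epsilon>\<^sup>2)"
  have m: "0 < m" "m \<le> \<epsilon>" "m \<le> \<epsilon>\<^sup>2" using \<epsilon> by (auto simp: m_def)
  \<comment> \<open>\<open>p <= 1 / 2\<close> keeps \<open>1 / q\<close> at most 2, so that
    \<open>(1 - q) / q <= 2 * p\<close>.\<close>
  define p where "p = min (1 / 2) (m / 16)"
  have p: "0 < p" "p \<le> 1 / 2" "p \<le> m / 16" using m by (auto simp: p_def)
  define q where "q = 1 - p"
  have q: "0 < q" "q < 1" "1 / 2 \<le> q" using p by (auto simp: q_def)
  obtain n where n: "q ^ n < m / 16" using real_arch_pow_inv[of "m / 16" q] m q by auto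
  \<comment> \<open>The constant 800 = 8 * 100 brings \<open>93 * (real n)^2 / K^2\<close> below
    \<open>m / 8\<close>; the \<open>+ 1\<close> keeps \<open>K\<close> positive for
    \<open>n = 0\<close>.\<close>
  define K where "K = sqrt (800 * (real n + 1)\<^sup>2 / m)"
  have K2: "K\<^sup>2 = 800 * (real n + 1)\<^sup>2 / m" and K: "0 < K" using m by (auto simp: K_def)
  interpret T: truncated_bridge M B q K n using q K by unfold_locales auto
  have a1: "93 * (real n)\<^sup>2 / K\<^sup>2 \<le> m / 8"
  proof -
    have "(real n)\<^sup>2 \<le> (real n + 1)\<^sup>2" by (intro power_mono) auto
    moreover have "0 \<le> (real n + 1)\<^sup>2" by simp
    ultimately have "93 * (real n)\<^sup>2 \<le> 100 * (real n + 1)\<^sup>2" by linarith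
    then have "m * (93 * (real n)\<^sup>2) \<le> m * (100 * (real n + 1)\<^sup>2)" using m by (intro mult_left_mono) auto
    then show ?thesis unfolding K2 using m by (simp add: field_simps)
  qed
  have a2: "real n / K\<^sup>2 \<le> m / 8"
  proof -
    have "real n * 1 \<le> (real n + 1) * (real n + 1)" by (intro mult_mono) auto
    then have "m * real n \<le> m * (100 * (real n + 1)\<^sup>2)" using m by (intro mult_left_mono) (auto simp: power2_eq_square)
    then show ?thesis unfolding K2 using m by (simp add: field_simps)
  qed
  have a3: "((1 - q) / q)\<^sup>2 \<le> m / 8"
  proof -
    have "(1 - q) / q \<le> 2 * p" using q p by (simp add: q_def field_simps)
    then have "((1 - q) / q)\<^sup>2 \<le> (2 * p)\<^sup>2" using q by (intro power_mono) auto
    also have "\<dots> = (2 * p) * (2 * p)" by (simp add: power2_eq_square)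
    also have "\<dots> \<le> 1 * (2 * p)" using p by (intro mult_right_mono) auto
    finally show ?thesis using p by simp
  qed
  have a4: "q ^ Suc n \<le> m / 16" 
  proof -
    have "q ^ Suc n \<le> q ^ n" by (rule power_decreasing) (use q in auto)
    then show ?thesis using n by linarith
  qed
  have a5: "1 - T.grid n \<le> m / 8"
  proof -
    have "1 - q = p" by (simp add: q_def)
    then show ?thesis using T.grid_diff_last a4 p unfolding T.grid_last by linarith
  qed
  have e1: "2 * q ^ n + 93 * (real n)\<^sup>2 / K\<^sup>2 + ((1 - q) + q ^ Suc n) \<le> \<epsilon>"
  proof -
    have "1 - q = p" by (simp add: q_def)
    then show ?thesis using a1 a4 n p m by linarith
  qed
  have e2: "((1 - q) / q)\<^sup>2 + real n / K\<^sup>2 + (1 - T.grid n) \<le> \<epsilon>\<^sup>2"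
    using a2 a3 a5 m by linarith
  show thesis by (rule that[OF T.equilibrium[OF e1 e2]])
qed

section \<open>The strong payoff of the bridge strategy\<close>

lemma lborel_integral_eq:
  fixes f :: "real \<Rightarrow> real"
  assumes "continuous_on {a..b} f"
  shows "set_integrable lborel {a..b} f" "(LINT x:{a..b}|lborel. f x) = integral {a..b} f"
proof -
  show i: "set_integrable lborel {a..b} f"
    using borel_integrable_atLeastAtMost'[OF assms] .
  show "(LINT x:{a..b}|lborel. f x) = integral {a..b} f" by (rule set_borel_integral_eq_integral(2)[OF i])
qed

lemma lborel_integral_FTC:
  fixes F f :: "real \<Rightarrow> real"
  assumes ab: "a \<le> b" and f: "continuous_on {a..b} f"
    and F: "\<And>x. a \<le> x \<Longrightarrow> x \<le> b \<Longrightarrow> (F has_real_derivative f x) (at x within {a..b})"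
  shows "(LINT x:{a..b}|lborel. f x) = F b - F a"
proof -
  have "(f has_integral (F b - F a)) {a..b}"
    using F by (intro fundamental_theorem_of_calculus[OF ab]) (auto simp: has_real_derivative_iff_has_vector_derivative)
  then show ?thesis unfolding lborel_integral_eq(2)[OF f] by (rule integral_unique)
qed

lemma lborel_integral_deriv:
  fixes f :: "real \<Rightarrow> real"
  assumes f: "continuous_on {a..b} f" and x: "x \<in> {a..b}"
  shows "((\<lambda>t. LINT s:{a..t}|lborel. f s) has_real_derivative f x) (at x within {a..b})"
proof -
  have "((\<lambda>t. integral {a..t} f) has_real_derivative f x) (at x within {a..b})"
    using integral_has_vector_derivative[OF f x] by (simp add: has_real_derivative_iff_has_vector_derivative)
  then show ?thesis
  proof (rule has_field_derivative_transform_within[OF _ zero_less_one x])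
    fix t assume "t \<in> {a..b}"
    then show "integral {a..t} f = (LINT s:{a..t}|lborel. f s)"
      using continuous_on_subset[OF f, of "{a..t}"] lborel_integral_eq(2)[of a t f] by auto
  qed
qed

text \<open>Around \<open>t < 1\<close> the interval up to \<open>(t + 1) / 2\<close> is a
  neighbourhood relative to the half-open interval, so continuity on compact initial intervals is
  enough.\<close>

lemma continuous_on_half_open:
  fixes f :: "real \<Rightarrow> real"
  assumes "\<And>t. 0 \<le> t \<Longrightarrow> t < 1 \<Longrightarrow> continuous_on {0..t} f"
  shows "continuous_on {0..<1} f"
  unfolding continuous_on_eq_continuous_within
proof
  fix t :: real assume t: "t \<in> {0..<1}"
  let ?s = "(t + 1) / 2"
  have "continuous (at t within {0..?s}) f"
    using assms[of ?s] t by (simp add: continuous_on_eq_continuous_within)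
  moreover have "at t within {0..?s} = at t within {0..<1}"
    by (rule at_within_nhd[where S="{..<?s}"]) (use t in auto)
  ultimately show "continuous (at t within {0..<1}) f" by simp
qed

section \<open>Pathwise solution of the bridge equation\<close>

context
  fixes b :: "real \<Rightarrow> real" and v :: real
  assumes b: "continuous_on {0..1} b" and b0: "b 0 = 0"
begin

text \<open>The derivative of (Q - b)/(1 - t) along any solution: 1/(1 - t) is the integrating
  factor of this linear equation.\<close>

private definition "f s = (v - b s) / (1 - s)\<^sup>2"
private definition "A t = (LINT s:{0..t}|lborel. f s)"

private lemma f_cont: "T < 1 \<Longrightarrow> continuous_on {0..T} f"
  unfolding f_def[abs_def] by (intro continuous_intros continuous_on_subset[OF b]) auto

private lemma A_deriv: "T < 1 \<Longrightarrow> x \<in> {0..T} \<Longrightarrow> (A has_real_derivative f x) (at x within {0..T})"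
  unfolding A_def[abs_def] by (rule lborel_integral_deriv[OF f_cont])

private lemma A_0: "A 0 = 0"
  unfolding A_def by (subst lborel_integral_eq(2)) auto

private lemma A_cont: "T < 1 \<Longrightarrow> continuous_on {0..T} A"
  by (rule DERIV_continuous_on[where D=f]) (rule A_deriv)

text \<open>By the product rule the derivative of \<open>(1 - t) * A t\<close> is
  \<open>(v - b t) / (1 - t) - A t\<close>, and this is the drift
  \<open>(v - Q t) / (1 - t)\<close>.\<close>

lemma bridge_ode_exists:
  fixes t :: real
  defines "Q \<equiv> \<lambda>t. b t + (1 - t) * (LINT s:{0..t}|lborel. (v - b s) / (1 - s)\<^sup>2)"
  assumes t: "0 \<le> t" "t < 1"
  shows "set_integrable lborel {0..t} (\<lambda>s. (v - Q s) / (1 - s))" "(LINT s:{0..t}|lborel. (v - Q s) / (1 - s)) + b t = Q t"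
    "continuous_on {0..t} Q"
proof -
  have Q: "Q = (\<lambda>t. b t + (1 - t) * A t)" unfolding Q_def A_def f_def ..
  have "continuous_on {0..t} b" by (rule continuous_on_subset[OF b]) (use t in auto)
  then show Qc: "continuous_on {0..t} Q" unfolding Q by (intro continuous_intros A_cont t)
  have c: "continuous_on {0..t} (\<lambda>s. (v - Q s) / (1 - s))" by (intro continuous_intros Qc) (use t in auto)
  then show "set_integrable lborel {0..t} (\<lambda>s. (v - Q s) / (1 - s))" by (rule lborel_integral_eq)
  have "(LINT s:{0..t}|lborel. (v - Q s) / (1 - s)) = (1 - t) * A t - (1 - 0) * A 0"
  proof (rule lborel_integral_FTC[OF t(1) c])
    fix x assume x: "0 \<le> x" "x \<le> t"
    have "((\<lambda>x. (1 - x) * A x) has_real_derivative (0 - 1) * A x + f x * (1 - x)) (at x within {0..t})"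
      using x t by (intro DERIV_mult DERIV_diff DERIV_const DERIV_ident A_deriv) auto
    moreover have "(0 - 1) * A x + f x * (1 - x) = (v - Q x) / (1 - x)"
    proof -
      define y where "y = 1 - x"
      have "y \<noteq> 0" using x t by (simp add: y_def)
      then have "(v - b x) / y\<^sup>2 * y = (v - b x) / y" "(v - (b x + y * A x)) / y = (v - b x) / y - A x"
        by (simp_all add: power2_eq_square field_simps)
      then show ?thesis unfolding Q f_def y_def by simp
    qed
    ultimately show "((\<lambda>x. (1 - x) * A x) has_real_derivative (v - Q x) / (1 - x)) (at x within {0..t})" by simp
  qed
  then show "(LINT s:{0..t}|lborel. (v - Q s) / (1 - s)) + b t = Q t" by (simp add: A_0 Q)
qed

text \<open>Called for because \<open>order_flow\<close> is an arbitrary choice among solutions.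
  Divided by \<open>1 - t\<close>, the drift part of any solution has derivative \<open>f\<close>,
  which does not involve the solution.\<close>

lemma bridge_ode_unique:
  assumes Q: "continuous_on {0..<1} Q" "\<And>t. 0 \<le> t \<Longrightarrow> t < 1 \<Longrightarrow> Q t = (LINT s:{0..t}|lborel. (v - Q s) / (1 - s)) + b t"
    and t: "0 \<le> t" "t < 1"
  shows "Q t = b t + (1 - t) * (LINT s:{0..t}|lborel. (v - b s) / (1 - s)\<^sup>2)"
proof -
  let ?h = "\<lambda>s. (v - Q s) / (1 - s)" and ?Y = "\<lambda>u. LINT s:{0..u}|lborel. (v - Q s) / (1 - s)"
  have hc: "continuous_on {0..t} ?h" using t by (intro continuous_intros continuous_on_subset[OF Q(1)]) auto
  have "A t = ?Y t / (1 - t) - ?Y 0 / (1 - 0)"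
    unfolding A_def
  proof (rule lborel_integral_FTC[OF t(1) f_cont[OF t(2)]])
    fix x assume x: "0 \<le> x" "x \<le> t"
    have "((\<lambda>x. ?Y x / (1 - x)) has_real_derivative (?h x * (1 - x) - ?Y x * (0 - 1)) / ((1 - x) * (1 - x))) (at x within {0..t})"
      using x t by (intro DERIV_divide DERIV_diff DERIV_const DERIV_ident lborel_integral_deriv[OF hc]) auto
    moreover have "(?h x * (1 - x) - ?Y x * (0 - 1)) / ((1 - x) * (1 - x)) = f x"
      using x t Q(2)[of x] by (simp add: f_def power2_eq_square)
    ultimately show "((\<lambda>x. ?Y x / (1 - x)) has_real_derivative f x) (at x within {0..t})" by simp
  qed
  moreover have "?Y 0 = 0" using Q(2)[of 0] b0 lborel_integral_eq(2)[of 0 0 ?h] by simp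
  ultimately have "?Y t = (1 - t) * A t" using t by simp
  then show ?thesis using Q(2)[OF t] unfolding A_def f_def by simp
qed

end

context brownian begin

lemma bridge_path_eq: "0 \<le> s \<Longrightarrow> along Q (back_strategy v) s \<omega> = (v - Q s \<omega>) / (1 - s)"
  by (simp add: along_def back_strategy_def path_upto_def)

text \<open>The classical formula, v t plus (1-t) times the integral of dB/(1-s), integrated by
  parts: in this form it makes sense for each path without a stochastic integral.\<close>

definition bridge :: "real \<Rightarrow> real \<Rightarrow> 'a \<Rightarrow> real" where
  "bridge v t \<omega> = B t \<omega> + (1 - t) * (LINT s:{0..t}|lborel. (v - B s \<omega>) / (1 - s)\<^sup>2)"

lemma integral_along_bridge:
  assumes "0 \<le> t"
  shows "(LINT s:{0..t}|lborel. along Q (back_strategy v) s \<omega>) = (LINT s:{0..t}|lborel. (v - Q s \<omega>) / (1 - s))"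
    "set_integrable lborel {0..t} (\<lambda>s. along Q (back_strategy v) s \<omega>) \<longleftrightarrow> set_integrable lborel {0..t} (\<lambda>s. (v - Q s \<omega>) / (1 - s))"
proof -
  have eq: "indicator {0..t} s *\<^sub>R along Q (back_strategy v) s \<omega> = indicator {0..t} s *\<^sub>R ((v - Q s \<omega>) / (1 - s))" for s
    by (cases "s \<in> {0..t}") (simp_all add: bridge_path_eq)
  show "(LINT s:{0..t}|lborel. along Q (back_strategy v) s \<omega>) = (LINT s:{0..t}|lborel. (v - Q s \<omega>) / (1 - s))"
    "set_integrable lborel {0..t} (\<lambda>s. along Q (back_strategy v) s \<omega>) \<longleftrightarrow> set_integrable lborel {0..t} (\<lambda>s. (v - Q s \<omega>) / (1 - s))"
    unfolding set_lebesgue_integral_def set_integrable_def eq by auto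
qed

lemma bridge_solves: "solves_sde M B (back_strategy v) (bridge v)"
  unfolding solves_sde_def
proof (intro conjI ballI)
  fix t :: real assume "t \<in> {0..<1}"
  then have t: "0 \<le> t" "t < 1" by auto
  let ?L = "restrict_space lborel {0..t}"
  interpret L: sigma_finite_measure ?L
    by (rule sigma_finite_measure_restrict_space[OF sigma_finite_lborel]) auto
  have "(\<lambda>(r, \<omega>). B r \<omega>) \<in> borel_measurable (restrict_space borel {0..t} \<Otimes>\<^sub>M F t)"
    using progressive_B t by (auto simp: progressive_def)
  then have "(\<lambda>z. B (snd z) (fst z)) \<in> borel_measurable (F t \<Otimes>\<^sub>M restrict_space borel {0..t})"
    using measurable_pair_swap[of "\<lambda>(r, \<omega>). B r \<omega>"] by (simp add: case_prod_beta)
  moreover have "sets (F t \<Otimes>\<^sub>M restrict_space borel {0..t}) = sets (F t \<Otimes>\<^sub>M ?L)"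
    by (intro sets_pair_measure_cong refl sets_restrict_space_cong) simp
  ultimately have [measurable]: "(\<lambda>z. B (snd z) (fst z)) \<in> borel_measurable (F t \<Otimes>\<^sub>M ?L)"
    by (simp cong: measurable_cong_sets)
  have [measurable]: "(\<lambda>s. s) \<in> borel_measurable ?L" by (intro measurable_restrict_space1) simp
  have "(\<lambda>\<omega>. \<integral>s. (v - B s \<omega>) / (1 - s)\<^sup>2 \<partial>?L) \<in> borel_measurable (F t)"
    by (rule L.borel_measurable_lebesgue_integral, unfold case_prod_beta) measurable
  moreover have "(\<integral>s. (v - B s \<omega>) / (1 - s)\<^sup>2 \<partial>?L) = (LINT s:{0..t}|lborel. (v - B s \<omega>) / (1 - s)\<^sup>2)" for \<omega>
    unfolding set_lebesgue_integral_def by (subst integral_restrict_space) auto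
  moreover have "B t \<in> borel_measurable (F t)" using t by (intro measurable_natural_filtration) auto
  ultimately show "bridge v t \<in> borel_measurable (F t)" unfolding bridge_def[abs_def] by simp
next
  fix \<omega> assume \<omega>: "\<omega> \<in> space M"
  note ex = bridge_ode_exists[OF B_continuous[OF \<omega>] B_0[OF \<omega>], where v=v, folded bridge_def]
  show "continuous_on {0..<1} (\<lambda>t. bridge v t \<omega>)" by (rule continuous_on_half_open) (rule ex(3))
  fix t :: real assume "t \<in> {0..<1}"
  then have t: "0 \<le> t" "t < 1" by auto
  show "set_integrable lborel {0..t} (\<lambda>s. along (bridge v) (back_strategy v) s \<omega>)"
    using ex(1)[OF t] by (simp add: integral_along_bridge[OF t(1)])
  show "bridge v t \<omega> = (LINT s:{0..t}|lborel. along (bridge v) (back_strategy v) s \<omega>) + B t \<omega>"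
    using ex(2)[OF t] by (simp add: integral_along_bridge[OF t(1)])
qed

lemma order_flow_bridge:
  assumes \<omega>: "\<omega> \<in> space M" and t: "0 \<le> t" "t < 1"
  shows "order_flow M B (back_strategy v) t \<omega> = bridge v t \<omega>"
proof -
  let ?Q = "order_flow M B (back_strategy v)"
  have S: "solves_sde M B (back_strategy v) ?Q"
    unfolding order_flow_def by (rule someI[of "solves_sde M B (back_strategy v)", OF bridge_solves])
  show ?thesis
    unfolding bridge_def
  proof (rule bridge_ode_unique[OF B_continuous[OF \<omega>] B_0[OF \<omega>] _ _ t])
    show "continuous_on {0..<1} (\<lambda>t. ?Q t \<omega>)" using S \<omega> by (simp add: solves_sde_def)
    fix t :: real assume t: "0 \<le> t" "t < 1"
    then have "?Q t \<omega> = (LINT s:{0..t}|lborel. along ?Q (back_strategy v) s \<omega>) + B t \<omega>"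
      using S \<omega> by (simp add: solves_sde_def)
    then show "?Q t \<omega> = (LINT s:{0..t}|lborel. (v - ?Q s \<omega>) / (1 - s)) + B t \<omega>"
      by (simp add: integral_along_bridge[OF t(1)])
  qed
qed

section \<open>Second moment of the bridge\<close>

lemma B_covariance:
  assumes "0 \<le> s" "s \<le> 1" "0 \<le> u" "u \<le> 1"
  shows "(\<integral>\<omega>. B s \<omega> * B u \<omega> \<partial>M) = min s u"
proof -
  have "(\<integral>\<omega>. B s \<omega> * B u \<omega> \<partial>M) = s" if "0 \<le> s" "s \<le> u" "u \<le> 1" for s u
  proof -
    have Bs: "B s \<in> borel_measurable (F s)" using that by (intro measurable_natural_filtration) auto
    have i: "has_bochner_integral M (\<lambda>\<omega>. B s \<omega> * (B u \<omega> - B s \<omega>)) ((\<integral>\<omega>. B s \<omega> \<partial>M) * (\<integral>\<omega>. B u \<omega> - B s \<omega> \<partial>M))"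
      using adapted_times_increment[OF that(1,2,3) Bs integrable_B, of "\<lambda>x. x"] integrable_increment[OF that] that by simp
    have "(\<integral>\<omega>. B s \<omega> * B u \<omega> \<partial>M) = (\<integral>\<omega>. B s \<omega> * (B u \<omega> - B s \<omega>) + (B s \<omega>)\<^sup>2 \<partial>M)"
      by (intro Bochner_Integration.integral_cong) (simp_all add: power2_eq_square algebra_simps)
    also have "\<dots> = 0 + s"
      using i integrable_B_power[of s 2] B_moments[of s] that by (simp add: has_bochner_integral_iff)
    finally show ?thesis by simp
  qed
  from this[of s u] this[of u s] assms show ?thesis by (cases "s \<le> u") (simp_all add: mult.commute min_def)
qed

text \<open>Fubini. With \<open>X\<close> a value of \<open>B\<close> it gives the covariance with a
  time integral, and with \<open>X\<close> that time integral itself its variance, so that only the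
  covariances of Brownian motion remain to be integrated.\<close>

lemma time_integral_product:
  assumes g: "g \<in> borel_measurable I01" "\<And>s. s \<in> {0..1} \<Longrightarrow> \<bar>g s\<bar> \<le> C"
    and X: "X \<in> borel_measurable M" "integrable M (\<lambda>\<omega>. (X \<omega>)\<^sup>2)"
  shows "integrable M (\<lambda>\<omega>. X \<omega> * (\<integral>s. g s * B s \<omega> \<partial>I01))"
    "(\<integral>\<omega>. X \<omega> * (\<integral>s. g s * B s \<omega> \<partial>I01) \<partial>M) = (\<integral>s. g s * (\<integral>\<omega>. X \<omega> * B s \<omega> \<partial>M) \<partial>I01)"
proof -
  interpret P: pair_sigma_finite M I01 by standard
  have C: "0 \<le> C" using g(2)[of 0] by simp
  note [measurable] = g(1) X(1) progressive_joint_measurable[OF progressive_B]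
  have "integrable (M \<Otimes>\<^sub>M I01) (\<lambda>(\<omega>, s). X \<omega> * (g s * B s \<omega>))"
  proof (rule integrableI_bounded)
    show "(\<lambda>(\<omega>, s). X \<omega> * (g s * B s \<omega>)) \<in> borel_measurable (M \<Otimes>\<^sub>M I01)" by measurable
    have "(\<integral>\<^sup>+z. ennreal (norm (case z of (\<omega>, s) \<Rightarrow> X \<omega> * (g s * B s \<omega>))) \<partial>(M \<Otimes>\<^sub>M I01))
      = (\<integral>\<^sup>+\<omega>. \<integral>\<^sup>+s. ennreal (norm (case (\<omega>, s) of (\<omega>, s) \<Rightarrow> X \<omega> * (g s * B s \<omega>))) \<partial>I01 \<partial>M)"
      by (rule I01.nn_integral_fst[symmetric]) measurable
    also have "\<dots> \<le> (\<integral>\<^sup>+\<omega>. \<integral>\<^sup>+s. ennreal (C * ((X \<omega>)\<^sup>2 + (B s \<omega>)\<^sup>2)) \<partial>I01 \<partial>M)"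
    proof (intro nn_integral_mono, unfold prod.case, intro ennreal_leI)
      fix \<omega> s assume s: "s \<in> space I01"
      have "\<bar>X \<omega>\<bar> * \<bar>B s \<omega>\<bar> \<le> (X \<omega>)\<^sup>2 + (B s \<omega>)\<^sup>2" by (rule mult_le_square_sum)
      then have "\<bar>g s\<bar> * (\<bar>X \<omega>\<bar> * \<bar>B s \<omega>\<bar>) \<le> C * ((X \<omega>)\<^sup>2 + (B s \<omega>)\<^sup>2)" using g(2)[of s] s C by (intro mult_mono) auto
      then show "norm (X \<omega> * (g s * B s \<omega>)) \<le> C * ((X \<omega>)\<^sup>2 + (B s \<omega>)\<^sup>2)" by (simp add: abs_mult ac_simps)
    qed
    also have "\<dots> = (\<integral>\<^sup>+s. \<integral>\<^sup>+\<omega>. ennreal (C * ((X \<omega>)\<^sup>2 + (B s \<omega>)\<^sup>2)) \<partial>M \<partial>I01)"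
      by (rule P.Fubini'[symmetric]) measurable
    also have "\<dots> \<le> (\<integral>\<^sup>+s. ennreal (C * ((\<integral>\<omega>. (X \<omega>)\<^sup>2 \<partial>M) + 1)) \<partial>I01)"
    proof (rule nn_integral_mono)
      fix s assume "s \<in> space I01"
      then have s: "0 \<le> s" "s \<le> 1" by auto
      have "(\<integral>\<^sup>+\<omega>. ennreal (C * ((X \<omega>)\<^sup>2 + (B s \<omega>)\<^sup>2)) \<partial>M) = ennreal (\<integral>\<omega>. C * ((X \<omega>)\<^sup>2 + (B s \<omega>)\<^sup>2) \<partial>M)"
        using X(2) integrable_B_power[OF s, of 2] C by (intro nn_integral_eq_integral) auto
      also have "(\<integral>\<omega>. C * ((X \<omega>)\<^sup>2 + (B s \<omega>)\<^sup>2) \<partial>M) = C * ((\<integral>\<omega>. (X \<omega>)\<^sup>2 \<partial>M) + s)"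
        using X(2) integrable_B_power[OF s, of 2] by (simp add: B_moments[OF s])
      also have "ennreal \<dots> \<le> ennreal (C * ((\<integral>\<omega>. (X \<omega>)\<^sup>2 \<partial>M) + 1))" using C s by (intro ennreal_leI mult_left_mono) auto
      finally show "(\<integral>\<^sup>+\<omega>. ennreal (C * ((X \<omega>)\<^sup>2 + (B s \<omega>)\<^sup>2)) \<partial>M) \<le> ennreal (C * ((\<integral>\<omega>. (X \<omega>)\<^sup>2 \<partial>M) + 1))" .
    qed
    also have "\<dots> < \<infinity>" using I01.emeasure_space_1 by simp
    finally show "(\<integral>\<^sup>+z. ennreal (norm (case z of (\<omega>, s) \<Rightarrow> X \<omega> * (g s * B s \<omega>))) \<partial>(M \<Otimes>\<^sub>M I01)) < \<infinity>" .
  qed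
  note i = this
  have pull: "(\<integral>s. X \<omega> * (g s * B s \<omega>) \<partial>I01) = X \<omega> * (\<integral>s. g s * B s \<omega> \<partial>I01)" for \<omega> by simp
  show "integrable M (\<lambda>\<omega>. X \<omega> * (\<integral>s. g s * B s \<omega> \<partial>I01))"
    using P.integrable_fst[OF i] by (simp only: pull)
  have "(\<integral>\<omega>. X \<omega> * (\<integral>s. g s * B s \<omega> \<partial>I01) \<partial>M) = (\<integral>\<omega>. \<integral>s. X \<omega> * (g s * B s \<omega>) \<partial>I01 \<partial>M)" by (simp only: pull)
  also have "\<dots> = (\<integral>s. \<integral>\<omega>. X \<omega> * (g s * B s \<omega>) \<partial>M \<partial>I01)" by (rule P.Fubini_integral[OF i, symmetric])
  also have "\<dots> = (\<integral>s. g s * (\<integral>\<omega>. X \<omega> * B s \<omega> \<partial>M) \<partial>I01)"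
  proof -
    have "(\<lambda>\<omega>. X \<omega> * (g s * B s \<omega>)) = (\<lambda>\<omega>. g s * (X \<omega> * B s \<omega>))" for s by (auto simp: ac_simps)
    then show ?thesis by simp
  qed
  finally show "(\<integral>\<omega>. X \<omega> * (\<integral>s. g s * B s \<omega> \<partial>I01) \<partial>M) = (\<integral>s. g s * (\<integral>\<omega>. X \<omega> * B s \<omega> \<partial>M) \<partial>I01)" .
qed

text \<open>Jensen's inequality over the unit interval, path by path, followed by Fubini.\<close>

lemma time_integral_square_integrable:
  assumes g: "g \<in> borel_measurable I01" "\<And>s. s \<in> {0..1} \<Longrightarrow> \<bar>g s\<bar> \<le> C"
  shows "(\<lambda>\<omega>. \<integral>s. g s * B s \<omega> \<partial>I01) \<in> borel_measurable M"
    "integrable M (\<lambda>\<omega>. (\<integral>s. g s * B s \<omega> \<partial>I01)\<^sup>2)"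
proof -
  interpret P: pair_sigma_finite M I01 by standard
  have C: "0 \<le> C" using g(2)[of 0] by simp
  note [measurable] = g(1) progressive_joint_measurable[OF progressive_B]
  show m[measurable]: "(\<lambda>\<omega>. \<integral>s. g s * B s \<omega> \<partial>I01) \<in> borel_measurable M"
    by (rule I01.borel_measurable_lebesgue_integral) measurable
  show "integrable M (\<lambda>\<omega>. (\<integral>s. g s * B s \<omega> \<partial>I01)\<^sup>2)"
  proof (rule integrableI_bounded)
    have "(\<integral>\<^sup>+\<omega>. ennreal (norm ((\<integral>s. g s * B s \<omega> \<partial>I01)\<^sup>2)) \<partial>M) \<le> (\<integral>\<^sup>+\<omega>. \<integral>\<^sup>+s. ennreal (C\<^sup>2 * (B s \<omega>)\<^sup>2) \<partial>I01 \<partial>M)"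
    proof (rule nn_integral_mono)
      fix \<omega> assume \<omega>: "\<omega> \<in> space M"
      have Bm[measurable]: "(\<lambda>s. B s \<omega>) \<in> borel_measurable I01" by (rule progressive_section_measurable[OF progressive_B \<omega>])
      obtain D where D: "\<And>s. s \<in> {0..1} \<Longrightarrow> \<bar>B s \<omega>\<bar> \<le> D"
        using compact_imp_bounded[OF compact_continuous_image[OF B_continuous[OF \<omega>]]] unfolding bounded_iff by fastforce
      have D0: "0 \<le> D" using D[of 0] by simp
      let ?h = "\<lambda>s. g s * B s \<omega>" and ?m = "\<integral>s. g s * B s \<omega> \<partial>I01"
      have hb: "\<bar>?h s\<bar> \<le> C * D" if "s \<in> {0..1}" for s
        using g(2)[OF that] D[OF that] C by (simp add: abs_mult mult_mono)
      have hi: "integrable I01 ?h" by (rule integrable_I01_bounded[where C="C * D"]) (measurable, rule hb)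
      have hi2: "integrable I01 (\<lambda>s. (?h s)\<^sup>2)"
        by (rule integrable_I01_bounded[where C="(C * D)\<^sup>2"]) (measurable, use hb C D0 in \<open>simp add: abs_le_square_iff[symmetric]\<close>)
      have Bi: "integrable I01 (\<lambda>s. C\<^sup>2 * (B s \<omega>)\<^sup>2)"
        by (intro Bochner_Integration.integrable_mult_right integrable_I01_bounded[where C="D\<^sup>2"])
          (measurable, use D D0 in \<open>simp add: abs_le_square_iff[symmetric]\<close>)
      have "0 \<le> (\<integral>s. (?h s - ?m)\<^sup>2 \<partial>I01)" by (rule integral_nonneg_AE) simp
      also have "\<dots> = (\<integral>s. (?h s)\<^sup>2 \<partial>I01) - ?m\<^sup>2"
        unfolding power2_diff using hi hi2 I01.prob_space by (simp add: power2_eq_square)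
      finally have "?m\<^sup>2 \<le> (\<integral>s. (?h s)\<^sup>2 \<partial>I01)" by simp
      also have "\<dots> \<le> (\<integral>s. C\<^sup>2 * (B s \<omega>)\<^sup>2 \<partial>I01)"
      proof (rule integral_mono[OF hi2 Bi])
        fix s assume "s \<in> space I01"
        then have "(g s)\<^sup>2 \<le> C\<^sup>2" using g(2)[of s] C by (simp add: abs_le_square_iff[symmetric])
        then show "(?h s)\<^sup>2 \<le> C\<^sup>2 * (B s \<omega>)\<^sup>2" by (simp add: power_mult_distrib mult_right_mono)
      qed
      finally have "ennreal (norm (?m\<^sup>2)) \<le> ennreal (\<integral>s. C\<^sup>2 * (B s \<omega>)\<^sup>2 \<partial>I01)" by (simp add: ennreal_leI)
      also have "\<dots> = (\<integral>\<^sup>+s. ennreal (C\<^sup>2 * (B s \<omega>)\<^sup>2) \<partial>I01)" by (rule nn_integral_eq_integral[OF Bi, symmetric]) simp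
      finally show "ennreal (norm (?m\<^sup>2)) \<le> (\<integral>\<^sup>+s. ennreal (C\<^sup>2 * (B s \<omega>)\<^sup>2) \<partial>I01)" .
    qed
    also have "\<dots> = (\<integral>\<^sup>+s. \<integral>\<^sup>+\<omega>. ennreal (C\<^sup>2 * (B s \<omega>)\<^sup>2) \<partial>M \<partial>I01)" by (rule P.Fubini'[symmetric]) measurable
    also have "\<dots> \<le> (\<integral>\<^sup>+s. ennreal (C\<^sup>2) \<partial>I01)"
    proof (rule nn_integral_mono)
      fix s assume "s \<in> space I01"
      then have s: "0 \<le> s" "s \<le> 1" by auto
      have "(\<integral>\<^sup>+\<omega>. ennreal (C\<^sup>2 * (B s \<omega>)\<^sup>2) \<partial>M) = ennreal (\<integral>\<omega>. C\<^sup>2 * (B s \<omega>)\<^sup>2 \<partial>M)"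
        using integrable_B_power[OF s, of 2] by (intro nn_integral_eq_integral) auto
      also have "\<dots> = ennreal (C\<^sup>2 * s)" by (simp add: B_moments[OF s])
      also have "\<dots> \<le> ennreal (C\<^sup>2)" using s by (intro ennreal_leI mult_left_le) auto
      finally show "(\<integral>\<^sup>+\<omega>. ennreal (C\<^sup>2 * (B s \<omega>)\<^sup>2) \<partial>M) \<le> ennreal (C\<^sup>2)" .
    qed
    also have "\<dots> < \<infinity>" using I01.emeasure_space_1 by simp
    finally show "(\<integral>\<^sup>+\<omega>. ennreal (norm ((\<integral>s. g s * B s \<omega> \<partial>I01)\<^sup>2)) \<partial>M) < \<infinity>" .
  qed measurable
qed

text \<open>The kernel of the bridge formula, cut off at \<open>t\<close>. For \<open>t < 1\<close>
  it is bounded, as the lemmas on time integrals require.\<close>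

definition wt :: "real \<Rightarrow> real \<Rightarrow> real" where
  "wt t s = indicator {0..t} s / (1 - s)\<^sup>2"

lemma wt_measurable [measurable]: "wt t \<in> borel_measurable I01"
proof -
  have [measurable]: "(\<lambda>s. s) \<in> borel_measurable I01" "(indicator {0..t} :: real \<Rightarrow> real) \<in> borel_measurable I01"
    unfolding I01_def by (intro measurable_restrict_space1, simp)+
  show ?thesis unfolding wt_def[abs_def] by measurable
qed

lemma wt_bound:
  assumes "t < 1" shows "\<bar>wt t s\<bar> \<le> 1 / (1 - t)\<^sup>2"
proof (cases "s \<in> {0..t}")
  case True
  then have "(1 - t)\<^sup>2 \<le> (1 - s)\<^sup>2" using assms by (intro power_mono) auto
  then have "1 / (1 - s)\<^sup>2 \<le> 1 / (1 - t)\<^sup>2" using assms by (intro divide_left_mono mult_pos_pos) auto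
  then show ?thesis using True by (simp add: wt_def)
qed (simp add: wt_def)

lemma integral_wt:
  assumes t: "0 \<le> t" "t < 1"
  shows "(\<integral>s. wt t s * f s \<partial>I01) = (LINT s:{0..t}|lborel. f s / (1 - s)\<^sup>2)"
proof -
  have "indicator {0..1} s *\<^sub>R (wt t s * f s) = indicator {0..t} s *\<^sub>R (f s / (1 - s)\<^sup>2)" for s
    using t by (auto simp: wt_def split: split_indicator)
  then show ?thesis unfolding integral_I01 set_lebesgue_integral_def by simp
qed

lemma integral_wt_min:
  assumes u: "0 \<le> u" "u \<le> t" and t: "t < 1"
  shows "(\<integral>s. wt t s * min s u \<partial>I01) = ln (1 - u) + u / (1 - t)"
proof -
  let ?F = "\<lambda>s. if s \<le> u then 1 / (1 - s) + ln (1 - s) else u / (1 - s) + (1 + ln (1 - u))"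
  have c: "continuous_on {0..t} (\<lambda>s. min s u / (1 - s)\<^sup>2)" using t by (intro continuous_intros) auto
  have "(LINT s:{0..t}|lborel. min s u / (1 - s)\<^sup>2) = integral {0..t} (\<lambda>s. min s u / (1 - s)\<^sup>2)"
    by (rule lborel_integral_eq(2)[OF c])
  \<comment> \<open>Split at the kink of \<open>min s u\<close>: below \<open>u\<close> an
    antiderivative is \<open>1 / (1 - s) + ln (1 - s)\<close>, above it
    \<open>u / (1 - s)\<close>.\<close>
  also have "\<dots> = integral {0..u} (\<lambda>s. min s u / (1 - s)\<^sup>2) + integral {u..t} (\<lambda>s. min s u / (1 - s)\<^sup>2)"
    by (rule Henstock_Kurzweil_Integration.integral_combine[OF u integrable_continuous_real[OF c], symmetric])
  also have "integral {0..u} (\<lambda>s. min s u / (1 - s)\<^sup>2) = (1 / (1 - u) + ln (1 - u)) - (1 / (1 - 0) + ln (1 - 0))"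
  proof (rule integral_unique, rule fundamental_theorem_of_calculus[OF u(1)])
    fix x assume x: "x \<in> {0..u}"
    have "((\<lambda>s. 1 / (1 - s) + ln (1 - s)) has_real_derivative min x u / (1 - x)\<^sup>2) (at x within {0..u})"
    proof -
      have "((\<lambda>s. 1 / (1 - s) + ln (1 - s)) has_real_derivative 1 / ((1 - x) * (1 - x)) - 1 / (1 - x)) (at x within {0..u})"
        using x u t by (auto intro!: derivative_eq_intros)
      moreover have "1 / ((1 - x) * (1 - x)) - 1 / (1 - x) = min x u / (1 - x)\<^sup>2"
      proof -
        define y where "y = 1 - x"
        have "y \<noteq> 0" "x = 1 - y" "min x u = x" using x u t by (auto simp: y_def)
        then show ?thesis unfolding y_def[symmetric] by (simp add: field_simps power2_eq_square)
      qed
      ultimately show ?thesis by simp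
    qed
    then show "((\<lambda>s. 1 / (1 - s) + ln (1 - s)) has_vector_derivative min x u / (1 - x)\<^sup>2) (at x within {0..u})"
      by (simp add: has_real_derivative_iff_has_vector_derivative)
  qed
  also have "integral {u..t} (\<lambda>s. min s u / (1 - s)\<^sup>2) = u / (1 - t) - u / (1 - u)"
  proof (rule integral_unique, rule fundamental_theorem_of_calculus[OF u(2)])
    fix x assume x: "x \<in> {u..t}"
    have "((\<lambda>s. u / (1 - s)) has_real_derivative min x u / (1 - x)\<^sup>2) (at x within {u..t})"
      using x u t by (auto intro!: derivative_eq_intros simp: power2_eq_square)
    then show "((\<lambda>s. u / (1 - s)) has_vector_derivative min x u / (1 - x)\<^sup>2) (at x within {u..t})"
      by (simp add: has_real_derivative_iff_has_vector_derivative)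
  qed
  finally have "(LINT s:{0..t}|lborel. min s u / (1 - s)\<^sup>2) = ln (1 - u) + u / (1 - t) + (1 / (1 - u) - u / (1 - u) - 1)" by simp
  also have "1 / (1 - u) - u / (1 - u) - 1 = 0" using u t by (simp add: diff_divide_distrib[symmetric])
  finally show ?thesis using u t by (simp add: integral_wt)
qed

lemma integral_wt_double:
  fixes t :: real
  assumes t: "0 \<le> t" "t < 1"
  shows "(LINT u:{0..t}|lborel. (ln (1 - u) + u / (1 - t)) / (1 - u)\<^sup>2)
    = 2 * (t / (1 - t) + ln (1 - t)) / (1 - t) - t\<^sup>2 / (1 - t)\<^sup>2"
proof -
  \<comment> \<open>An antiderivative: the first summand has derivative
    \<open>ln (1 - u) / (1 - u)^2\<close>, the second \<open>u / (1 - u)^2\<close> divided by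
    \<open>1 - t\<close>.\<close>
  let ?H = "\<lambda>u. (ln (1 - u) + 1) / (1 - u) + (1 / (1 - u) + ln (1 - u)) / (1 - t)"
  have "(LINT u:{0..t}|lborel. (ln (1 - u) + u / (1 - t)) / (1 - u)\<^sup>2) = ?H t - ?H 0"
  proof (rule lborel_integral_FTC[OF t(1), where F="?H"])
    show "continuous_on {0..t} (\<lambda>u. (ln (1 - u) + u / (1 - t)) / (1 - u)\<^sup>2)" using t by (intro continuous_intros) auto
    fix x assume x: "0 \<le> x" "x \<le> t"
    have "(?H has_real_derivative ((- 1 / (1 - x)) * (1 - x) + (ln (1 - x) + 1)) / ((1 - x) * (1 - x)) + (1 / ((1 - x) * (1 - x)) - 1 / (1 - x)) / (1 - t)) (at x within {0..t})"
      using x t by (auto intro!: derivative_eq_intros)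
    moreover have "((- 1 / (1 - x)) * (1 - x) + (ln (1 - x) + 1)) / ((1 - x) * (1 - x)) + (1 / ((1 - x) * (1 - x)) - 1 / (1 - x)) / (1 - t)
       = (ln (1 - x) + x / (1 - t)) / (1 - x)\<^sup>2"
    proof -
      define y where "y = 1 - x"
      have y: "y \<noteq> 0" "x = 1 - y" using x t by (auto simp: y_def)
      have "1 / (y * y) - 1 / y = x / y\<^sup>2" using y by (simp add: field_simps power2_eq_square)
      moreover have "(- 1 / y) * y + (ln y + 1) = ln y" using y by simp
      ultimately show ?thesis unfolding y_def[symmetric] by (simp add: power2_eq_square add_divide_distrib)
    qed
    ultimately show "(?H has_real_derivative (ln (1 - x) + x / (1 - t)) / (1 - x)\<^sup>2) (at x within {0..t})" by simp
  qed
  also have "?H t - ?H 0 = 2 * (t / (1 - t) + ln (1 - t)) / (1 - t) - t\<^sup>2 / (1 - t)\<^sup>2"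
  proof -
    define y where "y = 1 - t"
    have y: "y \<noteq> 0" "t = 1 - y" using t by (auto simp: y_def)
    show ?thesis unfolding y_def[symmetric] y(2) using y(1) by (simp add: field_simps power2_eq_square)
  qed
  finally show ?thesis .
qed

text \<open>The difference has mean (1-t) v and variance t (1-t); the logarithms in the covariance
  and in the variance of the time integral cancel. The common factor 1-t keeps the mean of (v -
  Q)^2/(1-t) bounded up to time 1.\<close>

lemma bridge_second_moment:
  assumes t: "0 \<le> t" "t < 1"
  shows "integrable M (\<lambda>\<omega>. (v - bridge v t \<omega>)\<^sup>2)" "(\<integral>\<omega>. (v - bridge v t \<omega>)\<^sup>2 \<partial>M) = (1 - t)\<^sup>2 * v\<^sup>2 + t * (1 - t)"
proof -
  have t1: "t \<le> 1" using t by simp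
  define a where "a \<omega> = (\<integral>s. wt t s * B s \<omega> \<partial>I01)" for \<omega>
  note wb = wt_bound[OF t(2)]
  have am[measurable]: "a \<in> borel_measurable M" and a2: "integrable M (\<lambda>\<omega>. (a \<omega>)\<^sup>2)"
    unfolding a_def[abs_def] using time_integral_square_integrable[OF wt_measurable wb] by auto
  have Bm[measurable]: "B u \<in> borel_measurable M" if "0 \<le> u" "u \<le> 1" for u using that by (rule B_measurable)
  note Btm[measurable] = Bm[OF t(1) t1]
  note prod = time_integral_product[OF wt_measurable wb, folded a_def]
  have ai: "integrable M a" "(\<integral>\<omega>. a \<omega> \<partial>M) = 0"
  proof -
    show "integrable M a" using prod(1)[of "\<lambda>_. 1"] by simp
    have "(\<integral>\<omega>. a \<omega> \<partial>M) = (\<integral>s. wt t s * (\<integral>\<omega>. B s \<omega> \<partial>M) \<partial>I01)" using prod(2)[of "\<lambda>_. 1"] by simp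
    also have "\<dots> = (\<integral>s. 0 \<partial>I01)" by (intro Bochner_Integration.integral_cong) (auto simp: B_moments)
    finally show "(\<integral>\<omega>. a \<omega> \<partial>M) = 0" by simp
  qed
  have Ba: "integrable M (\<lambda>\<omega>. B u \<omega> * a \<omega>)" "(\<integral>\<omega>. B u \<omega> * a \<omega> \<partial>M) = ln (1 - u) + u / (1 - t)" if u: "0 \<le> u" "u \<le> t" for u
  proof -
    have u1: "0 \<le> u" "u \<le> 1" using u t by auto
    show "integrable M (\<lambda>\<omega>. B u \<omega> * a \<omega>)" using integrable_B_power[OF u1, of 2] by (intro prod(1) Bm u1)
    have "(\<integral>\<omega>. B u \<omega> * a \<omega> \<partial>M) = (\<integral>s. wt t s * (\<integral>\<omega>. B u \<omega> * B s \<omega> \<partial>M) \<partial>I01)"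
      using integrable_B_power[OF u1, of 2] by (intro prod(2) Bm u1)
    also have "\<dots> = (\<integral>s. wt t s * min s u \<partial>I01)"
      using u1 by (intro Bochner_Integration.integral_cong) (auto simp: B_covariance min.commute)
    finally show "(\<integral>\<omega>. B u \<omega> * a \<omega> \<partial>M) = ln (1 - u) + u / (1 - t)" using integral_wt_min[OF u t(2)] by simp
  qed
  have aa: "(\<integral>\<omega>. (a \<omega>)\<^sup>2 \<partial>M) = 2 * (t / (1 - t) + ln (1 - t)) / (1 - t) - t\<^sup>2 / (1 - t)\<^sup>2"
  proof -
    have "(\<integral>\<omega>. (a \<omega>)\<^sup>2 \<partial>M) = (\<integral>\<omega>. a \<omega> * a \<omega> \<partial>M)" by (simp add: power2_eq_square)
    also have "\<dots> = (\<integral>s. wt t s * (\<integral>\<omega>. a \<omega> * B s \<omega> \<partial>M) \<partial>I01)" by (rule prod(2)[OF am a2])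
    also have "\<dots> = (\<integral>s. wt t s * (ln (1 - s) + s / (1 - t)) \<partial>I01)"
    proof (rule Bochner_Integration.integral_cong)
      fix s assume "s \<in> space I01"
      then show "wt t s * (\<integral>\<omega>. a \<omega> * B s \<omega> \<partial>M) = wt t s * (ln (1 - s) + s / (1 - t))"
        using Ba(2)[of s] by (cases "s \<le> t") (auto simp: mult.commute wt_def)
    qed simp
    finally show ?thesis unfolding integral_wt[OF t] integral_wt_double[OF t] .
  qed
  have br: "v - bridge v t \<omega> = (1 - t) * v - B t \<omega> + (1 - t) * a \<omega>" if \<omega>: "\<omega> \<in> space M" for \<omega>
  proof -
    have Bc: "continuous_on {0..t} (\<lambda>s. B s \<omega> / (1 - s)\<^sup>2)"
      by (intro continuous_intros continuous_on_subset[OF B_continuous[OF \<omega>]]) (use t in auto)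
    have vc: "continuous_on {0..t} (\<lambda>s. v / (1 - s)\<^sup>2)" by (intro continuous_intros) (use t in auto)
    have "(LINT s:{0..t}|lborel. v / (1 - s)\<^sup>2) = v / (1 - t) - v / (1 - 0)"
    proof (rule lborel_integral_FTC[OF t(1) vc])
      fix x assume "0 \<le> x" "x \<le> t"
      then show "((\<lambda>s. v / (1 - s)) has_real_derivative v / (1 - x)\<^sup>2) (at x within {0..t})"
        using t by (auto intro!: derivative_eq_intros simp: power2_eq_square)
    qed
    moreover have "(LINT s:{0..t}|lborel. (v - B s \<omega>) / (1 - s)\<^sup>2) = (LINT s:{0..t}|lborel. v / (1 - s)\<^sup>2) - (LINT s:{0..t}|lborel. B s \<omega> / (1 - s)\<^sup>2)"
      using set_integral_diff(2)[OF lborel_integral_eq(1)[OF vc] lborel_integral_eq(1)[OF Bc]] by (simp add: diff_divide_distrib)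
    moreover have "(LINT s:{0..t}|lborel. B s \<omega> / (1 - s)\<^sup>2) = a \<omega>" unfolding a_def by (rule integral_wt[OF t, symmetric])
    ultimately have "bridge v t \<omega> = B t \<omega> + (1 - t) * (v / (1 - t) - v - a \<omega>)" unfolding bridge_def by simp
    moreover have "(1 - t) * (v / (1 - t) - v - a \<omega>) = v - (1 - t) * v - (1 - t) * a \<omega>" using t by (simp add: right_diff_distrib)
    ultimately show ?thesis by simp
  qed
  let ?c = "1 - t"
  have ex: "((1 - t) * v - B t \<omega> + (1 - t) * a \<omega>)\<^sup>2
    = ?c\<^sup>2 * v\<^sup>2 + (B t \<omega>)\<^sup>2 + ?c\<^sup>2 * (a \<omega>)\<^sup>2 - 2 * ?c * v * B t \<omega> + 2 * ?c\<^sup>2 * v * a \<omega> - 2 * ?c * (B t \<omega> * a \<omega>)" for \<omega>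
    by (simp add: power2_eq_square algebra_simps)
  note ints = integrable_B_power[OF t(1) t1, of 2] a2 integrable_B[OF t(1) t1] ai(1) Ba(1)[OF t(1) order_refl]
  have "integrable M (\<lambda>\<omega>. ((1 - t) * v - B t \<omega> + (1 - t) * a \<omega>)\<^sup>2)" unfolding ex using ints by simp
  then show "integrable M (\<lambda>\<omega>. (v - bridge v t \<omega>)\<^sup>2)"
    by (rule Bochner_Integration.integrable_cong[THEN iffD1, rotated 2]) (simp_all add: br)
  have "(\<integral>\<omega>. (v - bridge v t \<omega>)\<^sup>2 \<partial>M) = (\<integral>\<omega>. ((1 - t) * v - B t \<omega> + (1 - t) * a \<omega>)\<^sup>2 \<partial>M)"
    by (intro Bochner_Integration.integral_cong) (simp_all add: br)
  also have "\<dots> = ?c\<^sup>2 * v\<^sup>2 + t + ?c\<^sup>2 * (2 * (t / ?c + ln ?c) / ?c - t\<^sup>2 / ?c\<^sup>2) - 2 * ?c * (ln ?c + t / ?c)"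
    unfolding ex using ints by (simp add: prob_space B_moments[OF t(1) t1] ai(2) aa Ba(2)[OF t(1) order_refl])
  also have "\<dots> = ?c\<^sup>2 * v\<^sup>2 + t * ?c"
  proof -
    define y where "y = 1 - t"
    have y: "y \<noteq> 0" "t = 1 - y" using t by (auto simp: y_def)
    have "y\<^sup>2 * (2 * (t / y + ln y) / y - t\<^sup>2 / y\<^sup>2) = 2 * y * (ln y + t / y) - t\<^sup>2"
      using y(1) by (simp add: field_simps power2_eq_square)
    then show ?thesis unfolding y_def[symmetric] by (simp add: y(2) power2_eq_square algebra_simps)
  qed
  finally show "(\<integral>\<omega>. (v - bridge v t \<omega>)\<^sup>2 \<partial>M) = (1 - t)\<^sup>2 * v\<^sup>2 + t * (1 - t)" .
qed

text \<open>Moving the upper limit \<open>t\<close> into the integrand as a case distinction turns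
  the time integral into one over a fixed space with parameters, hence jointly measurable. The
  indicator leaves out \<open>t = 1\<close>, where the equation no longer speaks about the
  flow.\<close>

lemma bridge_measurable:
  "(\<lambda>(\<omega>, t). indicator {0..<1} t * bridge v t \<omega>) \<in> borel_measurable (M \<Otimes>\<^sub>M I01)"
proof -
  let ?N = "M \<Otimes>\<^sub>M I01"
  have "(\<lambda>z. indicator {0..<1} (snd z) * bridge v (snd z) (fst z)) \<in> borel_measurable ?N"
  proof -
    have B: "(\<lambda>z. B (snd z) (fst z)) \<in> borel_measurable ?N"
      using progressive_joint_measurable[OF progressive_B] by (simp add: case_prod_beta)
    have id[measurable]: "(\<lambda>s. s) \<in> borel_measurable I01" unfolding I01_def by (intro measurable_restrict_space1) simp
    have "(\<lambda>z. B (snd z) (fst (fst z))) \<in> borel_measurable (?N \<Otimes>\<^sub>M I01)"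
    proof -
      have "(\<lambda>\<zeta>. (fst (fst \<zeta>), snd \<zeta>)) \<in> measurable (?N \<Otimes>\<^sub>M I01) ?N" by measurable
      from measurable_compose[OF this B] show ?thesis by simp
    qed
    note [measurable] = B this
    have w: "(\<lambda>\<zeta>. if snd \<zeta> \<le> snd (fst \<zeta>) then (v - B (snd \<zeta>) (fst (fst \<zeta>))) / (1 - snd \<zeta>)\<^sup>2 else 0) \<in> borel_measurable (?N \<Otimes>\<^sub>M I01)"
      by measurable
    have "(\<lambda>z. \<integral>s. (if s \<le> snd z then (v - B s (fst z)) / (1 - s)\<^sup>2 else 0) \<partial>I01) \<in> borel_measurable ?N"
      by (rule I01.borel_measurable_lebesgue_integral) (use w in \<open>simp add: case_prod_beta\<close>)
    note [measurable] = this
    have [measurable]: "(indicator {0..<1} :: real \<Rightarrow> real) \<in> borel_measurable I01" unfolding I01_def by (intro measurable_restrict_space1) simp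
    have "(\<lambda>z. indicator {0..<1} (snd z) * (B (snd z) (fst z) + (1 - snd z) *
        (\<integral>s. (if s \<le> snd z then (v - B s (fst z)) / (1 - s)\<^sup>2 else 0) \<partial>I01))) \<in> borel_measurable ?N"
      by measurable
    moreover have "indicator {0..<1} t * (B t \<omega> + (1 - t) * (\<integral>s. (if s \<le> t then (v - B s \<omega>) / (1 - s)\<^sup>2 else 0) \<partial>I01))
      = indicator {0..<1} t * bridge v t \<omega>" for t \<omega>
    proof (cases "t \<in> {0..<1}")
      case True
      have "indicator {0..1} s *\<^sub>R (if s \<le> t then (v - B s \<omega>) / (1 - s)\<^sup>2 else 0) = indicator {0..t} s *\<^sub>R ((v - B s \<omega>) / (1 - s)\<^sup>2)" for s
        using True by (auto split: split_indicator)
      then show ?thesis unfolding bridge_def integral_I01 set_lebesgue_integral_def by simp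
    qed simp
    ultimately show ?thesis by simp
  qed
  then show ?thesis by (simp add: case_prod_beta)
qed

lemma integral_bridge_payoff: "(\<integral>t. ((1 - t) * v\<^sup>2 + t) \<partial>I01) = (v\<^sup>2 + 1) / 2"
proof -
  have c: "continuous_on {0..1} (\<lambda>t. (1 - t) * v\<^sup>2 + t)" by (intro continuous_intros)
  have "(LINT t:{0..1}|lborel. (1 - t) * v\<^sup>2 + t) = ((1 - 1\<^sup>2 / 2) * v\<^sup>2 + 1\<^sup>2 / 2) - ((0 - 0\<^sup>2 / 2) * v\<^sup>2 + 0\<^sup>2 / 2)"
    by (rule lborel_integral_FTC[OF _ c, where F="\<lambda>t. (t - t\<^sup>2 / 2) * v\<^sup>2 + t\<^sup>2 / 2"])
      (auto intro!: derivative_eq_intros simp: algebra_simps)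
  then show ?thesis unfolding integral_I01 by (simp add: field_simps)
qed

text \<open>The running payoff is (v - Q)^2/(1-t), nonnegative with mean (1-t) v^2 + t, so the order
  of integration may be changed although the control is unbounded.\<close>

lemma strong_payoff_back: "strong_payoff M B back_price v (back_strategy v) = (v\<^sup>2 + 1) / 2"
proof -
  interpret P: pair_sigma_finite M I01 by standard
  \<comment> \<open>The inner indicator gives the integrand the form covered by
    \<open>bridge_measurable\<close>; wherever the outer one does not vanish, it equals 1.\<close>
  let ?g = "\<lambda>\<omega> t. indicator {0..<1} t * ((v - indicator {0..<1} t * bridge v t \<omega>)\<^sup>2 / (1 - t))"
  have [measurable]: "(\<lambda>s. s) \<in> borel_measurable I01" "(indicator {0..<1} :: real \<Rightarrow> real) \<in> borel_measurable I01"
    unfolding I01_def by (intro measurable_restrict_space1, simp)+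
  note [measurable] = bridge_measurable[of v]
  have gm: "(\<lambda>(\<omega>, t). ?g \<omega> t) \<in> borel_measurable (M \<Otimes>\<^sub>M I01)"
    unfolding case_prod_beta using bridge_measurable[of v, unfolded case_prod_beta] by measurable
  have g0: "0 \<le> ?g \<omega> t" for \<omega> t by (cases "t \<in> {0..<1}") auto
  have gE: "integrable M (\<lambda>\<omega>. ?g \<omega> t)" "(\<integral>\<omega>. ?g \<omega> t \<partial>M) = indicator {0..<1} t * ((1 - t) * v\<^sup>2 + t)" for t
  proof -
    have "integrable M (\<lambda>\<omega>. ?g \<omega> t) \<and> (\<integral>\<omega>. ?g \<omega> t \<partial>M) = indicator {0..<1} t * ((1 - t) * v\<^sup>2 + t)"
    proof (cases "t \<in> {0..<1}")
      case True
      then have t: "0 \<le> t" "t < 1" by auto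
      have "((1 - t)\<^sup>2 * v\<^sup>2 + t * (1 - t)) / (1 - t) = (1 - t) * v\<^sup>2 + t"
        using t by (simp add: add_divide_distrib power2_eq_square)
      then show ?thesis using bridge_second_moment[OF t, of v] True by simp
    qed simp
    then show "integrable M (\<lambda>\<omega>. ?g \<omega> t)" "(\<integral>\<omega>. ?g \<omega> t \<partial>M) = indicator {0..<1} t * ((1 - t) * v\<^sup>2 + t)" by auto
  qed
  have gi: "integrable (M \<Otimes>\<^sub>M I01) (\<lambda>(\<omega>, t). ?g \<omega> t)"
  proof (rule integrableI_bounded[OF gm])
    have "(\<integral>\<^sup>+z. ennreal (norm (case z of (\<omega>, t) \<Rightarrow> ?g \<omega> t)) \<partial>(M \<Otimes>\<^sub>M I01))
      = (\<integral>\<^sup>+\<omega>. \<integral>\<^sup>+t. ennreal (norm (case (\<omega>, t) of (\<omega>, t) \<Rightarrow> ?g \<omega> t)) \<partial>I01 \<partial>M)"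
      by (rule I01.nn_integral_fst[symmetric]) (use gm in measurable)
    also have "\<dots> = (\<integral>\<^sup>+\<omega>. \<integral>\<^sup>+t. ennreal (?g \<omega> t) \<partial>I01 \<partial>M)"
      unfolding prod.case real_norm_def abs_of_nonneg[OF g0] ..
    also have "\<dots> = (\<integral>\<^sup>+t. \<integral>\<^sup>+\<omega>. ennreal (?g \<omega> t) \<partial>M \<partial>I01)"
      by (rule P.Fubini'[symmetric]) (use gm in \<open>simp add: case_prod_beta\<close>)
    also have "\<dots> = (\<integral>\<^sup>+t. ennreal (indicator {0..<1} t * ((1 - t) * v\<^sup>2 + t)) \<partial>I01)"
      using gE g0 by (intro nn_integral_cong) (subst nn_integral_eq_integral, auto)
    also have "\<dots> \<le> (\<integral>\<^sup>+t. ennreal (v\<^sup>2 + 1) \<partial>I01)"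
    proof (intro nn_integral_mono ennreal_leI)
      fix t assume "t \<in> space I01"
      then have "t \<le> 1" "(1 - t) * v\<^sup>2 \<le> v\<^sup>2" by (auto intro!: mult_left_le_one_le)
      then show "indicator {0..<1} t * ((1 - t) * v\<^sup>2 + t) \<le> v\<^sup>2 + 1" by (auto split: split_indicator)
    qed
    also have "\<dots> < \<infinity>" using I01.emeasure_space_1 by simp
    finally show "(\<integral>\<^sup>+z. ennreal (norm (case z of (\<omega>, t) \<Rightarrow> ?g \<omega> t)) \<partial>(M \<Otimes>\<^sub>M I01)) < \<infinity>" .
  qed
  have "strong_payoff M B back_price v (back_strategy v) = (\<integral>\<omega>. \<integral>t. ?g \<omega> t \<partial>I01 \<partial>M)"
    unfolding strong_payoff_def
  proof (rule Bochner_Integration.integral_cong[OF refl])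
    fix \<omega> assume \<omega>: "\<omega> \<in> space M"
    let ?Q = "order_flow M B (back_strategy v)"
    have "indicator {0..<1} t *\<^sub>R ((v - along ?Q back_price t \<omega>) * along ?Q (back_strategy v) t \<omega>) = indicator {0..1} t *\<^sub>R ?g \<omega> t" for t
    proof (cases "t \<in> {0..<1}")
      case True
      then have t: "0 \<le> t" "t < 1" by auto
      have "along ?Q back_price t \<omega> = bridge v t \<omega>" "along ?Q (back_strategy v) t \<omega> = (v - bridge v t \<omega>) / (1 - t)"
        using order_flow_bridge[OF \<omega> t, of v] t by (simp_all add: bridge_path_eq along_def back_price_def path_upto_def back_strategy_def)
      then show ?thesis using True by (simp add: power2_eq_square)
    qed simp
    then show "(LINT t:{0..<1}|lborel. (v - along ?Q back_price t \<omega>) * along ?Q (back_strategy v) t \<omega>) = (\<integral>t. ?g \<omega> t \<partial>I01)"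
      unfolding integral_I01 set_lebesgue_integral_def by simp
  qed
  also have "\<dots> = (\<integral>t. \<integral>\<omega>. ?g \<omega> t \<partial>M \<partial>I01)" by (rule P.Fubini_integral[OF gi, symmetric])
  also have "\<dots> = (\<integral>t. indicator {0..<1} t * ((1 - t) * v\<^sup>2 + t) \<partial>I01)" by (simp only: gE(2))
  also have "\<dots> = (\<integral>t. ((1 - t) * v\<^sup>2 + t) \<partial>I01)"
  proof (rule integral_cong_AE)
    have "AE t in lborel. t \<noteq> (1::real)" by (rule AE_lborel_singleton)
    then have "AE t in I01. t \<noteq> 1" unfolding I01_def by (subst AE_restrict_space_iff) auto
    then show "AE t in I01. indicator {0..<1} t * ((1 - t) * v\<^sup>2 + t) = (1 - t) * v\<^sup>2 + t"
      using AE_space by eventually_elim (auto split: split_indicator)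
  qed measurable
  also have "\<dots> = (v\<^sup>2 + 1) / 2" by (rule integral_bridge_payoff)
  finally show ?thesis .
qed

end

theorem proposition5p3:
  fixes M :: "'a measure" and B :: "real \<Rightarrow> 'a \<Rightarrow> real" and V :: "'a \<Rightarrow> real"
  assumes "brownian_motion M B"
    and "distributed M lborel V std_normal_density"
    and "prob_space.indep_set M (sets (vimage_algebra (space M) V borel)) (sets (natural_filtration M B 1))"
  shows "(\<lambda>v. strong_payoff M B back_price v (back_strategy v)) \<in> set_value M B (distr M borel V)"
proof -
  interpret brownian M B by unfold_locales (rule assms(1))
  have "distr M borel V = distr M lborel V" by (rule distr_cong) auto
  also have "\<dots> = gaussian" using assms(2) by (simp add: distributed_def gaussian_def)
  finally have law: "distr M borel V = gaussian" .
  show ?thesis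
    unfolding set_value_def law strong_payoff_back
  proof (rule INT_I)
    fix \<epsilon> :: real assume "\<epsilon> \<in> {0<..}"
    then obtain \<theta> where "(back_price, \<theta>) \<in> eps_equilibria M B gaussian \<epsilon>"
      "(\<integral>\<^sup>+v\<in>measure_support gaussian. ennreal \<bar>(v\<^sup>2 + 1) / 2 - payoff M B (along B back_price) v (along B (\<theta> v))\<bar> \<partial>gaussian) \<le> ennreal \<epsilon>"
      using equilibrium_exists[of \<epsilon>] by auto
    moreover have "(\<lambda>v. (v\<^sup>2 + 1) / 2) \<in> borel_measurable (restrict_space borel (measure_support gaussian))"
      by (intro measurable_restrict_space1) measurable
    ultimately show "(\<lambda>v. (v\<^sup>2 + 1) / 2) \<in> eps_set_value M B gaussian \<epsilon>"
      unfolding eps_set_value_def by blast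
  qed
qed

end
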